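(* Let $n\in\{1,2\}$, let $\Gamma\subset\mathbb{R}^2$ be a $\mathbb{Z}^n$-periodic metric graph embedded in the plane, let $a,b\in BUC(\Gamma)\cap SO(\Gamma)$, and let $k:\mathbb{R}^2\to\mathbb{C}$ be a continuous function for which there are constants $C>0$ and $\varepsilon>0$ with $$|k(z)|\le C(1+|z|)^{-2-\varepsilon}\quad\text{for all }z\in\mathbb{R}^2.$$ Let $(Tu)(x)=\int_\Gamma k(x-y)u(y)\,dy$, $x\in\Gamma$, and let $1<p<\infty$. Then $A=aI+bT$ is a Fredholm operator on $L^p(\Gamma)$ if and only if the following conditions are satisfied: (a) $\inf_{x\in\Gamma}|a(x)|>0$; (b) every limit operator $A^g$ of $A$ is invertible on $L^p(\Gamma)$.
   Context: Graph. $\Gamma\subset\mathbb{R}^2$ is a connected metric graph with countably infinite vertex set in $\mathbb{R}^2$, whose edges are line segments in the plane joining their endpoints and meeting only at common endpoints; there are no loops or multiple edges; every vertex has finite positive valency. $\Gamma$ carries its path metric and the measure $dy$ which is one-dimensional Lebesgue (arc-length) measure on each edge; $L^p(\Gamma)$ is taken with respect to this measure. $\Gamma$ is $\mathbb{Z}^n$-periodic: $\mathbb{Z}^n$, regarded as a discrete subgroup of $(\mathbb{R}^2,+)$, acts on $\Gamma$ by translations $x\mapsto x+g$, mapping vertices to vertices and edges to edges, and $\Gamma/\mathbb{Z}^n$ is compact. $\Gamma_0\subset\Gamma$ is a bounded measurable fundamental domain containing exactly one point from each orbit. $BUC(\Gamma)$ is the set of bounded uniformly continuous functions on $\Gamma$.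 $SO(\Gamma)$ is the set of $f\in L^\infty(\Gamma)$ with $\lim_{\alpha\to\infty}\sup_{y\in\Gamma_0}|f(y+\beta+\alpha)-f(y+\alpha)|=0$ for every $\beta\in\mathbb{Z}^n$ ($\alpha\in\mathbb{Z}^n$). $fI$ denotes multiplication by $f$, and $(V_gu)(x):=u(x-g)$ for $g\in\mathbb{Z}^n$. Limit operators. $\mathcal{H}$ is the set of all sequences $h:\mathbb{N}\to\mathbb{Z}^n$ with $|h(m)|\to\infty$. A bounded operator $A^h$ on $L^p(\Gamma)$ is the limit operator of $A$ defined by $h\in\mathcal{H}$ if, for every compact $M\subset\Gamma$ with characteristic function $\chi_M$, $\|(V_{h(m)}^{-1}AV_{h(m)}-A^h)\chi_MI\|\to0$ and $\|\chi_M(V_{h(m)}^{-1}AV_{h(m)}-A^h)\|\to0$ in operator norm on $L^p(\Gamma)$ as $m\to\infty$. *)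

theory Defs
  imports "HOL-Analysis.Analysis"
begin

section \<open>Planar metric graphs\<close>

type_synonym plane = "real ^ 2"

text \<open>
  A graph is given by its vertex set \<open>V\<close> and its set \<open>E\<close> of edges, an edge being the set of its two
  endpoints (so there are no loops and no multiple edges); geometrically the edge \<open>e\<close> is the
  segment \<open>convex hull e\<close>. As every vertex lies on an edge, the graph as a point set is the
  union of its edges.
\<close>

definition graph_points :: "plane set set \<Rightarrow> plane set" where
  "graph_points E = (\<Union>e\<in>E. convex hull e)"

definition planar_graph :: "plane set \<Rightarrow> plane set set \<Rightarrow> bool" where
  "planar_graph V E \<longleftrightarrow>
     countable V \<and> infinite V \<and>
     (\<forall>e\<in>E. \<exists>u\<in>V. \<exists>v\<in>V. u \<noteq> v \<and> e = {u, v}) \<and>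
     (\<forall>e\<in>E. \<forall>f\<in>E. e \<noteq> f \<longrightarrow> convex hull e \<inter> convex hull f \<subseteq> e \<inter> f) \<and>
     (\<forall>v\<in>V. finite {e \<in> E. v \<in> e} \<and> {e \<in> E. v \<in> e} \<noteq> {}) \<and>
     (\<forall>u\<in>V. \<forall>v\<in>V. (u, v) \<in> {(x, y). {x, y} \<in> E}\<^sup>*)"


subsection \<open>Path metric\<close>

text \<open>\<open>walk E x y L\<close>: there is a path of length \<open>L\<close> from \<open>x\<close> to \<open>y\<close> composed of finitely many
  pieces, each of them a subsegment of an edge. In \<open>path_dist\<close>, the value \<open>0\<close> outside the graph only
  serves to meet the requirements of \<open>Metric_space\<close>.\<close>

inductive walk :: "plane set set \<Rightarrow> plane \<Rightarrow> plane \<Rightarrow> real \<Rightarrow> bool" for E where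
  walk_refl: "x \<in> graph_points E \<Longrightarrow> walk E x x 0"
| walk_step: "walk E x y L \<Longrightarrow> e \<in> E \<Longrightarrow> y \<in> convex hull e \<Longrightarrow> z \<in> convex hull e
    \<Longrightarrow> walk E x z (L + dist y z)"

definition path_dist :: "plane set set \<Rightarrow> plane \<Rightarrow> plane \<Rightarrow> real" where
  "path_dist E x y = (if \<exists>L. walk E x y L then Inf {L. walk E x y L} else 0)"

definition path_metric :: "plane set set \<Rightarrow> plane metric" where
  "path_metric E = metric (graph_points E, path_dist E)"

lemma walk_points: "walk E x y L \<Longrightarrow> x \<in> graph_points E \<and> y \<in> graph_points E"
  by (induction rule: walk.induct) (auto simp: graph_points_def)

lemma walk_dist_le: "walk E x y L \<Longrightarrow> dist x y \<le> L"
proof (induction rule: walk.induct)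
  case (walk_step x y L e z)
  then show ?case using dist_triangle[of x z y] by linarith
qed simp

lemma walk_trans:
  assumes "walk E y z M" "walk E x y L"
  shows "walk E x z (L + M)"
  using assms
proof (induction rule: walk.induct)
  case (walk_step y w M e z)
  then show ?case using walk.walk_step[of E x w "L + M" e z] by (simp add: add.assoc)
qed simp

lemma walk_edge:
  assumes "e \<in> E" "x \<in> convex hull e" "y \<in> convex hull e"
  shows "walk E x y (dist x y)"
  using walk_step[OF walk_refl[of x E] assms] assms by (auto simp: graph_points_def)

lemma walk_sym: "walk E x y L \<Longrightarrow> walk E y x L"
proof (induction rule: walk.induct)
  case (walk_refl x)
  then show ?case by (rule walk.walk_refl)
next
  case (walk_step x y L e z)
  then have "walk E z y (dist z y)" by (auto intro: walk_edge)
  then have "walk E z x (dist z y + L)" using walk_step.IH walk_trans by blast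
  then show ?case by (simp add: dist_commute add.commute)
qed

lemma walk_exists:
  assumes G: "planar_graph V E" and x: "x \<in> graph_points E" and y: "y \<in> graph_points E"
  shows "\<exists>L. walk E x y L"
proof -
  have vert: "\<exists>v\<in>V. \<exists>L. walk E z v L" if "z \<in> graph_points E" for z
  proof -
    from that obtain e where e: "e \<in> E" "z \<in> convex hull e" by (auto simp: graph_points_def)
    with G obtain u v where uv: "u \<in> V" "e = {u, v}" unfolding planar_graph_def by metis
    then have "walk E z u (dist z u)" 
      using e by (intro walk_edge[OF e]) (simp add: hull_inc)
    then show ?thesis using uv by blast
  qed
  obtain u L where u: "u \<in> V" "walk E x u L" using vert[OF x] by blast
  obtain v M where v: "v \<in> V" "walk E y v M" using vert[OF y] by blast
  have "(u, v) \<in> {(x, y). {x, y} \<in> E}\<^sup>*" using G u v unfolding planar_graph_def by blast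
  then have "\<exists>K. walk E u v K"
  proof (induction rule: rtrancl_induct)
    case base
    then show ?case using u walk_points walk_refl by blast
  next
    case (step a b)
    then have "walk E a b (dist a b)" by (auto intro!: walk_edge[of "{a, b}"] hull_inc)
    then show ?case using step walk_trans by blast
  qed
  then show ?thesis using u v walk_trans walk_sym by blast
qed

lemma path_dist_greatest:
  assumes "planar_graph V E" "x \<in> graph_points E" "y \<in> graph_points E"
    and "\<And>L. walk E x y L \<Longrightarrow> c \<le> L"
  shows "c \<le> path_dist E x y"
proof -
  have "c \<le> Inf {L. walk E x y L}"
    using walk_exists[OF assms(1-3)] assms(4) by (intro cInf_greatest) auto
  then show ?thesis using walk_exists[OF assms(1-3)] by (simp add: path_dist_def)
qed

lemma path_dist_le: "walk E x y L \<Longrightarrow> path_dist E x y \<le> L"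
proof -
  assume w: "walk E x y L"
  then have "Inf {L. walk E x y L} \<le> L"
    by (intro cInf_lower) (auto intro!: bdd_belowI[of _ "dist x y"] walk_dist_le)
  then show ?thesis using w by (auto simp: path_dist_def)
qed

lemma Metric_space_path_dist:
  assumes G: "planar_graph V E"
  shows "Metric_space (graph_points E) (path_dist E)"
proof
  have sym: "walk E x y L = walk E y x L" for x y L using walk_sym by blast
  have ge: "dist x y \<le> path_dist E x y" if "x \<in> graph_points E" "y \<in> graph_points E" for x y
    by (rule path_dist_greatest[OF G that]) (rule walk_dist_le)
  show "0 \<le> path_dist E x y" for x y
  proof (cases "\<exists>L. walk E x y L")
    case True
    then have "x \<in> graph_points E" "y \<in> graph_points E" using walk_points by blast+
    then show ?thesis using ge[of x y] zero_le_dist[of x y] by linarith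
  qed (simp add: path_dist_def)
  show "path_dist E x y = path_dist E y x" for x y
  proof -
    have "walk E x y = walk E y x" by (intro ext sym)
    then show ?thesis by (simp add: path_dist_def)
  qed
  show "path_dist E x y = 0 \<longleftrightarrow> x = y" if "x \<in> graph_points E" "y \<in> graph_points E" for x y
    using ge[OF that] ge[OF that(1,1)] path_dist_le[OF walk_refl[OF that(1)]] by auto
  show "path_dist E x z \<le> path_dist E x y + path_dist E y z"
    if "x \<in> graph_points E" "y \<in> graph_points E" "z \<in> graph_points E" for x y z
  proof -
    have "path_dist E x z - L \<le> path_dist E y z" if "walk E x y L" for L
      using that path_dist_greatest[OF G \<open>y \<in> _\<close> \<open>z \<in> _\<close>, of "path_dist E x z - L"]
        path_dist_le[OF walk_trans] by (simp add: diff_le_eq add.commute)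
    then have "path_dist E x z - path_dist E y z \<le> path_dist E x y"
      by (intro path_dist_greatest[OF G that(1,2)]) (simp add: algebra_simps)
    then show ?thesis by simp
  qed
qed

lemma mspace_path_metric: "planar_graph V E \<Longrightarrow> mspace (path_metric E) = graph_points E"
  by (simp add: path_metric_def Metric_space.mspace_metric Metric_space_path_dist)

lemma mdist_path_metric: "planar_graph V E \<Longrightarrow> mdist (path_metric E) = path_dist E"
  by (simp add: path_metric_def Metric_space.mdist_metric Metric_space_path_dist)


subsection \<open>Arc-length measure\<close>

definition segment_measure :: "plane \<Rightarrow> plane \<Rightarrow> plane measure" where
  "segment_measure u v =
     distr (restrict_space lborel {0..dist u v}) borel (\<lambda>s. u + s *\<^sub>R sgn (v - u))"

text \<open>The value does not depend on which endpoint is called \<open>u\<close>, see \<open>edge_measure_eq\<close>.\<close>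

definition edge_measure :: "plane set \<Rightarrow> plane measure" where
  "edge_measure e = (THE m. \<exists>u v. e = {u, v} \<and> m = segment_measure u v)"

text \<open>The measure \<open>dy\<close>: the sum of the arc-length measures of the edges, as a measure on the set of
  points of the graph.\<close>

definition graph_measure :: "plane set set \<Rightarrow> plane measure" where
  "graph_measure E =
     restrict_space
       (measure_of UNIV (sets borel) (\<lambda>A. \<integral>\<^sup>+e. emeasure (edge_measure e) A \<partial>count_space E))
       (graph_points E)"

lemma sets_segment_measure [simp]: "sets (segment_measure u v) = sets borel"
  by (simp add: segment_measure_def)

lemma emeasure_segment_measure:
  assumes "A \<in> sets borel"
  shows "emeasure (segment_measure u v) A
    = emeasure lborel {s \<in> {0..dist u v}. u + s *\<^sub>R sgn (v - u) \<in> A}"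
proof -
  have "(\<lambda>s. u + s *\<^sub>R sgn (v - u)) \<in> borel_measurable (restrict_space lborel {0..dist u v})"
    by (intro measurable_restrict_space1) simp
  then have "emeasure (segment_measure u v) A = emeasure (restrict_space lborel {0..dist u v})
      ((\<lambda>s. u + s *\<^sub>R sgn (v - u)) -` A \<inter> {0..dist u v})"
    unfolding segment_measure_def using assms by (subst emeasure_distr) (auto simp: space_restrict_space)
  also have "\<dots> = emeasure lborel ((\<lambda>s. u + s *\<^sub>R sgn (v - u)) -` A \<inter> {0..dist u v})"
    by (subst emeasure_restrict_space) auto
  finally show ?thesis by (simp add: vimage_def Int_def conj_commute)
qed

lemma segment_measure_commute: "segment_measure u v = segment_measure v u"
proof (rule measure_eqI)
  fix A assume "A \<in> sets (segment_measure u v)"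
  then have A: "A \<in> sets borel" by simp
  define S where "S u v = {s \<in> {0..dist u v}. u + s *\<^sub>R sgn (v - u) \<in> A}" for u v :: plane
  have S_sets: "S u v \<in> sets lborel" for u v
  proof -
    have "S u v = {0..dist u v} \<inter> ((\<lambda>s. u + s *\<^sub>R sgn (v - u)) -` A \<inter> space borel)"
      by (auto simp: S_def)
    moreover have "(\<lambda>s. u + s *\<^sub>R sgn (v - u)) -` A \<inter> space borel \<in> sets borel"
      by (rule measurable_sets[OF _ A]) simp
    ultimately show ?thesis by simp
  qed
  have flip: "v + s *\<^sub>R sgn (u - v) = u + (dist u v - s) *\<^sub>R sgn (v - u)" for s
  proof -
    have "dist u v *\<^sub>R sgn (v - u) = v - u"
      by (cases "u = v") (simp_all add: dist_norm norm_minus_commute sgn_div_norm)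
    moreover have "sgn (u - v) = - sgn (v - u)" by (metis minus_diff_eq sgn_minus)
    ultimately show ?thesis by (simp add: scaleR_left_diff_distrib)
  qed
  have "S v u = (\<lambda>s. dist u v + (-1) * s) -` S u v"
    by (auto simp: S_def flip dist_commute)
  moreover have "emeasure lborel (S u v)
      = emeasure (density (distr lborel borel (\<lambda>s. dist u v + (-1) * s)) (\<lambda>_. ennreal \<bar>-1\<bar>)) (S u v)"
    using lborel_real_affine[of "-1" "dist u v"] by simp
  ultimately have "emeasure lborel (S u v) = emeasure lborel (S v u)"
    using S_sets[of u v] by (simp add: emeasure_density emeasure_distr)
  then show "emeasure (segment_measure u v) A = emeasure (segment_measure v u) A"
    by (simp add: emeasure_segment_measure[OF A] S_def)
qed simp

lemma edge_measure_eq: "edge_measure {u, v} = segment_measure u v"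
  unfolding edge_measure_def
  by (rule the_equality) (auto simp: doubleton_eq_iff segment_measure_commute)

lemma planar_graph_borel:
  assumes "planar_graph V E"
  shows "graph_points E \<in> sets borel"
proof -
  have edge: "\<exists>u\<in>V. \<exists>v\<in>V. e = {u, v}" if "e \<in> E" for e
    using assms that unfolding planar_graph_def by metis
  have "E \<subseteq> (\<lambda>(u, v). {u, v}) ` (V \<times> V)" using edge by force
  moreover have "countable V" using assms by (simp add: planar_graph_def)
  ultimately have "countable E" by (meson countable_SIGMA countable_image countable_subset)
  moreover have "convex hull e \<in> sets borel" if "e \<in> E" for e
    using edge[OF that] by (auto intro!: borel_closed compact_imp_closed finite_imp_compact_convex_hull)
  ultimately show ?thesis unfolding graph_points_def by (intro sets.countable_UN') auto
qed

lemma emeasure_graph_measure: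
  assumes G: "planar_graph V E" and A: "A \<in> sets borel" "A \<subseteq> graph_points E"
  shows "emeasure (graph_measure E) A = (\<integral>\<^sup>+e. emeasure (edge_measure e) A \<partial>count_space E)"
proof -
  let ?\<mu> = "\<lambda>A. \<integral>\<^sup>+e. emeasure (edge_measure e) A \<partial>count_space E"
  let ?M = "measure_of UNIV (sets borel) ?\<mu>"
  have sb: "sets ?M = sets borel" using sets.sigma_sets_eq[of "borel :: plane measure"] by simp
  have se: "sets (edge_measure e) = sets borel" if "e \<in> E" for e
    using G that unfolding planar_graph_def by (metis edge_measure_eq sets_segment_measure)
  have "countably_additive (sets borel) ?\<mu>"
  proof (rule countably_additiveI)
    fix B :: "nat \<Rightarrow> plane set"
    assume B: "range B \<subseteq> sets borel" "disjoint_family B"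
    have "(\<Sum>i. ?\<mu> (B i)) = (\<integral>\<^sup>+e. (\<Sum>i. emeasure (edge_measure e) (B i)) \<partial>count_space E)"
      by (rule nn_integral_suminf[symmetric]) simp
    also have "\<dots> = ?\<mu> (\<Union>i. B i)"
      using B by (intro nn_integral_cong suminf_emeasure) (auto simp: se)
    finally show "(\<Sum>i. ?\<mu> (B i)) = ?\<mu> (\<Union>i. B i)" .
  qed
  then have "emeasure ?M A = ?\<mu> A"
    using A sb by (intro emeasure_measure_of[OF refl]) (auto simp: positive_def)
  then show ?thesis
    using A planar_graph_borel[OF G] sb unfolding graph_measure_def
    by (subst emeasure_restrict_space) auto
qed


section \<open>Periodicity\<close>

text \<open>An embedding \<open>\<iota>\<close> of \<open>int ^ 'n\<close> as a discrete subgroup of the plane; below, \<open>G\<close> is its range.\<close>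

definition lattice_embedding :: "(int ^ 'n \<Rightarrow> plane) \<Rightarrow> bool" where
  "lattice_embedding \<iota> \<longleftrightarrow> inj \<iota> \<and> (\<forall>a b. \<iota> (a + b) = \<iota> a + \<iota> b) \<and> discrete (range \<iota>)"

definition orbit_of :: "plane set \<Rightarrow> plane \<Rightarrow> plane set" where
  "orbit_of G x = (\<lambda>g. x + g) ` G"

text \<open>The last clause says that the orbit space with the quotient topology is compact.\<close>

definition periodic_graph :: "plane set \<Rightarrow> plane set \<Rightarrow> plane set set \<Rightarrow> bool" where
  "periodic_graph G V E \<longleftrightarrow>
     (\<forall>g\<in>G. (\<forall>v\<in>V. v + g \<in> V) \<and> (\<forall>e\<in>E. (\<lambda>x. x + g) ` e \<in> E)) \<and>
     (\<exists>Q. quotient_map (mtopology_of (path_metric E)) Q (orbit_of G) \<and> compact_space Q)"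

definition fundamental_domain :: "plane set \<Rightarrow> plane set set \<Rightarrow> plane set \<Rightarrow> bool" where
  "fundamental_domain G E D \<longleftrightarrow>
     D \<subseteq> graph_points E \<and> bounded D \<and> D \<in> sets (completion (graph_measure E)) \<and>
     (\<forall>x\<in>graph_points E. \<exists>!y. y \<in> D \<and> y \<in> orbit_of G x)"


section \<open>Function spaces\<close>

text \<open>Elements of the Lebesgue spaces are represented by measurable functions, which are identified
  when they agree almost everywhere.\<close>

definition Lp_set :: "'a measure \<Rightarrow> real \<Rightarrow> ('a \<Rightarrow> complex) set" where
  "Lp_set M p = {f \<in> borel_measurable M. integrable M (\<lambda>x. cmod (f x) powr p)}"

definition Lp_norm :: "'a measure \<Rightarrow> real \<Rightarrow> ('a \<Rightarrow> complex) \<Rightarrow> real" where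
  "Lp_norm M p f = (\<integral>x. cmod (f x) powr p \<partial>M) powr (1 / p)"

definition Linf_set :: "'a measure \<Rightarrow> ('a \<Rightarrow> complex) set" where
  "Linf_set M = {f \<in> borel_measurable M. \<exists>C. AE x in M. cmod (f x) \<le> C}"

definition BUC :: "plane set set \<Rightarrow> (plane \<Rightarrow> complex) set" where
  "BUC E = {f. bounded (f ` graph_points E) \<and>
               uniformly_continuous_map (path_metric E) euclidean_metric f}"

text \<open>\<open>D\<close> is the fundamental domain. The supremum is taken in \<open>ennreal\<close> because a member of
  \<open>Linf_set\<close> may be unbounded on a null set.\<close>

definition SO :: "plane set \<Rightarrow> plane set set \<Rightarrow> plane set \<Rightarrow> (plane \<Rightarrow> complex) set" where
  "SO G E D = {f \<in> Linf_set (graph_measure E). \<forall>\<beta>\<in>G.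
     ((\<lambda>\<alpha>. SUP y\<in>D. ennreal (cmod (f (y + \<beta> + \<alpha>) - f (y + \<alpha>)))) \<longlongrightarrow> 0)
       (inf at_infinity (principal G))}"


section \<open>Operators on Lebesgue spaces\<close>

text \<open>Operators are maps on representatives. A map satisfying \<open>bounded_op\<close> sends functions that agree
  almost everywhere to functions that agree almost everywhere, so it induces a bounded linear
  operator on equivalence classes, and every such operator arises in this way.\<close>

type_synonym 'a oper = "('a \<Rightarrow> complex) \<Rightarrow> 'a \<Rightarrow> complex"

definition bounded_op :: "'a measure \<Rightarrow> real \<Rightarrow> 'a oper \<Rightarrow> bool" where
  "bounded_op M p A \<longleftrightarrow>
     (\<forall>u\<in>Lp_set M p. A u \<in> Lp_set M p) \<and>
     (\<forall>u\<in>Lp_set M p. \<forall>v\<in>Lp_set M p. AE x in M. A (\<lambda>y. u y + v y) x = A u x + A v x) \<and>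
     (\<forall>u\<in>Lp_set M p. \<forall>c. AE x in M. A (\<lambda>y. c * u y) x = c * A u x) \<and>
     (\<exists>C. \<forall>u\<in>Lp_set M p. Lp_norm M p (A u) \<le> C * Lp_norm M p u)"

definition op_norm :: "'a measure \<Rightarrow> real \<Rightarrow> 'a oper \<Rightarrow> ennreal" where
  "op_norm M p A = (SUP u\<in>{u \<in> Lp_set M p. Lp_norm M p u \<le> 1}. ennreal (Lp_norm M p (A u)))"

definition invertible_op :: "'a measure \<Rightarrow> real \<Rightarrow> 'a oper \<Rightarrow> bool" where
  "invertible_op M p A \<longleftrightarrow> bounded_op M p A \<and>
     (\<exists>B. bounded_op M p B \<and>
       (\<forall>u\<in>Lp_set M p. (AE x in M. A (B u) x = u x) \<and> (AE x in M. B (A u) x = u x)))"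

text \<open>Fredholm: kernel and cokernel are spanned by finitely many (classes of) functions. The range is
  then automatically closed.\<close>

definition fredholm_op :: "'a measure \<Rightarrow> real \<Rightarrow> 'a oper \<Rightarrow> bool" where
  "fredholm_op M p A \<longleftrightarrow> bounded_op M p A \<and>
     (\<exists>S. finite S \<and> S \<subseteq> {u \<in> Lp_set M p. AE x in M. A u x = 0} \<and>
       (\<forall>u\<in>Lp_set M p. (AE x in M. A u x = 0) \<longrightarrow>
          (\<exists>c. AE x in M. u x = (\<Sum>s\<in>S. c s * s x)))) \<and>
     (\<exists>S. finite S \<and> S \<subseteq> Lp_set M p \<and>
       (\<forall>v\<in>Lp_set M p. \<exists>u\<in>Lp_set M p.
          \<exists>c. AE x in M. v x = A u x + (\<Sum>s\<in>S. c s * s x)))"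

definition mult_op :: "('a \<Rightarrow> complex) \<Rightarrow> 'a oper" where
  "mult_op f u = (\<lambda>x. f x * u x)"

definition shift_op :: "plane \<Rightarrow> plane oper" where
  "shift_op g u = (\<lambda>x. u (x - g))"

definition conv_op :: "plane set set \<Rightarrow> (plane \<Rightarrow> complex) \<Rightarrow> plane oper" where
  "conv_op E k u = (\<lambda>x. \<integral>y. k (x - y) * u y \<partial>graph_measure E)"

lemma inv_shift_op: "inv (shift_op g) = shift_op (- g)"
  by (rule inv_unique_comp) (auto simp: shift_op_def fun_eq_iff)


subsection \<open>Limit operators\<close>

definition escaping_seqs :: "plane set \<Rightarrow> (nat \<Rightarrow> plane) set" where
  "escaping_seqs G = {h. range h \<subseteq> G \<and> filterlim (\<lambda>m. norm (h m)) at_top sequentially}"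

definition is_limit_op ::
  "plane set set \<Rightarrow> real \<Rightarrow> plane oper \<Rightarrow> (nat \<Rightarrow> plane) \<Rightarrow> plane oper \<Rightarrow> bool" where
  "is_limit_op E p A h B \<longleftrightarrow> bounded_op (graph_measure E) p B \<and>
     (\<forall>M. compactin (mtopology_of (path_metric E)) M \<longrightarrow>
        (let X = mult_op (indicator M);
             R = (\<lambda>m u x. (inv (shift_op (h m)) \<circ> A \<circ> shift_op (h m)) u x - B u x)
         in (\<lambda>m. op_norm (graph_measure E) p (R m \<circ> X)) \<longlonglongrightarrow> 0 \<and>
            (\<lambda>m. op_norm (graph_measure E) p (X \<circ> R m)) \<longlonglongrightarrow> 0))"

end

theory Submission
  imports Defs "HOL-Library.Function_Algebras"
begin

text \<open>\<^emph>\<open>Necessity.\<close> A Fredholm operator bounds, up to a constant, the norm of one of any \<open>n + 1\<close> functions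
  with disjoint supports by the norms of their images, where \<open>n\<close> is the dimension of its kernel.
  If \<open>a\<close> came close to \<open>0\<close>, normalised indicators of small disjoint pieces of the graph, on which \<open>T\<close> is
  small as well, would contradict this. Likewise, translates along \<open>h\<close> of a function with compact support are
  eventually disjoint, whence limit operators are bounded below. A limit operator is surjective because
  some nontrivial combination of \<open>n + 1\<close> far apart translates of \<open>v\<close>, with \<open>n\<close> now the codimension of the range of \<open>A\<close>,
  is of the form \<open>A u\<close>; cutting \<open>u\<close> off around one of the translates and translating back gives an
  approximate preimage of \<open>v\<close>.

  \<^emph>\<open>Sufficiency.\<close> By slow oscillation a limit operator is of the form \<open>a' I + b' T\<close> with \<open>G\<close>-periodic coefficients.
  Up to a prescribed accuracy, which may depend on the norm of the inverse of the limit operator, finitely many of them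
  describe \<open>A\<close> on all large balls far away. Their inverses are glued along a partition into
  large squares with Lipschitz cutoffs. Commutators of \<open>T\<close> with slowly varying functions are small, and \<open>T\<close> is compact
  on bounded sets, where \<open>1 / a\<close> serves as the inverse. The result is an inverse of \<open>A\<close> up to a small operator
  and one of finite rank. Compactness only enters through such finite rank approximations.\<close>

section \<open>Seminormed spaces of functions\<close>

text \<open>Elements of the Lebesgue spaces remain functions: equality means
  \<open>N (u - v) = 0\<close>, and operators are linear up to null functions only. The definition
  of Fredholm operators is algebraic (two finite spanning sets), while necessity uses estimates;
  these come from a Baire category argument modulo a finite-dimensional space. The obstacle to
  sufficiency is that no common bound for the inverses of the limit operators is known. So the error
  allowed to a limit pair \<open>t\<close> is \<open>\<theta> / c t\<close>, where
  \<open>c t\<close> bounds its own inverse, and choices follow a fixed order: the finite family of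
  pairs, the mesh \<open>L\<close> (commutators must be small against the sum of all
  \<open>c t\<close>), the radius beyond which every square near the graph has a partner. Squares
  with the same partner share one cutoff; this bounds the number of pieces independently of
  \<open>L\<close>, and each point still meets at most nine cutoffs. The exponent of decay is split:
  \<open>2 + \<epsilon> / 2\<close> makes the kernel integrable uniformly over the graph, the rest
  leaves a factor tending to \<open>0\<close> for tails and commutators.\<close>

text \<open>As simplification rules these would unfold the operations inside eta-expanded functions.\<close>

lemmas fun_ops = plus_fun_apply minus_apply uminus_apply zero_fun_apply times_fun_apply one_fun_apply

declare fun_ops [simp del]

definition scl :: "complex \<Rightarrow> ('a \<Rightarrow> complex) \<Rightarrow> 'a \<Rightarrow> complex" where
  "scl c u = (\<lambda>x. c * u x)"

interpretation fun_vs: vector_space scl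
  by unfold_locales (auto simp: scl_def fun_ops fun_eq_iff algebra_simps)

lemma sum_fun_apply: "(\<Sum>i\<in>I. f i) x = (\<Sum>i\<in>I. f i x)"
  by (induction I rule: infinite_finite_induct) (auto simp: fun_ops)

text \<open>More vectors than \<open>card S\<close> in the span of \<open>S\<close> are dependent;
  dividing a relation by its coefficient of largest modulus gives the normalisation. Coefficients of
  modulus at most \<open>1\<close> keep sums of errors under control, and \<open>d i = 1\<close>
  lets one vector be recovered from the combination. Repeated values of \<open>z\<close> are treated
  apart because dependence is a property of the set of values.\<close>

lemma exists_relation:
  assumes "finite S" and z: "\<And>j. j \<le> card S \<Longrightarrow> z j \<in> fun_vs.span S"
  shows "\<exists>d i. i \<le> card S \<and> d i = 1 \<and> (\<forall>j\<le>card S. cmod (d j) \<le> 1) \<and> (\<Sum>j\<le>card S. scl (d j) (z j)) = 0"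
proof (cases "inj_on z {..card S}")
  case False
  then obtain i j where ij: "i \<le> card S" "j \<le> card S" "i \<noteq> j" "z i = z j" by (auto simp: inj_on_def)
  define d :: "nat \<Rightarrow> complex" where "d k = (if k = i then 1 else if k = j then -1 else 0)" for k
  have "(\<Sum>k\<le>card S. scl (d k) (z k)) = (\<Sum>k\<in>{i,j}. scl (d k) (z k))"
    using ij by (intro sum.mono_neutral_right) (auto simp: d_def)
  also have "\<dots> = 0" using ij by (simp add: d_def scl_def fun_ops fun_eq_iff)
  finally show ?thesis using ij by (intro exI[of _ d] exI[of _ i]) (auto simp: d_def)
next
  case True
  let ?Z = "z ` {..card S}"
  have "card ?Z = Suc (card S)" using True by (simp add: card_image)
  have "?Z \<subseteq> fun_vs.span S" using z by auto
  then have "fun_vs.dependent ?Z"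
    using fun_vs.independent_span_bound[OF assms(1), of ?Z] \<open>card ?Z = _\<close> by auto
  then obtain u v where u: "v \<in> ?Z" "u v \<noteq> 0" "(\<Sum>v\<in>?Z. scl (u v) v) = 0"
    by (subst (asm) fun_vs.dependent_finite) auto
  obtain i where i: "i \<le> card S" "\<And>j. j \<le> card S \<Longrightarrow> cmod (u (z j)) \<le> cmod (u (z i))"
  proof -
    have "Max ((\<lambda>j. cmod (u (z j))) ` {..card S}) \<in> (\<lambda>j. cmod (u (z j))) ` {..card S}"
      by (intro Max_in) auto
    then obtain i where i: "i \<le> card S" "Max ((\<lambda>j. cmod (u (z j))) ` {..card S}) = cmod (u (z i))"
      by (rule imageE) simp
    then have "cmod (u (z j)) \<le> cmod (u (z i))" if "j \<le> card S" for j
      using Max_ge[of "(\<lambda>j. cmod (u (z j))) ` {..card S}" "cmod (u (z j))"] that by simp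
    with i(1) show ?thesis by (rule that)
  qed
  have nz: "u (z i) \<noteq> 0" using u(1,2) i(2) by fastforce
  define d where "d j = u (z j) / u (z i)" for j
  have "(\<Sum>j\<le>card S. scl (u (z j)) (z j)) = 0" using u(3) True by (simp add: sum.reindex)
  then have "(\<Sum>j\<le>card S. u (z j) * z j x) = 0" for x
    using sum_fun_apply[of "\<lambda>j. scl (u (z j)) (z j)" "{..card S}" x] by (simp add: scl_def fun_ops)
  moreover have "(\<Sum>j\<le>card S. d j * z j x) = (\<Sum>j\<le>card S. u (z j) * z j x) / u (z i)" for x
    by (simp add: d_def sum_divide_distrib)
  ultimately have "(\<Sum>j\<le>card S. scl (d j) (z j)) = 0"
    by (auto simp: fun_eq_iff sum_fun_apply scl_def fun_ops)
  then show ?thesis using i nz by (intro exI[of _ d] exI[of _ i]) (auto simp: d_def norm_divide)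
qed

text \<open>Completeness is phrased through absolutely convergent series, the form in which both the
  successive approximation and the Baire argument use it. \<open>N\<close> is a seminorm: it may
  vanish on nonzero functions.\<close>

locale cspace =
  fixes L :: "('a \<Rightarrow> complex) set" and N :: "('a \<Rightarrow> complex) \<Rightarrow> real"
  assumes zero_mem [simp]: "0 \<in> L"
    and add_mem [simp]: "u \<in> L \<Longrightarrow> v \<in> L \<Longrightarrow> u + v \<in> L"
    and scl_mem [simp]: "u \<in> L \<Longrightarrow> scl c u \<in> L"
    and tri: "u \<in> L \<Longrightarrow> v \<in> L \<Longrightarrow> N (u + v) \<le> N u + N v"
    and N_scl [simp]: "u \<in> L \<Longrightarrow> N (scl c u) = cmod c * N u"
    and complete: "(\<And>n. U n \<in> L) \<Longrightarrow> summable (\<lambda>n. N (U n)) \<Longrightarrow>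
      \<exists>v\<in>L. (\<lambda>n. N (v - (\<Sum>i<n. U i))) \<longlonglongrightarrow> 0"
begin

lemma uminus_eq: "- u = scl (-1) u" for u :: "'a \<Rightarrow> complex" by (simp add: scl_def fun_ops fun_eq_iff)

lemma uminus_mem [simp]: "u \<in> L \<Longrightarrow> - u \<in> L" unfolding uminus_eq by (rule scl_mem)

lemma diff_mem [simp]: "u \<in> L \<Longrightarrow> v \<in> L \<Longrightarrow> u - v \<in> L"
  using add_mem[of u "- v"] by simp

lemma sum_mem [simp]: "(\<And>i. i \<in> I \<Longrightarrow> f i \<in> L) \<Longrightarrow> sum f I \<in> L"
  by (induction I rule: infinite_finite_induct) auto

lemma span_mem: "S \<subseteq> L \<Longrightarrow> z \<in> fun_vs.span S \<Longrightarrow> z \<in> L"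
  by (metis fun_vs.span_minimal fun_vs.subspace_def add_mem scl_mem zero_mem subsetD)

lemma N_zero [simp]: "N 0 = 0"
  using N_scl[of 0 0] zero_mem by (simp add: scl_def zero_fun_def del: N_scl)

lemma N_uminus [simp]: "u \<in> L \<Longrightarrow> N (- u) = N u"
  unfolding uminus_eq by (subst N_scl) auto

lemma N_nonneg [simp]: "u \<in> L \<Longrightarrow> 0 \<le> N u"
  using tri[of u "- u"] by simp

lemma N_minus_commute: "u \<in> L \<Longrightarrow> v \<in> L \<Longrightarrow> N (u - v) = N (v - u)"
  using N_uminus[of "u - v"] by simp

lemma tri_diff: "u \<in> L \<Longrightarrow> v \<in> L \<Longrightarrow> N (u - v) \<le> N u + N v"
  using tri[of u "- v"] by simp

lemma tri3: "u \<in> L \<Longrightarrow> v \<in> L \<Longrightarrow> w \<in> L \<Longrightarrow> N (u - w) \<le> N (u - v) + N (v - w)"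
  using tri[of "u - v" "v - w"] by simp

lemma tri_le: "u \<in> L \<Longrightarrow> v \<in> L \<Longrightarrow> N u \<le> N v + N (u - v)"
  using tri[of v "u - v"] by simp

lemma N_sum_le: "(\<And>i. i \<in> I \<Longrightarrow> f i \<in> L) \<Longrightarrow> N (sum f I) \<le> (\<Sum>i\<in>I. N (f i))"
proof (induction I rule: infinite_finite_induct)
  case (insert i I)
  have "N (f i + sum f I) \<le> N (f i) + N (sum f I)" by (rule tri) (auto intro: sum_mem insert.prems)
  moreover have "N (sum f I) \<le> (\<Sum>i\<in>I. N (f i))" by (rule insert.IH) (auto intro: insert.prems)
  ultimately show "N (sum f (insert i I)) \<le> (\<Sum>i\<in>insert i I. N (f i))"
    unfolding sum.insert[OF insert.hyps] by linarith
qed auto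

lemma N_eq: "u \<in> L \<Longrightarrow> v \<in> L \<Longrightarrow> N (u - v) = 0 \<Longrightarrow> N u = N v"
  using tri_le[of u v] tri_le[of v u] N_minus_commute[of u v] by auto

lemma null_trans:
  "u \<in> L \<Longrightarrow> v \<in> L \<Longrightarrow> w \<in> L \<Longrightarrow> N (u - v) = 0 \<Longrightarrow> N (v - w) = 0 \<Longrightarrow> N (u - w) = 0"
  using tri3[of u v w] N_nonneg[of "u - w"] by fastforce

section \<open>Bounded operators, linear up to null functions\<close>

definition blin :: "(('a \<Rightarrow> complex) \<Rightarrow> 'a \<Rightarrow> complex) \<Rightarrow> bool" where
  "blin A \<longleftrightarrow> (\<forall>u\<in>L. A u \<in> L) \<and> (\<forall>u\<in>L. \<forall>v\<in>L. N (A (u + v) - (A u + A v)) = 0) \<and>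
     (\<forall>u\<in>L. \<forall>c. N (A (scl c u) - scl c (A u)) = 0) \<and> (\<exists>C. \<forall>u\<in>L. N (A u) \<le> C * N u)"

lemma blin_mem: "blin A \<Longrightarrow> u \<in> L \<Longrightarrow> A u \<in> L" by (simp add: blin_def)

lemma blin_add: "blin A \<Longrightarrow> u \<in> L \<Longrightarrow> v \<in> L \<Longrightarrow> N (A (u + v) - (A u + A v)) = 0"
  by (simp add: blin_def)

lemma blin_scl: "blin A \<Longrightarrow> u \<in> L \<Longrightarrow> N (A (scl c u) - scl c (A u)) = 0"
  by (simp add: blin_def)

lemma blin_bound:
  assumes "blin A"
  obtains C where "C > 0" "\<And>u. u \<in> L \<Longrightarrow> N (A u) \<le> C * N u"
proof -
  obtain C where C: "\<And>u. u \<in> L \<Longrightarrow> N (A u) \<le> C * N u" using assms unfolding blin_def by blast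
  have "N (A u) \<le> (\<bar>C\<bar> + 1) * N u" if "u \<in> L" for u
    using C[OF that] mult_right_mono[of C "\<bar>C\<bar> + 1" "N u"] that by fastforce
  then show ?thesis by (intro that[of "\<bar>C\<bar> + 1"]) auto
qed

lemma blin_null: assumes "blin A" "u \<in> L" "N u = 0" shows "N (A u) = 0"
proof -
  obtain C where "C > 0" "\<And>u. u \<in> L \<Longrightarrow> N (A u) \<le> C * N u" using blin_bound[OF assms(1)] by blast
  from this(2)[OF assms(2)] show ?thesis using assms(3) N_nonneg[OF blin_mem[OF assms(1,2)]] by simp
qed

lemma blin_diff: assumes "blin A" "u \<in> L" "v \<in> L" shows "N (A (u - v) - (A u - A v)) = 0"
proof -
  note [simp] = blin_mem[OF assms(1)]
  have "N (A ((u - v) + v) - (A (u - v) + A v)) = 0" using assms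
    by (intro blin_add[of A "u - v" v]) simp_all
  then show ?thesis using assms N_minus_commute[of "A u" "A (u - v) + A v"]
    by (simp add: algebra_simps)
qed

lemma N_A_diff: assumes "blin A" "u \<in> L" "v \<in> L" shows "N (A u - A v) = N (A (u - v))"
  using N_eq[OF _ _ blin_diff[OF assms]] blin_mem[OF assms(1)] assms by simp

lemma blin_cong: "blin A \<Longrightarrow> u \<in> L \<Longrightarrow> v \<in> L \<Longrightarrow> N (u - v) = 0 \<Longrightarrow> N (A u - A v) = 0"
  by (simp add: N_A_diff blin_null)

lemma blin_sum:
  assumes "blin A" "finite I" "\<And>i. i \<in> I \<Longrightarrow> u i \<in> L"
  shows "N (A (\<Sum>i\<in>I. scl (d i) (u i)) - (\<Sum>i\<in>I. scl (d i) (A (u i)))) = 0"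
  using assms(2,3)
proof (induction I)
  note [simp] = blin_mem[OF assms(1)]
  case empty
  show ?case unfolding sum.empty diff_zero by (rule blin_null[OF assms(1) zero_mem N_zero])
next
  note [simp] = blin_mem[OF assms(1)]
  case (insert i I)
  let ?s = "\<Sum>i\<in>I. scl (d i) (u i)" and ?t = "\<Sum>i\<in>I. scl (d i) (A (u i))"
  have m: "?s \<in> L" "?t \<in> L" "u i \<in> L" "A (u i) \<in> L" "A ?s \<in> L" "A (scl (d i) (u i)) \<in> L"
    "A (scl (d i) (u i) + ?s) \<in> L"
    using insert.prems assms(1) by auto
  have "N (A (scl (d i) (u i) + ?s) - (A (scl (d i) (u i)) + A ?s)) = 0"
    using m assms(1) by (intro blin_add[of A "scl (d i) (u i)" ?s]) auto
  moreover have "N ((A (scl (d i) (u i)) + A ?s) - (scl (d i) (A (u i)) + ?t)) = 0"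
  proof -
    have "N ((A (scl (d i) (u i)) - scl (d i) (A (u i))) + (A ?s - ?t)) \<le> 0"
      using tri[of "A (scl (d i) (u i)) - scl (d i) (A (u i))" "A ?s - ?t"] m insert
        blin_scl[OF assms(1), of "u i" "d i"] by auto
    moreover have "(A (scl (d i) (u i)) - scl (d i) (A (u i))) + (A ?s - ?t)
       = (A (scl (d i) (u i)) + A ?s) - (scl (d i) (A (u i)) + ?t)" by simp
    ultimately have "N ((A (scl (d i) (u i)) + A ?s) - (scl (d i) (A (u i)) + ?t)) \<le> 0" by simp
    moreover have "N ((A (scl (d i) (u i)) + A ?s) - (scl (d i) (A (u i)) + ?t)) \<ge> 0"
      using m by (intro N_nonneg diff_mem add_mem scl_mem)
    ultimately show ?thesis by linarith
  qed
  ultimately have "N (A (scl (d i) (u i) + ?s) - (scl (d i) (A (u i)) + ?t)) = 0"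
    by (rule null_trans[rotated 3]) (use m in auto)
  then show ?case unfolding sum.insert[OF insert.hyps] .
qed

text \<open>The iteration of the open mapping theorem, carried out modulo a finite-dimensional space.\<close>

lemma iterate_solution:
  assumes A: "blin A" and S: "finite S" "S \<subseteq> L" and C: "C \<ge> 0"
    and step: "\<And>v. v \<in> L \<Longrightarrow> \<exists>u\<in>L. \<exists>c. N u \<le> C * N v \<and> (\<forall>s\<in>S. cmod (c s) \<le> C * N v) \<and>
      N (v - A u - (\<Sum>s\<in>S. scl (c s) s)) \<le> N v / 2"
    and v: "v \<in> L"
  shows "\<exists>u\<in>L. \<exists>c. N u \<le> 2 * C * N v \<and> N (v - A u - (\<Sum>s\<in>S. scl (c s) s)) = 0"
proof -
  note [simp] = blin_mem[OF A]
  define Q where "Q v u c \<longleftrightarrow> u \<in> L \<and> N u \<le> C * N v \<and> (\<forall>s\<in>S. cmod (c s) \<le> C * N v) \<and>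
      N (v - A u - (\<Sum>s\<in>S. scl (c s) s)) \<le> N v / 2" for v u c
  have "\<forall>v\<in>L. \<exists>x. Q v (fst x) (snd x)" 
  proof
    fix v assume "v \<in> L"
    then obtain u c where "Q v u c" using step unfolding Q_def by blast
    then show "\<exists>x. Q v (fst x) (snd x)" by (intro exI[of _ "(u, c)"]) simp
  qed
  then obtain f where "\<forall>v\<in>L. Q v (fst (f v)) (snd (f v))" by (rule bchoice[THEN exE])
  then have f: "v \<in> L \<Longrightarrow> Q v (fst (f v)) (snd (f v))" for v by blast
  define U where "U v = fst (f v)" for v
  define c where "c v = snd (f v)" for v
  have U: "\<And>v. v \<in> L \<Longrightarrow> U v \<in> L" "\<And>v. v \<in> L \<Longrightarrow> N (U v) \<le> C * N v"
    and c: "\<And>v s. v \<in> L \<Longrightarrow> s \<in> S \<Longrightarrow> cmod (c v s) \<le> C * N v"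
    and e: "\<And>v. v \<in> L \<Longrightarrow> N (v - A (U v) - (\<Sum>s\<in>S. scl (c v s) s)) \<le> N v / 2"
    using f by (auto simp: Q_def U_def c_def)
  \<comment> \<open>\<open>r n\<close> is the residual after \<open>n\<close> corrections. Its norm
    is at most \<open>N v / 2 ^ n\<close>, so the corrections and the coefficients are dominated by
    geometric series; their sum is the origin of the factor \<open>2 * C\<close>.\<close>
  define r where "r n = ((\<lambda>v. v - A (U v) - (\<Sum>s\<in>S. scl (c v s) s)) ^^ n) v" for n
  have r0: "r 0 = v" and rS: "r (Suc n) = r n - A (U (r n)) - (\<Sum>s\<in>S. scl (c (r n) s) s)" for n
    by (auto simp: r_def)
  have rL: "r n \<in> L" for n
  proof (induction n)
    case (Suc n)
    then show ?case unfolding rS using A U S(2) by (intro diff_mem sum_mem) auto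
  qed (simp add: r0 v)
  have rN: "N (r n) \<le> N v * (1/2) ^ n" for n
  proof (induction n)
    case (Suc n)
    have "N (r (Suc n)) \<le> N (r n) / 2" unfolding rS by (rule e[OF rL])
    with Suc show ?case by simp
  qed (simp add: r0)
  have sm: "summable (\<lambda>n. C * (N v * (1/2) ^ n))" by (intro summable_mult) auto
  have uN: "N (U (r n)) \<le> C * (N v * (1/2) ^ n)" for n
    using U(2)[OF rL[of n]] mult_left_mono[OF rN[of n] C] by linarith
  have cN: "cmod (c (r n) s) \<le> C * (N v * (1/2) ^ n)" if "s \<in> S" for n s
    using c[OF rL[of n] that] mult_left_mono[OF rN[of n] C] by linarith
  have ss: "summable (\<lambda>n. N (U (r n)))"
    using U(1) rL uN by (intro summable_comparison_test[OF _ sm]) auto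
  obtain u where u: "u \<in> L" "(\<lambda>n. N (u - (\<Sum>i<n. U (r i)))) \<longlonglongrightarrow> 0"
    using complete[of "\<lambda>n. U (r n)", OF _ ss] U(1) rL by auto
  define d where "d s = (\<Sum>n. c (r n) s)" for s
  have d: "(\<lambda>n. \<Sum>i<n. c (r i) s) \<longlonglongrightarrow> d s" if "s \<in> S" for s
    unfolding d_def using cN[OF that]
    by (intro summable_LIMSEQ summable_comparison_test[OF _ sm]) auto
  have geo: "(\<Sum>i<n. C * (N v * (1/2) ^ i)) \<le> 2 * C * N v" for n
  proof -
    have "(\<Sum>i<n. C * (N v * (1/2) ^ i)) = C * N v * (\<Sum>i<n. (1/2) ^ i)"
      by (simp add: sum_distrib_left mult.assoc)
    also have "\<dots> \<le> C * N v * 2"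
      using C v by (intro mult_left_mono) (auto simp: sum_gp_strict)
    finally show ?thesis by simp
  qed
  let ?P = "\<lambda>n. \<Sum>i<n. U (r i)"
  have PL: "?P n \<in> L" for n using U(1) rL by (intro sum_mem) auto
  have "N u \<le> 2 * C * N v + N (u - ?P n)" for n
  proof -
    have "N (?P n) \<le> (\<Sum>i<n. N (U (r i)))" by (rule N_sum_le) (use U(1) rL in auto)
    also have "\<dots> \<le> (\<Sum>i<n. C * (N v * (1/2) ^ i))" by (intro sum_mono uN)
    finally show ?thesis using geo[of n] tri_le[OF u(1) PL[of n]] by linarith
  qed
  moreover have "(\<lambda>n. 2 * C * N v + N (u - ?P n)) \<longlonglongrightarrow> 2 * C * N v + 0"
    by (intro tendsto_intros u(2))
  ultimately have Nu: "N u \<le> 2 * C * N v"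
    using LIMSEQ_le_const[of "\<lambda>n. 2 * C * N v + N (u - ?P n)" "2 * C * N v + 0" "N u"] by auto
  obtain K where K: "K > 0" "\<And>u. u \<in> L \<Longrightarrow> N (A u) \<le> K * N u" using blin_bound[OF A] by blast
  \<comment> \<open>The images of the corrections are summed one by one, since \<open>A\<close> is
    additive only up to null functions. This keeps the decomposition an identity of
    functions.\<close>
  have tele: "v = r n + (\<Sum>i<n. A (U (r i))) + (\<Sum>s\<in>S. scl (\<Sum>i<n. c (r i) s) s)" for n
  proof (induction n)
    case 0
    then show ?case by (simp add: r0)
  next
    case (Suc n)
    have "(\<Sum>s\<in>S. scl (\<Sum>i<Suc n. c (r i) s) s)
        = (\<Sum>s\<in>S. scl (\<Sum>i<n. c (r i) s) s) + (\<Sum>s\<in>S. scl (c (r n) s) s)"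
      by (simp add: sum.distrib[symmetric] fun_vs.scale_left_distrib)
    then show ?case using Suc by (simp add: rS algebra_simps)
  qed
  let ?E = "v - A u - (\<Sum>s\<in>S. scl (d s) s)"
  have EL: "?E \<in> L" using v A u(1) S(2) by (intro diff_mem sum_mem) auto
  \<comment> \<open>A bound for the final error that tends to \<open>0\<close>: the residual, the
    truncation of \<open>u\<close> and the truncation of the coefficients.\<close>
  define b where "b n = N v * (1/2) ^ n + K * N (u - ?P n)
      + (\<Sum>s\<in>S. cmod ((\<Sum>i<n. c (r i) s) - d s) * N s)" for n
  have "N ?E \<le> b n" for n
  proof -
    have Au: "N ((\<Sum>i<n. A (U (r i))) - A u) \<le> K * N (u - ?P n)"
    proof -
      have "N (A (?P n) - (\<Sum>i<n. A (U (r i)))) = 0"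
        using blin_sum[OF A, of "{..<n}" "\<lambda>i. U (r i)" "\<lambda>_. 1"] U(1) rL by simp
      moreover have "N (A (?P n) - A u) \<le> K * N (u - ?P n)"
        using N_A_diff[OF A PL u(1), of n] K(2)[of "?P n - u"] PL[of n] u(1) N_minus_commute[of "?P n" u] by simp
      moreover have "N ((\<Sum>i<n. A (U (r i))) - A u) \<le> N ((\<Sum>i<n. A (U (r i))) - A (?P n)) + N (A (?P n) - A u)"
        using A U(1) rL u(1) PL by (intro tri3 sum_mem blin_mem[OF A]) auto
      moreover have "N ((\<Sum>i<n. A (U (r i))) - A (?P n)) = N (A (?P n) - (\<Sum>i<n. A (U (r i))))"
        using A U(1) rL u(1) PL by (intro N_minus_commute sum_mem blin_mem[OF A]) auto
      ultimately show ?thesis by linarith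
    qed
    have E: "?E = (r n + ((\<Sum>i<n. A (U (r i))) - A u)) + (\<Sum>s\<in>S. scl ((\<Sum>i<n. c (r i) s) - d s) s)"
      using tele[of n] by (simp add: fun_vs.scale_left_diff_distrib sum_subtractf algebra_simps)
    have "N ?E \<le> N (r n + ((\<Sum>i<n. A (U (r i))) - A u)) + N (\<Sum>s\<in>S. scl ((\<Sum>i<n. c (r i) s) - d s) s)"
      unfolding E using A U(1) rL u(1) S(2) by (intro tri add_mem diff_mem sum_mem scl_mem blin_mem[OF A]) auto
    also have "\<dots> \<le> (N (r n) + N ((\<Sum>i<n. A (U (r i))) - A u)) + (\<Sum>s\<in>S. N (scl ((\<Sum>i<n. c (r i) s) - d s) s))"
      using A U(1) rL u(1) S(2) by (intro add_mono tri N_sum_le add_mem diff_mem sum_mem scl_mem blin_mem[OF A]) auto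
    also have "(\<Sum>s\<in>S. N (scl ((\<Sum>i<n. c (r i) s) - d s) s)) = (\<Sum>s\<in>S. cmod ((\<Sum>i<n. c (r i) s) - d s) * N s)"
      using S(2) by (intro sum.cong) auto
    finally show ?thesis using rN[of n] Au by (simp add: b_def)
  qed
  moreover have "b \<longlonglongrightarrow> N v * 0 + K * 0 + (\<Sum>s\<in>S. cmod (d s - d s) * N s)"
    unfolding b_def by (intro tendsto_intros u(2) d LIMSEQ_realpow_zero) auto
  ultimately have "N ?E \<le> 0" using LIMSEQ_le_const[of b 0 "N ?E"] by auto
  then show ?thesis using Nu u(1) EL by (intro bexI[of _ u] exI[of _ d]) (auto intro: order_antisym)
qed

end

section \<open>Algebra of bounded operators\<close>

context cspace
begin

lemma blin_add_scl:
  assumes "blin A" "u \<in> L" "v \<in> L"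
  shows "N (A (u + scl t v) - (A u + scl t (A v))) = 0"
proof -
  note m = blin_mem[OF assms(1)]
  have "N (A (u + scl t v) - (A u + A (scl t v))) = 0"
    using assms by (intro blin_add[OF assms(1)]) auto
  moreover have "N ((A u + A (scl t v)) - (A u + scl t (A v))) = 0"
    using blin_scl[OF assms(1,3), of t] by simp
  ultimately show ?thesis
    by (rule null_trans[rotated 3]) (use m assms in auto)
qed

lemma blinI:
  assumes "\<And>u. u \<in> L \<Longrightarrow> A u \<in> L"
    and "\<And>u v. u \<in> L \<Longrightarrow> v \<in> L \<Longrightarrow> N (A (u + v) - (A u + A v)) = 0"
    and "\<And>u c. u \<in> L \<Longrightarrow> N (A (scl c u) - scl c (A u)) = 0"
    and "\<And>u. u \<in> L \<Longrightarrow> N (A u) \<le> C * N u"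
  shows "blin A"
  unfolding blin_def by (intro conjI ballI allI exI[of _ C] assms)

lemma null_le: "u \<in> L \<Longrightarrow> N u \<le> 0 \<Longrightarrow> N u = 0"
  using N_nonneg[of u] by linarith

lemma blin_comp:
  assumes A: "blin A" and B: "blin B"
  shows "blin (\<lambda>u. A (B u))"
proof -
  note [simp] = blin_mem[OF A] blin_mem[OF B]
  obtain C where C: "C > 0" "\<And>u. u \<in> L \<Longrightarrow> N (A u) \<le> C * N u" using blin_bound[OF A] by blast
  obtain D where D: "D > 0" "\<And>u. u \<in> L \<Longrightarrow> N (B u) \<le> D * N u" using blin_bound[OF B] by blast
  show ?thesis
  proof (rule blinI[where C = "C * D"])
    fix u v assume uv: "u \<in> L" "v \<in> L"
    have "N (A (B (u + v)) - A (B u + B v)) = 0" using uv by (intro blin_cong[OF A] blin_add[OF B]) auto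
    moreover have "N (A (B u + B v) - (A (B u) + A (B v))) = 0" using uv by (intro blin_add[OF A]) auto
    ultimately show "N (A (B (u + v)) - (A (B u) + A (B v))) = 0"
      by (rule null_trans[rotated 3]) (use uv in auto)
  next
    fix u c assume u: "u \<in> L"
    have "N (A (B (scl c u)) - A (scl c (B u))) = 0" using u by (intro blin_cong[OF A] blin_scl[OF B]) auto
    moreover have "N (A (scl c (B u)) - scl c (A (B u))) = 0" using u by (intro blin_scl[OF A]) auto
    ultimately show "N (A (B (scl c u)) - scl c (A (B u))) = 0"
      by (rule null_trans[rotated 3]) (use u in auto)
  next
    fix u assume u: "u \<in> L"
    have "N (A (B u)) \<le> C * N (B u)" using C u by simp
    also have "\<dots> \<le> C * (D * N u)" using C D u by (intro mult_left_mono) auto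
    finally show "N (A (B u)) \<le> C * D * N u" by simp
  qed simp
qed

lemma null_add:
  assumes "u \<in> L" "v \<in> L" "N u = 0" "N v = 0" shows "N (u + v) = 0"
  using tri[OF assms(1,2)] assms by (intro null_le) auto

lemma blin_plus_op:
  assumes A: "blin A" and B: "blin B"
  shows "blin (\<lambda>u. A u + B u)"
proof -
  note [simp] = blin_mem[OF A] blin_mem[OF B]
  obtain C where C: "C > 0" "\<And>u. u \<in> L \<Longrightarrow> N (A u) \<le> C * N u" using blin_bound[OF A] by blast
  obtain D where D: "D > 0" "\<And>u. u \<in> L \<Longrightarrow> N (B u) \<le> D * N u" using blin_bound[OF B] by blast
  show ?thesis
  proof (rule blinI[where C = "C + D"])
    fix u v assume uv: "u \<in> L" "v \<in> L"
    have "N ((A (u + v) - (A u + A v)) + (B (u + v) - (B u + B v))) = 0"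
      using uv by (intro null_add blin_add[OF A] blin_add[OF B]) auto
    then show "N ((A (u + v) + B (u + v)) - ((A u + B u) + (A v + B v))) = 0"
      by (simp add: algebra_simps)
  next
    fix u c assume u: "u \<in> L"
    have "N ((A (scl c u) - scl c (A u)) + (B (scl c u) - scl c (B u))) = 0"
      using u by (intro null_add blin_scl[OF A] blin_scl[OF B]) auto
    then show "N ((A (scl c u) + B (scl c u)) - scl c (A u + B u)) = 0"
      by (simp add: algebra_simps fun_vs.scale_right_distrib)
  next
    fix u assume u: "u \<in> L"
    show "N (A u + B u) \<le> (C + D) * N u"
      using C(2)[OF u] D(2)[OF u] tri[of "A u" "B u"] u by (simp add: algebra_simps)
  qed simp
qed

lemma blin_scl_op: "blin (scl c)"
proof (rule blinI[where C = "cmod c"])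
  show "N (scl c (u + v) - (scl c u + scl c v)) = 0" for u v
    by (simp add: fun_vs.scale_right_distrib)
  show "N (scl c (scl d u) - scl d (scl c u)) = 0" for u d
    by (simp add: mult.commute)
qed auto

lemma blin_minus_op:
  assumes A: "blin A" and B: "blin B"
  shows "blin (\<lambda>u. A u - B u)"
  using blin_plus_op[OF A blin_comp[OF blin_scl_op[of "-1"] B]] by simp

lemma blin_zero_op: "blin (\<lambda>u. 0)"
  by (rule blinI[where C = 0]) auto

lemma blin_sum_op: "(\<And>i. i \<in> I \<Longrightarrow> blin (A i)) \<Longrightarrow> blin (\<lambda>u. \<Sum>i\<in>I. A i u)"
proof (induction I rule: infinite_finite_induct)
  case (insert i I)
  have 1: "blin (A i)" by (rule insert.prems) simp
  have "blin (\<lambda>u. \<Sum>i\<in>I. A i u)"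
  proof (rule insert.IH)
    fix j assume "j \<in> I" then show "blin (A j)" using insert.prems[of j] by simp
  qed
  with 1 have "blin (\<lambda>u. A i u + (\<Sum>i\<in>I. A i u))" by (rule blin_plus_op)
  then show ?case unfolding sum.insert[OF insert.hyps] .
qed (auto simp: blin_zero_op)

subsection \<open>The open mapping theorem for operators of finite corank\<close>

definition corange :: "(('a \<Rightarrow> complex) \<Rightarrow> 'a \<Rightarrow> complex) \<Rightarrow> ('a \<Rightarrow> complex) set \<Rightarrow> bool" where
  "corange A S \<longleftrightarrow> finite S \<and> S \<subseteq> L \<and>
     (\<forall>v\<in>L. \<exists>u\<in>L. \<exists>c. N (v - A u - (\<Sum>s\<in>S. scl (c s) s)) = 0)"

text \<open>Baire's argument with nested balls: if the approximable points filled no ball, then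
  balls could be shrunk successively so as to avoid the images of the sets \<open>Y 0\<close>,
  \<open>Y 1\<close>, and so on. The centres converge to a point outside all these images, although
  \<open>corange A S\<close> puts every point into one of them.\<close>

lemma baire_step:
  assumes A: "blin A" and S: "corange A S"
  defines "Y m u c \<equiv> u \<in> L \<and> N u \<le> real m \<and> (\<forall>s\<in>S. cmod (c s) \<le> real m)"
    and "R u c \<equiv> A u + (\<Sum>s\<in>S. scl (c s) s)"
  shows "\<exists>m. \<exists>y\<in>L. \<exists>r>0. \<forall>y'\<in>L. N (y' - y) < r \<longrightarrow> (\<forall>e>0. \<exists>u c. Y m u c \<and> N (y' - R u c) < e)"
proof (rule ccontr)
  note [simp] = blin_mem[OF A]
  have SL: "s \<in> S \<Longrightarrow> s \<in> L" for s using S by (auto simp: corange_def)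
  have RL: "u \<in> L \<Longrightarrow> R u c \<in> L" for u c unfolding R_def using SL by (intro add_mem sum_mem) auto
  assume neg: "\<not> ?thesis"
  have ex: "\<exists>y'\<in>L. \<exists>e>0. N (y' - y) < r \<and> (\<forall>u c. Y m u c \<longrightarrow> e \<le> N (y' - R u c))"
    if "y \<in> L" "r > 0" for m y r
  proof -
    define W where "W m y r \<longleftrightarrow> (\<forall>y'\<in>L. N (y' - y) < r \<longrightarrow> (\<forall>e>0. \<exists>u c. Y m u c \<and> N (y' - R u c) < e))"
      for m y r
    have "\<not> (\<exists>m. \<exists>y\<in>L. \<exists>r>0. W m y r)" using neg unfolding W_def .
    then have "\<not> W m y r" using that by blast
    then obtain y' e where "y' \<in> L" "N (y' - y) < r" "e > 0" and
      *: "\<not> (\<exists>u c. Y m u c \<and> N (y' - R u c) < e)" unfolding W_def by blast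
    moreover have "e \<le> N (y' - R u c)" if "Y m u c" for u c
    proof (rule ccontr)
      assume "\<not> e \<le> N (y' - R u c)"
      then show False using * that by (simp add: not_le)
    qed
    ultimately show ?thesis by blast
  qed
  \<comment> \<open>Pairs are centres with radii. The new ball lies in the old one and has at most
    half its radius, and its centre is farther than this radius from every image treated at step
    \<open>n\<close>; so no point of the closed new ball is such an image.\<close>
  define Q where "Q n x x' \<longleftrightarrow> N (fst x' - fst x) + snd x' \<le> snd x \<and> snd x' \<le> snd x / 2 \<and>
     (\<forall>u c. Y n u c \<longrightarrow> N (fst x' - R u c) > snd x')" for n x and x' :: "('a \<Rightarrow> complex) \<times> real"
  have "\<exists>f. \<forall>n. (fst (f n) \<in> L \<and> snd (f n) > 0 \<and> (n = 0 \<longrightarrow> f n = (0, 1))) \<and> Q n (f n) (f (Suc n))"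
  proof (rule dependent_nat_choice)
    show "\<exists>x::('a \<Rightarrow> complex) \<times> real. fst x \<in> L \<and> snd x > 0 \<and> (0 = (0::nat) \<longrightarrow> x = (0, 1))"
      by (intro exI[of _ "(0,1)"]) auto
  next
    fix x :: "('a \<Rightarrow> complex) \<times> real" and n :: nat
    assume x: "fst x \<in> L \<and> snd x > 0 \<and> (n = 0 \<longrightarrow> x = (0, 1))"
    then obtain y' e where y': "y' \<in> L" "e > 0" "N (y' - fst x) < snd x"
      "\<And>u c. Y n u c \<Longrightarrow> e \<le> N (y' - R u c)" using ex[of "fst x" "snd x" n] by blast
    define r' where "r' = min (e / 2) (min (snd x / 2) (snd x - N (y' - fst x)))"
    have r': "r' > 0" "r' < e" "r' \<le> snd x / 2" "N (y' - fst x) + r' \<le> snd x"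
      using y'(2,3) x unfolding r'_def by linarith+
    have "Q n x (y', r')" unfolding Q_def using r' y'(4) by fastforce
    then show "\<exists>y. (fst y \<in> L \<and> snd y > 0 \<and> (Suc n = 0 \<longrightarrow> y = (0, 1))) \<and> Q n x y"
      using r' y' by (intro exI[of _ "(y', r')"]) auto
  qed
  then obtain f where f: "\<And>n. fst (f n) \<in> L" "\<And>n. snd (f n) > 0" "f 0 = (0, 1)"
    "\<And>n. Q n (f n) (f (Suc n))" by blast
  define y r where "y n = fst (f n)" and "r n = snd (f n)" for n
  have y: "y n \<in> L" "r n > 0" "N (y (Suc n) - y n) + r (Suc n) \<le> r n" "r (Suc n) \<le> r n / 2"
    "Y n u c \<Longrightarrow> N (y (Suc n) - R u c) > r (Suc n)" and y0: "y 0 = 0" "r 0 = 1" for n u c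
    using f unfolding y_def r_def Q_def by auto
  have rn: "r n \<le> (1/2) ^ n" for n
  proof (induction n)
    case (Suc n)
    then show ?case using y(4)[of n] by simp
  qed (simp add: y0)
  have "N (y (Suc n) - y n) \<le> (1/2) ^ n" for n using y(3)[of n] y(2)[of "Suc n"] rn[of n] by linarith
  then have "summable (\<lambda>n. N (y (Suc n) - y n))"
    using y(1) by (intro summable_comparison_test[OF _ summable_geometric[of "1/2::real"]]) auto
  then obtain v where v: "v \<in> L" "(\<lambda>n. N (v - (\<Sum>i<n. y (Suc i) - y i))) \<longlonglongrightarrow> 0"
    using complete[of "\<lambda>n. y (Suc n) - y n"] y(1) by auto
  have tele: "(\<Sum>i<n. y (Suc i) - y i) = y n" for n
    using sum_lessThan_telescope[of y n] y0 by simp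
  have lim: "(\<lambda>n. N (v - y n)) \<longlonglongrightarrow> 0" using v(2) by (simp only: tele)
  have mono: "N (y (m + k) - y m) + r (m + k) \<le> r m" for m k
  proof (induction k)
    case (Suc k)
    have "N (y (m + Suc k) - y m) \<le> N (y (m + Suc k) - y (m + k)) + N (y (m + k) - y m)"
      by (rule tri3) (auto simp: y)
    then show ?case using Suc y(3)[of "m + k"] by simp
  qed simp
  have near: "N (v - y m) \<le> r m" for m
  proof -
    have "N (v - y m) \<le> N (v - y n) + r m" if "n \<ge> m" for n
      using mono[of m "n - m"] that y(2)[of n] tri3[of v "y n" "y m"] y(1) v(1) by fastforce
    moreover have "(\<lambda>n. N (v - y n) + r m) \<longlonglongrightarrow> 0 + r m" by (intro tendsto_intros lim)
    ultimately show ?thesis using LIMSEQ_le_const[of "\<lambda>n. N (v - y n) + r m" "0 + r m"] by auto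
  qed
  obtain u c where uc: "u \<in> L" "N (v - A u - (\<Sum>s\<in>S. scl (c s) s)) = 0"
    using S[unfolded corange_def, THEN conjunct2, THEN conjunct2, rule_format, OF v(1)] by blast
  have uc': "N (v - R u c) = 0" using uc(2) by (simp add: R_def diff_diff_eq)
  obtain m where m: "max (N u) (\<Sum>s\<in>S. cmod (c s)) \<le> real m" using real_arch_simple by blast
  have "cmod (c s) \<le> (\<Sum>s\<in>S. cmod (c s))" if "s \<in> S" for s
    using S that by (intro member_le_sum) (auto simp: corange_def)
  then have "Y m u c" using m uc(1) unfolding Y_def by fastforce
  then have "r (Suc m) < N (y (Suc m) - R u c)" by (rule y(5))
  also have "\<dots> \<le> N (y (Suc m) - v) + N (v - R u c)" using y(1) v(1) RL uc(1) by (intro tri3) auto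
  finally show False using near[of "Suc m"] uc' N_minus_commute[OF y(1) v(1), of "Suc m"] by linarith
qed

text \<open>The ball found by \<open>baire_step\<close> need not be centred at \<open>0\<close>.
  Subtracting approximations of its centre and of the centre plus a small multiple of
  \<open>v\<close>, and scaling back, gives a solution for \<open>v\<close> up to half of its norm;
  \<open>iterate_solution\<close> removes this error.\<close>

lemma open_mapping:
  assumes A: "blin A" and S: "corange A S"
  shows "\<exists>C\<ge>0. \<forall>v\<in>L. \<exists>u\<in>L. \<exists>c. N u \<le> C * N v \<and> N (v - A u - (\<Sum>s\<in>S. scl (c s) s)) = 0"
proof -
  note [simp] = blin_mem[OF A]
  have SL: "s \<in> S \<Longrightarrow> s \<in> L" and fS: "finite S" for s using S by (auto simp: corange_def)
  define R where "R u c = A u + (\<Sum>s\<in>S. scl (c s) s)" for u c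
  have RL: "u \<in> L \<Longrightarrow> R u c \<in> L" for u c unfolding R_def using SL by (intro add_mem sum_mem) auto
  obtain m y r where y: "y \<in> L" "r > 0" and ap: "\<And>y' e. y' \<in> L \<Longrightarrow> N (y' - y) < r \<Longrightarrow> e > 0 \<Longrightarrow>
     \<exists>u c. u \<in> L \<and> N u \<le> real m \<and> (\<forall>s\<in>S. cmod (c s) \<le> real m) \<and> N (y' - R u c) < e"
  proof -
    note * = baire_step[OF A S, folded R_def]
    obtain m y r where "y \<in> L" "r > 0" and ap: "\<forall>y'\<in>L. N (y' - y) < r \<longrightarrow> (\<forall>e>0. \<exists>u c.
      (u \<in> L \<and> N u \<le> real m \<and> (\<forall>s\<in>S. cmod (c s) \<le> real m)) \<and> N (y' - R u c) < e)"
      using * by (elim exE bexE conjE)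
    then show ?thesis using that[of y r m] by simp
  qed
  \<comment> \<open>Two approximants of size \<open>m\<close> differ by at most
    \<open>2 * m\<close>, and division by \<open>t = r / (2 * N v)\<close> turns this into
    \<open>C * N v\<close>. The same division turns the two errors \<open>r / 8\<close> into
    \<open>N v / 2\<close>.\<close>
  define C where "C = 4 * real m / r"
  have C: "C \<ge> 0" using y by (simp add: C_def)
  have step: "\<exists>u\<in>L. \<exists>c. N u \<le> C * N v \<and> (\<forall>s\<in>S. cmod (c s) \<le> C * N v) \<and>
      N (v - A u - (\<Sum>s\<in>S. scl (c s) s)) \<le> N v / 2" if v: "v \<in> L" for v
  proof (cases "N v = 0")
    case True
    have "N (v - A 0 - (\<Sum>s\<in>S. scl 0 s)) \<le> N v + N (A 0)" using tri_diff[of v "A 0"] v by simp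
    moreover have "N (A 0) = 0" by (rule blin_null[OF A]) auto
    ultimately show ?thesis using True by (intro bexI[of _ 0] exI[of _ "\<lambda>_. 0"]) auto
  next
    case False
    then have Nv: "N v > 0" using N_nonneg[OF v] by linarith
    define t where "t = r / (2 * N v)"
    have t: "t > 0" using Nv y by (simp add: t_def)
    have "N (y + scl (of_real t) v - y) < r" using v Nv y t by (simp add: t_def norm_divide)
    then obtain u1 c1 where 1: "u1 \<in> L" "N u1 \<le> real m" "\<And>s. s \<in> S \<Longrightarrow> cmod (c1 s) \<le> real m"
      "N (y + scl (of_real t) v - R u1 c1) < r / 8"
      using ap[of "y + scl (of_real t) v" "r / 8"] v y by auto
    obtain u2 c2 where 2: "u2 \<in> L" "N u2 \<le> real m" "\<And>s. s \<in> S \<Longrightarrow> cmod (c2 s) \<le> real m"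
      "N (y - R u2 c2) < r / 8" using ap[of y "r / 8"] y by auto
    define u c where "u = scl (of_real (1/t)) (u1 - u2)" and "c s = of_real (1/t) * (c1 s - c2 s)" for s
    have u: "u \<in> L" using 1 2 by (simp add: u_def)
    have mt: "2 * real m / t = C * N v" using y Nv by (simp add: C_def t_def field_simps)
    have "N (u1 - u2) \<le> 2 * real m" using tri_diff[OF 1(1) 2(1)] 1 2 by linarith
    then have "(1/t) * N (u1 - u2) \<le> (1/t) * (2 * real m)" using t by (intro mult_left_mono) auto
    then have Nu: "N u \<le> C * N v" using 1 2 t mt by (simp add: u_def norm_divide)
    have Nc: "cmod (c s) \<le> C * N v" if "s \<in> S" for s
    proof -
      have "cmod (c1 s - c2 s) \<le> 2 * real m"
        using norm_triangle_ineq4[of "c1 s" "c2 s"] 1(3)[OF that] 2(3)[OF that] by linarith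
      then have "(1/t) * cmod (c1 s - c2 s) \<le> (1/t) * (2 * real m)" using t by (intro mult_left_mono) auto
      then show ?thesis using t mt by (simp add: c_def norm_mult norm_divide)
    qed
    have "N (A (u1 - u2) - (A u1 - A u2)) = 0" using 1 2 by (intro blin_diff[OF A])
    define z where "z = (y + scl (of_real t) v - R u1 c1) - (y - R u2 c2)"
    have zL: "z \<in> L" using 1 2 v y RL by (simp add: z_def)
    have "N z < r / 4" using tri_diff[of "y + scl (of_real t) v - R u1 c1" "y - R u2 c2"] 1 2 v y RL
      unfolding z_def by simp
    have zz: "scl (of_real (1/t)) z = v - scl (of_real (1/t)) (A u1 - A u2) - (\<Sum>s\<in>S. scl (c s) s)"
    proof -
      have "z = scl (of_real t) v - (A u1 - A u2) - (\<Sum>s\<in>S. scl (c1 s - c2 s) s)"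
        unfolding z_def R_def by (simp add: fun_vs.scale_left_diff_distrib sum_subtractf)
      moreover have "scl (of_real (1/t)) (\<Sum>s\<in>S. scl (c1 s - c2 s) s) = (\<Sum>s\<in>S. scl (c s) s)"
        unfolding fun_vs.scale_sum_right c_def by simp
      ultimately show ?thesis using t by (simp add: fun_vs.scale_right_diff_distrib)
    qed
    have "N (A (u1 - u2) - (A u1 - A u2)) = 0" using 1 2 by (intro blin_diff[OF A])
    then have n1: "N (scl (of_real (1/t)) (A (u1 - u2)) - scl (of_real (1/t)) (A u1 - A u2)) = 0"
      using 1 2 by (subst fun_vs.scale_right_diff_distrib[symmetric]) (simp del: fun_vs.scale_right_diff_distrib)
    have n2: "N (A u - scl (of_real (1/t)) (A (u1 - u2))) = 0"
      unfolding u_def using 1 2 by (intro blin_scl[OF A]) auto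
    have n3: "N (A u - scl (of_real (1/t)) (A u1 - A u2)) = 0"
      using u 1 2 by (intro null_trans[OF _ _ _ n2 n1]) auto
    have "v - A u - (\<Sum>s\<in>S. scl (c s) s) = scl (of_real (1/t)) z - (A u - scl (of_real (1/t)) (A u1 - A u2))"
      unfolding zz by simp
    note E = this
    have "N (v - A u - (\<Sum>s\<in>S. scl (c s) s)) \<le> N (scl (of_real (1/t)) z)"
      unfolding E using tri_diff[of "scl (of_real (1/t)) z" "A u - scl (of_real (1/t)) (A u1 - A u2)"] n3 u 1 2 zL by simp
    also have "\<dots> = (1/t) * N z" using zL t by (simp add: norm_divide)
    also have "\<dots> \<le> (1/t) * (r / 4)" using \<open>N z < r / 4\<close> t by (intro mult_left_mono) auto
    also have "\<dots> = N v / 2" using y Nv by (simp add: t_def field_simps)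
    finally show ?thesis using u Nu Nc by blast
  qed
  have "\<forall>v\<in>L. \<exists>u\<in>L. \<exists>c. N u \<le> 2 * C * N v \<and> N (v - A u - (\<Sum>s\<in>S. scl (c s) s)) = 0"
    using iterate_solution[OF A fS _ C step] SL by blast
  then show ?thesis using C by (intro exI[of _ "2 * C"]) auto
qed

subsection \<open>Fredholm operators\<close>

definition fred :: "(('a \<Rightarrow> complex) \<Rightarrow> 'a \<Rightarrow> complex) \<Rightarrow> bool" where
  "fred A \<longleftrightarrow> blin A \<and>
     (\<exists>S. finite S \<and> S \<subseteq> {u \<in> L. N (A u) = 0} \<and>
       (\<forall>u\<in>L. N (A u) = 0 \<longrightarrow> (\<exists>c. N (u - (\<Sum>s\<in>S. scl (c s) s)) = 0))) \<and>
     (\<exists>S. corange A S)"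

text \<open>The open mapping estimate with the remainder written as an element of a span, the form
  to which \<open>exists_relation\<close> applies.\<close>

lemma fred_upper:
  assumes "fred A"
  shows "\<exists>S C. finite S \<and> S \<subseteq> L \<and> C \<ge> 0 \<and>
    (\<forall>v\<in>L. \<exists>u\<in>L. \<exists>z\<in>fun_vs.span S. N u \<le> C * N v \<and> N (v - A u - z) = 0)"
proof -
  obtain S where S: "corange A S" and A: "blin A" using assms by (auto simp: fred_def)
  obtain C where C: "C \<ge> 0" "\<And>v. v \<in> L \<Longrightarrow>
      \<exists>u\<in>L. \<exists>c. N u \<le> C * N v \<and> N (v - A u - (\<Sum>s\<in>S. scl (c s) s)) = 0"
    using open_mapping[OF A S] by blast
  have "(\<Sum>s\<in>S. scl (c s) s) \<in> fun_vs.span S" for c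
    by (intro fun_vs.span_sum fun_vs.span_scale fun_vs.span_base)
  then have "\<exists>u\<in>L. \<exists>z\<in>fun_vs.span S. N u \<le> C * N v \<and> N (v - A u - z) = 0" if "v \<in> L" for v
    using C(2)[OF that] by blast
  moreover have "finite S" "S \<subseteq> L" using S by (auto simp: corange_def)
  ultimately show ?thesis using C(1) by (intro exI[of _ S] exI[of _ C]) simp
qed

text \<open>If \<open>c s\<close> were nonzero, the relation would express \<open>s\<close> by the
  range and the remaining elements, so that \<open>S - {s}\<close> would do as well. Hence the span
  of a spanning set of least size meets the range only trivially.\<close>

lemma corange_minimal:
  assumes A: "blin A" and S: "corange A S" and min: "\<And>T. corange A T \<Longrightarrow> card S \<le> card T"
    and u: "u \<in> L" and null: "N (A u + (\<Sum>s\<in>S. scl (c s) s)) = 0" and s: "s \<in> S"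
  shows "c s = 0"
proof (rule ccontr)
  note [simp] = blin_mem[OF A]
  assume c: "c s \<noteq> 0"
  have SL: "s \<in> S \<Longrightarrow> s \<in> L" and fS: "finite S" for s using S by (auto simp: corange_def)
  have "corange A (S - {s})" unfolding corange_def
  proof (intro conjI ballI)
    fix v assume v: "v \<in> L"
    then obtain u' c' where u': "u' \<in> L" "N (v - A u' - (\<Sum>s\<in>S. scl (c' s) s)) = 0"
      using S unfolding corange_def by blast
    define t where "t = c' s / c s"
    define c'' where "c'' r = c' r - t * c r" for r
    let ?w = "u' + scl (- t) u"
    have 1: "N (A ?w - (A u' + scl (- t) (A u))) = 0" by (rule blin_add_scl[OF A u'(1) u])
    have "(\<Sum>r\<in>S - {s}. scl (c'' r) r) = (\<Sum>r\<in>S. scl (c'' r) r)"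
      using fS s c by (subst sum.remove[OF fS s]) (simp add: c''_def t_def)
    also have "\<dots> = (\<Sum>r\<in>S. scl (c' r) r) - scl t (\<Sum>r\<in>S. scl (c r) r)"
      by (simp add: c''_def fun_vs.scale_left_diff_distrib sum_subtractf fun_vs.scale_sum_right)
    finally have 2: "v - A ?w - (\<Sum>r\<in>S - {s}. scl (c'' r) r) =
        (v - A u' - (\<Sum>s\<in>S. scl (c' s) s)) + (scl t (A u + (\<Sum>s\<in>S. scl (c s) s))
         - (A ?w - (A u' + scl (- t) (A u))))"
      by (simp add: fun_vs.scale_right_distrib)
    have 3: "N (scl t (A u + (\<Sum>s\<in>S. scl (c s) s))) = 0" using null u SL by simp
    have m: "v - A u' - (\<Sum>s\<in>S. scl (c' s) s) \<in> L" "scl t (A u + (\<Sum>s\<in>S. scl (c s) s)) \<in> L"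
       "A ?w - (A u' + scl (- t) (A u)) \<in> L" using v u u' SL by simp_all
    have "N (scl t (A u + (\<Sum>s\<in>S. scl (c s) s)) - (A ?w - (A u' + scl (- t) (A u)))) = 0"
      using tri_diff[OF m(2,3)] 1 3 m by (intro null_le) auto
    then have "N (v - A ?w - (\<Sum>r\<in>S - {s}. scl (c'' r) r)) = 0"
      unfolding 2 by (intro null_add u'(2) diff_mem m)
    moreover have "?w \<in> L" using u u' by simp
    ultimately show "\<exists>u\<in>L. \<exists>c. N (v - A u - (\<Sum>s\<in>S - {s}. scl (c s) s)) = 0" by blast
  qed (use fS SL in auto)
  from min[OF this] show False using card_Diff1_less[OF fS s] by linarith
qed

text \<open>The open mapping estimate solves \<open>A u = A u'\<close> modulo the span of
  \<open>S\<close> with \<open>u'\<close> bounded by \<open>A u\<close>. For \<open>S\<close> of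
  least size the component in the span vanishes by \<open>corange_minimal\<close>, so
  \<open>u - u'\<close> lies in the kernel, and \<open>z\<close> is its expansion in the finite
  spanning set of the kernel.\<close>

lemma fred_lower:
  assumes "fred A"
  shows "\<exists>S C. finite S \<and> S \<subseteq> L \<and> C \<ge> 0 \<and> (\<forall>u\<in>L. \<exists>z\<in>fun_vs.span S. N (u - z) \<le> C * N (A u))"
proof -
  obtain S0 where A: "blin A" and S0: "corange A S0" using assms by (auto simp: fred_def)
  note [simp] = blin_mem[OF A]
  obtain S where S: "corange A S" and min: "\<And>T. corange A T \<Longrightarrow> card S \<le> card T"
    using ex_has_least_nat[of "corange A" S0 card] S0 by blast
  have SL: "s \<in> S \<Longrightarrow> s \<in> L" and fS: "finite S" for s using S by (auto simp: corange_def)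
  obtain C where C: "C \<ge> 0" "\<And>v. v \<in> L \<Longrightarrow>
      \<exists>u\<in>L. \<exists>c. N u \<le> C * N v \<and> N (v - A u - (\<Sum>s\<in>S. scl (c s) s)) = 0"
    using open_mapping[OF A S] by blast
  obtain K where K: "finite K" "K \<subseteq> {u \<in> L. N (A u) = 0}"
    "\<And>u. u \<in> L \<Longrightarrow> N (A u) = 0 \<Longrightarrow> \<exists>c. N (u - (\<Sum>s\<in>K. scl (c s) s)) = 0"
    using assms unfolding fred_def by blast
  have "\<exists>z\<in>fun_vs.span K. N (u - z) \<le> C * N (A u)" if u: "u \<in> L" for u
  proof -
    have "A u \<in> L" using u by simp
    then obtain u' c where u': "u' \<in> L" "N u' \<le> C * N (A u)"
      "N (A u - A u' - (\<Sum>s\<in>S. scl (c s) s)) = 0" using C(2) by blast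
    let ?X = "A u - A u' - (\<Sum>s\<in>S. scl (c s) s)"
    have X: "?X \<in> L" using u u' SL by simp
    have d: "N (A (u - u') - (A u - A u')) = 0" by (rule blin_diff[OF A u u'(1)])
    have "A (u - u') + (\<Sum>s\<in>S. scl (- c s) s) = (A (u - u') - (A u - A u')) + ?X"
      by (simp add: sum_negf)
    then have "N (A (u - u') + (\<Sum>s\<in>S. scl (- c s) s)) = 0"
      using null_add[OF _ X d u'(3)] u u' by simp
    then have "- c s = 0" if "s \<in> S" for s
      using corange_minimal[OF A S min, of "u - u'" "\<lambda>s. - c s"] that u u' by simp
    then have "(\<Sum>s\<in>S. scl (c s) s) = 0" by (intro sum.neutral) auto
    then have "N (A u - A u') = 0" using u'(3) by simp
    then have "N (A (u - u')) = 0" using N_A_diff[OF A u u'(1)] by simp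
    then obtain e where e: "N (u - u' - (\<Sum>s\<in>K. scl (e s) s)) = 0"
      using K(3)[of "u - u'"] u u' by auto
    let ?z = "\<Sum>s\<in>K. scl (e s) s"
    have "?z \<in> fun_vs.span K" by (intro fun_vs.span_sum fun_vs.span_scale fun_vs.span_base)
    moreover have "?z \<in> L" using K(2) by (intro sum_mem scl_mem) auto
    then have "N (u - ?z) \<le> C * N (A u)"
      using tri[of u' "u - u' - ?z"] e u' u by simp
    ultimately show ?thesis by blast
  qed
  then show ?thesis using K(1,2) C(1) by (intro exI[of _ K] exI[of _ C]) auto
qed

text \<open>On the kernel of \<open>A\<close> the estimate reads
  \<open>N (u + F u) \<le> N u / 2\<close> up to null functions, so there \<open>F u = 0\<close>
  forces \<open>N u = 0\<close>. As \<open>F\<close> maps into a finite-dimensional space, preimages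
  of a basis of the image of the kernel span the kernel. \<open>F\<close> has to be linear exactly,
  since dimensions are counted among functions and not among classes.\<close>

lemma fred_kernel:
  assumes A: "blin A" and B: "blin B" and F: "\<And>u v. u \<in> L \<Longrightarrow> v \<in> L \<Longrightarrow> F (u + v) = F u + F v"
    "\<And>u c. u \<in> L \<Longrightarrow> F (scl c u) = scl c (F u)"
    and S: "finite S" "S \<subseteq> L" "\<And>u. u \<in> L \<Longrightarrow> F u \<in> fun_vs.span S"
    and near: "\<And>u. u \<in> L \<Longrightarrow> N (B (A u) - u - F u) \<le> N u / 2"
  shows "\<exists>S. finite S \<and> S \<subseteq> {u \<in> L. N (A u) = 0} \<and>
       (\<forall>u\<in>L. N (A u) = 0 \<longrightarrow> (\<exists>c. N (u - (\<Sum>s\<in>S. scl (c s) s)) = 0))"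
proof -
  note [simp] = blin_mem[OF A] blin_mem[OF B]
  define K where "K = {u \<in> L. N (A u) = 0}"
  have inj: "N u = 0" if u: "u \<in> K" "F u = 0" for u
  proof -
    have uL: "u \<in> L" using u by (simp add: K_def)
    have "N (B (A u)) = 0" using u by (intro blin_null[OF B]) (auto simp: K_def)
    moreover have "N (B (A u) - u) \<le> N u / 2" using near[OF uL] u by simp
    ultimately have "N u \<le> N u / 2"
      using tri_le[of u "B (A u)"] N_minus_commute[of u "B (A u)"] uL by simp
    then show ?thesis using uL by (intro null_le) auto
  qed
  obtain Bs where Bs: "Bs \<subseteq> F ` K" "fun_vs.independent Bs" "F ` K \<subseteq> fun_vs.span Bs"
    using fun_vs.maximal_independent_subset by blast
  have "F ` K \<subseteq> fun_vs.span S" using S(3) by (auto simp: K_def)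
  then have fin: "finite Bs" using fun_vs.independent_span_bound[OF S(1) Bs(2)] Bs(1) by auto
  obtain g where g: "\<And>b. b \<in> Bs \<Longrightarrow> g b \<in> K" "\<And>b. b \<in> Bs \<Longrightarrow> F (g b) = b"
  proof -
    have "\<forall>b\<in>Bs. \<exists>u. u \<in> K \<and> F u = b" using Bs(1) by auto
    then show ?thesis by (rule bchoice[THEN exE]) (auto intro: that)
  qed
  have injg: "inj_on g Bs" using g(2) by (metis inj_onI)
  have Fsum: "F (\<Sum>b\<in>T. scl (a b) (g b)) = (\<Sum>b\<in>T. scl (a b) b) \<and> (\<Sum>b\<in>T. scl (a b) (g b)) \<in> L"
    if "T \<subseteq> Bs" "finite T" for T a
    using that(2,1)
  proof (induction T)
    case empty
    have "F (scl 0 0) = scl 0 (F 0)" by (rule F(2)) simp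
    then have "F 0 = 0" by simp
    then show ?case unfolding sum.empty by simp
  next
    case (insert b T)
    then have "g b \<in> L" "F (g b) = b" using g by (auto simp: K_def)
    then show ?case unfolding sum.insert[OF insert.hyps]
      using insert by (simp add: F)
  qed
  have "\<exists>c. N (u - (\<Sum>s\<in>g ` Bs. scl (c s) s)) = 0" if u: "u \<in> L" "N (A u) = 0" for u
  proof -
    have "F u \<in> fun_vs.span Bs" using Bs(3) u by (auto simp: K_def)
    then obtain a where a: "F u = (\<Sum>b\<in>Bs. scl (a b) b)"
      using fun_vs.span_finite[OF fin] by auto
    let ?w = "\<Sum>b\<in>Bs. scl (a b) (g b)"
    have w: "?w \<in> L" "F ?w = F u" using Fsum[OF order_refl fin, of a] a by auto
    have gL: "b \<in> Bs \<Longrightarrow> g b \<in> L" "b \<in> Bs \<Longrightarrow> N (A (g b)) = 0" for b using g(1) by (auto simp: K_def)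
    have "N (A ?w - (\<Sum>b\<in>Bs. scl (a b) (A (g b)))) = 0" by (rule blin_sum[OF A fin gL(1)])
    moreover have "N (\<Sum>b\<in>Bs. scl (a b) (A (g b))) \<le> (\<Sum>b\<in>Bs. N (scl (a b) (A (g b))))"
      using gL by (intro N_sum_le) auto
    moreover have "(\<Sum>b\<in>Bs. N (scl (a b) (A (g b)))) = 0" using gL by (intro sum.neutral) auto
    moreover have "(\<Sum>b\<in>Bs. scl (a b) (A (g b))) \<in> L" using gL by (intro sum_mem) auto
    ultimately have "N (A ?w) = 0" using N_eq[of "A ?w" "\<Sum>b\<in>Bs. scl (a b) (A (g b))"] w null_le by simp
    then have "N (A u - A ?w) \<le> 0" using tri_diff[of "A u" "A ?w"] u w by simp
    then have "N (A (u - ?w)) = 0" using N_A_diff[OF A u(1) w(1)] u w by (intro null_le) auto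
    then have "u - ?w \<in> K" using u w by (simp add: K_def)
    moreover have "F (u - ?w) = 0"
    proof -
      have "F (u + scl (-1) ?w) = F u + scl (-1) (F ?w)" using u w by (subst F) (auto simp: F(2)[OF w(1)] simp del: fun_vs.scale_minus_left)
      then show ?thesis using w by simp
    qed
    ultimately have "N (u - ?w) = 0" by (rule inj)
    moreover have "(\<Sum>s\<in>g ` Bs. scl (a (F s)) s) = ?w"
      using g(2) by (simp add: sum.reindex[OF injg])
    ultimately have "N (u - (\<Sum>s\<in>g ` Bs. scl (a (F s)) s)) = 0" by simp
    then show ?thesis by (rule exI[of _ "\<lambda>s. a (F s)"])
  qed
  moreover have "finite (g ` Bs)" "g ` Bs \<subseteq> {u \<in> L. N (A u) = 0}" using fin g(1) by (auto simp: K_def)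
  ultimately show ?thesis by blast
qed

text \<open>\<open>A B - F\<close> differs from the identity by at most one half, so it is
  surjective by \<open>iterate_solution\<close> with no finite-dimensional part. Moving
  \<open>F w\<close> to the other side exhibits \<open>v\<close> as an element of the range of
  \<open>A\<close> plus the span of \<open>S\<close>.\<close>

lemma fred_corange:
  assumes A: "blin A" and B: "blin B" and F: "blin F"
    and S: "finite S" "S \<subseteq> L" "\<And>u. u \<in> L \<Longrightarrow> F u \<in> fun_vs.span S"
    and near: "\<And>u. u \<in> L \<Longrightarrow> N (A (B u) - u - F u) \<le> N u / 2"
  shows "corange A S"
proof -
  note m = blin_mem[OF A] blin_mem[OF B] blin_mem[OF F]
  have P: "blin (\<lambda>u. A (B u) - F u)" by (rule blin_minus_op[OF blin_comp[OF A B] F])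
  have "\<exists>u\<in>L. \<exists>c. N (v - A u - (\<Sum>s\<in>S. scl (c s) s)) = 0" if v: "v \<in> L" for v
  proof -
    have "\<exists>u\<in>L. \<exists>c. N u \<le> 1 * N v \<and> (\<forall>s\<in>{}. cmod (c s) \<le> 1 * N v) \<and>
      N (v - (A (B u) - F u) - (\<Sum>s\<in>{}. scl (c s) s)) \<le> N v / 2" if v: "v \<in> L" for v
    proof -
      have "v - (A (B v) - F v) = - (A (B v) - v - F v)" by simp
      then have "N (v - (A (B v) - F v)) = N (A (B v) - v - F v)"
        using N_uminus[of "A (B v) - v - F v"] v m by (simp add: algebra_simps)
      then have "N (v - (A (B v) - F v)) \<le> N v / 2" using near[OF v] by simp
      then show ?thesis using v by (intro bexI[of _ v] exI[of _ "\<lambda>_. 0"]) auto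
    qed
    from iterate_solution[OF P _ _ _ this v] obtain w where w: "w \<in> L" "N (v - (A (B w) - F w)) = 0"
      by auto
    obtain c where c: "F w = (\<Sum>s\<in>S. scl (c s) s)"
      using S(3)[OF w(1)] fun_vs.span_finite[OF S(1)] by auto
    have "v - A (B w) - (\<Sum>s\<in>S. scl (- c s) s) = v - (A (B w) - F w)"
      by (simp add: c sum_negf)
    note E = this
    have "N (v - A (B w) - (\<Sum>s\<in>S. scl (- c s) s)) = 0" unfolding E by (rule w(2))
    show ?thesis
      by (rule bexI[OF _ m(2)[OF w(1)]], rule exI[of _ "\<lambda>s. - c s"]) fact
  qed
  then show ?thesis using S by (auto simp: corange_def)
qed

section \<open>Invertibility from a lower bound and dense range\<close>

definition inv_op :: "(('a \<Rightarrow> complex) \<Rightarrow> 'a \<Rightarrow> complex) \<Rightarrow> bool" where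
  "inv_op A \<longleftrightarrow> blin A \<and> (\<exists>B. blin B \<and> (\<forall>u\<in>L. N (A (B u) - u) = 0 \<and> N (B (A u) - u) = 0))"

text \<open>The lower bound controls the size of an approximate solution with error
  \<open>N v / 2\<close>, so that \<open>iterate_solution\<close> makes it exact. Solutions are
  selected by choice; that the selection is linear up to null functions follows from the injectivity
  contained in the lower bound.\<close>

lemma inv_opI:
  assumes B: "blin B" and low: "\<And>u. u \<in> L \<Longrightarrow> N u \<le> K * N (B u)"
    and dense: "\<And>v e. v \<in> L \<Longrightarrow> e > 0 \<Longrightarrow> \<exists>u\<in>L. N (B u - v) \<le> e"
  shows "inv_op B"
proof -
  note [simp] = blin_mem[OF B]
  define C where "C = 2 * \<bar>K\<bar>"
  have C: "C \<ge> 0" by (simp add: C_def)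
  have step: "\<exists>u\<in>L. \<exists>c. N u \<le> C * N v \<and> (\<forall>s\<in>{}. cmod (c s) \<le> C * N v) \<and>
      N (v - B u - (\<Sum>s\<in>{}. scl (c s) s)) \<le> N v / 2" if v: "v \<in> L" for v
  proof (cases "N v = 0")
    case True
    then have "N (v - B 0) \<le> 0" using tri_diff[of v "B 0"] v blin_null[OF B, of 0] by simp
    then show ?thesis using True v by (intro bexI[of _ 0]) auto
  next
    case False
    then have "N v / 2 > 0" using N_nonneg[OF v] by simp
    then obtain u where u: "u \<in> L" "N (B u - v) \<le> N v / 2" using dense[OF v] by blast
    have "N u \<le> \<bar>K\<bar> * N (B u)"
      using low[OF u(1)] mult_right_mono[of K "\<bar>K\<bar>" "N (B u)"] u by fastforce
    also have "\<dots> \<le> \<bar>K\<bar> * (2 * N v)"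
    proof (rule mult_left_mono)
      have "N (B u) \<le> N v + N (B u - v)" using u v by (intro tri_le) auto
      then show "N (B u) \<le> 2 * N v" using u(2) N_nonneg[OF v] by linarith
    qed simp
    finally show ?thesis using u v N_minus_commute[of v "B u"]
      by (intro bexI[of _ u]) (auto simp: C_def)
  qed
  define X where "X v = (SOME u. u \<in> L \<and> N u \<le> 2 * C * N v \<and> N (v - B u) = 0)" for v
  have X: "X v \<in> L" "N (X v) \<le> 2 * C * N v" "N (v - B (X v)) = 0" if v: "v \<in> L" for v
  proof -
    have "\<exists>u. u \<in> L \<and> N u \<le> 2 * C * N v \<and> N (v - B u) = 0"
      using iterate_solution[OF B _ _ C step v] by auto
    from someI_ex[OF this] show "X v \<in> L" "N (X v) \<le> 2 * C * N v" "N (v - B (X v)) = 0"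
      unfolding X_def by auto
  qed
  have X': "N (B (X v) - v) = 0" if "v \<in> L" for v using X[OF that] N_minus_commute[of v "B (X v)"] that by simp
  have inj: "N (u - w) = 0" if "u \<in> L" "w \<in> L" "N (B u - B w) = 0" for u w
    using low[of "u - w"] N_A_diff[OF B that(1,2)] that by (intro null_le) auto
  have XB: "N (X (B u) - u) = 0" if u: "u \<in> L" for u
    by (rule inj[OF X(1) u X']) (simp_all add: u)
  have "blin X"
  proof (rule blinI[where C = "2 * C"])
    fix u v assume uv: "u \<in> L" "v \<in> L"
    have m: "B (X u + X v) \<in> L" "B (X u) + B (X v) \<in> L" "u + v \<in> L" "B (X (u + v)) \<in> L"
      using X(1) uv by simp_all
    have 1: "N (B (X u + X v) - (B (X u) + B (X v))) = 0" using X(1) uv by (intro blin_add[OF B]) auto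
    have "N ((B (X u) - u) + (B (X v) - v)) = 0"
      by (rule null_add[OF _ _ X'[OF uv(1)] X'[OF uv(2)]]) (simp_all add: uv X(1))
    then have 2: "N ((B (X u) + B (X v)) - (u + v)) = 0" by (simp add: algebra_simps)
    have 3: "N ((u + v) - B (X (u + v))) = 0" by (rule X(3)[OF m(3)])
    have 4: "N (B (X u + X v) - B (X (u + v))) = 0"
      by (rule null_trans[OF m(1,3,4) null_trans[OF m(1-3) 1 2] 3])
    have "N ((X u + X v) - X (u + v)) = 0" by (rule inj[OF _ _ 4]) (simp_all add: uv X(1))
    then show "N (X (u + v) - (X u + X v)) = 0" using N_minus_commute[of "X u + X v" "X (u + v)"] X(1) uv by simp
  next
    fix u c assume u: "u \<in> L"
    have m: "B (scl c (X u)) \<in> L" "scl c (B (X u)) \<in> L" "scl c u \<in> L" "B (X (scl c u)) \<in> L"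
      using X(1) u by simp_all
    have 1: "N (B (scl c (X u)) - scl c (B (X u))) = 0" using X(1) u by (intro blin_scl[OF B]) auto
    have 2: "N (scl c (B (X u)) - scl c u) = 0"
      using X'[OF u] u X(1) N_scl[of "B (X u) - u" c] by (simp add: fun_vs.scale_right_diff_distrib)
    have 3: "N (scl c u - B (X (scl c u))) = 0" by (rule X(3)[OF m(3)])
    have 4: "N (B (scl c (X u)) - B (X (scl c u))) = 0"
      by (rule null_trans[OF m(1,3,4) null_trans[OF m(1-3) 1 2] 3])
    have "N (scl c (X u) - X (scl c u)) = 0" by (rule inj[OF _ _ 4]) (simp_all add: u X(1))
    then show "N (X (scl c u) - scl c (X u)) = 0" using N_minus_commute[of "scl c (X u)" "X (scl c u)"] X(1) u by simp
  qed (use X(1,2) in auto)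
  then show ?thesis unfolding inv_op_def using X' XB by (intro conjI B exI[of _ X] ballI) simp_all
qed

end

section \<open>Lebesgue spaces\<close>

lemma powr_above_tangent:
  fixes s t p :: real
  assumes "p > 1" "s \<ge> 0" "t > 0"
  shows "t powr p + p * t powr (p - 1) * (s - t) \<le> s powr p"
proof (cases "s = 0")
  case True
  have "t powr p = t powr (p - 1) * t" using assms by (simp add: powr_mult_base mult.commute)
  then have "t powr p + p * t powr (p - 1) * (s - t) = (1 - p) * t powr p" using True by (simp add: algebra_simps)
  then show ?thesis using assms True by (simp add: mult_nonpos_nonneg)
next
  case False
  have "((\<lambda>x. x powr p) has_real_derivative p * t powr (p - 1)) (at t within {0<..})"
    using assms by (intro DERIV_subset[OF has_real_derivative_powr]) auto
  then have "s powr p - t powr p \<ge> p * t powr (p - 1) * (s - t)"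
    using assms False by (intro convex_on_imp_above_tangent[OF powr_convex[of p]])
      (auto simp: interior_open)
  then show ?thesis by simp
qed

text \<open>Convexity of the power at \<open>r\<close>, the mean of \<open>s / a\<close> and
  \<open>t / b\<close> with weights \<open>a\<close> and \<open>b\<close>. Integrated with weights
  close to the norms of two functions, it gives Minkowski's inequality.\<close>

lemma powr_add_le_weighted:
  fixes s t a b p :: real
  assumes "p > 1" "s \<ge> 0" "t \<ge> 0" "a > 0" "b > 0"
  shows "(s + t) powr p \<le> (a + b) powr (p - 1) * (a powr (1 - p) * s powr p + b powr (1 - p) * t powr p)"
proof (cases "s + t = 0")
  case False
  define r where "r = (s + t) / (a + b)"
  have r: "r > 0" using False assms by (simp add: r_def)
  have 1: "r powr p + p * r powr (p - 1) * (s / a - r) \<le> (s / a) powr p"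
    using assms r by (intro powr_above_tangent) auto
  have 2: "r powr p + p * r powr (p - 1) * (t / b - r) \<le> (t / b) powr p"
    using assms r by (intro powr_above_tangent) auto
  have "a * (r powr p + p * r powr (p - 1) * (s / a - r)) + b * (r powr p + p * r powr (p - 1) * (t / b - r))
      = (a + b) * r powr p + p * r powr (p - 1) * (s + t - (a + b) * r)"
    using assms by (simp add: field_simps)
  also have "s + t - (a + b) * r = 0" using assms by (simp add: r_def)
  finally have "a * (r powr p + p * r powr (p - 1) * (s / a - r)) + b * (r powr p + p * r powr (p - 1) * (t / b - r))
      = (a + b) * r powr p" by simp
  moreover have "a * (r powr p + p * r powr (p - 1) * (s / a - r)) \<le> a * (s / a) powr p"
    "b * (r powr p + p * r powr (p - 1) * (t / b - r)) \<le> b * (t / b) powr p"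
    using 1 2 assms by (auto intro!: mult_left_mono)
  ultimately have "(a + b) * r powr p \<le> a * (s / a) powr p + b * (t / b) powr p" by linarith
  then have "(a + b) powr (p - 1) * ((a + b) * r powr p)
      \<le> (a + b) powr (p - 1) * (a * (s / a) powr p + b * (t / b) powr p)"
    by (intro mult_left_mono) auto
  moreover have "(a + b) powr (p - 1) * ((a + b) * r powr p) = (s + t) powr p"
  proof -
    have "(a + b) powr (p - 1) * ((a + b) * r powr p) = (a + b) powr p * r powr p"
      using assms by (simp add: powr_mult_base mult.assoc[symmetric] mult.commute)
    also have "\<dots> = ((a + b) * r) powr p" using assms r by (simp add: powr_mult)
    finally show ?thesis using assms by (simp add: r_def)
  qed
  moreover have "x * (y / x) powr p = x powr (1 - p) * y powr p" if "x > 0" "y \<ge> 0" for x y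
    using that by (simp add: powr_divide powr_diff)
  ultimately show ?thesis using assms by simp
qed (use assms in \<open>auto simp: add_nonneg_eq_0_iff\<close>)

lemma LpI:
  assumes "p > 0" "u \<in> borel_measurable M" "c \<ge> 0"
    and "(\<integral>\<^sup>+x. ennreal (cmod (u x) powr p) \<partial>M) \<le> ennreal (c powr p)"
  shows "u \<in> Lp_set M p" "Lp_norm M p u \<le> c"
proof -
  have [measurable]: "u \<in> borel_measurable M" by fact
  have i: "integrable M (\<lambda>x. cmod (u x) powr p)"
    using assms(4) by (intro integrableI_bounded) (auto simp: less_top[symmetric] top_unique)
  then show "u \<in> Lp_set M p" using assms(2) by (simp add: Lp_set_def)
  have "ennreal (\<integral>x. cmod (u x) powr p \<partial>M) \<le> ennreal (c powr p)"
    using assms(4) nn_integral_eq_integral[OF i] by simp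
  then have "(\<integral>x. cmod (u x) powr p \<partial>M) \<le> c powr p" by (subst (asm) ennreal_le_iff) auto
  then have "Lp_norm M p u \<le> (c powr p) powr (1 / p)"
    unfolding Lp_norm_def using assms by (intro powr_mono2) auto
  also have "\<dots> = c" using assms by (simp add: powr_powr)
  finally show "Lp_norm M p u \<le> c" .
qed

lemma LpD:
  assumes "p > 0" "u \<in> Lp_set M p"
  shows "(\<integral>\<^sup>+x. ennreal (cmod (u x) powr p) \<partial>M) = ennreal (Lp_norm M p u powr p)"
proof -
  have i: "integrable M (\<lambda>x. cmod (u x) powr p)" using assms by (simp add: Lp_set_def)
  have "Lp_norm M p u powr p = (\<integral>x. cmod (u x) powr p \<partial>M)"
    using assms by (simp add: Lp_norm_def powr_powr)
  then show ?thesis using nn_integral_eq_integral[OF i] by simp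
qed

lemma Lp_norm_nonneg: "Lp_norm M p u \<ge> 0" by (simp add: Lp_norm_def)

lemma Lp_measurable: "u \<in> Lp_set M p \<Longrightarrow> u \<in> borel_measurable M" by (simp add: Lp_set_def)

lemma Lp_dominated:
  assumes "p > 0" "u \<in> Lp_set M p" "v \<in> borel_measurable M" "c \<ge> 0"
    and "AE x in M. cmod (v x) \<le> c * cmod (u x)"
  shows "v \<in> Lp_set M p" "Lp_norm M p v \<le> c * Lp_norm M p u"
proof -
  have [measurable]: "u \<in> borel_measurable M" "v \<in> borel_measurable M" using assms Lp_measurable by auto
  have "(\<integral>\<^sup>+x. ennreal (cmod (v x) powr p) \<partial>M) \<le> (\<integral>\<^sup>+x. ennreal (c powr p) * ennreal (cmod (u x) powr p) \<partial>M)"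
    using assms(5)
  proof (intro nn_integral_mono_AE, eventually_elim)
    case (elim x)
    then have "cmod (v x) powr p \<le> (c * cmod (u x)) powr p" using assms by (intro powr_mono2) auto
    also have "\<dots> = c powr p * cmod (u x) powr p" using assms by (simp add: powr_mult)
    finally show ?case by (simp add: ennreal_mult[symmetric] ennreal_leI)
  qed
  also have "\<dots> = ennreal (c powr p) * ennreal (Lp_norm M p u powr p)"
    using LpD[OF assms(1,2)] by (subst nn_integral_cmult) auto
  also have "\<dots> = ennreal ((c * Lp_norm M p u) powr p)"
    using assms by (simp add: ennreal_mult[symmetric] powr_mult Lp_norm_nonneg)
  finally have *: "(\<integral>\<^sup>+x. ennreal (cmod (v x) powr p) \<partial>M) \<le> ennreal ((c * Lp_norm M p u) powr p)" .
  show "v \<in> Lp_set M p" "Lp_norm M p v \<le> c * Lp_norm M p u"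
    using LpI[OF assms(1,3) _ *] assms Lp_norm_nonneg[of M p u] by auto
qed

lemma Lp_add:
  assumes p: "p > 1" and u: "u \<in> Lp_set M p" and v: "v \<in> Lp_set M p"
  shows "u + v \<in> Lp_set M p" "Lp_norm M p (u + v) \<le> Lp_norm M p u + Lp_norm M p v"
proof -
  have [measurable]: "u \<in> borel_measurable M" "v \<in> borel_measurable M" using u v Lp_measurable by auto
  have meas: "u + v \<in> borel_measurable M" by (simp add: plus_fun_def)
  \<comment> \<open>Numbers strictly above the norms are positive even if a norm is
    \<open>0\<close>, as the weights have to be; the gap is closed at the end.\<close>
  have *: "u + v \<in> Lp_set M p \<and> Lp_norm M p (u + v) \<le> a + b"
    if ab: "a > Lp_norm M p u" "b > Lp_norm M p v" for a b
  proof -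
    have pos: "a > 0" "b > 0" using ab Lp_norm_nonneg[of M p u] Lp_norm_nonneg[of M p v] by linarith+
    let ?c = "(a + b) powr (p - 1) * a powr (1 - p)" and ?d = "(a + b) powr (p - 1) * b powr (1 - p)"
    have "(\<integral>\<^sup>+x. ennreal (cmod ((u + v) x) powr p) \<partial>M)
        \<le> (\<integral>\<^sup>+x. ennreal ?c * ennreal (cmod (u x) powr p) + ennreal ?d * ennreal (cmod (v x) powr p) \<partial>M)"
    proof (intro nn_integral_mono)
      fix x
      have "cmod ((u + v) x) powr p \<le> (cmod (u x) + cmod (v x)) powr p"
        using p by (intro powr_mono2) (auto simp: fun_ops norm_triangle_ineq)
      also have "\<dots> \<le> ?c * cmod (u x) powr p + ?d * cmod (v x) powr p"
        using powr_add_le_weighted[OF p _ _ pos, of "cmod (u x)" "cmod (v x)"] by (simp add: algebra_simps)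
      finally show "ennreal (cmod ((u + v) x) powr p) \<le> ennreal ?c * ennreal (cmod (u x) powr p) + ennreal ?d * ennreal (cmod (v x) powr p)"
        by (simp add: ennreal_mult[symmetric] ennreal_plus[symmetric] ennreal_leI del: ennreal_plus)
    qed
    also have "\<dots> = ennreal ?c * ennreal (Lp_norm M p u powr p) + ennreal ?d * ennreal (Lp_norm M p v powr p)"
      using LpD[of p u M] LpD[of p v M] u v p by (simp add: nn_integral_add nn_integral_cmult)
    also have "\<dots> = ennreal (?c * Lp_norm M p u powr p + ?d * Lp_norm M p v powr p)"
      by (simp add: ennreal_mult[symmetric] ennreal_plus[symmetric] del: ennreal_plus)
    also have "\<dots> \<le> ennreal (?c * a powr p + ?d * b powr p)"
      using ab p by (intro ennreal_leI add_mono mult_left_mono powr_mono2) (auto simp: Lp_norm_nonneg)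
    also have "?c * a powr p + ?d * b powr p = (a + b) powr p"
    proof -
      have *: "a powr (1 - p) * a powr p = a" "b powr (1 - p) * b powr p = b"
        using pos by (simp_all add: powr_add[symmetric])
      have "?c * a powr p + ?d * b powr p = (a + b) powr (p - 1) * (a + b)"
        by (simp add: mult.assoc * distrib_left)
      then show ?thesis using pos powr_mult_base[of "a + b" "p - 1"] by (simp add: mult.commute)
    qed
    finally have "(\<integral>\<^sup>+x. ennreal (cmod ((u + v) x) powr p) \<partial>M) \<le> ennreal ((a + b) powr p)" .
    then show ?thesis using LpI[OF _ meas, of p "a + b"] p pos by auto
  qed
  show "u + v \<in> Lp_set M p" using *[of "Lp_norm M p u + 1" "Lp_norm M p v + 1"] by simp
  show "Lp_norm M p (u + v) \<le> Lp_norm M p u + Lp_norm M p v"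
  proof (rule field_le_epsilon)
    fix e :: real assume "e > 0"
    then show "Lp_norm M p (u + v) \<le> Lp_norm M p u + Lp_norm M p v + e"
      using *[of "Lp_norm M p u + e / 2" "Lp_norm M p v + e / 2"] by simp
  qed
qed

lemma Lp_scl:
  assumes p: "p > 0" and u: "u \<in> Lp_set M p"
  shows "scl c u \<in> Lp_set M p" "Lp_norm M p (scl c u) = cmod c * Lp_norm M p u"
proof -
  have [measurable]: "u \<in> borel_measurable M" using u Lp_measurable by auto
  have m: "scl c u \<in> borel_measurable M" by (simp add: scl_def)
  have "cmod (scl c u x) powr p = cmod c powr p * cmod (u x) powr p" for x
    by (simp add: scl_def norm_mult powr_mult)
  then show "Lp_norm M p (scl c u) = cmod c * Lp_norm M p u"
    using p by (simp add: Lp_norm_def powr_mult powr_powr)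
  show "scl c u \<in> Lp_set M p"
    by (rule Lp_dominated[OF p u m, of "cmod c"]) (auto simp: scl_def norm_mult)
qed

lemma Lp_zero: "0 \<in> Lp_set M p"
  by (simp add: Lp_set_def zero_fun_def)

lemma Lp_sum:
  assumes p: "p > 1" and "\<And>i. i \<in> I \<Longrightarrow> U i \<in> Lp_set M p"
  shows "(\<Sum>i\<in>I. U i) \<in> Lp_set M p \<and> Lp_norm M p (\<Sum>i\<in>I. U i) \<le> (\<Sum>i\<in>I. Lp_norm M p (U i))"
  using assms(2)
proof (induction I rule: infinite_finite_induct)
  case (insert i I)
  have 1: "U i \<in> Lp_set M p" and 2: "(\<Sum>i\<in>I. U i) \<in> Lp_set M p"
    "Lp_norm M p (\<Sum>i\<in>I. U i) \<le> (\<Sum>i\<in>I. Lp_norm M p (U i))"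
    using insert by auto
  show "(\<Sum>i\<in>insert i I. U i) \<in> Lp_set M p \<and> Lp_norm M p (\<Sum>i\<in>insert i I. U i) \<le> (\<Sum>i\<in>insert i I. Lp_norm M p (U i))"
    unfolding sum.insert[OF insert.hyps] using Lp_add[OF p 1 2(1)] 2(2) by simp
qed (auto simp: Lp_zero, auto simp: Lp_norm_def zero_fun_def)

lemma Lp_norm_modulus: "Lp_norm M p (\<lambda>x. of_real (cmod (u x))) = Lp_norm M p u"
  by (simp add: Lp_norm_def)

lemma Lp_modulus: "u \<in> Lp_set M p \<Longrightarrow> (\<lambda>x. of_real (cmod (u x))) \<in> Lp_set M p"
proof -
  assume u: "u \<in> Lp_set M p"
  then have [measurable]: "u \<in> borel_measurable M" by (rule Lp_measurable)
  have "(\<lambda>x. complex_of_real (cmod (u x))) \<in> borel_measurable M" by measurable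
  then show ?thesis using u by (simp add: Lp_set_def)
qed

text \<open>The Riesz-Fischer argument: monotone convergence makes the sum of the moduli finite
  almost everywhere, which defines the limit pointwise, and Fatou's lemma bounds the norm of each
  tail by the tail of the series of norms.\<close>

lemma Lp_complete:
  assumes p: "p > 1" and U: "\<And>n. U n \<in> Lp_set M p" and s: "summable (\<lambda>n. Lp_norm M p (U n))"
  shows "\<exists>v\<in>Lp_set M p. (\<lambda>n. Lp_norm M p (v - (\<Sum>i<n. U i))) \<longlonglongrightarrow> 0"
proof -
  have [measurable]: "U n \<in> borel_measurable M" for n using U Lp_measurable by auto
  define C where "C = (\<Sum>n. Lp_norm M p (U n))"
  have C: "C \<ge> 0" unfolding C_def by (intro suminf_nonneg s Lp_norm_nonneg)
  define A where "A n = (\<Sum>i<n. (\<lambda>x. complex_of_real (cmod (U i x))))" for n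
  have A: "A n \<in> Lp_set M p" "Lp_norm M p (A n) \<le> C" for n
  proof -
    have *: "A n \<in> Lp_set M p \<and> Lp_norm M p (A n) \<le> (\<Sum>i<n. Lp_norm M p (\<lambda>x. of_real (cmod (U i x))))"
      unfolding A_def by (rule Lp_sum[OF p]) (intro Lp_modulus U)
    then show "A n \<in> Lp_set M p" by blast
    have "(\<Sum>i<n. Lp_norm M p (U i)) \<le> C" unfolding C_def by (intro sum_le_suminf s) (auto simp: Lp_norm_nonneg)
    with * show "Lp_norm M p (A n) \<le> C" unfolding Lp_norm_modulus by linarith
  qed
  have Ax: "A n x = of_real (\<Sum>i<n. cmod (U i x))" for n x by (simp add: A_def sum_fun_apply)
  have normA: "cmod (A n x) = (\<Sum>i<n. cmod (U i x))" for n x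
    unfolding Ax by (simp add: sum_nonneg del: of_real_sum)
  let ?S = "\<lambda>n x. ennreal ((\<Sum>i<n. cmod (U i x)) powr p)"
  have "(\<integral>\<^sup>+x. (SUP n. ?S n x) \<partial>M) = (SUP n. \<integral>\<^sup>+x. ?S n x \<partial>M)"
  proof (rule nn_integral_monotone_convergence_SUP)
    show "incseq ?S" using p
      by (intro incseq_SucI le_funI ennreal_leI powr_mono2) (auto intro: sum_nonneg)
  qed auto
  also have "\<dots> \<le> ennreal (C powr p)"
  proof (rule SUP_least)
    fix n
    have "(\<integral>\<^sup>+x. ?S n x \<partial>M) = ennreal (Lp_norm M p (A n) powr p)"
      using LpD[of p "A n" M] A(1) p by (simp add: normA)
    also have "\<dots> \<le> ennreal (C powr p)"
      using A(2) p by (intro ennreal_leI powr_mono2) (auto simp: Lp_norm_nonneg)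
    finally show "(\<integral>\<^sup>+x. ?S n x \<partial>M) \<le> ennreal (C powr p)" .
  qed
  finally have "(\<integral>\<^sup>+x. (SUP n. ?S n x) \<partial>M) \<noteq> \<infinity>" by (auto simp: top_unique)
  then have ae: "AE x in M. (SUP n. ?S n x) \<noteq> \<infinity>" by (intro nn_integral_noteq_infinite) auto
  have ae': "AE x in M. summable (\<lambda>i. U i x)" using ae
  proof eventually_elim
    case (elim x)
    then obtain r where r: "r \<ge> 0" "(SUP n. ?S n x) = ennreal r" by (cases "SUP n. ?S n x") auto
    have "(\<Sum>i<n. cmod (U i x)) \<le> r powr (1 / p)" for n
    proof -
      have "?S n x \<le> ennreal r" unfolding r(2)[symmetric] by (intro SUP_upper) auto
      then have "(\<Sum>i<n. cmod (U i x)) powr p \<le> r" using r by (subst (asm) ennreal_le_iff) auto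
      then have "((\<Sum>i<n. cmod (U i x)) powr p) powr (1/p) \<le> r powr (1 / p)"
        using p by (intro powr_mono2) auto
      then show ?thesis using p by (simp add: powr_powr sum_nonneg)
    qed
    then have "summable (\<lambda>i. cmod (U i x))"
      by (intro bounded_imp_summable[of _ "r powr (1 / p)"]) (simp_all add: lessThan_Suc_atMost[symmetric] del: sum.lessThan_Suc)
    then show ?case by (rule summable_norm_cancel)
  qed
  define v where "v x = (\<Sum>i. U i x)" for x
  have [measurable]: "v \<in> borel_measurable M" unfolding v_def by (intro borel_measurable_suminf) auto
  have tail: "v - (\<Sum>i<n. U i) \<in> Lp_set M p \<and> Lp_norm M p (v - (\<Sum>i<n. U i)) \<le> (\<Sum>i. Lp_norm M p (U (i + n)))" for n
  proof -
    have sn: "summable (\<lambda>i. Lp_norm M p (U (i + n)))" by (rule summable_ignore_initial_segment[OF s])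
    let ?c = "\<Sum>i. Lp_norm M p (U (i + n))"
    have c: "?c \<ge> 0" by (intro suminf_nonneg sn Lp_norm_nonneg)
    have meas: "v - (\<Sum>i<n. U i) \<in> borel_measurable M"
    proof -
      have "v - (\<Sum>i<n. U i) = (\<lambda>x. v x - (\<Sum>i<n. U i x))" by (simp add: fun_eq_iff fun_ops sum_fun_apply)
      then show ?thesis by simp
    qed
    define T where "T m = (\<Sum>i<m. U (i + n))" for m
    have T: "T m \<in> Lp_set M p" "Lp_norm M p (T m) \<le> ?c" for m
    proof -
      have *: "T m \<in> Lp_set M p \<and> Lp_norm M p (T m) \<le> (\<Sum>i<m. Lp_norm M p (U (i + n)))"
        unfolding T_def by (rule Lp_sum[OF p]) (intro U)
      then show "T m \<in> Lp_set M p" by blast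
      have "(\<Sum>i<m. Lp_norm M p (U (i + n))) \<le> ?c" by (intro sum_le_suminf sn) (auto simp: Lp_norm_nonneg)
      with * show "Lp_norm M p (T m) \<le> ?c" by linarith
    qed
    have [measurable]: "T m \<in> borel_measurable M" for m using T(1) Lp_measurable by auto
    have "(\<integral>\<^sup>+x. ennreal (cmod ((v - (\<Sum>i<n. U i)) x) powr p) \<partial>M)
        \<le> (\<integral>\<^sup>+x. liminf (\<lambda>m. ennreal (cmod (T m x) powr p)) \<partial>M)"
      using ae'
    proof (intro nn_integral_mono_AE, eventually_elim)
      case (elim x)
      have "(\<lambda>i. U (i + n) x) sums (v x - (\<Sum>i<n. U i x))"
        unfolding v_def using sums_split_initial_segment[OF summable_sums[OF elim(2)], of n] by simp
      then have "(\<lambda>m. T m x) \<longlonglongrightarrow> (v - (\<Sum>i<n. U i)) x"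
        by (simp add: sums_def T_def sum_fun_apply fun_ops)
      then have "(\<lambda>m. ennreal (cmod (T m x) powr p)) \<longlonglongrightarrow> ennreal (cmod ((v - (\<Sum>i<n. U i)) x) powr p)"
        using p by (intro tendsto_intros tendsto_powr') auto
      then have "liminf (\<lambda>m. ennreal (cmod (T m x) powr p)) = ennreal (cmod ((v - (\<Sum>i<n. U i)) x) powr p)"
        by (rule lim_imp_Liminf[OF sequentially_bot])
      then show ?case by simp
    qed
    also have "\<dots> \<le> liminf (\<lambda>m. \<integral>\<^sup>+x. ennreal (cmod (T m x) powr p) \<partial>M)"
      by (intro nn_integral_liminf) auto
    also have "\<dots> = liminf (\<lambda>m. ennreal (Lp_norm M p (T m) powr p))"
      using LpD[of p "T _" M] T(1) p by simp
    also have "\<dots> \<le> liminf (\<lambda>m. ennreal (?c powr p))"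
      using T(2) p by (intro Liminf_mono always_eventually allI ennreal_leI powr_mono2) (auto simp: Lp_norm_nonneg)
    also have "\<dots> = ennreal (?c powr p)" by (simp add: Liminf_const)
    finally show ?thesis using LpI[OF _ meas c] p by auto
  qed
  have "v \<in> Lp_set M p" using tail[of 0] by simp
  moreover have "(\<lambda>n. Lp_norm M p (v - (\<Sum>i<n. U i))) \<longlonglongrightarrow> 0"
  proof (rule tendsto_sandwich[OF _ _ tendsto_const suminf_exist_split2[OF s]])
  qed (use tail in \<open>auto simp: Lp_norm_nonneg intro!: always_eventually\<close>)
  ultimately show ?thesis by blast
qed

lemma Lp_norm_eq_0:
  assumes p: "p > 0" and u: "u \<in> Lp_set M p"
  shows "Lp_norm M p u = 0 \<longleftrightarrow> (AE x in M. u x = 0)"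
proof -
  have i: "integrable M (\<lambda>x. cmod (u x) powr p)" using u by (simp add: Lp_set_def)
  have "Lp_norm M p u = 0 \<longleftrightarrow> (\<integral>x. cmod (u x) powr p \<partial>M) = 0"
    using p by (auto simp: Lp_norm_def)
  also have "\<dots> \<longleftrightarrow> (AE x in M. cmod (u x) powr p = 0)"
    by (intro integral_nonneg_eq_0_iff_AE i) auto
  finally show ?thesis by simp
qed

section \<open>Lebesgue spaces as seminormed spaces, and the notions of the theorem in these
  terms\<close>

locale Lp_space =
  fixes M :: "'a measure" and p :: real
  assumes p: "1 < p"
begin

abbreviation LP where "LP \<equiv> Lp_set M p"
abbreviation NP where "NP \<equiv> Lp_norm M p"

sublocale cspace LP NP
proof
  show "\<exists>v\<in>LP. (\<lambda>n. NP (v - (\<Sum>i<n. U i))) \<longlonglongrightarrow> 0" if "\<And>n. U n \<in> LP" "summable (\<lambda>n. NP (U n))" for U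
    by (rule Lp_complete[OF p that])
qed (use p in \<open>auto intro: Lp_zero Lp_add Lp_scl\<close>)

lemma p0 [simp]: "0 < p" using p by linarith

lemma null_iff: "u \<in> LP \<Longrightarrow> NP u = 0 \<longleftrightarrow> (AE x in M. u x = 0)"
  by (intro Lp_norm_eq_0) auto

lemma null_diff_iff: "u \<in> LP \<Longrightarrow> v \<in> LP \<Longrightarrow> NP (u - v) = 0 \<longleftrightarrow> (AE x in M. u x = v x)"
  by (subst null_iff) (auto simp: fun_ops)

lemma bounded_op_iff: "bounded_op M p A \<longleftrightarrow> blin A"
proof -
  have p1: "(\<lambda>y. u y + v y) = u + v" "(\<lambda>y. c * u y) = scl c u" for u v :: "'a \<Rightarrow> complex" and c
    by (simp_all add: fun_eq_iff fun_ops scl_def)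
  have p2: "(u + v) x = u x + v x" "scl c u x = c * u x" for u v :: "'a \<Rightarrow> complex" and c x
    by (simp_all add: fun_ops scl_def)
  show ?thesis
  proof (cases "\<forall>u\<in>LP. A u \<in> LP")
    case True
    have 1: "NP (A (u + v) - (A u + A v)) = 0 \<longleftrightarrow> (AE x in M. A (u + v) x = A u x + A v x)"
      if "u \<in> LP" "v \<in> LP" for u v
      using that True by (subst null_diff_iff; simp add: p2)
    have 2: "NP (A (scl c u) - scl c (A u)) = 0 \<longleftrightarrow> (AE x in M. A (scl c u) x = c * A u x)" if "u \<in> LP" for u c
      using that True by (subst null_diff_iff; simp add: p2)
    show ?thesis unfolding bounded_op_def blin_def p1 by (simp add: 1 2)
  qed (auto simp: bounded_op_def blin_def)
qed

lemma invertible_op_iff: "invertible_op M p A \<longleftrightarrow> inv_op A"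
proof -
  have *: "(AE x in M. A (B u) x = u x) \<and> (AE x in M. B (A u) x = u x) \<longleftrightarrow>
    NP (A (B u) - u) = 0 \<and> NP (B (A u) - u) = 0" if "blin A" "blin B" "u \<in> LP" for A B u
    using that blin_mem[of A] blin_mem[of B] by (simp add: null_diff_iff)
  show ?thesis unfolding invertible_op_def inv_op_def bounded_op_iff
    by (intro conj_cong ex_cong1 ball_cong refl *)
qed

lemma fredholm_op_iff: "fredholm_op M p A \<longleftrightarrow> fred A"
proof (cases "blin A")
  case True
  note m = blin_mem[OF True]
  have sum: "(\<Sum>s\<in>S. scl (c s) s) x = (\<Sum>s\<in>S. c s * s x)" for S c and x :: 'a
    by (simp add: sum_fun_apply scl_def)
  have k: "{u \<in> LP. AE x in M. A u x = 0} = {u \<in> LP. NP (A u) = 0}"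
    using m by (auto simp: null_iff)
  have 1: "(\<forall>u\<in>LP. (AE x in M. A u x = 0) \<longrightarrow> (\<exists>c. AE x in M. u x = (\<Sum>s\<in>S. c s * s x)))
    \<longleftrightarrow> (\<forall>u\<in>LP. NP (A u) = 0 \<longrightarrow> (\<exists>c. NP (u - (\<Sum>s\<in>S. scl (c s) s)) = 0))" if "S \<subseteq> LP" for S
  proof -
    have "NP (u - (\<Sum>s\<in>S. scl (c s) s)) = 0 \<longleftrightarrow> (AE x in M. u x = (\<Sum>s\<in>S. c s * s x))" if "u \<in> LP" for u c
    proof -
      have "(\<Sum>s\<in>S. scl (c s) s) \<in> LP" using \<open>S \<subseteq> LP\<close> by (auto intro!: sum_mem)
      then show ?thesis using that by (subst null_diff_iff) (auto simp: sum)
    qed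
    moreover have "NP (A u) = 0 \<longleftrightarrow> (AE x in M. A u x = 0)" if "u \<in> LP" for u
      using m[OF that] by (rule null_iff)
    ultimately show ?thesis by simp
  qed
  have 2: "(\<forall>v\<in>LP. \<exists>u\<in>LP. \<exists>c. AE x in M. v x = A u x + (\<Sum>s\<in>S. c s * s x))
    \<longleftrightarrow> (\<forall>v\<in>LP. \<exists>u\<in>LP. \<exists>c. NP (v - A u - (\<Sum>s\<in>S. scl (c s) s)) = 0)" if "S \<subseteq> LP" for S
  proof -
    have "NP (v - A u - (\<Sum>s\<in>S. scl (c s) s)) = 0 \<longleftrightarrow> (AE x in M. v x = A u x + (\<Sum>s\<in>S. c s * s x))"
      if "u \<in> LP" "v \<in> LP" for u v c
    proof -
      have "v - A u \<in> LP" "(\<Sum>s\<in>S. scl (c s) s) \<in> LP"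
        using that m \<open>S \<subseteq> LP\<close> by (auto intro!: sum_mem)
      then have "NP (v - A u - (\<Sum>s\<in>S. scl (c s) s)) = 0 \<longleftrightarrow> (AE x in M. v x - A u x = (\<Sum>s\<in>S. c s * s x))"
        by (subst null_diff_iff) (auto simp: sum fun_ops)
      then show ?thesis by (simp add: diff_eq_eq add.commute)
    qed
    then show ?thesis by simp
  qed
  show ?thesis unfolding fredholm_op_def fred_def corange_def bounded_op_iff k
    by (intro conj_cong ex_cong1 refl 1 2) auto
qed (auto simp: fredholm_op_def fred_def bounded_op_iff)

lemma mult_mem:
  assumes "f \<in> borel_measurable M" "\<And>x. x \<in> space M \<Longrightarrow> cmod (f x) \<le> c" "c \<ge> 0" "u \<in> LP"
  shows "f * u \<in> LP" "NP (f * u) \<le> c * NP u"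
proof -
  have [measurable]: "u \<in> borel_measurable M" using assms Lp_measurable by auto
  have m: "f * u \<in> borel_measurable M" using assms(1) by (simp add: times_fun_def)
  have "AE x in M. cmod ((f * u) x) \<le> c * cmod (u x)"
    using assms(2) by (intro AE_I2) (auto simp: fun_ops norm_mult mult_right_mono)
  from Lp_dominated[OF p0 assms(4) m assms(3) this] show "f * u \<in> LP" "NP (f * u) \<le> c * NP u" by auto
qed

lemma blin_mult:
  assumes "f \<in> borel_measurable M" "\<And>x. x \<in> space M \<Longrightarrow> cmod (f x) \<le> c" "c \<ge> 0"
  shows "blin (\<lambda>u. f * u)"
proof (rule blinI[where C = c])
  show "NP (f * (u + v) - (f * u + f * v)) = 0" for u v by (simp add: distrib_left)
  have "f * scl c u = scl c (f * u)" for c u by (simp add: fun_eq_iff fun_ops scl_def)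
  then show "NP (f * scl c u - scl c (f * u)) = 0" for u c by simp
qed (use mult_mem[OF assms] in auto)

text \<open>Dominated convergence, with the \<open>p\<close>-th power of the modulus of
  \<open>u\<close> as majorant.\<close>

lemma Lp_vanishing:
  assumes u: "u \<in> LP" and S: "\<And>m. S m \<in> sets M"
    and ev: "\<And>x. x \<in> space M \<Longrightarrow> eventually (\<lambda>m. x \<notin> S m) sequentially"
  shows "(\<lambda>m. NP (indicator (S m) * u)) \<longlonglongrightarrow> 0"
proof -
  have [measurable]: "u \<in> borel_measurable M" "S m \<in> sets M" for m using u S Lp_measurable by auto
  have i: "integrable M (\<lambda>x. cmod (u x) powr p)" using u by (simp add: Lp_set_def)
  have "(\<lambda>m. \<integral>x. cmod ((indicator (S m) * u) x) powr p \<partial>M) \<longlonglongrightarrow> (\<integral>x. 0 \<partial>M)"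
  proof (rule integral_dominated_convergence[where w = "\<lambda>x. cmod (u x) powr p"])
    show "AE x in M. (\<lambda>m. cmod ((indicator (S m) * u) x) powr p) \<longlonglongrightarrow> 0"
    proof (rule AE_I2)
      fix x assume "x \<in> space M"
      from ev[OF this] have "eventually (\<lambda>m. cmod ((indicator (S m) * u) x) powr p = 0) sequentially"
        by eventually_elim (simp add: fun_ops)
      then show "(\<lambda>m. cmod ((indicator (S m) * u) x) powr p) \<longlonglongrightarrow> 0" by (rule tendsto_eventually)
    qed
    show "AE x in M. norm (cmod ((indicator (S m) * u) x) powr p) \<le> cmod (u x) powr p" for m
      by (auto simp: fun_ops indicator_def)
  qed (auto simp: fun_ops i)
  then have "(\<lambda>m. (\<integral>x. cmod ((indicator (S m) * u) x) powr p \<partial>M) powr (1/p)) \<longlonglongrightarrow> 0 powr (1/p)"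
    by (intro tendsto_powr') (auto intro!: always_eventually)
  then show ?thesis by (simp add: Lp_norm_def)
qed

end

context Lp_space
begin

subsection \<open>Schur's test\<close>

text \<open>Jensen's inequality for the measure \<open>\<bar>\<kappa>(x, \<cdot>)\<bar> dy\<close>.\<close>

lemma schur_pointwise:
  fixes g h :: "'a \<Rightarrow> complex" and \<alpha> :: real
  assumes [measurable]: "g \<in> borel_measurable M" "h \<in> borel_measurable M"
    and \<alpha>: "\<alpha> > 0" "(\<integral>\<^sup>+y. ennreal (cmod (g y)) \<partial>M) \<le> ennreal \<alpha>"
  shows "ennreal (cmod (\<integral>y. g y * h y \<partial>M) powr p) \<le>
    ennreal (\<alpha> powr (p - 1)) * (\<integral>\<^sup>+y. ennreal (cmod (g y) * cmod (h y) powr p) \<partial>M)"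
proof (cases "(\<integral>\<^sup>+y. ennreal (cmod (g y) * cmod (h y) powr p) \<partial>M) = \<infinity>")
  case True
  then show ?thesis using \<alpha> by (simp add: ennreal_mult_top)
next
  case False
  have ig: "integrable M (\<lambda>y. cmod (g y))"
    using \<alpha>(2) by (intro integrableI_bounded) (auto simp: less_top[symmetric] top_unique)
  have ip: "integrable M (\<lambda>y. cmod (g y) * cmod (h y) powr p)"
    using False by (intro integrableI_bounded) (auto simp: less_top[symmetric] top_unique)
  have le1: "t \<le> 1 + t powr p" if "t \<ge> 0" for t :: real
  proof (cases "t \<le> 1")
    case False
    then show ?thesis using powr_mono[of 1 p t] p that by simp
  qed (auto intro: add_increasing2)
  have igh: "integrable M (\<lambda>y. cmod (g y) * cmod (h y))"
  proof (rule Bochner_Integration.integrable_bound[OF Bochner_Integration.integrable_add[OF ig ip]])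
    have "cmod (g y) * cmod (h y) \<le> cmod (g y) * (1 + cmod (h y) powr p)" for y
      by (intro mult_left_mono le1) auto
    then show "AE y in M. norm (cmod (g y) * cmod (h y)) \<le> norm (cmod (g y) + cmod (g y) * cmod (h y) powr p)"
      by (auto simp: algebra_simps)
  qed auto
  define I where "I = (\<integral>y. cmod (g y) * cmod (h y) \<partial>M)"
  define G where "G = (\<integral>y. cmod (g y) \<partial>M)"
  define J where "J = (\<integral>y. cmod (g y) * cmod (h y) powr p \<partial>M)"
  have "I \<ge> 0" "G \<ge> 0" "J \<ge> 0" unfolding I_def G_def J_def by (auto intro!: integral_nonneg_AE)
  have "ennreal G \<le> ennreal \<alpha>" using nn_integral_eq_integral[OF ig] \<alpha>(2) by (simp add: G_def)
  then have G: "G \<le> \<alpha>" using \<alpha>(1) by (subst (asm) ennreal_le_iff) auto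
  have "I powr p \<le> \<alpha> powr (p - 1) * J"
  proof (cases "I = 0")
    case True
    then show ?thesis using \<open>J \<ge> 0\<close> by simp
  next
    case False
    \<comment> \<open>The tangent is taken at \<open>I / \<alpha>\<close>, although the total mass
      \<open>G\<close> may be smaller than \<open>\<alpha>\<close>. The discrepancy contributes
      \<open>(p - 1) * t powr p * (\<alpha> - G)\<close>, which has the favourable sign.\<close>
    define t where "t = I / \<alpha>"
    have t: "t > 0" "I = \<alpha> * t" using False \<open>I \<ge> 0\<close> \<alpha> by (auto simp: t_def)
    have "(\<integral>y. t powr p * cmod (g y) + p * t powr (p - 1) * (cmod (g y) * cmod (h y) - t * cmod (g y)) \<partial>M) \<le> J"
      unfolding J_def
    proof (rule integral_mono)
      show "integrable M (\<lambda>y. t powr p * cmod (g y) + p * t powr (p - 1) * (cmod (g y) * cmod (h y) - t * cmod (g y)))"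
        using ig igh by (intro Bochner_Integration.integrable_add integrable_mult_right Bochner_Integration.integrable_diff)
      fix y
      have "cmod (g y) * (t powr p + p * t powr (p - 1) * (cmod (h y) - t)) \<le> cmod (g y) * cmod (h y) powr p"
        using p t by (intro mult_left_mono powr_above_tangent) auto
      then show "t powr p * cmod (g y) + p * t powr (p - 1) * (cmod (g y) * cmod (h y) - t * cmod (g y)) \<le> cmod (g y) * cmod (h y) powr p"
        by (simp add: algebra_simps)
    qed (rule ip)
    also have "(\<integral>y. t powr p * cmod (g y) + p * t powr (p - 1) * (cmod (g y) * cmod (h y) - t * cmod (g y)) \<partial>M)
        = t powr p * G + p * t powr (p - 1) * (I - t * G)"
      unfolding G_def I_def using ig igh by simp
    finally have 1: "t powr p * G + p * t powr (p - 1) * (I - t * G) \<le> J" .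
    have "t powr (p - 1) * t = t powr p" using t powr_mult_base[of t "p - 1"] by (simp add: mult.commute)
    then have "t powr p * G + p * t powr (p - 1) * (I - t * G) = t powr p * G + p * t powr p * (\<alpha> - G)"
      unfolding t(2) by (simp add: algebra_simps)
    also have "\<dots> = \<alpha> * t powr p + (p - 1) * (t powr p * (\<alpha> - G))" by (simp add: algebra_simps)
    also have "\<dots> \<ge> \<alpha> * t powr p" using p G by simp
    finally have "\<alpha> * t powr p \<le> J" using 1 by linarith
    then have "\<alpha> powr (p - 1) * (\<alpha> * t powr p) \<le> \<alpha> powr (p - 1) * J" by (intro mult_left_mono) auto
    moreover have "\<alpha> powr (p - 1) * (\<alpha> * t powr p) = I powr p"
      unfolding t(2) using \<alpha> t powr_mult_base[of \<alpha> "p - 1"] by (simp add: powr_mult mult.commute mult.left_commute)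
    ultimately show ?thesis by simp
  qed
  moreover have "cmod (\<integral>y. g y * h y \<partial>M) \<le> I"
    unfolding I_def using integral_norm_bound[of M "\<lambda>y. g y * h y"] by (simp add: norm_mult)
  then have "cmod (\<integral>y. g y * h y \<partial>M) powr p \<le> I powr p" using p by (intro powr_mono2) auto
  ultimately have "cmod (\<integral>y. g y * h y \<partial>M) powr p \<le> \<alpha> powr (p - 1) * J" by linarith
  then have "ennreal (cmod (\<integral>y. g y * h y \<partial>M) powr p) \<le> ennreal (\<alpha> powr (p - 1) * J)"
    by (rule ennreal_leI)
  also have "\<dots> = ennreal (\<alpha> powr (p - 1)) * (\<integral>\<^sup>+y. ennreal (cmod (g y) * cmod (h y) powr p) \<partial>M)"
    using nn_integral_eq_integral[OF ip] \<open>J \<ge> 0\<close> by (simp add: J_def ennreal_mult)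
  finally show ?thesis .
qed

text \<open>Jensen's inequality for each \<open>x\<close>, then Fubini: the row bound enters with
  exponent \<open>p - 1\<close>, the column bound with exponent \<open>1\<close>. The two are kept
  apart because a kernel that lives on a small set of \<open>y\<close> has small row integrals while
  its column integrals are merely bounded.\<close>

lemma schur_test:
  fixes k :: "'a \<Rightarrow> 'a \<Rightarrow> complex"
  assumes sf: "sigma_finite_measure M"
    and k[measurable]: "(\<lambda>(x, y). k x y) \<in> borel_measurable (M \<Otimes>\<^sub>M M)"
    and \<alpha>: "\<alpha> > 0" "\<And>x. x \<in> space M \<Longrightarrow> (\<integral>\<^sup>+y. ennreal (cmod (k x y)) \<partial>M) \<le> ennreal \<alpha>"
    and \<beta>: "\<beta> > 0" "\<And>y. y \<in> space M \<Longrightarrow> (\<integral>\<^sup>+x. ennreal (cmod (k x y)) \<partial>M) \<le> ennreal \<beta>"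
    and u: "u \<in> LP"
  shows "(\<lambda>x. \<integral>y. k x y * u y \<partial>M) \<in> LP"
    and "NP (\<lambda>x. \<integral>y. k x y * u y \<partial>M) \<le> (\<alpha> powr (p - 1) * \<beta>) powr (1 / p) * NP u"
proof -
  interpret sigma_finite_measure M by (rule sf)
  interpret P: pair_sigma_finite M M by (intro pair_sigma_finite.intro sf)
  have [measurable]: "u \<in> borel_measurable M" using u Lp_measurable by auto
  have meas: "(\<lambda>x. \<integral>y. k x y * u y \<partial>M) \<in> borel_measurable M" by measurable
  have "(\<integral>\<^sup>+x. ennreal (cmod (\<integral>y. k x y * u y \<partial>M) powr p) \<partial>M)
     \<le> (\<integral>\<^sup>+x. ennreal (\<alpha> powr (p - 1)) * (\<integral>\<^sup>+y. ennreal (cmod (k x y) * cmod (u y) powr p) \<partial>M) \<partial>M)"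
  proof (rule nn_integral_mono)
    fix x assume x: "x \<in> space M"
    have "(\<lambda>y. k x y) \<in> borel_measurable M" using x by measurable
    then show "ennreal (cmod (\<integral>y. k x y * u y \<partial>M) powr p) \<le>
      ennreal (\<alpha> powr (p - 1)) * (\<integral>\<^sup>+y. ennreal (cmod (k x y) * cmod (u y) powr p) \<partial>M)"
      using \<alpha> x by (intro schur_pointwise) auto
  qed
  also have "\<dots> = ennreal (\<alpha> powr (p - 1)) * (\<integral>\<^sup>+x. (\<integral>\<^sup>+y. ennreal (cmod (k x y) * cmod (u y) powr p) \<partial>M) \<partial>M)"
    by (subst nn_integral_cmult) auto
  also have "(\<integral>\<^sup>+x. (\<integral>\<^sup>+y. ennreal (cmod (k x y) * cmod (u y) powr p) \<partial>M) \<partial>M)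
      = (\<integral>\<^sup>+y. (\<integral>\<^sup>+x. ennreal (cmod (k x y) * cmod (u y) powr p) \<partial>M) \<partial>M)"
    by (rule P.Fubini'[symmetric]) measurable
  also have "\<dots> \<le> (\<integral>\<^sup>+y. ennreal \<beta> * ennreal (cmod (u y) powr p) \<partial>M)"
  proof (rule nn_integral_mono)
    fix y assume y: "y \<in> space M"
    have [measurable]: "(\<lambda>x. k x y) \<in> borel_measurable M" using y by measurable
    have "(\<integral>\<^sup>+x. ennreal (cmod (k x y) * cmod (u y) powr p) \<partial>M)
        = (\<integral>\<^sup>+x. ennreal (cmod (k x y)) \<partial>M) * ennreal (cmod (u y) powr p)"
      by (simp add: ennreal_mult nn_integral_multc)
    also have "\<dots> \<le> ennreal \<beta> * ennreal (cmod (u y) powr p)" using \<beta> y by (intro mult_right_mono) auto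
    finally show "(\<integral>\<^sup>+x. ennreal (cmod (k x y) * cmod (u y) powr p) \<partial>M) \<le> ennreal \<beta> * ennreal (cmod (u y) powr p)" .
  qed
  also have "\<dots> = ennreal \<beta> * ennreal (NP u powr p)"
    using LpD[OF p0 u] by (subst nn_integral_cmult) auto
  finally have "(\<integral>\<^sup>+x. ennreal (cmod (\<integral>y. k x y * u y \<partial>M) powr p) \<partial>M)
     \<le> ennreal (\<alpha> powr (p - 1)) * (ennreal \<beta> * ennreal (NP u powr p))"
    by (simp add: mult_left_mono)
  also have "\<dots> = ennreal (((\<alpha> powr (p - 1) * \<beta>) powr (1 / p) * NP u) powr p)"
    using \<alpha> \<beta> p by (simp add: ennreal_mult[symmetric] powr_mult powr_powr Lp_norm_nonneg mult.assoc)
  finally have *: "(\<integral>\<^sup>+x. ennreal (cmod (\<integral>y. k x y * u y \<partial>M) powr p) \<partial>M)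
    \<le> ennreal (((\<alpha> powr (p - 1) * \<beta>) powr (1 / p) * NP u) powr p)" .
  show "(\<lambda>x. \<integral>y. k x y * u y \<partial>M) \<in> LP"
    "NP (\<lambda>x. \<integral>y. k x y * u y \<partial>M) \<le> (\<alpha> powr (p - 1) * \<beta>) powr (1 / p) * NP u"
    using LpI[OF p0 meas _ *] by (auto simp: Lp_norm_nonneg)
qed

subsection \<open>Sums with bounded overlap\<close>

text \<open>Each of the at most \<open>q\<close> nonzero terms is bounded by the
  \<open>p\<close>-norm of the whole family. What matters is that the constant does not depend on
  the size of \<open>I\<close>.\<close>

lemma sum_overlap_powr:
  fixes t :: "'i \<Rightarrow> complex"
  assumes "finite I" "card {i \<in> I. t i \<noteq> 0} \<le> q"
  shows "cmod (\<Sum>i\<in>I. t i) powr p \<le> real q powr p * (\<Sum>i\<in>I. cmod (t i) powr p)"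
proof -
  let ?J = "{i \<in> I. t i \<noteq> 0}" and ?s = "\<Sum>i\<in>I. cmod (t i) powr p"
  have s: "?s \<ge> 0" by (intro sum_nonneg) auto
  have le: "cmod (t i) \<le> ?s powr (1 / p)" if "i \<in> I" for i
  proof -
    have "cmod (t i) powr p \<le> ?s" using assms that by (intro member_le_sum) auto
    then have "(cmod (t i) powr p) powr (1 / p) \<le> ?s powr (1 / p)" using p by (intro powr_mono2) auto
    then show ?thesis using p by (simp add: powr_powr)
  qed
  have "cmod (\<Sum>i\<in>I. t i) = cmod (\<Sum>i\<in>?J. t i)"
    using assms by (intro arg_cong[where f = cmod] sum.mono_neutral_right) auto
  also have "\<dots> \<le> (\<Sum>i\<in>?J. ?s powr (1 / p))"
    by (intro order.trans[OF norm_sum] sum_mono le) auto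
  also have "\<dots> = real (card ?J) * ?s powr (1 / p)" by simp
  also have "\<dots> \<le> real q * ?s powr (1 / p)" using assms by (intro mult_right_mono) auto
  finally have "cmod (\<Sum>i\<in>I. t i) powr p \<le> (real q * ?s powr (1 / p)) powr p"
    using p by (intro powr_mono2) auto
  also have "\<dots> = real q powr p * ?s" using s p by (simp add: powr_mult powr_powr)
  finally show ?thesis .
qed

lemma NP_sum_overlap:
  assumes I: "finite I" and t: "\<And>i. i \<in> I \<Longrightarrow> t i \<in> LP"
    and q: "\<And>x. x \<in> space M \<Longrightarrow> card {i \<in> I. t i x \<noteq> 0} \<le> q"
    and le: "(\<Sum>i\<in>I. NP (t i) powr p) \<le> c powr p" "c \<ge> 0"
  shows "NP (\<Sum>i\<in>I. t i) \<le> real q * c"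
proof -
  have [measurable]: "i \<in> I \<Longrightarrow> t i \<in> borel_measurable M" for i using t Lp_measurable by auto
  have m: "(\<Sum>i\<in>I. t i) \<in> borel_measurable M" by (intro Lp_measurable[of _ _ p] sum_mem t)
  have "(\<integral>\<^sup>+x. ennreal (cmod ((\<Sum>i\<in>I. t i) x) powr p) \<partial>M)
     \<le> (\<integral>\<^sup>+x. ennreal (real q powr p) * (\<Sum>i\<in>I. ennreal (cmod (t i x) powr p)) \<partial>M)"
  proof (rule nn_integral_mono)
    fix x assume "x \<in> space M"
    from sum_overlap_powr[OF I q[OF this]]
    have "cmod ((\<Sum>i\<in>I. t i) x) powr p \<le> real q powr p * (\<Sum>i\<in>I. cmod (t i x) powr p)"
      by (simp add: sum_fun_apply)
    then have "ennreal (cmod ((\<Sum>i\<in>I. t i) x) powr p) \<le> ennreal (real q powr p * (\<Sum>i\<in>I. cmod (t i x) powr p))"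
      by (rule ennreal_leI)
    then show "ennreal (cmod ((\<Sum>i\<in>I. t i) x) powr p) \<le> ennreal (real q powr p) * (\<Sum>i\<in>I. ennreal (cmod (t i x) powr p))"
      by (simp add: ennreal_mult sum_nonneg)
  qed
  also have "\<dots> = ennreal (real q powr p) * (\<integral>\<^sup>+x. (\<Sum>i\<in>I. ennreal (cmod (t i x) powr p)) \<partial>M)"
    by (rule nn_integral_cmult) measurable
  also have "(\<integral>\<^sup>+x. (\<Sum>i\<in>I. ennreal (cmod (t i x) powr p)) \<partial>M) = (\<Sum>i\<in>I. \<integral>\<^sup>+x. ennreal (cmod (t i x) powr p) \<partial>M)"
    by (rule nn_integral_sum) measurable
  also have "\<dots> = (\<Sum>i\<in>I. ennreal (NP (t i) powr p))"
    using t by (intro sum.cong LpD) auto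
  also have "\<dots> = ennreal (\<Sum>i\<in>I. NP (t i) powr p)" by simp
  also have "ennreal (real q powr p) * \<dots> \<le> ennreal (real q powr p) * ennreal (c powr p)"
    using le by (intro mult_left_mono ennreal_leI) auto
  also have "\<dots> = ennreal ((real q * c) powr p)"
    using le by (simp add: ennreal_mult[symmetric] powr_mult)
  finally have "(\<integral>\<^sup>+x. ennreal (cmod ((\<Sum>i\<in>I. t i) x) powr p) \<partial>M) \<le> ennreal ((real q * c) powr p)" .
  from LpI(2)[OF p0 m _ this] show ?thesis using le by simp
qed

text \<open>Pointwise, \<open>u\<close> is counted at most \<open>q\<close> times. Together with
  \<open>NP_sum_overlap\<close> this estimates sums of local operators without a factor that grows
  with the number of pieces.\<close>

lemma sum_NP_overlap:
  assumes I: "finite I" and f: "\<And>i. i \<in> I \<Longrightarrow> f i \<in> borel_measurable M"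
    "\<And>i x. i \<in> I \<Longrightarrow> x \<in> space M \<Longrightarrow> cmod (f i x) \<le> 1"
    and q: "\<And>x. x \<in> space M \<Longrightarrow> card {i \<in> I. f i x \<noteq> 0} \<le> q"
    and u: "u \<in> LP"
  shows "(\<Sum>i\<in>I. NP (f i * u) powr p) \<le> real q * NP u powr p"
proof -
  have [measurable]: "u \<in> borel_measurable M" using u Lp_measurable by auto
  have [measurable]: "i \<in> I \<Longrightarrow> f i * u \<in> borel_measurable M" for i using f(1) by (simp add: times_fun_def)
  have "ennreal (\<Sum>i\<in>I. NP (f i * u) powr p) = (\<Sum>i\<in>I. ennreal (NP (f i * u) powr p))" by simp
  also have "\<dots> = (\<Sum>i\<in>I. \<integral>\<^sup>+x. ennreal (cmod ((f i * u) x) powr p) \<partial>M)"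
    using u f by (intro sum.cong LpD[symmetric] mult_mem(1)[where c = 1] refl) auto
  also have "\<dots> = (\<integral>\<^sup>+x. (\<Sum>i\<in>I. ennreal (cmod ((f i * u) x) powr p)) \<partial>M)"
    by (rule nn_integral_sum[symmetric]) measurable
  also have "\<dots> \<le> (\<integral>\<^sup>+x. ennreal (real q) * ennreal (cmod (u x) powr p) \<partial>M)"
  proof (rule nn_integral_mono)
    fix x assume x: "x \<in> space M"
    have "(\<Sum>i\<in>I. cmod ((f i * u) x) powr p) = (\<Sum>i\<in>{i\<in>I. f i x \<noteq> 0}. cmod ((f i * u) x) powr p)"
      using I by (intro sum.mono_neutral_right) (auto simp: fun_ops)
    also have "\<dots> \<le> (\<Sum>i\<in>{i\<in>I. f i x \<noteq> 0}. cmod (u x) powr p)"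
    proof (intro sum_mono powr_mono2)
      fix i assume "i \<in> {i\<in>I. f i x \<noteq> 0}"
      then have "cmod (f i x) * cmod (u x) \<le> 1 * cmod (u x)" using f(2)[of i x] x by (intro mult_right_mono) auto
      then show "cmod ((f i * u) x) \<le> cmod (u x)" by (simp add: fun_ops norm_mult)
    qed (use p in auto)
    also have "\<dots> = real (card {i\<in>I. f i x \<noteq> 0}) * cmod (u x) powr p" by simp
    also have "\<dots> \<le> real q * cmod (u x) powr p" using q[OF x] by (intro mult_right_mono) auto
    finally show "(\<Sum>i\<in>I. ennreal (cmod ((f i * u) x) powr p)) \<le> ennreal (real q) * ennreal (cmod (u x) powr p)"
      by (simp add: ennreal_mult[symmetric] ennreal_leI)
  qed
  also have "\<dots> = ennreal (real q) * ennreal (NP u powr p)"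
    using LpD[OF p0 u] by (subst nn_integral_cmult) auto
  also have "\<dots> = ennreal (real q * NP u powr p)" by (simp add: ennreal_mult)
  finally show ?thesis by (subst (asm) ennreal_le_iff) auto
qed

text \<open>The equation \<open>indicator (P j) * U j = U j\<close> expresses that
  \<open>U j\<close> is supported in \<open>P j\<close>. It is demanded at every point, so that
  products with the indicator of a disjoint set vanish identically.\<close>

definition disjointly_bounded_below :: "'a oper \<Rightarrow> nat \<Rightarrow> real \<Rightarrow> bool" where
  "disjointly_bounded_below A n C \<longleftrightarrow>
     (\<forall>U P e. (\<forall>j\<le>n. U j \<in> LP \<and> P j \<in> sets M \<and> NP (A (U j)) \<le> e \<and> indicator (P j) * U j = U j)
      \<longrightarrow> disjoint_family_on P {..n} \<longrightarrow> (\<exists>j\<le>n. NP (U j) \<le> C * e))"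

text \<open>Here \<open>n\<close> is the dimension of the kernel: among \<open>n + 1\<close> elements of the kernel close to the given
  functions there is a linear relation.\<close>

lemma fred_disjoint_supports:
  assumes A: "fred A"
  shows "\<exists>n. \<exists>C\<ge>0. disjointly_bounded_below A n C"
proof -
  obtain S C where S: "finite S" "S \<subseteq> LP" "C \<ge> 0"
    "\<And>u. u \<in> LP \<Longrightarrow> \<exists>z\<in>fun_vs.span S. NP (u - z) \<le> C * NP (A u)" using fred_lower[OF A] by blast
  define n where "n = card S"
  have "\<exists>j\<le>n. NP (U j) \<le> ((real n + 1) * C) * e"
    if U: "\<And>j. j \<le> n \<Longrightarrow> U j \<in> LP" "\<And>j. j \<le> n \<Longrightarrow> P j \<in> sets M" "\<And>j. j \<le> n \<Longrightarrow> NP (A (U j)) \<le> e"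
      "\<And>j. j \<le> n \<Longrightarrow> indicator (P j) * U j = U j" and dis: "disjoint_family_on P {..n}" for U P e
  proof -
    have "\<forall>j\<in>{..n}. \<exists>z. z \<in> fun_vs.span S \<and> NP (U j - z) \<le> C * NP (A (U j))" using S(4) U(1) by blast
    then obtain z where z: "\<And>j. j \<le> n \<Longrightarrow> z j \<in> fun_vs.span S" "\<And>j. j \<le> n \<Longrightarrow> NP (U j - z j) \<le> C * NP (A (U j))"
      by (rule bchoice[THEN exE]) auto
    obtain d i where d: "i \<le> n" "d i = 1" "\<And>j. j \<le> n \<Longrightarrow> cmod (d j) \<le> 1" "(\<Sum>j\<le>n. scl (d j) (z j)) = 0"
      using exists_relation[OF S(1), of z] z(1) unfolding n_def by blast
    have zL: "j \<le> n \<Longrightarrow> z j \<in> LP" for j using span_mem[OF S(2)] z(1) by blast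
    let ?w = "\<Sum>j\<le>n. scl (d j) (U j)"
    have wL: "?w \<in> LP" using U(1) by (intro sum_mem scl_mem) auto
    \<comment> \<open>Restriction to \<open>P i\<close> isolates \<open>U i\<close>, as
      \<open>d i = 1\<close> and the other supports are disjoint from \<open>P i\<close>. By the
      relation among the \<open>z j\<close>, the same combination consists of the small differences
      \<open>U j - z j\<close>.\<close>
    have "indicator (P i) * ?w = (\<Sum>j\<le>n. indicator (P i) * scl (d j) (U j))" by (rule sum_distrib_left)
    also have "\<dots> = (\<Sum>j\<in>{i}. indicator (P i) * scl (d j) (U j))"
    proof (rule sum.mono_neutral_right)
      show "\<forall>j\<in>{..n} - {i}. indicator (P i) * scl (d j) (U j) = 0"
      proof
        fix j assume j: "j \<in> {..n} - {i}"
        then have dj: "P i \<inter> P j = {}" using dis d(1) by (auto simp: disjoint_family_on_def)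
        have "U j x = 0" if "x \<in> P i" for x
          using U(4)[of j] j that dj by (auto simp: fun_eq_iff fun_ops indicator_def split: if_splits)
        then show "indicator (P i) * scl (d j) (U j) = 0"
          by (auto simp: fun_eq_iff fun_ops scl_def indicator_def)
      qed
    qed (use d in auto)
    also have "\<dots> = U i" using d U(4)[of i] by simp
    finally have "NP (U i) = NP (indicator (P i) * ?w)" by simp
    also have "\<dots> \<le> 1 * NP ?w"
      using U(2)[OF d(1)] wL by (intro mult_mem(2)) (auto simp: indicator_def)
    also have "?w = (\<Sum>j\<le>n. scl (d j) (U j - z j))"
      using d(4) by (simp add: fun_vs.scale_right_diff_distrib sum_subtractf)
    finally have "NP (U i) \<le> NP (\<Sum>j\<le>n. scl (d j) (U j - z j))" by simp
    also have "\<dots> \<le> (\<Sum>j\<le>n. NP (scl (d j) (U j - z j)))"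
      using U(1) zL by (intro N_sum_le) auto
    also have "\<dots> \<le> (\<Sum>j\<le>n. C * e)"
    proof (rule sum_mono)
      fix j assume "j \<in> {..n}"
      then have j: "j \<le> n" by simp
      have "NP (scl (d j) (U j - z j)) = cmod (d j) * NP (U j - z j)" using U(1) zL j by (intro N_scl) auto
      also have "\<dots> \<le> 1 * (C * e)"
        using d(3)[OF j] z(2)[OF j] U(3)[OF j] S(3) U(1)[OF j] zL[OF j]
        by (intro mult_mono order.trans[OF z(2)[OF j]] mult_left_mono) auto
      finally show "NP (scl (d j) (U j - z j)) \<le> C * e" by simp
    qed
    also have "\<dots> = ((real n + 1) * C) * e" by (simp add: algebra_simps)
    finally show ?thesis using d(1) by blast
  qed
  note main = this
  show ?thesis unfolding disjointly_bounded_below_def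
  proof (rule exI[of _ n], rule exI[of _ "(real n + 1) * C"], intro conjI allI impI)
    fix U P e
    assume "\<forall>j\<le>n. U j \<in> LP \<and> P j \<in> sets M \<and> NP (A (U j)) \<le> e \<and> indicator (P j) * U j = U j"
      and "disjoint_family_on P {..n}"
    then show "\<exists>j\<le>n. NP (U j) \<le> (real n + 1) * C * e" by (intro main[of U P e]) auto
  qed (use S(3) in simp)
qed

end

section \<open>Periodic graphs\<close>

text \<open>The group enters as a discrete subgroup of the plane; its parametrisation by integer
  vectors returns only in the final theorem.\<close>

locale periodic_planar_graph =
  fixes G V D :: "plane set" and E :: "plane set set"
  assumes G_zero: "0 \<in> G" and G_add: "g \<in> G \<Longrightarrow> h \<in> G \<Longrightarrow> g + h \<in> G"
    and G_uminus: "g \<in> G \<Longrightarrow> - g \<in> G" and G_discrete: "discrete G"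
    and planar: "planar_graph V E" and periodic: "periodic_graph G V E"
    and domain: "fundamental_domain G E D"
begin

abbreviation \<Gamma> where "\<Gamma> \<equiv> graph_points E"

lemma G_diff: "g \<in> G \<Longrightarrow> h \<in> G \<Longrightarrow> g - h \<in> G"
  using G_add[of g "- h"] G_uminus by simp

lemma G_separated: "\<exists>s>0. \<forall>g\<in>G. \<forall>h\<in>G. dist g h < s \<longrightarrow> g = h"
proof -
  have "0 isolated_in G" using G_discrete G_zero by (rule discreteD)
  then obtain s where s: "s > 0" "\<And>g. g \<in> G \<Longrightarrow> dist 0 g < s \<Longrightarrow> g = 0" by (rule isolated_inE_dist) auto
  have "g = h" if "g \<in> G" "h \<in> G" "dist g h < s" for g h
    using s(2)[of "g - h"] G_diff[OF that(1,2)] that(3) by (simp add: dist_norm norm_minus_commute)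
  with s(1) show ?thesis by blast
qed

lemma G_finite: "finite {g \<in> G. norm (x - g) \<le> r}"
proof -
  have "uniform_discrete {g \<in> G. norm (x - g) \<le> r}"
    using G_separated unfolding uniform_discrete_def by blast
  moreover have "{g \<in> G. norm (x - g) \<le> r} \<subseteq> cball x r" by (auto simp: dist_norm)
  then have "bounded {g \<in> G. norm (x - g) \<le> r}" using bounded_cball bounded_subset by blast
  ultimately show ?thesis using uniform_discrete_finite_iff by blast
qed

text \<open>Subtracting one fixed element of the left-hand set maps that set injectively into a ball
  about \<open>0\<close>. So the count is bounded uniformly in \<open>x\<close>.\<close>

lemma G_card: "card {g \<in> G. norm (x - g) \<le> r} \<le> card {g \<in> G. norm (0 - g) \<le> 2 * r}"
proof (cases "{g \<in> G. norm (x - g) \<le> r} = {}")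
  case False
  then obtain h where h: "h \<in> G" "norm (x - h) \<le> r" by blast
  have "(\<lambda>g. g - h) ` {g \<in> G. norm (x - g) \<le> r} \<subseteq> {g \<in> G. norm (0 - g) \<le> 2 * r}"
  proof (clarsimp simp: G_diff h)
    fix g assume "norm (x - g) \<le> r"
    then show "norm (g - h) \<le> 2 * r"
      using h norm_triangle_ineq4[of "x - h" "x - g"] by (simp add: algebra_simps)
  qed
  moreover have "inj_on (\<lambda>g. g - h) {g \<in> G. norm (x - g) \<le> r}" by (auto intro: inj_onI)
  ultimately show ?thesis using card_inj_on_le[OF _ _ G_finite] by blast
next
  case True
  show ?thesis unfolding True by simp
qed

lemma edge_translate: "e \<in> E \<Longrightarrow> g \<in> G \<Longrightarrow> (\<lambda>x. x + g) ` e \<in> E"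
  using periodic unfolding periodic_graph_def by blast

lemma hull_translate: "convex hull ((\<lambda>x. x + g) ` e) = (\<lambda>x. x + g) ` (convex hull e)" for g :: plane
  using convex_hull_translation[of g e] by (simp add: add.commute)

lemma hull_translate_iff: "x + g \<in> convex hull ((\<lambda>x. x + g) ` e) \<longleftrightarrow> x \<in> convex hull e" for g :: plane
  unfolding hull_translate by auto

lemma \<Gamma>_add: "x \<in> \<Gamma> \<Longrightarrow> g \<in> G \<Longrightarrow> x + g \<in> \<Gamma>"
  unfolding graph_points_def using edge_translate hull_translate_iff by blast

lemma \<Gamma>_add_iff: "g \<in> G \<Longrightarrow> x + g \<in> \<Gamma> \<longleftrightarrow> x \<in> \<Gamma>"
  using \<Gamma>_add[of x g] \<Gamma>_add[of "x + g" "- g"] G_uminus by auto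

lemma \<Gamma>_diff_iff: "g \<in> G \<Longrightarrow> x - g \<in> \<Gamma> \<longleftrightarrow> x \<in> \<Gamma>"
  using \<Gamma>_add_iff[of "- g" x] G_uminus by auto

lemma walk_translate: "walk E x y L \<Longrightarrow> g \<in> G \<Longrightarrow> walk E (x + g) (y + g) L"
proof (induction rule: walk.induct)
  case (walk_refl x)
  then show ?case by (intro walk.walk_refl \<Gamma>_add)
next
  case (walk_step x y L e z)
  then have "walk E (x + g) (z + g) (L + dist (y + g) (z + g))"
    by (intro walk.walk_step[of E _ _ _ "(\<lambda>x. x + g) ` e"] edge_translate) (auto simp: hull_translate)
  then show ?case by simp
qed

lemma walk_translate_iff: "g \<in> G \<Longrightarrow> walk E (x + g) (y + g) L \<longleftrightarrow> walk E x y L"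
  using walk_translate[of x y L g] walk_translate[of "x + g" "y + g" L "- g"] G_uminus by auto

lemma path_dist_translate: "g \<in> G \<Longrightarrow> path_dist E (x + g) (y + g) = path_dist E x y"
proof -
  assume "g \<in> G"
  then have "walk E (x + g) (y + g) = walk E x y" by (intro ext walk_translate_iff)
  then show ?thesis unfolding path_dist_def by (simp only:)
qed

section \<open>Consequences of the compactness of the orbit space\<close>

interpretation PM: Metric_space \<Gamma> "path_dist E"
  by (rule Metric_space_path_dist[OF planar])

lemma path_dist_lessD:
  assumes "x \<in> \<Gamma>" "y \<in> \<Gamma>" "path_dist E x y < r"
  shows "\<exists>L<r. walk E x y L"
proof -
  have ex: "\<exists>L. walk E x y L" by (rule walk_exists[OF planar assms(1,2)])
  then have "Inf {L. walk E x y L} < r" using assms(3) by (simp add: path_dist_def)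
  then show ?thesis using cInf_lessD[of "{L. walk E x y L}" r] ex by auto
qed

lemma mtopology_path_metric: "mtopology_of (path_metric E) = PM.mtopology"
  unfolding path_metric_def by (rule PM.mtopology_of)

text \<open>The translates of a path-metric ball together form a \<open>G\<close>-invariant open
  set, hence the full preimage of an open set of orbits, and compactness of the quotient leaves
  finitely many of these. The radius may depend on the centre, because the stars of
  \<open>local_star\<close> have no common size in advance.\<close>

lemma orbit_cover:
  assumes \<rho>: "\<And>x. x \<in> \<Gamma> \<Longrightarrow> \<rho> x > 0"
  shows "\<exists>Z. finite Z \<and> Z \<subseteq> \<Gamma> \<and> (\<forall>x\<in>\<Gamma>. \<exists>z\<in>Z. \<exists>g\<in>G. path_dist E (z + g) x < \<rho> z)"
proof -
  obtain Q where Q: "quotient_map PM.mtopology Q (orbit_of G)" "compact_space Q"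
    using periodic unfolding periodic_graph_def mtopology_path_metric by blast
  have top: "orbit_of G ` \<Gamma> = topspace Q" using Q(1) unfolding quotient_map_def by simp
  define B where "B z = {x \<in> \<Gamma>. \<exists>g\<in>G. path_dist E (z + g) x < \<rho> z}" for z
  have inv: "x + h \<in> B z" if "x \<in> B z" "h \<in> G" for x h z
  proof -
    from that obtain g where g: "g \<in> G" "path_dist E (z + g) x < \<rho> z" "x \<in> \<Gamma>" by (auto simp: B_def)
    then have "path_dist E (z + (g + h)) (x + h) < \<rho> z"
      using path_dist_translate[OF that(2), of "z + g" x] by (simp add: add.assoc)
    then show ?thesis using g that G_add \<Gamma>_add unfolding B_def by blast
  qed
  have op: "openin Q (orbit_of G ` B z)" if z: "z \<in> \<Gamma>" for z
  proof -
    have "{x \<in> \<Gamma>. orbit_of G x \<in> orbit_of G ` B z} = B z"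
    proof (intro equalityI subsetI)
      fix x assume "x \<in> {x \<in> \<Gamma>. orbit_of G x \<in> orbit_of G ` B z}"
      then obtain y where y: "x \<in> \<Gamma>" "y \<in> B z" "orbit_of G x = orbit_of G y" by auto
      have "x \<in> orbit_of G x" using G_zero unfolding orbit_of_def by force
      then obtain h where "h \<in> G" "x = y + h" using y(3) unfolding orbit_of_def by auto
      then show "x \<in> B z" using inv y by blast
    qed (auto simp: B_def)
    also have "B z = (\<Union>g\<in>G. PM.mball (z + g) (\<rho> z))"
      using z \<Gamma>_add by (auto simp: B_def)
    finally have eq: "{x \<in> topspace PM.mtopology. orbit_of G x \<in> orbit_of G ` B z} = (\<Union>g\<in>G. PM.mball (z + g) (\<rho> z))"
      by simp
    have "openin PM.mtopology (\<Union>g\<in>G. PM.mball (z + g) (\<rho> z))" by (intro openin_Union) auto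
    moreover have "orbit_of G ` B z \<subseteq> topspace Q" unfolding top[symmetric] by (auto simp: B_def)
    ultimately show ?thesis using Q(1) unfolding quotient_map_def eq[symmetric] by blast
  qed
  have self: "z \<in> B z" if "z \<in> \<Gamma>" for z
    using that \<rho>[OF that] G_zero unfolding B_def by (auto intro!: bexI[of _ 0])
  have "topspace Q \<subseteq> \<Union>((\<lambda>z. orbit_of G ` B z) ` \<Gamma>)"
    unfolding top[symmetric] using self by blast
  then obtain F where F: "finite F" "F \<subseteq> (\<lambda>z. orbit_of G ` B z) ` \<Gamma>" "topspace Q \<subseteq> \<Union>F"
    using Q(2) op unfolding compact_space_alt by (metis (no_types, lifting) imageE)
  obtain Z where Z: "Z \<subseteq> \<Gamma>" "finite Z" "F = (\<lambda>z. orbit_of G ` B z) ` Z"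
    using finite_subset_image[OF F(1,2)] by blast
  have "\<exists>z\<in>Z. \<exists>g\<in>G. path_dist E (z + g) x < \<rho> z" if x: "x \<in> \<Gamma>" for x
  proof -
    have "orbit_of G x \<in> \<Union>F" using F(3) x top by blast
    then obtain z y where z: "z \<in> Z" "y \<in> B z" "orbit_of G x = orbit_of G y" unfolding Z(3) by auto
    have "x \<in> orbit_of G x" using G_zero unfolding orbit_of_def by force
    then obtain h where "h \<in> G" "x = y + h" using z(3) unfolding orbit_of_def by auto
    then have "x \<in> B z" using inv z by blast
    then show ?thesis using z(1) unfolding B_def by blast
  qed
  then show ?thesis using Z by blast
qed

lemma edge_cases:
  assumes "e \<in> E"
  obtains u v where "e = {u, v}" "u \<noteq> v" "u \<in> V" "v \<in> V"
proof -
  have "\<forall>e\<in>E. \<exists>u\<in>V. \<exists>v\<in>V. u \<noteq> v \<and> e = {u, v}" using planar by (simp add: planar_graph_def)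
  then show ?thesis using assms that by blast
qed

lemma edge_Int: "e \<in> E \<Longrightarrow> f \<in> E \<Longrightarrow> e \<noteq> f \<Longrightarrow> x \<in> convex hull e \<Longrightarrow> x \<in> convex hull f \<Longrightarrow> x \<in> e \<and> x \<in> f"
proof -
  have "\<forall>e\<in>E. \<forall>f\<in>E. e \<noteq> f \<longrightarrow> convex hull e \<inter> convex hull f \<subseteq> e \<inter> f"
    using planar by (simp add: planar_graph_def)
  then show "e \<in> E \<Longrightarrow> f \<in> E \<Longrightarrow> e \<noteq> f \<Longrightarrow> x \<in> convex hull e \<Longrightarrow> x \<in> convex hull f \<Longrightarrow> x \<in> e \<and> x \<in> f"
    by blast
qed

lemma finite_edges_at_vertex: "finite {e \<in> E. x \<in> e}"
proof (cases "x \<in> V")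
  case True
  then show ?thesis using planar unfolding planar_graph_def by blast
next
  case False
  then have "{e \<in> E. x \<in> e} = {}" by (auto elim: edge_cases)
  then show ?thesis by (metis finite.emptyI)
qed

lemma finite_edges_at: "finite {e \<in> E. x \<in> convex hull e}"
proof (cases "\<exists>e0\<in>E. x \<in> convex hull e0 \<and> x \<notin> e0")
  case True
  then obtain e0 where e0: "e0 \<in> E" "x \<in> convex hull e0" "x \<notin> e0" by blast
  have "{e \<in> E. x \<in> convex hull e} \<subseteq> {e0}" using edge_Int[of _ e0 x] e0 by blast
  then show ?thesis by (rule finite_subset) simp
next
  case False
  then have "{e \<in> E. x \<in> convex hull e} \<subseteq> {e \<in> E. x \<in> e}" by blast
  then show ?thesis using finite_edges_at_vertex finite_subset by blast
qed

text \<open>Short walks from \<open>x\<close> stay inside the edges through \<open>x\<close>: to leave such an edge one has to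
  pass an endpoint different from \<open>x\<close>.\<close>

lemma local_star:
  assumes x: "x \<in> \<Gamma>"
  shows "\<exists>r>0. \<forall>y L. walk E x y L \<longrightarrow> L < r \<longrightarrow> (\<exists>e\<in>E. x \<in> convex hull e \<and> y \<in> convex hull e)"
proof -
  define F where "F = \<Union>{e \<in> E. x \<in> convex hull e} - {x}"
  have "finite e" if "e \<in> E" for e using edge_cases[OF that] by (metis finite.emptyI finite.insertI)
  then have fin: "finite F" unfolding F_def using finite_edges_at[of x] by auto
  define r where "r = Min (insert 1 (dist x ` F))"
  have r: "r > 0" "\<And>y. y \<in> F \<Longrightarrow> r \<le> dist x y"
    unfolding r_def using fin by (auto simp: F_def)
  have "x' = x \<Longrightarrow> L < r \<Longrightarrow> \<exists>e\<in>E. x \<in> convex hull e \<and> y \<in> convex hull e" if "walk E x' y L" for x' y L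
    using that
  proof (induction rule: walk.induct)
    case (walk_refl x')
    then show ?case unfolding graph_points_def by blast
  next
    case (walk_step x' y L f z)
    have "L < r" using walk_step.prems zero_le_dist[of y z] by linarith
    then obtain e where e: "e \<in> E" "x \<in> convex hull e" "y \<in> convex hull e"
      using walk_step.IH walk_step.prems by blast
    show ?case
    proof (cases "y = x \<or> f = e")
      case True
      then show ?thesis using walk_step.hyps e by blast
    next
      case False
      then have "y \<in> e" using edge_Int[OF e(1) walk_step.hyps(2)] e walk_step.hyps by blast
      then have "y \<in> F" using False e by (auto simp: F_def)
      moreover have "dist x y \<le> L" using walk_dist_le[OF walk_step.hyps(1)] walk_step.prems by simp
      ultimately show ?thesis using r(2)[of y] \<open>L < r\<close> by linarith
    qed
  qed
  then show ?thesis using r(1) by blast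
qed


text \<open>Cover the graph by translates of finitely many stars. The midpoint of an edge lies on no
  other edge; so when it lies in a star, the edge itself is a translate of one of the finitely many
  edges through the centre.\<close>

lemma finite_edge_orbits: "\<exists>E0. finite E0 \<and> E0 \<subseteq> E \<and> (\<forall>e\<in>E. \<exists>f\<in>E0. \<exists>g\<in>G. e = (\<lambda>x. x + g) ` f)"
proof -
  have "\<forall>x\<in>\<Gamma>. \<exists>r>0. \<forall>y L. walk E x y L \<longrightarrow> L < r \<longrightarrow> (\<exists>e\<in>E. x \<in> convex hull e \<and> y \<in> convex hull e)"
    using local_star by blast
  then obtain \<rho> where "\<forall>x\<in>\<Gamma>. \<rho> x > 0 \<and>
      (\<forall>y L. walk E x y L \<longrightarrow> L < \<rho> x \<longrightarrow> (\<exists>e\<in>E. x \<in> convex hull e \<and> y \<in> convex hull e))"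
    by (rule bchoice[THEN exE])
  then have \<rho>: "\<And>x. x \<in> \<Gamma> \<Longrightarrow> \<rho> x > 0"
    "\<And>x y L. x \<in> \<Gamma> \<Longrightarrow> walk E x y L \<Longrightarrow> L < \<rho> x \<Longrightarrow> \<exists>e\<in>E. x \<in> convex hull e \<and> y \<in> convex hull e"
    by blast+
  from orbit_cover[of \<rho>, OF \<rho>(1)]
  obtain Z where "finite Z \<and> Z \<subseteq> \<Gamma> \<and> (\<forall>x\<in>\<Gamma>. \<exists>z\<in>Z. \<exists>g\<in>G. path_dist E (z + g) x < \<rho> z)" ..
  then have Z: "finite Z" "Z \<subseteq> \<Gamma>" "\<And>x. x \<in> \<Gamma> \<Longrightarrow> \<exists>z\<in>Z. \<exists>g\<in>G. path_dist E (z + g) x < \<rho> z"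
    by simp_all
  define E0 where "E0 = (\<Union>z\<in>Z. {e \<in> E. z \<in> convex hull e})"
  have "\<exists>f\<in>E0. \<exists>g\<in>G. e = (\<lambda>x. x + g) ` f" if e: "e \<in> E" for e
  proof -
    obtain u v where uv: "e = {u, v}" "u \<noteq> v" using edge_cases[OF e] by metis
    define m where "m = midpoint u v"
    have m: "m \<in> convex hull e" "m \<notin> e"
      using uv midpoint_in_closed_segment[of u v] by (auto simp: m_def segment_convex_hull[symmetric])
    then have "m \<in> \<Gamma>" using e unfolding graph_points_def by blast
    then obtain z g where z: "z \<in> Z" "g \<in> G" "path_dist E (z + g) m < \<rho> z" using Z(3) by blast
    then have zm: "z \<in> \<Gamma>" "m - g \<in> \<Gamma>" using Z(2) \<open>m \<in> \<Gamma>\<close> \<Gamma>_diff_iff by auto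
    have "path_dist E z (m - g) < \<rho> z" using z path_dist_translate[OF z(2), of z "m - g"] by simp
    then obtain L where "L < \<rho> z" "walk E z (m - g) L" using path_dist_lessD[OF zm] by blast
    then obtain f where f: "f \<in> E" "z \<in> convex hull f" "m - g \<in> convex hull f" using \<rho>(2)[OF zm(1)] by blast
    have "m \<in> convex hull ((\<lambda>x. x + g) ` f)" using hull_translate_iff[of "m - g" g f] f by simp
    then have "e = (\<lambda>x. x + g) ` f" using edge_Int[OF e edge_translate[OF f(1) z(2)] _ m(1)] m(2) by blast
    moreover have "f \<in> E0" using f z unfolding E0_def by blast
    ultimately show ?thesis using z(2) by blast
  qed
  moreover have "finite E0" unfolding E0_def using Z(1) finite_edges_at by blast
  moreover have "E0 \<subseteq> E" unfolding E0_def by blast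
  ultimately show ?thesis by blast
qed

subsection \<open>The arc-length measure\<close>

abbreviation M where "M \<equiv> graph_measure E"

lemma \<Gamma>_borel: "\<Gamma> \<in> sets borel" by (rule planar_graph_borel[OF planar])

lemma space_M [simp]: "space M = \<Gamma>"
  unfolding graph_measure_def using sets.sigma_sets_eq[of "borel :: plane measure"] by (simp add: space_restrict_space)

lemma sets_M: "sets M = sets (restrict_space borel \<Gamma>)"
  unfolding graph_measure_def using sets.sigma_sets_eq[of "borel :: plane measure"]
  by (intro sets_restrict_space_cong) simp

lemma sets_M_iff: "A \<in> sets M \<longleftrightarrow> A \<in> sets borel \<and> A \<subseteq> \<Gamma>"
  unfolding sets_M using \<Gamma>_borel by (subst sets_restrict_space_iff) auto

lemma borel_measurable_M [measurable (raw)]: "f \<in> borel_measurable borel \<Longrightarrow> f \<in> borel_measurable M"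
  using measurable_restrict_space1[of f borel borel \<Gamma>] measurable_cong_sets[OF sets_M refl] by blast

lemma emeasure_edge_le:
  assumes e: "e = {u, v}" and A: "A \<in> sets borel"
  shows "emeasure (edge_measure e) A \<le> ennreal (dist u v)"
proof -
  have "emeasure (edge_measure e) A = emeasure lborel {s \<in> {0..dist u v}. u + s *\<^sub>R sgn (v - u) \<in> A}"
    unfolding e edge_measure_eq by (rule emeasure_segment_measure[OF A])
  also have "\<dots> \<le> emeasure lborel {0..dist u v}" by (intro emeasure_mono) auto
  finally show ?thesis by simp
qed

lemma segment_point:
  fixes u v :: plane
  assumes "s \<in> {0..dist u v}"
  shows "u + s *\<^sub>R sgn (v - u) \<in> convex hull {u, v}"
proof (cases "u = v")
  case False
  then have "dist u v > 0" by simp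
  then have "u + s *\<^sub>R sgn (v - u) = (1 - s / dist u v) *\<^sub>R u + (s / dist u v) *\<^sub>R v"
    by (simp add: sgn_div_norm dist_norm norm_minus_commute algebra_simps divide_inverse)
  moreover have "0 \<le> s / dist u v" "s / dist u v \<le> 1" using assms \<open>dist u v > 0\<close> by auto
  ultimately show ?thesis unfolding segment_convex_hull[symmetric] in_segment by blast
qed (use assms in auto)

lemma emeasure_edge_0:
  assumes e: "e = {u, v}" and A: "A \<in> sets borel" "A \<inter> convex hull e = {}"
  shows "emeasure (edge_measure e) A = 0"
proof -
  have "{s \<in> {0..dist u v}. u + s *\<^sub>R sgn (v - u) \<in> A} = {}"
  proof (intro equals0I)
    fix s assume "s \<in> {s \<in> {0..dist u v}. u + s *\<^sub>R sgn (v - u) \<in> A}"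
    then have "u + s *\<^sub>R sgn (v - u) \<in> A \<inter> convex hull e" using segment_point[of s u v] e by simp
    then show False using A(2) by simp
  qed
  then show ?thesis unfolding e edge_measure_eq emeasure_segment_measure[OF A(1)] by (metis emeasure_empty)
qed

lemma emeasure_M: "A \<in> sets M \<Longrightarrow> emeasure M A = (\<integral>\<^sup>+e. emeasure (edge_measure e) A \<partial>count_space E)"
  using emeasure_graph_measure[OF planar, of A] by (auto simp: sets_M_iff)

text \<open>With finitely many orbits of edges the lengths are bounded, and by \<open>G_card\<close>
  the number of edges that meet a unit ball is bounded independently of its centre.\<close>

lemma emeasure_ball_bounded: "\<exists>m0\<ge>0. \<forall>x. emeasure M (\<Gamma> \<inter> ball x 1) \<le> ennreal m0"
proof -
  from finite_edge_orbits
  obtain E0 where "finite E0 \<and> E0 \<subseteq> E \<and> (\<forall>e\<in>E. \<exists>f\<in>E0. \<exists>g\<in>G. e = (\<lambda>x. x + g) ` f)" ..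
  then have E0: "finite E0" "E0 \<subseteq> E" "\<And>e. e \<in> E \<Longrightarrow> \<exists>f\<in>E0. \<exists>g\<in>G. e = (\<lambda>x. x + g) ` f"
    by simp_all
  have "bounded (\<Union>f\<in>E0. convex hull f)"
  proof (rule bounded_UN[OF E0(1)], rule ballI)
    fix f assume "f \<in> E0"
    then obtain u v where "f = {u, v}" using E0(2) edge_cases by (metis subsetD)
    then show "bounded (convex hull f)" by (simp add: bounded_convex_hull)
  qed
  then obtain r0 where r0: "\<And>f y. f \<in> E0 \<Longrightarrow> y \<in> convex hull f \<Longrightarrow> norm y \<le> r0"
    unfolding bounded_iff by blast
  have len: "emeasure (edge_measure e) A \<le> ennreal (2 * r0)" if e: "e \<in> E" and A: "A \<in> sets borel" for e A
  proof -
    obtain f g where f: "f \<in> E0" "g \<in> G" "e = (\<lambda>x. x + g) ` f" using E0(3)[OF e] by blast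
    then obtain u v where uv: "f = {u, v}" using E0(2) edge_cases by (metis subsetD)
    have "emeasure (edge_measure e) A \<le> ennreal (dist (u + g) (v + g))"
      by (rule emeasure_edge_le[OF _ A]) (simp add: f uv)
    also have "norm u \<le> r0" "norm v \<le> r0" using r0[OF f(1)] by (auto simp: uv hull_inc)
    then have "dist (u + g) (v + g) \<le> 2 * r0" using norm_triangle_ineq4[of u v] by (simp add: dist_norm)
    then have "ennreal (dist (u + g) (v + g)) \<le> ennreal (2 * r0)" by (rule ennreal_leI)
    finally show ?thesis .
  qed
  define c where "c = card E0 * card {g \<in> G. norm (0 - g) \<le> 2 * (r0 + 1)}"
  have "emeasure M (\<Gamma> \<inter> ball x 1) \<le> ennreal (real c * \<bar>2 * r0\<bar>)" for x
  proof -
    let ?A = "\<Gamma> \<inter> ball x 1"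
    let ?Ex = "{e \<in> E. convex hull e \<inter> ball x 1 \<noteq> {}}"
    let ?H = "{g \<in> G. norm (x - g) \<le> r0 + 1}"
    have sub: "?Ex \<subseteq> (\<lambda>(f, g). (\<lambda>x. x + g) ` f) ` (E0 \<times> ?H)"
    proof
      fix e assume "e \<in> ?Ex"
      then obtain y where y: "e \<in> E" "y \<in> convex hull e" "dist x y < 1" by auto
      obtain f g where f: "f \<in> E0" "g \<in> G" "e = (\<lambda>x. x + g) ` f" using E0(3)[OF y(1)] by blast
      have "y - g \<in> convex hull f" using y(2) hull_translate_iff[of "y - g" g f] f by simp
      then have "norm (y - g) \<le> r0" using r0 f by blast
      then have "norm (x - g) \<le> r0 + 1"
        using y(3) norm_triangle_ineq[of "x - y" "y - g"] by (simp add: dist_norm)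
      then show "e \<in> (\<lambda>(f, g). (\<lambda>x. x + g) ` f) ` (E0 \<times> ?H)" using f by force
    qed
    have fin: "finite (E0 \<times> ?H)" using E0(1) G_finite by blast
    then have finEx: "finite ?Ex" using sub by (meson finite_imageI finite_subset)
    have "card ?Ex \<le> card (E0 \<times> ?H)" using surj_card_le[OF fin sub] .
    also have "\<dots> = card E0 * card ?H" by (rule card_cartesian_product)
    also have "\<dots> \<le> c" unfolding c_def by (intro mult_left_mono G_card) auto
    finally have cE: "card ?Ex \<le> c" .
    have A: "?A \<in> sets M" using \<Gamma>_borel by (auto simp: sets_M_iff)
    have "emeasure M ?A = (\<integral>\<^sup>+e. emeasure (edge_measure e) ?A \<partial>count_space E)" by (rule emeasure_M[OF A])
    also have "\<dots> = (\<Sum>e\<in>?Ex. emeasure (edge_measure e) ?A)"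
    proof (rule nn_integral_count_space'[OF finEx])
      fix e assume e: "e \<in> E" "e \<notin> ?Ex"
      obtain u v where "e = {u, v}" using edge_cases[OF e(1)] by metis
      then show "emeasure (edge_measure e) ?A = 0"
        using e A by (intro emeasure_edge_0) (auto simp: sets_M_iff)
    qed auto
    also have "\<dots> \<le> (\<Sum>e\<in>?Ex. ennreal \<bar>2 * r0\<bar>)"
    proof (rule sum_mono)
      fix e assume "e \<in> ?Ex"
      then have "emeasure (edge_measure e) ?A \<le> ennreal (2 * r0)" using A by (intro len) (auto simp: sets_M_iff)
      also have "\<dots> \<le> ennreal \<bar>2 * r0\<bar>" by (intro ennreal_leI) simp
      finally show "emeasure (edge_measure e) ?A \<le> ennreal \<bar>2 * r0\<bar>" .
    qed
    also have "\<dots> = ennreal (real (card ?Ex) * \<bar>2 * r0\<bar>)" by (simp add: ennreal_mult ennreal_of_nat_eq_real_of_nat)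
    also have "\<dots> \<le> ennreal (real c * \<bar>2 * r0\<bar>)" using cE by (intro ennreal_leI mult_right_mono) auto
    finally show ?thesis .
  qed
  then show ?thesis by (intro exI[of _ "real c * \<bar>2 * r0\<bar>"]) simp
qed

end

section \<open>A decaying weight, integrable over the graph uniformly in its centre\<close>

definition weight :: "real \<Rightarrow> plane \<Rightarrow> real" where
  "weight d z = (1 + norm z) powr (- 2 - d)"

lemma weight_pos: "weight d z > 0" unfolding weight_def by (smt (verit) norm_ge_zero powr_gt_zero)

lemma norm_plane: "norm (z :: plane) = sqrt ((z $ 1)\<^sup>2 + (z $ 2)\<^sup>2)"
  by (simp add: norm_vec_def L2_set_def sum_2)

text \<open>Each coordinate receives half of the exponent, which still exceeds \<open>1\<close>.
  Summation over unit squares then separates into two convergent one-dimensional series.\<close>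

lemma weight_le_product:
  fixes z :: plane
  assumes d: "d > 0" and i: "real i \<le> \<bar>z $ 1\<bar>" and j: "real j \<le> \<bar>z $ 2\<bar>"
  shows "weight d z \<le> (1 + real i) powr (- 1 - d / 2) * (1 + real j) powr (- 1 - d / 2)"
proof -
  have "real i \<le> norm z" "real j \<le> norm z"
    using i j component_le_norm_cart[of z 1] component_le_norm_cart[of z 2] by linarith+
  then have "(1 + norm z) powr (- 1 - d / 2) \<le> (1 + real i) powr (- 1 - d / 2)"
    "(1 + norm z) powr (- 1 - d / 2) \<le> (1 + real j) powr (- 1 - d / 2)"
    using d by (auto intro!: powr_mono2')
  then have "(1 + norm z) powr (- 1 - d / 2) * (1 + norm z) powr (- 1 - d / 2)
      \<le> (1 + real i) powr (- 1 - d / 2) * (1 + real j) powr (- 1 - d / 2)"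
    by (intro mult_mono) auto
  then show ?thesis by (simp add: weight_def powr_add[symmetric])
qed

context periodic_planar_graph
begin

lemma bounded_emeasure: "emeasure M (\<Gamma> \<inter> ball 0 R) < \<infinity>"
proof -
  obtain m0 where m0: "\<And>x. emeasure M (\<Gamma> \<inter> ball x 1) \<le> ennreal m0" using emeasure_ball_bounded by blast
  have "compact (cball (0::plane) R)" by simp
  then obtain X where X: "finite X" "cball (0::plane) R \<subseteq> (\<Union>x\<in>X. ball x 1)"
    unfolding compact_eq_totally_bounded using zero_less_one by blast
  have S: "\<Gamma> \<inter> ball x r \<in> sets M" for x r using \<Gamma>_borel by (auto simp: sets_M_iff)
  have "ball (0::plane) R \<subseteq> cball 0 R" by auto
  have "emeasure M (\<Gamma> \<inter> ball 0 R) \<le> emeasure M (\<Union>x\<in>X. \<Gamma> \<inter> ball x 1)"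
  proof (rule emeasure_mono)
    show "\<Gamma> \<inter> ball 0 R \<subseteq> (\<Union>x\<in>X. \<Gamma> \<inter> ball x 1)" using X(2) \<open>ball 0 R \<subseteq> cball 0 R\<close> by auto
    show "(\<Union>x\<in>X. \<Gamma> \<inter> ball x 1) \<in> sets M" using X(1) S by (rule sets.finite_UN)
  qed
  also have "\<dots> \<le> (\<Sum>x\<in>X. emeasure M (\<Gamma> \<inter> ball x 1))"
    using X S by (intro emeasure_subadditive_finite) auto
  also have "\<dots> \<le> (\<Sum>x\<in>X. ennreal m0)" by (intro sum_mono m0)
  also have "\<dots> < \<infinity>" by (simp add: ennreal_mult_less_top of_nat_less_top)
  finally show ?thesis .
qed

lemma sigma_finite_M: "sigma_finite_measure M"
proof
  show "\<exists>A. countable A \<and> A \<subseteq> sets M \<and> \<Union>A = space M \<and> (\<forall>a\<in>A. emeasure M a \<noteq> \<infinity>)"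
  proof (intro exI[of _ "range (\<lambda>n::nat. \<Gamma> \<inter> ball 0 (real n))"] conjI)
    show "range (\<lambda>n::nat. \<Gamma> \<inter> ball 0 (real n)) \<subseteq> sets M"
      using \<Gamma>_borel by (auto simp: sets_M_iff)
    have "\<exists>n::nat. x \<in> ball 0 (real n)" for x :: plane
      using reals_Archimedean2[of "norm x"] by simp
    then show "\<Union> (range (\<lambda>n::nat. \<Gamma> \<inter> ball 0 (real n))) = space M" by auto
    show "\<forall>a\<in>range (\<lambda>n::nat. \<Gamma> \<inter> ball 0 (real n)). emeasure M a \<noteq> \<infinity>"
      using bounded_emeasure by (auto simp: less_top)
  qed auto
qed

lemma measurable_translate: "g \<in> G \<Longrightarrow> (\<lambda>x. x + g) \<in> measurable M M"
proof -
  assume g: "g \<in> G"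
  have "(\<lambda>x. x + g) \<in> borel_measurable M" by (rule borel_measurable_M) simp
  moreover have "(\<lambda>x. x + g) \<in> space M \<rightarrow> \<Gamma>" using g \<Gamma>_add by auto
  ultimately have "(\<lambda>x. x + g) \<in> measurable M (restrict_space borel \<Gamma>)"
    by (intro measurable_restrict_space2)
  then show ?thesis using measurable_cong_sets[OF refl sets_M] by blast
qed

lemma emeasure_edge_translate:
  assumes e: "e = {u, v}" and A: "A \<in> sets borel"
  shows "emeasure (edge_measure e) {x. x + g \<in> A} = emeasure (edge_measure ((\<lambda>x. x + g) ` e)) A"
proof -
  have "(\<lambda>x. x + g) -` A \<inter> space borel \<in> sets borel" by (rule measurable_sets[OF _ A]) simp
  then have A': "{x. x + g \<in> A} \<in> sets borel" by (simp add: vimage_def)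
  show ?thesis unfolding e image_insert image_empty edge_measure_eq
      emeasure_segment_measure[OF A] emeasure_segment_measure[OF A']
    by (simp add: add.assoc add.left_commute add.commute)
qed

text \<open>Translation permutes the edges and carries the arc length of each edge to that of its
  image, so the sum over the edges is merely reindexed.\<close>

lemma distr_translate:
  assumes g: "g \<in> G"
  shows "distr M M (\<lambda>x. x + g) = M"
proof (rule measure_eqI)
  fix A assume "A \<in> sets (distr M M (\<lambda>x. x + g))"
  then have A: "A \<in> sets M" by simp
  then have Ab: "A \<in> sets borel" "A \<subseteq> \<Gamma>" by (auto simp: sets_M_iff)
  have vi: "(\<lambda>x. x + g) -` A \<inter> space M = {x. x + g \<in> A}" using Ab(2) \<Gamma>_add_iff[OF g] by auto
  have A': "{x. x + g \<in> A} \<in> sets M" unfolding vi[symmetric] using measurable_translate[OF g] A by (rule measurable_sets)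
  have bij: "bij_betw (\<lambda>e. (\<lambda>x. x + g) ` e) E E"
  proof (rule bij_betwI[where g = "\<lambda>e. (\<lambda>x. x + - g) ` e"])
    show "(\<lambda>e. (\<lambda>x. x + g) ` e) \<in> E \<rightarrow> E" "(\<lambda>e. (\<lambda>x. x + - g) ` e) \<in> E \<rightarrow> E"
      using edge_translate g G_uminus by blast+
  qed (auto simp: image_image)
  have "emeasure (distr M M (\<lambda>x. x + g)) A = emeasure M {x. x + g \<in> A}"
    using emeasure_distr[OF measurable_translate[OF g] A] vi by simp
  also have "\<dots> = (\<integral>\<^sup>+e. emeasure (edge_measure e) {x. x + g \<in> A} \<partial>count_space E)"
    by (rule emeasure_M[OF A'])
  also have "\<dots> = (\<integral>\<^sup>+e. emeasure (edge_measure ((\<lambda>x. x + g) ` e)) A \<partial>count_space E)"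
  proof (rule nn_integral_cong)
    fix e assume "e \<in> space (count_space E)"
    then have "e \<in> E" by simp
    then obtain u v where "e = {u, v}" by (rule edge_cases)
    then show "emeasure (edge_measure e) {x. x + g \<in> A} = emeasure (edge_measure ((\<lambda>x. x + g) ` e)) A"
      by (rule emeasure_edge_translate[OF _ Ab(1)])
  qed
  also have "\<dots> = (\<integral>\<^sup>+e. emeasure (edge_measure e) A \<partial>count_space E)"
    by (rule nn_integral_bij_count_space[OF bij])
  also have "\<dots> = emeasure M A" by (rule emeasure_M[OF A, symmetric])
  finally show "emeasure (distr M M (\<lambda>x. x + g)) A = emeasure M A" .
qed simp

lemma nn_integral_translate:
  assumes "g \<in> G" "f \<in> borel_measurable M"
  shows "(\<integral>\<^sup>+x. f (x + g) \<partial>M) = (\<integral>\<^sup>+x. f x \<partial>M)"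
  using nn_integral_distr[OF measurable_translate[OF assms(1)], of f] assms distr_translate[OF assms(1)] by simp

lemma integral_translate:
  fixes f :: "plane \<Rightarrow> complex"
  assumes "g \<in> G" "f \<in> borel_measurable M"
  shows "(\<integral>x. f (x + g) \<partial>M) = (\<integral>x. f x \<partial>M)"
  using integral_distr[OF measurable_translate[OF assms(1)], of f] assms distr_translate[OF assms(1)] by simp

lemma shift_measurable:
  assumes "g \<in> G" "u \<in> borel_measurable M"
  shows "shift_op g u \<in> borel_measurable M"
  using measurable_compose[OF measurable_translate[OF G_uminus[OF assms(1)]] assms(2)] by (simp add: shift_op_def)

lemma shift_Lp:
  assumes p: "p > 0" and g: "g \<in> G" and u: "u \<in> Lp_set M p"
  shows "shift_op g u \<in> Lp_set M p" "Lp_norm M p (shift_op g u) = Lp_norm M p u"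
proof -
  have *: "shift_op g u \<in> Lp_set M p \<and> Lp_norm M p (shift_op g u) \<le> Lp_norm M p u"
    if g: "g \<in> G" and u: "u \<in> Lp_set M p" for g u
  proof -
    have m: "u \<in> borel_measurable M" using u by (rule Lp_measurable)
    then have "(\<lambda>x. ennreal (cmod (u x) powr p)) \<in> borel_measurable M" by measurable
    from nn_integral_translate[OF G_uminus[OF g] this]
    have "(\<integral>\<^sup>+x. ennreal (cmod (shift_op g u x) powr p) \<partial>M) \<le> ennreal (Lp_norm M p u powr p)"
      using LpD[OF p u] by (simp add: shift_op_def)
    from LpI[OF p shift_measurable[OF g m] Lp_norm_nonneg this] show ?thesis by simp
  qed
  show "shift_op g u \<in> Lp_set M p" using *[OF g u] by simp
  have "shift_op (- g) (shift_op g u) = u" by (simp add: shift_op_def fun_eq_iff)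
  then show "Lp_norm M p (shift_op g u) = Lp_norm M p u"
    using *[OF g u] *[OF G_uminus[OF g], of "shift_op g u"] by simp
qed

text \<open>The graph is sorted by the integer parts of the coordinate distances from
  \<open>x\<close>. Each class is covered by four unit balls, hence its measure is bounded
  uniformly, and on it the weight is at most a product of terms of two summable series.\<close>

lemma weight_integral:
  assumes d: "d > 0"
  shows "\<exists>K>0. \<forall>x. (\<integral>\<^sup>+y. ennreal (weight d (x - y)) \<partial>M) \<le> ennreal K"
proof -
  obtain m0 where m0: "m0 \<ge> 0" "\<And>x. emeasure M (\<Gamma> \<inter> ball x 1) \<le> ennreal m0"
    using emeasure_ball_bounded by blast
  define s where "s i = (1 + real i) powr (- 1 - d / 2)" for i :: nat
  have s0: "s i \<ge> 0" for i by (simp add: s_def)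
  have "summable (\<lambda>i. real i powr (- 1 - d / 2))" using d by (subst summable_real_powr_iff) auto
  then have ss: "summable s" unfolding s_def by (subst (asm) summable_Suc_iff[symmetric]) (simp add: add.commute)
  have sume: "(\<Sum>i. ennreal (s i)) = ennreal (suminf s)" using s0 ss by (intro suminf_ennreal2) auto
  have le_suminf: "f k \<le> (\<Sum>i. f i)" for f :: "nat \<Rightarrow> ennreal" and k
    using sum_le_suminf[of f "{k}"] by simp
  have "(\<integral>\<^sup>+y. ennreal (weight d (x - y)) \<partial>M) \<le> ennreal (suminf s * (suminf s * (4 * m0)))" for x
  proof -
    define C where "C i j = {y \<in> \<Gamma>. nat \<lfloor>\<bar>(x - y) $ 1\<bar>\<rfloor> = i \<and> nat \<lfloor>\<bar>(x - y) $ 2\<bar>\<rfloor> = j}" for i j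
    have Cm: "C i j \<in> sets M" for i j
    proof -
      have [measurable]: "(\<lambda>y. (x - y) $ k) \<in> borel_measurable borel" for k
        by (intro borel_measurable_continuous_onI continuous_intros)
      have "{y \<in> space borel. nat \<lfloor>\<bar>(x - y) $ 1\<bar>\<rfloor> = i \<and> nat \<lfloor>\<bar>(x - y) $ 2\<bar>\<rfloor> = j} \<in> sets borel" by measurable
      then have "\<Gamma> \<inter> {y. nat \<lfloor>\<bar>(x - y) $ 1\<bar>\<rfloor> = i \<and> nat \<lfloor>\<bar>(x - y) $ 2\<bar>\<rfloor> = j} \<in> sets borel"
        using \<Gamma>_borel by auto
      moreover have "\<Gamma> \<inter> {y. nat \<lfloor>\<bar>(x - y) $ 1\<bar>\<rfloor> = i \<and> nat \<lfloor>\<bar>(x - y) $ 2\<bar>\<rfloor> = j} = C i j"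
        by (auto simp: C_def)
      ultimately show ?thesis by (auto simp: sets_M_iff)
    qed
    have C4: "emeasure M (C i j) \<le> ennreal (4 * m0)" for i j
    proof -
      \<comment> \<open>The centres of the four unit squares, one for each choice of signs, that
        contain the points of \<open>C i j\<close>. Half of their diagonal is less than
        \<open>1\<close>.\<close>
      define c :: "real \<Rightarrow> real \<Rightarrow> plane" where
        "c a b = vector [x $ 1 + a * (real i + 1/2), x $ 2 + b * (real j + 1/2)]" for a b
      have sub: "C i j \<subseteq> (\<Gamma> \<inter> ball (c 1 1) 1) \<union> (\<Gamma> \<inter> ball (c 1 (-1)) 1) \<union>
          ((\<Gamma> \<inter> ball (c (-1) 1) 1) \<union> (\<Gamma> \<inter> ball (c (-1) (-1)) 1))"
      proof
        fix y assume y: "y \<in> C i j"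
        have *: "\<exists>a\<in>{1,-1}. \<bar>x $ k + a * (real n + 1/2) - y $ k\<bar> \<le> 1/2"
          if "nat \<lfloor>\<bar>(x - y) $ k\<bar>\<rfloor> = n" for k n
        proof -
          have "real n \<le> \<bar>x $ k - y $ k\<bar>" "\<bar>x $ k - y $ k\<bar> < real n + 1"
            using that by (auto simp: le_nat_floor)
          then show ?thesis by (cases "x $ k \<le> y $ k") (auto simp: abs_if split: if_splits)
        qed
        obtain a b where ab: "a \<in> {1,-1}" "b \<in> {1,-1}" "\<bar>x $ 1 + a * (real i + 1/2) - y $ 1\<bar> \<le> 1/2"
          "\<bar>x $ 2 + b * (real j + 1/2) - y $ 2\<bar> \<le> 1/2"
          using *[of 1 i] *[of 2 j] y unfolding C_def by blast
        have "(x $ 1 + a * (real i + 1/2) - y $ 1)\<^sup>2 \<le> (1/2)\<^sup>2" "(x $ 2 + b * (real j + 1/2) - y $ 2)\<^sup>2 \<le> (1/2)\<^sup>2"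
          using ab(3,4) by (metis abs_le_square_iff abs_of_pos half_gt_zero_iff zero_less_one)+
        then have "(x $ 1 + a * (real i + 1/2) - y $ 1)\<^sup>2 + (x $ 2 + b * (real j + 1/2) - y $ 2)\<^sup>2 < 1"
          by (simp add: power2_eq_square)
        then have "norm (c a b - y) < 1" unfolding norm_plane c_def by (simp add: real_sqrt_lt_1_iff)
        then show "y \<in> (\<Gamma> \<inter> ball (c 1 1) 1) \<union> (\<Gamma> \<inter> ball (c 1 (-1)) 1) \<union>
          ((\<Gamma> \<inter> ball (c (-1) 1) 1) \<union> (\<Gamma> \<inter> ball (c (-1) (-1)) 1))"
          using ab(1,2) y by (auto simp: C_def dist_norm)
      qed
      have S: "\<Gamma> \<inter> ball z r \<in> sets M" for z r using \<Gamma>_borel by (auto simp: sets_M_iff)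
      have un: "emeasure M (A \<union> B) \<le> e + f" if "A \<in> sets M" "B \<in> sets M" "emeasure M A \<le> e" "emeasure M B \<le> f" for A B e f
        using emeasure_subadditive[OF that(1,2)] add_mono[OF that(3,4)] by (rule order.trans)
      have "emeasure M (C i j) \<le> (ennreal m0 + ennreal m0) + (ennreal m0 + ennreal m0)"
        by (rule order.trans[OF emeasure_mono[OF sub]]) (intro un S m0 sets.Un)+
      also have "\<dots> = ennreal (4 * m0)" using m0(1) by (simp add: ennreal_plus[symmetric] del: ennreal_plus)
      finally show ?thesis .
    qed
    have "(\<integral>\<^sup>+y. ennreal (weight d (x - y)) \<partial>M)
      \<le> (\<integral>\<^sup>+y. (\<Sum>i. \<Sum>j. ennreal (s i * s j) * indicator (C i j) y) \<partial>M)"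
    proof (rule nn_integral_mono)
      fix y assume "y \<in> space M"
      define i j where "i = nat \<lfloor>\<bar>(x - y) $ 1\<bar>\<rfloor>" and "j = nat \<lfloor>\<bar>(x - y) $ 2\<bar>\<rfloor>"
      have y: "y \<in> C i j" using \<open>y \<in> space M\<close> by (simp add: C_def i_def j_def)
      have "weight d (x - y) \<le> s i * s j"
        unfolding s_def using d by (intro weight_le_product) (auto simp: i_def j_def)
      then have "ennreal (weight d (x - y)) \<le> ennreal (s i * s j) * indicator (C i j) y"
        using y by (simp add: ennreal_leI)
      also have "\<dots> \<le> (\<Sum>j. ennreal (s i * s j) * indicator (C i j) y)"
        by (rule le_suminf)
      also have "\<dots> \<le> (\<Sum>i. \<Sum>j. ennreal (s i * s j) * indicator (C i j) y)"
        by (rule le_suminf)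
      finally show "ennreal (weight d (x - y)) \<le> (\<Sum>i. \<Sum>j. ennreal (s i * s j) * indicator (C i j) y)" .
    qed
    also have "\<dots> = (\<Sum>i. \<Sum>j. ennreal (s i * s j) * emeasure M (C i j))"
      using Cm by (simp add: nn_integral_suminf nn_integral_cmult_indicator)
    also have "\<dots> \<le> (\<Sum>i. \<Sum>j. ennreal (s i) * (ennreal (s j) * ennreal (4 * m0)))"
      using s0 C4 by (intro suminf_le summableI)
        (auto simp: ennreal_mult mult.assoc intro!: suminf_le mult_left_mono)
    also have "\<dots> = ennreal (suminf s) * (ennreal (suminf s) * ennreal (4 * m0))"
      by (simp add: sume)
    also have "\<dots> = ennreal (suminf s * (suminf s * (4 * m0)))"
      using m0(1) suminf_nonneg[OF ss s0] by (simp add: ennreal_mult)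
    finally show ?thesis .
  qed
  then have "(\<integral>\<^sup>+y. ennreal (weight d (x - y)) \<partial>M) \<le> ennreal (\<bar>suminf s * (suminf s * (4 * m0))\<bar> + 1)" for x
    by (rule order.trans) (intro ennreal_leI, linarith)
  then show ?thesis by (intro exI[of _ "\<bar>suminf s * (suminf s * (4 * m0))\<bar> + 1"]) auto
qed

subsection \<open>Slowly oscillating functions\<close>

lemma domain_cover: assumes "x \<in> \<Gamma>" obtains y g where "y \<in> D" "g \<in> G" "x = y + g"
proof -
  have "\<forall>x\<in>\<Gamma>. \<exists>!y. y \<in> D \<and> y \<in> orbit_of G x" using domain by (simp add: fundamental_domain_def)
  then obtain y where y: "y \<in> D" "y \<in> orbit_of G x" using assms by blast
  then obtain g where g: "g \<in> G" "y = x + g" by (auto simp: orbit_of_def)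
  have "x = y + (- g)" using g by simp
  then show thesis by (rule that[OF y(1) G_uminus[OF g(1)]])
qed

lemma domain_bounded: "\<exists>d>0. \<forall>y\<in>D. norm y \<le> d"
  using domain unfolding fundamental_domain_def bounded_pos by blast

lemma domain_subset: "D \<subseteq> \<Gamma>" using domain by (simp add: fundamental_domain_def)

text \<open>Only finitely many \<open>\<beta>\<close> in the group have norm at most
  \<open>R\<close>, so the limits for the single \<open>\<beta>\<close> can be taken jointly. A
  point far out is a point of the bounded set \<open>D\<close> plus a group element that is far out
  as well.\<close>

lemma SO_uniform:
  assumes f: "f \<in> SO G E D" and \<eta>: "\<eta> > 0"
  shows "\<exists>R'. \<forall>x\<in>\<Gamma>. norm x \<ge> R' \<longrightarrow> (\<forall>\<beta>\<in>G. norm \<beta> \<le> R \<longrightarrow> cmod (f (x + \<beta>) - f x) \<le> \<eta>)"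
proof -
  obtain d where d: "d > 0" "\<And>y. y \<in> D \<Longrightarrow> norm y \<le> d" using domain_bounded by blast
  let ?B = "{\<beta> \<in> G. norm (0 - \<beta>) \<le> R}"
  have "\<exists>r. \<forall>\<alpha>\<in>G. norm \<alpha> \<ge> r \<longrightarrow> (\<forall>y\<in>D. cmod (f (y + \<beta> + \<alpha>) - f (y + \<alpha>)) \<le> \<eta>)" if "\<beta> \<in> G" for \<beta>
  proof -
    have "((\<lambda>\<alpha>. SUP y\<in>D. ennreal (cmod (f (y + \<beta> + \<alpha>) - f (y + \<alpha>)))) \<longlongrightarrow> 0) (inf at_infinity (principal G))"
      using f that by (simp add: SO_def)
    then have "eventually (\<lambda>\<alpha>. (SUP y\<in>D. ennreal (cmod (f (y + \<beta> + \<alpha>) - f (y + \<alpha>)))) < ennreal \<eta>) (inf at_infinity (principal G))"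
      by (rule order_tendstoD(2)) (use \<eta> in simp)
    then obtain r where r: "\<And>\<alpha>. r \<le> norm \<alpha> \<Longrightarrow> \<alpha> \<in> G \<Longrightarrow> (SUP y\<in>D. ennreal (cmod (f (y + \<beta> + \<alpha>) - f (y + \<alpha>)))) < ennreal \<eta>"
      unfolding eventually_inf_principal eventually_at_infinity by blast
    have "cmod (f (y + \<beta> + \<alpha>) - f (y + \<alpha>)) \<le> \<eta>" if "\<alpha> \<in> G" "norm \<alpha> \<ge> r" "y \<in> D" for \<alpha> y
    proof -
      have "ennreal (cmod (f (y + \<beta> + \<alpha>) - f (y + \<alpha>))) \<le> (SUP y\<in>D. ennreal (cmod (f (y + \<beta> + \<alpha>) - f (y + \<alpha>))))"
        by (rule SUP_upper[OF that(3)])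
      also have "\<dots> < ennreal \<eta>" using r that by simp
      finally show ?thesis by (simp add: ennreal_less_iff)
    qed
    then show ?thesis by blast
  qed
  then have "\<forall>\<beta>\<in>?B. \<exists>r. \<forall>\<alpha>\<in>G. norm \<alpha> \<ge> r \<longrightarrow> (\<forall>y\<in>D. cmod (f (y + \<beta> + \<alpha>) - f (y + \<alpha>)) \<le> \<eta>)" by simp
  then obtain r where r: "\<forall>\<beta>\<in>?B. \<forall>\<alpha>\<in>G. norm \<alpha> \<ge> r \<beta> \<longrightarrow> (\<forall>y\<in>D. cmod (f (y + \<beta> + \<alpha>) - f (y + \<alpha>)) \<le> \<eta>)"
    by (rule bchoice[THEN exE])
  have finB: "finite ?B" by (rule G_finite)
  define R' where "R' = Max (insert 0 (r ` ?B)) + d"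
  have rR: "r \<beta> + d \<le> R'" if "\<beta> \<in> ?B" for \<beta> unfolding R'_def using finB that by simp
  have "cmod (f (x + \<beta>) - f x) \<le> \<eta>" if x: "x \<in> \<Gamma>" "norm x \<ge> R'" and b: "\<beta> \<in> G" "norm \<beta> \<le> R" for x \<beta>
  proof -
    obtain y \<alpha> where y: "y \<in> D" "\<alpha> \<in> G" "x = y + \<alpha>" using domain_cover[OF x(1)] by blast
    have B: "\<beta> \<in> ?B" using b by simp
    have "norm \<alpha> \<ge> r \<beta>" using d(2)[OF y(1)] x(2) rR[OF B] norm_triangle_ineq[of y \<alpha>, folded y(3)] by linarith
    then have "cmod (f (y + \<beta> + \<alpha>) - f (y + \<alpha>)) \<le> \<eta>" using r B y by blast
    then show ?thesis using y(3) by (simp add: algebra_simps)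
  qed
  then show ?thesis by blast
qed

lemma SO_measurable: "f \<in> SO G E D \<Longrightarrow> f \<in> borel_measurable M"
  by (simp add: SO_def Linf_set_def)

lemma BUC_bounded: assumes "f \<in> BUC E" shows "\<exists>c\<ge>0. \<forall>x\<in>\<Gamma>. cmod (f x) \<le> c"
proof -
  have "bounded (f ` \<Gamma>)" using assms by (simp add: BUC_def)
  then obtain c where "\<forall>y\<in>f ` \<Gamma>. norm y \<le> c" unfolding bounded_iff by blast
  then have "\<forall>x\<in>\<Gamma>. cmod (f x) \<le> \<bar>c\<bar>" by fastforce
  then show ?thesis by (intro exI[of _ "\<bar>c\<bar>"]) simp
qed

lemma BUC_uniform:
  assumes f: "f \<in> BUC E" and \<eta>: "\<eta> > 0"
  shows "\<exists>\<delta>>0. \<forall>x\<in>\<Gamma>. \<forall>y\<in>\<Gamma>. path_dist E x y < \<delta> \<longrightarrow> cmod (f x - f y) < \<eta>"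
proof -
  have "uniformly_continuous_map (path_metric E) euclidean_metric f" using f by (simp add: BUC_def)
  then obtain \<delta> where "\<delta> > 0" "\<And>x y. x \<in> \<Gamma> \<Longrightarrow> y \<in> \<Gamma> \<Longrightarrow> path_dist E y x < \<delta> \<Longrightarrow> dist (f y) (f x) < \<eta>"
    using \<eta> unfolding uniformly_continuous_map_def mspace_path_metric[OF planar] mdist_path_metric[OF planar]
    by (auto simp: mdist_euclidean_metric)
  then show ?thesis by (intro exI[of _ \<delta>]) (auto simp: dist_norm)
qed

end

section \<open>Convolution type operators\<close>

context Lp_space
begin

lemma op_normD:
  assumes R: "blin R" and le: "op_norm M p R \<le> ennreal e" "e \<ge> 0" and u: "u \<in> LP"
  shows "NP (R u) \<le> e * NP u"
proof (cases "NP u = 0")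
  case True
  then show ?thesis using blin_null[OF R u] by simp
next
  case False
  then have n: "NP u > 0" using N_nonneg[OF u] by linarith
  let ?c = "complex_of_real (1 / NP u)"
  have cc: "cmod ?c = 1 / NP u" using n by (simp add: norm_divide)
  have cu: "scl ?c u \<in> LP" "NP (scl ?c u) = 1" using u n by (simp_all add: cc norm_divide)
  have "ennreal (NP (R (scl ?c u))) \<le> op_norm M p R"
    unfolding op_norm_def using cu by (intro SUP_upper) auto
  also have "\<dots> \<le> ennreal e" by (rule le)
  finally have "NP (R (scl ?c u)) \<le> e" using le(2) by (simp add: ennreal_le_iff)
  moreover have "NP (R (scl ?c u)) = NP (scl ?c (R u))"
    using blin_scl[OF R u] blin_mem[OF R] u by (intro N_eq) auto
  ultimately have "1 / NP u * NP (R u) \<le> e" using N_scl[OF blin_mem[OF R u], of ?c] unfolding cc by simp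
  then show ?thesis using n by (simp add: field_simps)
qed

lemma op_normI:
  assumes "\<And>u. u \<in> LP \<Longrightarrow> NP (R u) \<le> e * NP u" "e \<ge> 0"
  shows "op_norm M p R \<le> ennreal e"
  unfolding op_norm_def
proof (rule SUP_least)
  fix u assume "u \<in> {u \<in> LP. NP u \<le> 1}"
  then have "NP (R u) \<le> e * NP u" "e * NP u \<le> e * 1" using assms by (auto intro!: mult_left_mono simp: mult_left_le)
  then show "ennreal (NP (R u)) \<le> ennreal e" by (intro ennreal_leI) linarith
qed

end

section \<open>Compact subsets of the graph\<close>

context periodic_planar_graph
begin

interpretation PM: Metric_space \<Gamma> "path_dist E"
  by (rule Metric_space_path_dist[OF planar])

lemma dist_le_path_dist: "x \<in> \<Gamma> \<Longrightarrow> y \<in> \<Gamma> \<Longrightarrow> dist x y \<le> path_dist E x y"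
  by (rule path_dist_greatest[OF planar]) (auto intro: walk_dist_le)

lemma path_dist_edge_le: "e \<in> E \<Longrightarrow> x \<in> convex hull e \<Longrightarrow> y \<in> convex hull e \<Longrightarrow> path_dist E x y \<le> dist x y"
  by (rule path_dist_le[OF walk_edge])

lemma edge_subset: "e \<in> E \<Longrightarrow> convex hull e \<subseteq> \<Gamma>" by (auto simp: graph_points_def)

text \<open>Path distance dominates Euclidean distance, so the inclusion of the graph into the plane
  is continuous.\<close>

lemma compactin_imp_compact:
  assumes "compactin (mtopology_of (path_metric E)) S"
  shows "compact S" "S \<subseteq> \<Gamma>"
proof -
  have S: "compactin PM.mtopology S" using assms unfolding mtopology_path_metric .
  show "S \<subseteq> \<Gamma>" using compactin_subset_topspace[OF S] by simp
  have "continuous_map PM.mtopology Met_TC.mtopology (\<lambda>x. x)"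
    unfolding PM.metric_continuous_map[OF Met_TC.Metric_space_axioms]
  proof (intro conjI ballI allI impI)
    fix x and e :: real assume "x \<in> \<Gamma>" "e > 0"
    then show "\<exists>d>0. \<forall>y. y \<in> \<Gamma> \<and> path_dist E x y < d \<longrightarrow> dist x y < e"
      using dist_le_path_dist by (intro exI[of _ e]) fastforce
  qed auto
  then have "compactin euclidean ((\<lambda>x. x) ` S)" using image_compactin[OF S] by (simp only: mtopology_is_euclidean)
  then show "compact S" by simp
qed

text \<open>Within one edge the path distance is at most the Euclidean distance, so the inclusion of
  the edge into the metric graph is continuous.\<close>

lemma compactin_edge:
  assumes e: "e \<in> E"
  shows "compactin PM.mtopology (convex hull e)"
proof -
  obtain u v where "e = {u, v}" using e by (rule edge_cases)
  then have c: "compact (convex hull e)" by (simp add: finite_imp_compact_convex_hull)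
  have "continuous_map (top_of_set (convex hull e)) PM.mtopology (\<lambda>x. x)"
    unfolding PM.continuous_map_to_metric
  proof (intro ballI allI impI)
    fix x and r :: real assume x: "x \<in> topspace (top_of_set (convex hull e))" and r: "r > 0"
    show "\<exists>U. openin (top_of_set (convex hull e)) U \<and> x \<in> U \<and> (\<forall>y\<in>U. y \<in> PM.mball x r)"
    proof (intro exI[of _ "convex hull e \<inter> ball x r"] conjI ballI)
      fix y assume y: "y \<in> convex hull e \<inter> ball x r"
      then have "path_dist E x y < r" using path_dist_edge_le[OF e, of x y] x by auto
      then show "y \<in> PM.mball x r" using x y edge_subset[OF e] by auto
    qed (use x r in auto)
  qed
  moreover have "compactin (top_of_set (convex hull e)) (convex hull e)" using c by (simp add: compactin_subtopology)
  ultimately have "compactin PM.mtopology ((\<lambda>x. x) ` (convex hull e))" by (rule image_compactin[rotated])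
  then show ?thesis by simp
qed

lemma finite_edges_meeting: "finite {e \<in> E. convex hull e \<inter> cball 0 R \<noteq> {}}"
proof -
  from finite_edge_orbits
  obtain E0 where "finite E0 \<and> E0 \<subseteq> E \<and> (\<forall>e\<in>E. \<exists>f\<in>E0. \<exists>g\<in>G. e = (\<lambda>x. x + g) ` f)" ..
  then have E0: "finite E0" "E0 \<subseteq> E" "\<And>e. e \<in> E \<Longrightarrow> \<exists>f\<in>E0. \<exists>g\<in>G. e = (\<lambda>x. x + g) ` f"
    by simp_all
  have "bounded (\<Union>f\<in>E0. convex hull f)"
  proof (rule bounded_UN[OF E0(1)], rule ballI)
    fix f assume "f \<in> E0"
    then have "f \<in> E" using E0(2) by blast
    then obtain u v where "f = {u, v}" by (rule edge_cases)
    then show "bounded (convex hull f)" by (simp add: bounded_convex_hull)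
  qed
  then obtain r0 where r0: "\<And>f y. f \<in> E0 \<Longrightarrow> y \<in> convex hull f \<Longrightarrow> norm y \<le> r0"
    unfolding bounded_iff by blast
  let ?H = "{g \<in> G. norm (0 - g) \<le> r0 + R}"
  have "{e \<in> E. convex hull e \<inter> cball 0 R \<noteq> {}} \<subseteq> (\<lambda>(f, g). (\<lambda>x. x + g) ` f) ` (E0 \<times> ?H)"
  proof
    fix e assume "e \<in> {e \<in> E. convex hull e \<inter> cball 0 R \<noteq> {}}"
    then obtain y where y: "e \<in> E" "y \<in> convex hull e" "norm y \<le> R" by auto
    obtain f g where f: "f \<in> E0" "g \<in> G" "e = (\<lambda>x. x + g) ` f" using E0(3)[OF y(1)] by blast
    have "y - g \<in> convex hull f" using y(2) hull_translate_iff[of "y - g" g f] f by simp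
    then have "norm (y - g) \<le> r0" using r0 f by blast
    then have "norm (0 - g) \<le> r0 + R"
      using y(3) norm_triangle_ineq4[of "y - g" y] by simp
    then show "e \<in> (\<lambda>(f, g). (\<lambda>x. x + g) ` f) ` (E0 \<times> ?H)" using f by force
  qed
  moreover have "finite (E0 \<times> ?H)" using E0(1) G_finite by blast
  ultimately show ?thesis by (meson finite_imageI finite_subset)
qed

text \<open>Limit operators are tested on compact sets of the path metric, whereas the estimates use
  Euclidean balls. A ball meets finitely many edges, and their union mediates between the
  two.\<close>

lemma compact_exhaustion:
  "\<exists>S. compactin (mtopology_of (path_metric E)) S \<and> S \<in> sets M \<and> \<Gamma> \<inter> cball 0 R \<subseteq> S"
proof -
  let ?F = "{e \<in> E. convex hull e \<inter> cball 0 R \<noteq> {}}"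
  let ?S = "\<Union>e\<in>?F. convex hull e"
  have "compactin PM.mtopology ?S"
    using finite_edges_meeting compactin_edge by (intro compactin_Union) auto
  then have c: "compactin (mtopology_of (path_metric E)) ?S" unfolding mtopology_path_metric .
  have "?S \<in> sets M" using compactin_imp_compact[OF c] by (auto simp: sets_M_iff borel_compact)
  moreover have "\<Gamma> \<inter> cball 0 R \<subseteq> ?S" unfolding graph_points_def by blast
  ultimately show ?thesis using c by blast
qed

end

locale convolution_operator = periodic_planar_graph +
  fixes a b k :: "plane \<Rightarrow> complex" and p C0 \<epsilon> :: real
  assumes p_gt: "1 < p"
    and a_BUC: "a \<in> BUC E" and a_SO: "a \<in> SO G E D" and b_BUC: "b \<in> BUC E" and b_SO: "b \<in> SO G E D"
    and k_cont: "continuous_on UNIV k"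
    and C0: "C0 > 0" and \<epsilon>: "\<epsilon> > 0" and k_le: "cmod (k z) \<le> C0 * (1 + norm z) powr (- 2 - \<epsilon>)"
begin

sublocale Lp_space "graph_measure E" p by unfold_locales (rule p_gt)

abbreviation w where "w \<equiv> weight (\<epsilon> / 2)"

definition K :: real where
  "K = (SOME K. K > 0 \<and> (\<forall>x. (\<integral>\<^sup>+y. ennreal (w (x - y)) \<partial>M) \<le> ennreal K))"

lemma K: "K > 0" "(\<integral>\<^sup>+y. ennreal (w (x - y)) \<partial>M) \<le> ennreal K"
  using someI_ex[OF weight_integral[of "\<epsilon> / 2"]] \<epsilon> unfolding K_def by auto

lemma w_minus_commute: "w (x - y) = w (y - x)" by (simp add: weight_def norm_minus_commute)

lemma K': "(\<integral>\<^sup>+x. ennreal (w (x - y)) \<partial>M) \<le> ennreal K"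
  using K(2)[of y] by (subst w_minus_commute)

definition coef :: real where
  "coef = (SOME c. c > 0 \<and> (\<forall>x\<in>\<Gamma>. cmod (a x) \<le> c \<and> cmod (b x) \<le> c))"

lemma coef: "coef > 0" "x \<in> \<Gamma> \<Longrightarrow> cmod (a x) \<le> coef" "x \<in> \<Gamma> \<Longrightarrow> cmod (b x) \<le> coef"
proof -
  obtain c d where "c \<ge> 0" "\<forall>x\<in>\<Gamma>. cmod (a x) \<le> c" "d \<ge> 0" "\<forall>x\<in>\<Gamma>. cmod (b x) \<le> d"
    using BUC_bounded[OF a_BUC] BUC_bounded[OF b_BUC] by blast
  then have "\<exists>c. c > 0 \<and> (\<forall>x\<in>\<Gamma>. cmod (a x) \<le> c \<and> cmod (b x) \<le> c)"
    by (intro exI[of _ "c + d + 1"]) fastforce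
  from someI_ex[OF this] show "coef > 0" "x \<in> \<Gamma> \<Longrightarrow> cmod (a x) \<le> coef" "x \<in> \<Gamma> \<Longrightarrow> cmod (b x) \<le> coef"
    unfolding coef_def by auto
qed

lemma a_meas [measurable]: "a \<in> borel_measurable M" and b_meas [measurable]: "b \<in> borel_measurable M"
  using SO_measurable a_SO b_SO by auto

subsection \<open>Integral operators with decaying kernels\<close>

text \<open>The constant \<open>d\<close> gauges the operator: by Schur's test its norm is at most
  \<open>d * K\<close>. Commutators, tails and finite rank errors are all shown to be small by
  exhibiting a kernel with small \<open>d\<close>.\<close>

definition kernel :: "real \<Rightarrow> (plane \<Rightarrow> plane \<Rightarrow> complex) \<Rightarrow> bool" where
  "kernel d \<kappa> \<longleftrightarrow> (\<lambda>(x, y). \<kappa> x y) \<in> borel_measurable (borel \<Otimes>\<^sub>M borel) \<and> (\<forall>x y. cmod (\<kappa> x y) \<le> d * w (x - y))"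

definition Kop :: "(plane \<Rightarrow> plane \<Rightarrow> complex) \<Rightarrow> plane oper" where
  "Kop \<kappa> u = (\<lambda>x. \<integral>y. \<kappa> x y * u y \<partial>M)"

lemma kernel_measurable:
  assumes "kernel d \<kappa>"
  shows "(\<lambda>(x, y). \<kappa> x y) \<in> borel_measurable (M \<Otimes>\<^sub>M M)" "(\<lambda>y. \<kappa> x y) \<in> borel_measurable M"
proof -
  have m: "(\<lambda>(x, y). \<kappa> x y) \<in> borel_measurable (borel \<Otimes>\<^sub>M borel)" using assms by (simp add: kernel_def)
  have [measurable]: "(\<lambda>x. x) \<in> borel_measurable M" by (rule borel_measurable_M) simp
  have "(\<lambda>z. (fst z, snd z)) \<in> measurable (M \<Otimes>\<^sub>M M) (borel \<Otimes>\<^sub>M borel)" by measurable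
  from measurable_compose[OF this m] show "(\<lambda>(x, y). \<kappa> x y) \<in> borel_measurable (M \<Otimes>\<^sub>M M)"
    by (simp add: case_prod_beta)
  have "(\<lambda>y. (x, y)) \<in> measurable M (borel \<Otimes>\<^sub>M borel)" by measurable
  from measurable_compose[OF this m] show "(\<lambda>y. \<kappa> x y) \<in> borel_measurable M" by simp
qed

lemma w_measurable [measurable]: "(\<lambda>y. w (x - y)) \<in> borel_measurable M" "(\<lambda>x. w (x - y)) \<in> borel_measurable M"
proof -
  have "continuous_on UNIV (\<lambda>z. w z)" unfolding weight_def
    by (intro continuous_intros) (smt (verit) norm_ge_zero)
  then have "(\<lambda>z. w z) \<in> borel_measurable borel" by (rule borel_measurable_continuous_onI)
  note [measurable] = this
  show "(\<lambda>y. w (x - y)) \<in> borel_measurable M" "(\<lambda>x. w (x - y)) \<in> borel_measurable M"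
    by (rule borel_measurable_M; measurable)+
qed

lemma Kop_mem:
  assumes \<kappa>: "kernel d \<kappa>" and d: "d > 0" and u: "u \<in> LP"
  shows "Kop \<kappa> u \<in> LP" "NP (Kop \<kappa> u) \<le> d * K * NP u"
proof -
  have le: "cmod (\<kappa> x y) \<le> d * w (x - y)" for x y using \<kappa> by (simp add: kernel_def)
  have 1: "(\<integral>\<^sup>+y. ennreal (cmod (\<kappa> x y)) \<partial>M) \<le> ennreal (d * K)" for x
  proof -
    have "(\<integral>\<^sup>+y. ennreal (cmod (\<kappa> x y)) \<partial>M) \<le> (\<integral>\<^sup>+y. ennreal d * ennreal (w (x - y)) \<partial>M)"
      using le d less_imp_le[OF weight_pos] by (intro nn_integral_mono) (simp add: ennreal_mult[symmetric] ennreal_leI)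
    also have "\<dots> = ennreal d * (\<integral>\<^sup>+y. ennreal (w (x - y)) \<partial>M)" by (rule nn_integral_cmult) measurable
    also have "\<dots> \<le> ennreal d * ennreal K" by (intro mult_left_mono K) auto
    finally show ?thesis using d K by (simp add: ennreal_mult)
  qed
  have 2: "(\<integral>\<^sup>+x. ennreal (cmod (\<kappa> x y)) \<partial>M) \<le> ennreal (d * K)" for y
  proof -
    have "(\<integral>\<^sup>+x. ennreal (cmod (\<kappa> x y)) \<partial>M) \<le> (\<integral>\<^sup>+x. ennreal d * ennreal (w (x - y)) \<partial>M)"
      using le d less_imp_le[OF weight_pos] by (intro nn_integral_mono) (simp add: ennreal_mult[symmetric] ennreal_leI)
    also have "\<dots> = ennreal d * (\<integral>\<^sup>+x. ennreal (w (x - y)) \<partial>M)" by (rule nn_integral_cmult) measurable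
    also have "\<dots> \<le> ennreal d * ennreal K" by (intro mult_left_mono K') auto
    finally show ?thesis using d K by (simp add: ennreal_mult)
  qed
  have "d * K > 0" using d K by simp
  note S = schur_test[OF sigma_finite_M kernel_measurable(1)[OF \<kappa>] this 1 this 2 u]
  show "Kop \<kappa> u \<in> LP" unfolding Kop_def by (rule S(1))
  have "((d * K) powr (p - 1) * (d * K)) powr (1 / p) = d * K"
    using \<open>d * K > 0\<close> powr_mult_base[of "d * K" "p - 1"] p_gt by (simp add: mult.commute powr_powr)
  then show "NP (Kop \<kappa> u) \<le> d * K * NP u" using S(2) unfolding Kop_def by simp
qed

text \<open>The weight is bounded by \<open>1\<close> and integrable, and
  \<open>t \<le> 1 + t powr p\<close>. As integrability holds at every \<open>x\<close>, sums and
  differences of integral operators are identities of functions; this is the source of the exact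
  linearity that \<open>fred_kernel\<close> demands.\<close>

lemma Kop_integrable:
  assumes \<kappa>: "kernel d \<kappa>" and d: "d > 0" and u: "u \<in> LP"
  shows "integrable M (\<lambda>y. \<kappa> x y * u y)"
proof -
  have le: "cmod (\<kappa> x y) \<le> d * w (x - y)" for y using \<kappa> by (simp add: kernel_def)
  note [measurable] = kernel_measurable(2)[OF \<kappa>] Lp_measurable[OF u]
  have iw: "integrable M (\<lambda>y. w (x - y))"
    using K(2)[of x] less_imp_le[OF weight_pos]
    by (intro integrableI_bounded) (auto simp: less_top[symmetric] top_unique)
  have iu: "integrable M (\<lambda>y. cmod (u y) powr p)" using u by (simp add: Lp_set_def)
  have w1: "w z \<le> 1" for z
    unfolding weight_def using \<epsilon> powr_mono2'[of "- 2 - \<epsilon> / 2" 1 "1 + norm z"] by simp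
  have le1: "t \<le> 1 + t powr p" if "t \<ge> 0" for t :: real
  proof (cases "t \<le> 1")
    case False
    then show ?thesis using powr_mono[of 1 p t] p_gt that by simp
  qed (auto intro: add_increasing2)
  show ?thesis
  proof (rule Bochner_Integration.integrable_bound)
    show "integrable M (\<lambda>y. d * w (x - y) + d * cmod (u y) powr p)"
      using iw iu by (intro Bochner_Integration.integrable_add integrable_mult_right)
    have "norm (\<kappa> x y * u y) \<le> norm (d * w (x - y) + d * cmod (u y) powr p)" for y
    proof -
      have "norm (\<kappa> x y * u y) \<le> (d * w (x - y)) * (1 + cmod (u y) powr p)"
        unfolding norm_mult using d less_imp_le[OF weight_pos] by (intro mult_mono le le1) auto
      also have "\<dots> = d * w (x - y) + d * (w (x - y) * cmod (u y) powr p)" by (simp add: algebra_simps)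
      also have "\<dots> \<le> d * w (x - y) + d * (1 * cmod (u y) powr p)"
        using d w1 by (intro add_left_mono mult_left_mono mult_right_mono) auto
      finally show ?thesis by simp
    qed
    then show "AE y in M. norm (\<kappa> x y * u y) \<le> norm (d * w (x - y) + d * cmod (u y) powr p)" by simp
  qed measurable
qed

lemma Kop_add:
  assumes "kernel d \<kappa>" "d > 0" "u \<in> LP" "v \<in> LP"
  shows "Kop \<kappa> (u + v) = Kop \<kappa> u + Kop \<kappa> v"
  using Kop_integrable[OF assms(1,2,3)] Kop_integrable[OF assms(1,2,4)]
  by (simp add: Kop_def fun_eq_iff fun_ops distrib_left)

lemma Kop_scl: "Kop \<kappa> (scl c u) = scl c (Kop \<kappa> u)"
  by (simp add: Kop_def fun_eq_iff scl_def mult.left_commute)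

lemma Kop_kernel_diff:
  assumes "kernel d \<kappa>" "d > 0" "kernel d' \<kappa>'" "d' > 0" "u \<in> LP"
  shows "Kop \<kappa> u - Kop \<kappa>' u = Kop (\<lambda>x y. \<kappa> x y - \<kappa>' x y) u"
  using Kop_integrable[OF assms(1,2,5)] Kop_integrable[OF assms(3,4,5)]
  by (simp add: Kop_def fun_eq_iff fun_ops left_diff_distrib)

lemma blin_Kop:
  assumes "kernel d \<kappa>" "d > 0" shows "blin (Kop \<kappa>)"
  by (rule blinI[where C = "d * K"]) (simp_all add: Kop_mem[OF assms] Kop_add[OF assms] Kop_scl)

lemma k_measurable [measurable]: "k \<in> borel_measurable borel"
  using k_cont by (rule borel_measurable_continuous_onI)

text \<open>Half of the excess \<open>\<epsilon>\<close> of the decay is spent on the integrability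
  of the weight, the other half survives as a factor that tends to \<open>0\<close>.\<close>

lemma k_le_weight: "cmod (k z) \<le> C0 * w z * (1 + norm z) powr (- \<epsilon> / 2)"
proof -
  have "- 2 - \<epsilon> = (- 2 - \<epsilon> / 2) + (- \<epsilon> / 2)" by simp
  then have "(1 + norm z) powr (- 2 - \<epsilon>) = w z * (1 + norm z) powr (- \<epsilon> / 2)"
    unfolding weight_def by (simp only: powr_add)
  then show ?thesis using k_le[of z] by (simp add: mult.assoc)
qed

lemma k_kernel: "kernel C0 (\<lambda>x y. k (x - y))"
  unfolding kernel_def
proof (intro conjI allI)
  show "(\<lambda>(x, y). k (x - y)) \<in> borel_measurable (borel \<Otimes>\<^sub>M borel)" by measurable
  fix x y :: plane
  have "(1 + norm (x - y)) powr (- \<epsilon> / 2) \<le> 1 powr (- \<epsilon> / 2)" using \<epsilon> by (intro powr_mono2') auto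
  then have "C0 * w (x - y) * (1 + norm (x - y)) powr (- \<epsilon> / 2) \<le> C0 * w (x - y) * 1"
    using C0 less_imp_le[OF weight_pos] by (intro mult_left_mono) auto
  then show "cmod (k (x - y)) \<le> C0 * w (x - y)" using k_le_weight[of "x - y"] by linarith
qed

lemma k_decay:
  assumes "\<eta> > 0"
  shows "\<exists>R>0. \<forall>z. norm z \<ge> R \<longrightarrow> cmod (k z) \<le> \<eta> * w z"
proof -
  have "((\<lambda>r. (1 + r) powr (- \<epsilon> / 2)) \<longlongrightarrow> 0) at_top"
    using \<epsilon> by (intro tendsto_neg_powr filterlim_tendsto_add_at_top[OF tendsto_const filterlim_ident]) auto
  then have "eventually (\<lambda>r. (1 + r) powr (- \<epsilon> / 2) < \<eta> / C0) at_top"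
    by (rule order_tendstoD(2)) (use assms C0 in simp)
  then obtain R where R: "\<And>r. r \<ge> R \<Longrightarrow> (1 + r) powr (- \<epsilon> / 2) < \<eta> / C0"
    unfolding eventually_at_top_linorder by blast
  have "cmod (k z) \<le> \<eta> * w z" if "norm z \<ge> max R 1" for z
  proof -
    have "C0 * w z * (1 + norm z) powr (- \<epsilon> / 2) \<le> C0 * w z * (\<eta> / C0)"
      using R[of "norm z"] that C0 less_imp_le[OF weight_pos] by (intro mult_left_mono) auto
    then show ?thesis using k_le_weight[of z] C0 by (simp add: mult.commute)
  qed
  then show ?thesis by (intro exI[of _ "max R 1"]) auto
qed

section \<open>The convolution operator and its commutators with slowly varying cutoffs\<close>

definition T :: "plane oper" where "T = conv_op E k"

lemma T_eq: "T u = Kop (\<lambda>x y. k (x - y)) u"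
  by (simp add: T_def conv_op_def Kop_def)

lemma T_mem [simp]: "u \<in> LP \<Longrightarrow> T u \<in> LP"
  and T_le: "u \<in> LP \<Longrightarrow> NP (T u) \<le> C0 * K * NP u"
  unfolding T_eq using Kop_mem[OF k_kernel C0] by auto

lemma T_add: "u \<in> LP \<Longrightarrow> v \<in> LP \<Longrightarrow> T (u + v) = T u + T v"
  unfolding T_eq by (rule Kop_add[OF k_kernel C0])

lemma blin_T: "blin T"
  using blin_Kop[OF k_kernel C0] by (simp add: T_eq[abs_def])

lemma T_shift:
  assumes g: "g \<in> G" and u: "u \<in> LP"
  shows "T (shift_op g u) = shift_op g (T u)"
proof
  fix x
  have "(\<lambda>y. k (x - y) * u (y - g)) \<in> borel_measurable M"
    using shift_measurable[OF g Lp_measurable[OF u]] kernel_measurable(2)[OF k_kernel]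
    unfolding shift_op_def by measurable
  from integral_translate[OF g this]
  show "T (shift_op g u) x = shift_op g (T u) x"
    by (simp add: T_def conv_op_def shift_op_def algebra_simps)
qed

definition cut :: "(plane \<Rightarrow> real) \<Rightarrow> plane \<Rightarrow> complex" where
  "cut f = (\<lambda>x. complex_of_real (f x))"

definition lipcut :: "real \<Rightarrow> (plane \<Rightarrow> real) \<Rightarrow> bool" where
  "lipcut L f \<longleftrightarrow> (\<forall>x. 0 \<le> f x \<and> f x \<le> 1) \<and> (\<forall>x y. \<bar>f x - f y\<bar> \<le> dist x y / L)"

lemma lipcut_measurable: assumes "lipcut L f" "L > 0" shows "f \<in> borel_measurable borel"
proof (rule borel_measurable_continuous_onI)
  have "(1 / L)-lipschitz_on UNIV f"
    using assms by (intro lipschitz_onI) (auto simp: lipcut_def dist_real_def)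
  then show "continuous_on UNIV f" by (rule lipschitz_on_continuous_on)
qed

lemma cut_mem:
  assumes "lipcut L f" "L > 0" "u \<in> LP"
  shows "cut f * u \<in> LP" "NP (cut f * u) \<le> NP u"
proof -
  have [measurable]: "f \<in> borel_measurable M" by (rule borel_measurable_M[OF lipcut_measurable[OF assms(1,2)]])
  have m: "cut f \<in> borel_measurable M" unfolding cut_def by measurable
  have le: "cmod (cut f x) \<le> 1" for x using assms(1) by (simp add: cut_def lipcut_def)
  show "cut f * u \<in> LP" "NP (cut f * u) \<le> NP u"
    using mult_mem[OF m le _ assms(3)] by auto
qed

text \<open>The commutator has the kernel \<open>(f x - f y) * k (x - y)\<close>. For distant points
  it is small because \<open>k\<close> decays, for close points because a cutoff with Lipschitz
  constant \<open>1 / L\<close> hardly changes between them.\<close>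

lemma commutator:
  assumes "\<eta> > 0"
  shows "\<exists>L0>0. \<forall>L\<ge>L0. \<forall>f. lipcut L f \<longrightarrow> (\<forall>u\<in>LP. NP (cut f * T u - T (cut f * u)) \<le> \<eta> * NP u)"
proof -
  define d where "d = \<eta> / K"
  have d: "d > 0" using assms K by (simp add: d_def)
  obtain R where R: "R > 0" "\<And>z. norm z \<ge> R \<Longrightarrow> cmod (k z) \<le> d * w z" using k_decay[OF d] by blast
  \<comment> \<open>Chosen such that \<open>R / L0 = d / C0\<close>: for points closer than
    \<open>R\<close> the variation of the cutoff then compensates the constant \<open>C0\<close> of
    the kernel.\<close>
  define L0 where "L0 = R * C0 / d"
  have L0: "L0 > 0" using R C0 d by (simp add: L0_def)
  have "NP (cut f * T u - T (cut f * u)) \<le> \<eta> * NP u" if L: "L \<ge> L0" and f: "lipcut L f" and u: "u \<in> LP" for L f u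
  proof -
    have L0': "L > 0" using L L0 by linarith
    note [measurable] = lipcut_measurable[OF f L0']
    define \<kappa> where "\<kappa> x y = complex_of_real (f x - f y) * k (x - y)" for x y
    have "kernel d \<kappa>" unfolding kernel_def
    proof (intro conjI allI)
      show "(\<lambda>(x, y). \<kappa> x y) \<in> borel_measurable (borel \<Otimes>\<^sub>M borel)" unfolding \<kappa>_def by measurable
      fix x y
      have f1: "\<bar>f x - f y\<bar> \<le> 1" using f unfolding lipcut_def by (smt (verit))
      have f2: "\<bar>f x - f y\<bar> \<le> dist x y / L" using f by (simp add: lipcut_def)
      have nk: "cmod (\<kappa> x y) = \<bar>f x - f y\<bar> * cmod (k (x - y))" by (simp add: \<kappa>_def norm_mult flip: of_real_diff)
      show "cmod (\<kappa> x y) \<le> d * w (x - y)"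
      proof (cases "norm (x - y) \<ge> R")
        case True
        have "cmod (\<kappa> x y) \<le> 1 * cmod (k (x - y))" unfolding nk using f1 by (intro mult_right_mono) auto
        then show ?thesis using R(2)[OF True] by linarith
      next
        case False
        have "dist x y / L \<le> R / L0" using False L L0 R(1) by (intro frac_le) (auto simp: dist_norm)
        also have "R / L0 = d / C0" using R(1) C0 d by (simp add: L0_def)
        finally have f3: "\<bar>f x - f y\<bar> \<le> d / C0" using f2 by linarith
        have "cmod (k (x - y)) \<le> C0 * w (x - y)" using k_kernel by (simp add: kernel_def)
        with f3 have "cmod (\<kappa> x y) \<le> d / C0 * (C0 * w (x - y))" unfolding nk by (intro mult_mono) (use d C0 in auto)
        then show ?thesis using C0 by simp
      qed
    qed
    note kap = this
    have "cut f * T u - T (cut f * u) = Kop \<kappa> u"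
    proof
      fix x
      have 1: "integrable M (\<lambda>y. k (x - y) * u y)" by (rule Kop_integrable[OF k_kernel C0 u])
      have 2: "integrable M (\<lambda>y. k (x - y) * (cut f * u) y)"
        by (rule Kop_integrable[OF k_kernel C0 cut_mem(1)[OF f L0' u]])
      have "(cut f * T u - T (cut f * u)) x = (\<integral>y. cut f x * (k (x - y) * u y) \<partial>M) - (\<integral>y. k (x - y) * (cut f * u) y \<partial>M)"
        using 1 by (simp add: fun_ops T_eq Kop_def)
      also have "\<dots> = (\<integral>y. cut f x * (k (x - y) * u y) - k (x - y) * (cut f * u) y \<partial>M)"
        using 1 2 by (intro Bochner_Integration.integral_diff[symmetric]) auto
      also have "\<dots> = Kop \<kappa> u x" by (simp add: Kop_def \<kappa>_def cut_def fun_ops algebra_simps)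
      finally show "(cut f * T u - T (cut f * u)) x = Kop \<kappa> u x" .
    qed
    then show ?thesis using Kop_mem(2)[OF kap d u] K by (simp add: d_def)
  qed
  then show ?thesis using L0 by blast
qed

section \<open>The operator of the theorem and its translates\<close>

definition A :: "plane oper" where "A u = a * u + b * T u"

lemma a_mult [simp]: "u \<in> LP \<Longrightarrow> a * u \<in> LP" and a_mult_le: "u \<in> LP \<Longrightarrow> NP (a * u) \<le> coef * NP u"
  and b_mult [simp]: "u \<in> LP \<Longrightarrow> b * u \<in> LP" and b_mult_le: "u \<in> LP \<Longrightarrow> NP (b * u) \<le> coef * NP u"
  using mult_mem[of a coef u] mult_mem[of b coef u] coef by auto

lemma blin_A: "blin A"
proof -
  have "blin (\<lambda>u. a * u)" "blin (\<lambda>u. b * u)" using coef by (auto intro!: blin_mult[where c = coef])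
  from blin_plus_op[OF this(1) blin_comp[OF this(2) blin_T]] show ?thesis unfolding A_def[abs_def] .
qed

lemma A_mem [simp]: "u \<in> LP \<Longrightarrow> A u \<in> LP" by (rule blin_mem[OF blin_A])

definition Ash :: "plane \<Rightarrow> plane oper" where "Ash h u = shift_op (- h) (A (shift_op h u))"

lemma shift_mem [simp]: "g \<in> G \<Longrightarrow> u \<in> LP \<Longrightarrow> shift_op g u \<in> LP"
  and shift_norm [simp]: "g \<in> G \<Longrightarrow> u \<in> LP \<Longrightarrow> NP (shift_op g u) = NP u"
  using shift_Lp[of p g u] by auto

lemma shift_shift: "shift_op g (shift_op h u) = shift_op (g + h) u"
  by (simp add: shift_op_def fun_eq_iff algebra_simps)

lemma shift_0 [simp]: "shift_op 0 u = u" by (simp add: shift_op_def)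

lemma shift_mult: "shift_op g (u * v) = shift_op g u * shift_op g v"
  and shift_add: "shift_op g (u + v) = shift_op g u + shift_op g v"
  and shift_diff: "shift_op g (u - v) = shift_op g u - shift_op g v"
  and shift_scl: "shift_op g (scl c u) = scl c (shift_op g u)"
  by (simp_all add: shift_op_def fun_eq_iff fun_ops scl_def)

text \<open>\<open>T\<close> commutes with the translations in \<open>G\<close>, so conjugation
  moves the coefficients only.\<close>

lemma Ash_eq:
  assumes "h \<in> G" "u \<in> LP"
  shows "Ash h u = shift_op (- h) a * u + shift_op (- h) b * T u"
  unfolding Ash_def A_def T_shift[OF assms] shift_add shift_mult shift_shift by simp

lemma blin_shift: "g \<in> G \<Longrightarrow> blin (shift_op g)"
  by (rule blinI[where C = 1]) (simp_all add: shift_add shift_scl)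

lemma blin_Ash: "h \<in> G \<Longrightarrow> blin (Ash h)"
  unfolding Ash_def[abs_def] using blin_comp[OF blin_shift[OF G_uminus] blin_comp[OF blin_A blin_shift]] by simp

lemma limit_op_eq:
  assumes "range h \<subseteq> G"
  shows "is_limit_op E p A h B \<longleftrightarrow> blin B \<and> (\<forall>S. compactin (mtopology_of (path_metric E)) S \<longrightarrow>
     (\<lambda>m. op_norm M p (\<lambda>u. Ash (h m) (indicator S * u) - B (indicator S * u))) \<longlonglongrightarrow> 0 \<and>
     (\<lambda>m. op_norm M p (\<lambda>u. indicator S * (Ash (h m) u - B u))) \<longlonglongrightarrow> 0)"
proof -
  have 1: "(\<lambda>u x. (inv (shift_op (h m)) \<circ> A \<circ> shift_op (h m)) u x - B u x) \<circ> mult_op (indicator S)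
      = (\<lambda>u. Ash (h m) (indicator S * u) - B (indicator S * u))" for m S
    by (simp add: fun_eq_iff inv_shift_op Ash_def mult_op_def times_fun_def fun_ops)
  have 2: "mult_op (indicator S) \<circ> (\<lambda>u x. (inv (shift_op (h m)) \<circ> A \<circ> shift_op (h m)) u x - B u x)
      = (\<lambda>u. indicator S * (Ash (h m) u - B u))" for m S
    by (simp add: fun_eq_iff inv_shift_op Ash_def mult_op_def fun_ops)
  show ?thesis unfolding is_limit_op_def bounded_op_iff Let_def 1 2 ..
qed

lemma indicator_measurable: "S \<in> sets M \<Longrightarrow> (indicator S :: plane \<Rightarrow> complex) \<in> borel_measurable M"
  by (rule borel_measurable_indicator)

lemma indicator_mem:
  assumes "S \<in> sets M" "u \<in> LP"
  shows "indicator S * u \<in> LP" "NP (indicator S * u) \<le> NP u"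
  using mult_mem[OF indicator_measurable[OF assms(1)], of 1 u] assms(2) by (auto simp: indicator_def)

lemma blin_indicator: "S \<in> sets M \<Longrightarrow> blin (\<lambda>u. indicator S * u)"
  by (rule blin_mult[where c = 1]) (auto simp: indicator_def)

lemma ball_sets: "\<Gamma> \<inter> ball x r \<in> sets M" using \<Gamma>_borel by (auto simp: sets_M_iff)

lemma Lp_ball_approx:
  assumes "u \<in> LP"
  shows "(\<lambda>n. NP (u - indicator (\<Gamma> \<inter> ball 0 (real n)) * u)) \<longlonglongrightarrow> 0"
proof -
  have "(\<lambda>n. NP (indicator (\<Gamma> - ball 0 (real n)) * u)) \<longlonglongrightarrow> 0"
  proof (rule Lp_vanishing[OF assms])
    show "\<Gamma> - ball 0 (real n) \<in> sets M" for n using \<Gamma>_borel by (auto simp: sets_M_iff)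
    fix x :: plane
    obtain n0 :: nat where "norm x < real n0" using reals_Archimedean2 by blast
    then show "eventually (\<lambda>n. x \<notin> \<Gamma> - ball 0 (real n)) sequentially"
      unfolding eventually_sequentially by (intro exI[of _ n0]) (auto simp: dist_norm)
  qed
  moreover have "NP (u - indicator (\<Gamma> \<inter> ball 0 (real n)) * u) = NP (indicator (\<Gamma> - ball 0 (real n)) * u)" for n
  proof (rule N_eq)
    show m: "u - indicator (\<Gamma> \<inter> ball 0 (real n)) * u \<in> LP" using assms indicator_mem ball_sets by simp
    have S: "\<Gamma> - ball 0 (real n) \<in> sets M" using \<Gamma>_borel by (auto simp: sets_M_iff)
    show m': "indicator (\<Gamma> - ball 0 (real n)) * u \<in> LP" using indicator_mem(1)[OF S assms] .
    show "NP (u - indicator (\<Gamma> \<inter> ball 0 (real n)) * u - indicator (\<Gamma> - ball 0 (real n)) * u) = 0"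
      unfolding null_diff_iff[OF m m'] by (intro AE_I2) (auto simp: fun_ops indicator_def)
  qed
  ultimately show ?thesis by simp
qed

end

section \<open>Necessity\<close>

context periodic_planar_graph
begin

text \<open>The pieces are intervals on one edge through \<open>x\<close>, of equal length so that
  their indicators have the same norm. Other edges meet this one at most in endpoints and contribute
  nothing to the measure.\<close>

lemma short_pieces:
  fixes N :: nat
  assumes x: "x \<in> \<Gamma>" and \<delta>: "\<delta> > 0"
  shows "\<exists>m P. 0 < m \<and> m \<le> \<delta> \<and> disjoint_family_on P {..N} \<and>
    (\<forall>j\<le>N. P j \<in> sets M \<and> emeasure M (P j) = ennreal m \<and> (\<forall>y\<in>P j. path_dist E x y < \<delta>))"
proof -
  obtain e where e: "e \<in> E" "x \<in> convex hull e" using x by (auto simp: graph_points_def)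
  obtain u v where uv: "e = {u, v}" "u \<noteq> v" using e(1) by (rule edge_cases)
  define l where "l = dist u v"
  have l: "l > 0" using uv by (simp add: l_def)
  define \<phi> where "\<phi> s = u + s *\<^sub>R sgn (v - u)" for s
  have ns: "norm (sgn (v - u)) = 1" using uv by (simp add: norm_sgn)
  have d\<phi>: "dist (\<phi> s) (\<phi> t) = \<bar>s - t\<bar>" for s t
    by (simp add: \<phi>_def dist_norm scaleR_left_diff_distrib[symmetric] ns)
  have hull: "\<phi> s \<in> convex hull e" if "0 \<le> s" "s \<le> l" for s
    using segment_point[of s u v] that by (simp add: \<phi>_def uv l_def)
  obtain s0 where s0: "0 \<le> s0" "s0 \<le> l" "x = \<phi> s0"
  proof -
    obtain t where t: "0 \<le> t" "t \<le> 1" "x = (1 - t) *\<^sub>R u + t *\<^sub>R v"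
      using e(2) unfolding uv segment_convex_hull[symmetric] in_segment by blast
    have "l *\<^sub>R sgn (v - u) = v - u" using l by (simp add: sgn_div_norm l_def dist_norm norm_minus_commute)
    then have "\<phi> (t * l) = u + t *\<^sub>R (v - u)" by (simp add: \<phi>_def scaleR_scaleR[symmetric])
    moreover have "(1 - t) *\<^sub>R u + t *\<^sub>R v = u + t *\<^sub>R (v - u)" by (simp add: algebra_simps)
    ultimately have "x = \<phi> (t * l)" using t(3) by simp
    then show thesis using that[of "t * l"] t l by (simp add: mult_left_le_one_le)
  qed
  \<comment> \<open>At most half of the edge, so that an interval of length \<open>\<rho>\<close>
    with endpoint \<open>x\<close> fits on one side of \<open>x\<close>.\<close>
  define \<rho> where "\<rho> = min \<delta> l / 2"
  have \<rho>: "\<rho> > 0" "\<rho> < \<delta>" "\<rho> \<le> l / 2" using \<delta> l by (auto simp: \<rho>_def min_def)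
  define c where "c = (if s0 + \<rho> \<le> l then s0 else s0 - \<rho>)"
  have c: "0 \<le> c" "c + \<rho> \<le> l" "c \<le> s0" "s0 \<le> c + \<rho>" using s0 \<rho> by (auto simp: c_def)
  define q where "q = \<rho> / (real N + 1)"
  have q: "q > 0" "(real N + 1) * q = \<rho>" using \<rho> by (simp_all add: q_def)
  \<comment> \<open>Only the first half of each of the \<open>N + 1\<close> slots of length
    \<open>q\<close> is used, which makes the closed intervals disjoint.\<close>
  define m where "m = q / 2"
  have m: "m > 0" using q by (simp add: m_def)
  have "q \<le> \<rho>" using q \<rho>(1) by (simp add: q_def field_simps)
  then have m\<delta>: "m \<le> \<delta>" using \<rho> m by (simp add: m_def)
  define I where "I j = {c + real j * q .. c + real j * q + m}" for j
  have I: "I j \<subseteq> {c .. c + \<rho>}" if "j \<le> N" for j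
  proof -
    have "real j * q + m \<le> (real j + 1) * q" using q by (simp add: m_def algebra_simps)
    also have "\<dots> \<le> (real N + 1) * q" using that q by (intro mult_right_mono) auto
    finally show ?thesis using q unfolding I_def by auto
  qed
  have disI: "I i \<inter> I j = {}" if "i < j" for i j
  proof -
    have "real i * q + q \<le> real j * q" using that q mult_right_mono[of "real i + 1" "real j" q] by (simp add: algebra_simps)
    then show ?thesis using q by (auto simp: I_def m_def)
  qed
  define P where "P j = \<phi> ` I j" for j
  have inj: "\<phi> s = \<phi> t \<longleftrightarrow> s = t" for s t using d\<phi>[of s t] by auto
  have "disjoint_family_on P {..N}"
    unfolding disjoint_family_on_def P_def
  proof (intro ballI impI)
    fix i j :: nat assume "i \<noteq> j"
    then have "I i \<inter> I j = {}" using disI[of i j] disI[of j i] by (cases "i < j") auto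
    then show "\<phi> ` I i \<inter> \<phi> ` I j = {}" using inj by auto
  qed
  moreover have "P j \<in> sets M \<and> emeasure M (P j) = ennreal m \<and> (\<forall>y\<in>P j. path_dist E x y < \<delta>)" if j: "j \<le> N" for j
  proof (intro conjI ballI)
    have Ph: "P j \<subseteq> convex hull e" unfolding P_def using I[OF j] c hull by fastforce
    have "compact (P j)" unfolding P_def I_def \<phi>_def by (intro compact_continuous_image continuous_intros) auto
    then have Pb: "P j \<in> sets borel" by (rule borel_compact)
    then show PM: "P j \<in> sets M" using Ph edge_subset[OF e(1)] by (auto simp: sets_M_iff)
    have other: "emeasure (edge_measure f) (P j) = 0" if f: "f \<in> E" "f \<notin> {e}" for f
    proof -
      obtain u' v' where uv': "f = {u', v'}" "u' \<noteq> v'" using f(1) by (rule edge_cases)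
      have "{s \<in> {0..dist u' v'}. u' + s *\<^sub>R sgn (v' - u') \<in> P j} \<subseteq> (\<lambda>s. u' + s *\<^sub>R sgn (v' - u')) -` e"
        using segment_point[of _ u' v'] edge_Int[OF e(1) f(1)] f(2) Ph uv' by auto
      moreover have "finite ((\<lambda>s. u' + s *\<^sub>R sgn (v' - u')) -` e)"
        using uv uv' by (intro finite_vimageI) (auto intro!: injI simp: sgn_zero_iff)
      ultimately have "finite {s \<in> {0..dist u' v'}. u' + s *\<^sub>R sgn (v' - u') \<in> P j}" by (rule finite_subset)
      then show ?thesis unfolding uv'(1) edge_measure_eq emeasure_segment_measure[OF Pb]
        by (rule emeasure_lborel_countable[OF countable_finite])
    qed
    have "emeasure M (P j) = (\<integral>\<^sup>+f. emeasure (edge_measure f) (P j) \<partial>count_space E)" by (rule emeasure_M[OF PM])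
    also have "\<dots> = (\<Sum>f\<in>{e}. emeasure (edge_measure f) (P j))"
      by (rule nn_integral_count_space') (use other e in auto)
    also have "\<dots> = emeasure lborel {s \<in> {0..l}. \<phi> s \<in> P j}"
      by (simp add: uv edge_measure_eq emeasure_segment_measure[OF Pb] l_def \<phi>_def)
    also have "{s \<in> {0..l}. \<phi> s \<in> P j} = I j"
    proof (intro equalityI subsetI)
      fix s assume "s \<in> {s \<in> {0..l}. \<phi> s \<in> P j}"
      then show "s \<in> I j" using inj by (auto simp: P_def)
    next
      fix s assume s: "s \<in> I j"
      then have "s \<in> {c..c + \<rho>}" using I[OF j] by blast
      then show "s \<in> {s \<in> {0..l}. \<phi> s \<in> P j}" using s c by (auto simp: P_def)
    qed
    also have "emeasure lborel (I j) = ennreal m" using m by (simp add: I_def)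
    finally show "emeasure M (P j) = ennreal m" .
    fix y assume y: "y \<in> P j"
    then obtain s where s: "s \<in> I j" "y = \<phi> s" by (auto simp: P_def)
    have "path_dist E x y \<le> dist x y" using path_dist_edge_le[OF e(1,2)] Ph y by blast
    also have "\<dots> = \<bar>s0 - s\<bar>" by (simp add: s s0 d\<phi>)
    also have "\<dots> \<le> \<rho>" 
    proof -
      have "s \<in> {c..c + \<rho>}" using s(1) I[OF j] by blast
      then show ?thesis using c unfolding atLeastAtMost_iff by linarith
    qed
    finally show "path_dist E x y < \<delta>" using \<rho> by simp
  qed
  ultimately show ?thesis using m m\<delta> by (intro exI[of _ m] exI[of _ P]) simp
qed

end

context convolution_operator
begin

lemma \<Gamma>_nonempty: "\<Gamma> \<noteq> {}"
proof -
  have inf: "infinite V" and val: "\<forall>v\<in>V. finite {e \<in> E. v \<in> e} \<and> {e \<in> E. v \<in> e} \<noteq> {}"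
    using planar by (auto simp: planar_graph_def)
  obtain v where "v \<in> V" using inf by (metis finite.emptyI ex_in_conv)
  then obtain e where "e \<in> E" "v \<in> e" using val by blast
  then show ?thesis unfolding graph_points_def using hull_inc[of v e] by blast
qed

text \<open>With \<open>y\<close> restricted to \<open>P\<close> the row integrals are at most
  \<open>C0 * m\<close>, while the column integrals keep their bound. As \<open>p > 1\<close>, the
  row bound has a positive exponent in Schur's test, so the norm tends to \<open>0\<close> with
  \<open>m\<close>.\<close>

lemma T_indicator_le:
  assumes P: "P \<in> sets M" "emeasure M P \<le> ennreal m" and m: "m > 0" and u: "u \<in> LP" "indicator P * u = u"
  shows "NP (T u) \<le> ((C0 * m) powr (p - 1) * (C0 * K)) powr (1 / p) * NP u"
proof -
  define \<kappa> where "\<kappa> x y = k (x - y) * indicator P y" for x y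
  have [measurable]: "(indicator P :: plane \<Rightarrow> complex) \<in> borel_measurable M" by (rule indicator_measurable[OF P(1)])
  note [measurable] = kernel_measurable(1)[OF k_kernel]
  have meas: "(\<lambda>(x, y). \<kappa> x y) \<in> borel_measurable (M \<Otimes>\<^sub>M M)" unfolding \<kappa>_def by measurable
  have kC: "cmod (k z) \<le> C0" for z
  proof -
    have "(1 + norm z) powr (- 2 - \<epsilon>) \<le> 1 powr (- 2 - \<epsilon>)" using \<epsilon> by (intro powr_mono2') auto
    then have "C0 * (1 + norm z) powr (- 2 - \<epsilon>) \<le> C0 * 1" using C0 by (intro mult_left_mono) auto
    then show ?thesis using k_le[of z] by linarith
  qed
  have 1: "(\<integral>\<^sup>+y. ennreal (cmod (\<kappa> x y)) \<partial>M) \<le> ennreal (C0 * m)" for x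
  proof -
    have "(\<integral>\<^sup>+y. ennreal (cmod (\<kappa> x y)) \<partial>M) \<le> (\<integral>\<^sup>+y. ennreal C0 * indicator P y \<partial>M)"
      using kC by (intro nn_integral_mono) (auto simp: \<kappa>_def indicator_def ennreal_leI)
    also have "\<dots> = ennreal C0 * emeasure M P" using P(1) by (simp add: nn_integral_cmult_indicator)
    also have "\<dots> \<le> ennreal C0 * ennreal m" using P(2) by (intro mult_left_mono) auto
    finally show ?thesis using C0 m by (simp add: ennreal_mult)
  qed
  have 2: "(\<integral>\<^sup>+x. ennreal (cmod (\<kappa> x y)) \<partial>M) \<le> ennreal (C0 * K)" for y
  proof -
    have le: "cmod (\<kappa> x y) \<le> C0 * w (x - y)" for x
    proof -
      have "cmod (k (x - y)) \<le> C0 * w (x - y)" using k_kernel by (simp add: kernel_def)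
      moreover have "cmod (\<kappa> x y) \<le> cmod (k (x - y))" by (auto simp: \<kappa>_def indicator_def norm_mult)
      ultimately show ?thesis by linarith
    qed
    have "(\<integral>\<^sup>+x. ennreal (cmod (\<kappa> x y)) \<partial>M) \<le> (\<integral>\<^sup>+x. ennreal C0 * ennreal (w (x - y)) \<partial>M)"
      using le C0 less_imp_le[OF weight_pos] by (intro nn_integral_mono) (simp add: ennreal_mult[symmetric] ennreal_leI)
    also have "\<dots> = ennreal C0 * (\<integral>\<^sup>+x. ennreal (w (x - y)) \<partial>M)" by (rule nn_integral_cmult) measurable
    also have "\<dots> \<le> ennreal C0 * ennreal K" by (intro mult_left_mono K') auto
    finally show ?thesis using C0 K by (simp add: ennreal_mult)
  qed
  have pos: "C0 * m > 0" "C0 * K > 0" using C0 m K by auto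
  have "\<kappa> x y * u y = k (x - y) * u y" for x y
    using fun_cong[OF u(2), of y] by (simp add: \<kappa>_def fun_ops mult.assoc)
  then have "T u = (\<lambda>x. \<integral>y. \<kappa> x y * u y \<partial>M)" unfolding T_eq Kop_def by (simp only:)
  then show ?thesis using schur_test(2)[OF sigma_finite_M meas pos(1) 1 pos(2) 2 u(1)] by simp
qed

lemma fred_imp_a_bounded_below:
  assumes A: "fred A"
  shows "(INF x\<in>\<Gamma>. cmod (a x)) > 0"
proof (rule ccontr)
  assume "\<not> ?thesis"
  then have le0: "(INF x\<in>\<Gamma>. cmod (a x)) \<le> 0" by simp
  obtain n C where C: "C \<ge> 0" and "disjointly_bounded_below A n C"
    using fred_disjoint_supports[OF A] by blast
  note main = this(2)[unfolded disjointly_bounded_below_def]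
  \<comment> \<open>On the test functions \<open>A\<close> will have norm at most
    \<open>3 * \<eta>\<close>, so the lower bound would give \<open>1 \<le> 3 * C * \<eta>\<close>;
    this choice excludes it.\<close>
  define \<eta> where "\<eta> = 1 / (8 * (C + 1))"
  have \<eta>: "\<eta> > 0" using C by (simp add: \<eta>_def)
  have "\<exists>x\<in>\<Gamma>. cmod (a x) < \<eta>"
    using le0 \<eta> \<Gamma>_nonempty by (subst cINF_less_iff[symmetric]) (auto intro!: bdd_belowI[of _ 0])
  then obtain x where x: "x \<in> \<Gamma>" "cmod (a x) < \<eta>" by blast
  obtain \<delta> where \<delta>: "\<delta> > 0" "\<And>y. y \<in> \<Gamma> \<Longrightarrow> path_dist E x y < \<delta> \<Longrightarrow> cmod (a x - a y) < \<eta>"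
    using BUC_uniform[OF a_BUC \<eta>] x(1) by blast
  \<comment> \<open>The Schur constant of \<open>T_indicator_le\<close> tends to \<open>0\<close> as
    the measure \<open>m\<close> of the pieces does, here in order to get below
    \<open>\<eta> / coef\<close>.\<close>
  have ev: "eventually (\<lambda>m. 0 \<le> C0 * m) (at_right 0)"
    using C0 by (intro eventually_mono[OF eventually_at_right_less[of 0]]) auto
  have "((\<lambda>m. C0 * m) \<longlongrightarrow> C0 * 0) (at_right 0)" by (intro tendsto_intros)
  then have "((\<lambda>m. (C0 * m) powr (p - 1)) \<longlongrightarrow> (C0 * 0) powr (p - 1)) (at_right 0)"
    by (rule tendsto_powr'[OF _ tendsto_const]) (use ev p_gt in auto)
  then have "((\<lambda>m. (C0 * m) powr (p - 1) * (C0 * K)) \<longlongrightarrow> (C0 * 0) powr (p - 1) * (C0 * K)) (at_right 0)"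
    by (rule tendsto_mult[OF _ tendsto_const])
  then have "((\<lambda>m. ((C0 * m) powr (p - 1) * (C0 * K)) powr (1 / p)) \<longlongrightarrow> ((C0 * 0) powr (p - 1) * (C0 * K)) powr (1 / p)) (at_right 0)"
    by (rule tendsto_powr'[OF _ tendsto_const]) (use p_gt C0 K(1) in \<open>auto intro!: always_eventually\<close>)
  then have "eventually (\<lambda>m. ((C0 * m) powr (p - 1) * (C0 * K)) powr (1 / p) < \<eta> / coef) (at_right 0)"
    by (intro order_tendstoD(2)) (use \<eta> coef in auto)
  then obtain m1 where m1: "m1 > 0" "\<And>m. 0 < m \<Longrightarrow> m < m1 \<Longrightarrow> ((C0 * m) powr (p - 1) * (C0 * K)) powr (1 / p) < \<eta> / coef"
    unfolding eventually_at_right_field by blast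
  have "min \<delta> (m1 / 2) > 0" using \<delta> m1 by simp
  from short_pieces[OF x(1) this, of n]
  obtain m P where m: "m > 0" "m \<le> min \<delta> (m1 / 2)" and dis: "disjoint_family_on P {..n}"
    and P: "\<And>j. j \<le> n \<Longrightarrow> P j \<in> sets M" "\<And>j. j \<le> n \<Longrightarrow> emeasure M (P j) = ennreal m"
      "\<And>j y. j \<le> n \<Longrightarrow> y \<in> P j \<Longrightarrow> path_dist E x y < min \<delta> (m1 / 2)"
    by (elim exE conjE) simp
  define U where "U j = (indicator (P j) :: plane \<Rightarrow> complex)" for j
  define N0 where "N0 = m powr (1 / p)"
  have N0: "N0 > 0" using m by (simp add: N0_def)
  have U: "U j \<in> LP" "NP (U j) = N0" "indicator (P j) * U j = U j" if j: "j \<le> n" for j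
  proof -
    have pw: "(\<lambda>x. cmod (U j x) powr p) = indicator (P j)" by (auto simp: U_def indicator_def)
    have "integrable M (indicator (P j) :: plane \<Rightarrow> real)" using P(1,2)[OF j] by (intro integrable_real_indicator) auto
    then show "U j \<in> LP" using indicator_measurable[OF P(1)[OF j]] by (simp add: Lp_set_def pw U_def[of j, symmetric])
    have "measure M (P j) = m" using P(2)[OF j] m by (simp add: measure_def)
    then show "NP (U j) = N0" using P(1)[OF j] sets.sets_into_space[OF P(1)[OF j]]
      by (simp add: Lp_norm_def pw N0_def Int_absorb2)
    show "indicator (P j) * U j = U j" by (auto simp: U_def fun_ops fun_eq_iff indicator_def)
  qed
  have "NP (A (U j)) \<le> 3 * \<eta> * N0" if j: "j \<le> n" for j
  proof -
    have "NP (a * U j) \<le> 2 * \<eta> * NP (U j)"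
    proof -
      let ?f = "indicator (P j) * a"
      have [measurable]: "(indicator (P j) :: plane \<Rightarrow> complex) \<in> borel_measurable M" by (rule indicator_measurable[OF P(1)[OF j]])
      have f: "?f \<in> borel_measurable M" by (simp add: times_fun_def)
      have le: "cmod (?f y) \<le> 2 * \<eta>" if "y \<in> space M" for y
      proof (cases "y \<in> P j")
        case True
        then have "cmod (a x - a y) < \<eta>" using P(3)[OF j True] that \<delta>(2)[of y] by simp
        then have "cmod (a y) < 2 * \<eta>" using x(2) norm_triangle_ineq4[of "a x" "a x - a y"] by simp
        then show ?thesis using True by (simp add: fun_ops)
      qed (use \<eta> in \<open>simp add: fun_ops\<close>)
      have "NP (?f * U j) \<le> 2 * \<eta> * NP (U j)" using mult_mem(2)[OF f le _ U(1)[OF j]] \<eta> by simp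
      moreover have "?f * U j = a * U j" by (auto simp: U_def fun_ops fun_eq_iff indicator_def)
      ultimately show ?thesis by simp
    qed
    moreover have "NP (b * T (U j)) \<le> \<eta> * N0"
    proof -
      have "NP (T (U j)) \<le> ((C0 * m) powr (p - 1) * (C0 * K)) powr (1 / p) * NP (U j)"
        using P(2)[OF j] by (intro T_indicator_le[OF P(1)[OF j]] m U j) auto
      also have "\<dots> \<le> \<eta> / coef * NP (U j)" using m1(2)[of m] m m1(1) U[OF j] by (intro mult_right_mono) auto
      finally have "NP (T (U j)) \<le> \<eta> / coef * N0" using U[OF j] by simp
      then have "coef * NP (T (U j)) \<le> coef * (\<eta> / coef * N0)" using coef by (intro mult_left_mono) auto
      then show ?thesis using b_mult_le[OF T_mem[OF U(1)[OF j]]] coef(1) by simp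
    qed
    moreover have "NP (A (U j)) \<le> NP (a * U j) + NP (b * T (U j))"
      unfolding A_def using U[OF j] by (intro tri) auto
    ultimately show ?thesis using U(2)[OF j] by (simp add: algebra_simps)
  qed
  then obtain j where "j \<le> n" "NP (U j) \<le> C * (3 * \<eta> * N0)"
    using main[rule_format, of U P "3 * \<eta> * N0"] U P(1) dis by blast
  then have "N0 \<le> (3 * C * \<eta>) * N0" using U(2) by (simp add: algebra_simps)
  then have "1 \<le> 3 * C * \<eta>" using N0 by simp
  moreover have "3 * C * \<eta> < 1" using C by (simp add: \<eta>_def field_simps)
  ultimately show False by simp
qed

section \<open>Limit operators of a Fredholm operator\<close>

lemma far_apart:
  assumes h: "h \<in> escaping_seqs G" and R: "R \<ge> 0"
  shows "\<exists>f::nat \<Rightarrow> nat. (\<forall>j. f j \<ge> m0) \<and> (\<forall>i j. i \<noteq> j \<longrightarrow> dist (h (f i)) (h (f j)) > R)"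
proof -
  have ex: "\<exists>m\<ge>m0. norm (h m) > r" for r
  proof -
    have "eventually (\<lambda>m. norm (h m) > r) sequentially"
      using h unfolding escaping_seqs_def filterlim_at_top_dense by blast
    then obtain m1 where "\<And>m. m \<ge> m1 \<Longrightarrow> norm (h m) > r" unfolding eventually_sequentially by blast
    then show ?thesis by (intro exI[of _ "max m0 m1"]) simp
  qed
  \<comment> \<open>Every norm exceeds its predecessor by more than \<open>R\<close>, so the reverse
    triangle inequality separates any two of the chosen translations.\<close>
  have "\<exists>f. \<forall>n. f n \<ge> m0 \<and> norm (h (f (Suc n))) > norm (h (f n)) + R"
    by (rule dependent_nat_choice) (use ex in auto)
  then obtain f where f: "\<And>n. f n \<ge> m0" "\<And>n. norm (h (f (Suc n))) > norm (h (f n)) + R" by blast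
  have mono: "norm (h (f (i + Suc k))) > norm (h (f i)) + R" for i k
  proof (induction k)
    case (Suc k)
    then show ?case using f(2)[of "i + Suc k"] R by simp
  qed (use f in auto)
  have lt: "dist (h (f i)) (h (f j)) > R" if "i < j" for i j
    using mono[of i "j - i - 1"] that norm_triangle_ineq2[of "h (f j)" "h (f i)"]
    by (simp add: dist_norm norm_minus_commute)
  have "dist (h (f i)) (h (f j)) > R" if "i \<noteq> j" for i j
    using lt[of i j] lt[of j i] that by (cases "i < j") (auto simp: dist_commute)
  then show ?thesis using f(1) by blast
qed

text \<open>Convergence in operator norm against a compact set that swallows the ball gives one
  index for all functions supported there. The surjectivity proof relies on this uniformity, since
  its function is constructed only after the translations.\<close>

lemma limit_close:
  assumes hG: "range h \<subseteq> G" and lim: "is_limit_op E p A h B" and e: "e > 0"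
  shows "\<exists>m0. \<forall>m\<ge>m0. \<forall>u\<in>LP. indicator (\<Gamma> \<inter> ball 0 R) * u = u \<longrightarrow> NP (Ash (h m) u - B u) \<le> e * NP u"
proof -
  obtain S where S: "compactin (mtopology_of (path_metric E)) S" "S \<in> sets M" "\<Gamma> \<inter> cball 0 R \<subseteq> S"
    using compact_exhaustion by blast
  have B: "blin B" and "(\<lambda>m. op_norm M p (\<lambda>u. Ash (h m) (indicator S * u) - B (indicator S * u))) \<longlonglongrightarrow> 0"
    using lim S(1) unfolding limit_op_eq[OF hG] by auto
  then have "eventually (\<lambda>m. op_norm M p (\<lambda>u. Ash (h m) (indicator S * u) - B (indicator S * u)) < ennreal e) sequentially"
    by (intro order_tendstoD(2)) (use e in auto)
  then obtain m0 where m0: "\<And>m. m \<ge> m0 \<Longrightarrow> op_norm M p (\<lambda>u. Ash (h m) (indicator S * u) - B (indicator S * u)) < ennreal e"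
    unfolding eventually_sequentially by blast
  have "NP (Ash (h m) u - B u) \<le> e * NP u" if m: "m \<ge> m0" and u: "u \<in> LP" "indicator (\<Gamma> \<inter> ball 0 R) * u = u" for m u
  proof -
    have hm: "h m \<in> G" using hG by blast
    have "u x = 0" if "x \<notin> S" for x
    proof -
      have "x \<notin> \<Gamma> \<inter> ball 0 R" using S(3) that by auto
      then show ?thesis using fun_cong[OF u(2), of x] by (simp add: fun_ops)
    qed
    then have Su: "indicator S * u = u" by (auto simp: fun_eq_iff fun_ops indicator_def)
    have "blin (\<lambda>u. Ash (h m) (indicator S * u) - B (indicator S * u))"
      by (rule blin_minus_op[OF blin_comp[OF blin_Ash[OF hm] blin_indicator[OF S(2)]] blin_comp[OF B blin_indicator[OF S(2)]]])
    from op_normD[OF this less_imp_le[OF m0[OF m]] less_imp_le[OF e] u(1)] show ?thesis unfolding Su .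
  qed
  then show ?thesis by blast
qed

lemma NP_Ash: "h \<in> G \<Longrightarrow> u \<in> LP \<Longrightarrow> NP (Ash h u) = NP (A (shift_op h u))"
  unfolding Ash_def using G_uminus by simp

lemma fred_imp_limit_op_bounded_below:
  assumes A: "fred A" and h: "h \<in> escaping_seqs G" and lim: "is_limit_op E p A h B"
  shows "\<exists>K'. \<forall>u\<in>LP. NP u \<le> K' * NP (B u)"
proof -
  have hG: "range h \<subseteq> G" using h by (simp add: escaping_seqs_def)
  then have hm: "h m \<in> G" for m by blast
  have B: "blin B" using lim unfolding limit_op_eq[OF hG] by auto
  note [simp] = blin_mem[OF B]
  obtain n C where C: "C \<ge> 0" and "disjointly_bounded_below A n C"
    using fred_disjoint_supports[OF A] by blast
  note main = this(2)[unfolded disjointly_bounded_below_def]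
  have cpt: "NP u \<le> C * NP (B u)" if u: "u \<in> LP" and su: "indicator (\<Gamma> \<inter> ball 0 R) * u = u" and R: "R \<ge> 0" for u R
  proof (rule field_le_epsilon)
    fix e :: real assume e: "e > 0"
    \<comment> \<open>The summands \<open>1\<close> in the denominator make the choice possible for
      \<open>C = 0\<close> and for null functions too; in every case
      \<open>C * e' * NP u \<le> e\<close>.\<close>
    define e' where "e' = e / ((C + 1) * (NP u + 1))"
    have den: "(C + 1) * (NP u + 1) > 0" using C N_nonneg[OF u] by (intro mult_pos_pos) auto
    have e': "e' > 0" using e den by (simp add: e'_def)
    from limit_close[OF hG lim e', of R] obtain m0
      where m0: "\<And>m. m \<ge> m0 \<Longrightarrow> NP (Ash (h m) u - B u) \<le> e' * NP u" using u su by blast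
    have "2 * R \<ge> 0" using R by simp
    from far_apart[OF h this, of m0]
    obtain f :: "nat \<Rightarrow> nat" where "(\<forall>j. f j \<ge> m0) \<and> (\<forall>i j. i \<noteq> j \<longrightarrow> dist (h (f i)) (h (f j)) > 2 * R)" ..
    then have f: "\<And>j. f j \<ge> m0" "\<And>i j. i \<noteq> j \<Longrightarrow> dist (h (f i)) (h (f j)) > 2 * R" by blast+
    define U where "U j = shift_op (h (f j)) u" for j
    define P where "P j = \<Gamma> \<inter> ball (h (f j)) R" for j
    have "U j \<in> LP \<and> P j \<in> sets M \<and> NP (A (U j)) \<le> NP (B u) + e' * NP u \<and> indicator (P j) * U j = U j" for j
    proof (intro conjI)
      show "U j \<in> LP" using hm u by (simp add: U_def)
      show "P j \<in> sets M" unfolding P_def by (rule ball_sets)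
      have AL: "Ash (h (f j)) u \<in> LP" by (rule blin_mem[OF blin_Ash[OF hm] u])
      have "NP (A (U j)) = NP (Ash (h (f j)) u)" unfolding U_def using NP_Ash[OF hm u] by simp
      also have "\<dots> \<le> NP (B u) + NP (Ash (h (f j)) u - B u)" using AL u by (intro tri_le) auto
      finally show "NP (A (U j)) \<le> NP (B u) + e' * NP u" using m0[OF f(1)[of j]] by linarith
      have "U j x = 0" if "x \<notin> P j" for x
      proof -
        have "x - h (f j) \<notin> \<Gamma> \<inter> ball 0 R" using that \<Gamma>_diff_iff[OF hm] by (auto simp: P_def dist_norm norm_minus_commute)
        then show ?thesis using fun_cong[OF su, of "x - h (f j)"] by (simp add: U_def shift_op_def fun_ops)
      qed
      then show "indicator (P j) * U j = U j" by (auto simp: fun_eq_iff fun_ops indicator_def)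
    qed
    moreover have "disjoint_family_on P {..n}" unfolding disjoint_family_on_def
    proof (intro ballI impI)
      fix i j :: nat assume "i \<noteq> j"
      show "P i \<inter> P j = {}"
      proof (intro equals0I)
        fix x assume "x \<in> P i \<inter> P j"
        then have "dist (h (f i)) x < R" "dist (h (f j)) x < R" by (auto simp: P_def)
        then show False using f(2)[OF \<open>i \<noteq> j\<close>] dist_triangle2[of "h (f i)" "h (f j)" x] by linarith
      qed
    qed
    ultimately obtain j where "NP (U j) \<le> C * (NP (B u) + e' * NP u)" using main by blast
    then have 1: "NP u \<le> C * NP (B u) + C * e' * NP u" using hm u by (simp add: U_def algebra_simps)
    have "C * NP u \<le> (C + 1) * (NP u + 1)" using C N_nonneg[OF u] by (intro mult_mono) auto
    then have "e' * (C * NP u) \<le> e' * ((C + 1) * (NP u + 1))" using e' by (intro mult_left_mono) auto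
    also have "\<dots> = e" unfolding e'_def using den by (metis less_irrefl nonzero_eq_divide_eq)
    finally show "NP u \<le> C * NP (B u) + e" using 1 by (simp add: algebra_simps)
  qed
  \<comment> \<open>The constant \<open>C\<close> obtained for functions of bounded support does not
    depend on the support, so the bound extends to all of \<open>LP\<close> by density and
    boundedness of \<open>B\<close>.\<close>
  obtain K' where K': "K' > 0" "\<And>u. u \<in> LP \<Longrightarrow> NP (B u) \<le> K' * NP u" using blin_bound[OF B] by blast
  have "NP u \<le> C * NP (B u)" if u: "u \<in> LP" for u
  proof -
    define v where "v n = indicator (\<Gamma> \<inter> ball 0 (real n)) * u" for n :: nat
    have vL: "v n \<in> LP" for n unfolding v_def by (rule indicator_mem(1)[OF ball_sets u])
    have "NP u \<le> C * NP (B u) + (C * K' + 1) * NP (u - v n)" for n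
    proof -
      have "indicator (\<Gamma> \<inter> ball 0 (real n)) * v n = v n" by (auto simp: v_def fun_eq_iff fun_ops indicator_def)
      then have 1: "NP (v n) \<le> C * NP (B (v n))" by (intro cpt[OF vL, of "real n"]) auto
      have 2: "NP (B (v n)) \<le> NP (B u) + NP (B (v n) - B u)" using vL u by (intro tri_le) auto
      have 3: "NP (B (v n) - B u) \<le> K' * NP (u - v n)"
        using N_A_diff[OF B vL u, of n] K'(2)[of "v n - u"] vL[of n] u N_minus_commute[of "v n" u] by simp
      have "C * NP (B (v n)) \<le> C * (NP (B u) + K' * NP (u - v n))" using 2 3 C by (intro mult_left_mono) auto
      moreover have "NP u \<le> NP (v n) + NP (u - v n)" using vL u by (intro tri_le) auto
      ultimately show ?thesis using 1 by (simp add: algebra_simps)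
    qed
    moreover have "(\<lambda>n. C * NP (B u) + (C * K' + 1) * NP (u - v n)) \<longlonglongrightarrow> C * NP (B u) + (C * K' + 1) * 0"
      unfolding v_def by (intro tendsto_intros Lp_ball_approx u)
    ultimately show ?thesis using LIMSEQ_le_const[of "\<lambda>n. C * NP (B u) + (C * K' + 1) * NP (u - v n)" _ "NP u"] by auto
  qed
  then show ?thesis by blast
qed

definition bump :: "real \<Rightarrow> real \<Rightarrow> plane \<Rightarrow> real" where
  "bump R L x = min 1 (max 0 ((R + L - norm x) / L))"

lemma lipcut_bump: assumes "L > 0" shows "lipcut L (\<lambda>x. bump R L (x - c))"
proof -
  have "\<bar>min 1 (max 0 s) - min 1 (max 0 t)\<bar> \<le> \<bar>s - t\<bar>" for s t :: real by linarith
  then have 1: "\<bar>bump R L x - bump R L y\<bar> \<le> \<bar>(R + L - norm x) / L - (R + L - norm y) / L\<bar>" for x y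
    unfolding bump_def by blast
  have "\<bar>(R + L - norm x) / L - (R + L - norm y) / L\<bar> = \<bar>norm y - norm x\<bar> / L" for x y :: plane
    using assms by (simp add: diff_divide_distrib[symmetric])
  moreover have "\<bar>norm y - norm x\<bar> \<le> dist x y" for x y :: plane
    using norm_triangle_ineq3[of y x] by (simp add: dist_norm norm_minus_commute)
  ultimately have "\<bar>bump R L x - bump R L y\<bar> \<le> dist x y / L" for x y
    using 1[of x y] assms divide_right_mono[of "\<bar>norm y - norm x\<bar>" "dist x y" L] by (metis less_imp_le order.trans)
  from this[of "_ - c" "_ - c"] show ?thesis unfolding lipcut_def by (auto simp: bump_def dist_norm)
qed

lemma bump_1: "L > 0 \<Longrightarrow> norm x \<le> R \<Longrightarrow> bump R L x = 1" by (simp add: bump_def field_simps)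

lemma bump_0: "L > 0 \<Longrightarrow> norm x \<ge> R + L \<Longrightarrow> bump R L x = 0" by (simp add: bump_def field_simps)

text \<open>Multiplication by \<open>a\<close> commutes with the cutoff, so only the commutator with
  \<open>T\<close>, multiplied by \<open>b\<close>, remains.\<close>

lemma A_cut:
  assumes f: "lipcut L f" "L > 0" and u: "u \<in> LP" and le: "NP (cut f * T u - T (cut f * u)) \<le> \<eta> * NP u"
  shows "NP (A (cut f * u) - cut f * A u) \<le> coef * \<eta> * NP u"
proof -
  have m: "cut f * u \<in> LP" "cut f * T u \<in> LP" using cut_mem(1)[OF f] u by auto
  have "A (cut f * u) - cut f * A u = - (b * (cut f * T u - T (cut f * u)))"
    unfolding A_def by (simp add: algebra_simps)
  then have "NP (A (cut f * u) - cut f * A u) = NP (b * (cut f * T u - T (cut f * u)))"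
    using m by simp
  also have "\<dots> \<le> coef * NP (cut f * T u - T (cut f * u))" using m by (intro b_mult_le) auto
  also have "\<dots> \<le> coef * (\<eta> * NP u)" using le coef(1) by (intro mult_left_mono) auto
  finally show ?thesis by (simp add: mult.assoc)
qed

lemma fred_imp_limit_op_dense_range:
  assumes A: "fred A" and h: "h \<in> escaping_seqs G" and lim: "is_limit_op E p A h B"
    and v: "v \<in> LP" "indicator (\<Gamma> \<inter> ball 0 R) * v = v" and R: "R \<ge> 0" and e: "e > 0"
  shows "\<exists>u\<in>LP. NP (B u - v) \<le> e"
proof -
  have hG: "range h \<subseteq> G" using h by (simp add: escaping_seqs_def)
  then have hm: "h m \<in> G" for m by blast
  have B: "blin B" using lim unfolding limit_op_eq[OF hG] by auto
  note [simp] = blin_mem[OF B]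
  obtain S C where S: "finite S" "S \<subseteq> LP" "C \<ge> 0"
    "\<forall>v\<in>LP. \<exists>u\<in>LP. \<exists>z\<in>fun_vs.span S. NP u \<le> C * NP v \<and> NP (v - A u - z) = 0"
    using fred_upper[OF A] by (elim exE conjE) (rule that)
  define n where "n = card S"
  \<comment> \<open>A bound for the combination \<open>U\<close> below. It involves only
    \<open>A\<close> and \<open>v\<close>, hence it is known before the width of the cutoff and the
    distances of the translates are chosen.\<close>
  define Q where "Q = (real n + 1) * (C * NP v)"
  have Q: "Q \<ge> 0" using S(3) N_nonneg[OF v(1)] by (simp add: Q_def)
  \<comment> \<open>Two errors arise: the commutator costs \<open>coef * \<eta> * Q\<close>, and
    replacing the translate of \<open>A\<close> by \<open>B\<close> costs
    \<open>\<eta> * Q\<close>.\<close>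
  define \<eta> where "\<eta> = e / (2 * (coef + 1) * (Q + 1))"
  have den: "2 * (coef + 1) * (Q + 1) > 0" using coef(1) Q by (intro mult_pos_pos) auto
  have \<eta>: "\<eta> > 0" using e den by (simp add: \<eta>_def)
  obtain L where L: "L > 0" "\<And>f u. lipcut L f \<Longrightarrow> u \<in> LP \<Longrightarrow> NP (cut f * T u - T (cut f * u)) \<le> \<eta> * NP u"
    using commutator[OF \<eta>] by blast
  obtain m0 where m0: "\<And>m u. m \<ge> m0 \<Longrightarrow> u \<in> LP \<Longrightarrow> indicator (\<Gamma> \<inter> ball 0 (R + L)) * u = u \<Longrightarrow> NP (Ash (h m) u - B u) \<le> \<eta> * NP u"
    using limit_close[OF hG lim \<eta>, of "R + L"] by blast
  have "2 * (R + L) \<ge> 0" using R L(1) by simp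
  from far_apart[OF h this, of m0]
  obtain f :: "nat \<Rightarrow> nat" where "(\<forall>j. f j \<ge> m0) \<and> (\<forall>i j. i \<noteq> j \<longrightarrow> dist (h (f i)) (h (f j)) > 2 * (R + L))" ..
  then have f: "\<And>j. f j \<ge> m0" "\<And>i j. i \<noteq> j \<Longrightarrow> dist (h (f i)) (h (f j)) > 2 * (R + L)" by blast+
  let ?g = "\<lambda>j. h (f j)"
  have "\<forall>j. \<exists>x. fst x \<in> LP \<and> snd x \<in> fun_vs.span S \<and> NP (fst x) \<le> C * NP v \<and> NP (shift_op (?g j) v - A (fst x) - snd x) = 0"
  proof
    fix j
    have "shift_op (?g j) v \<in> LP" using hm v by simp
    then obtain u z where "u \<in> LP" "z \<in> fun_vs.span S" "NP u \<le> C * NP (shift_op (?g j) v)" "NP (shift_op (?g j) v - A u - z) = 0"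
      using S(4) by blast
    then show "\<exists>x. fst x \<in> LP \<and> snd x \<in> fun_vs.span S \<and> NP (fst x) \<le> C * NP v \<and> NP (shift_op (?g j) v - A (fst x) - snd x) = 0"
      using hm v by (intro exI[of _ "(u, z)"]) simp
  qed
  then obtain F where F: "\<And>j. fst (F j) \<in> LP \<and> snd (F j) \<in> fun_vs.span S \<and> NP (fst (F j)) \<le> C * NP v \<and> NP (shift_op (?g j) v - A (fst (F j)) - snd (F j)) = 0"
    by metis
  define uj zj where "uj j = fst (F j)" and "zj j = snd (F j)" for j
  have uz: "uj j \<in> LP" "zj j \<in> fun_vs.span S" "NP (uj j) \<le> C * NP v" "NP (shift_op (?g j) v - A (uj j) - zj j) = 0" for j
    using F[of j] by (auto simp: uj_def zj_def)
  have zL: "zj j \<in> LP" for j using span_mem[OF S(2) uz(2)] .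
  obtain d i where d: "i \<le> n" "d i = 1" "\<And>j. j \<le> n \<Longrightarrow> cmod (d j) \<le> 1" "(\<Sum>j\<le>n. scl (d j) (zj j)) = 0"
    using exists_relation[OF S(1), of zj] uz(2) unfolding n_def by blast
  define U where "U = (\<Sum>j\<le>n. scl (d j) (uj j))"
  define W where "W = (\<Sum>j\<le>n. scl (d j) (shift_op (?g j) v))"
  have UL: "U \<in> LP" and WL: "W \<in> LP" unfolding U_def W_def using uz hm v by (auto intro!: sum_mem)
  have NU: "NP U \<le> Q"
  proof -
    have "NP U \<le> (\<Sum>j\<le>n. NP (scl (d j) (uj j)))" unfolding U_def using uz by (intro N_sum_le) auto
    also have "\<dots> \<le> (\<Sum>j\<le>n. 1 * (C * NP v))"
    proof (rule sum_mono)
      fix j assume "j \<in> {..n}"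
      then have "cmod (d j) * NP (uj j) \<le> 1 * (C * NP v)"
        using d(3)[of j] uz(1,3)[of j] by (intro mult_mono) auto
      then show "NP (scl (d j) (uj j)) \<le> 1 * (C * NP v)" using uz(1)[of j] by simp
    qed
    also have "\<dots> = Q" by (simp add: Q_def algebra_simps)
    finally show ?thesis .
  qed
  have WU: "NP (A U - W) = 0"
  proof -
    let ?AU = "\<Sum>j\<le>n. scl (d j) (A (uj j))"
    let ?X = "\<Sum>j\<le>n. scl (d j) (shift_op (?g j) v - A (uj j) - zj j)"
    have 1: "NP (A U - ?AU) = 0" unfolding U_def using uz by (intro blin_sum[OF blin_A]) auto
    have AUL: "?AU \<in> LP" using uz by (auto intro!: sum_mem)
    have mX: "j \<le> n \<Longrightarrow> shift_op (?g j) v - A (uj j) - zj j \<in> LP" for j using uz zL hm v by simp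
    have "NP ?X \<le> (\<Sum>j\<le>n. NP (scl (d j) (shift_op (?g j) v - A (uj j) - zj j)))" using mX by (intro N_sum_le) auto
    also have "\<dots> = 0" using mX uz(4) by (intro sum.neutral) auto
    finally have X0: "NP ?X = 0" using mX by (intro null_le sum_mem) auto
    have "?X = W - ?AU - (\<Sum>j\<le>n. scl (d j) (zj j))"
      unfolding W_def by (simp add: fun_vs.scale_right_diff_distrib sum_subtractf)
    then have "?X = W - ?AU" using d(4) by simp
    then have "NP (?AU - W) = 0" using X0 N_minus_commute[OF AUL WL] by simp
    then show ?thesis using null_trans[OF A_mem[OF UL] AUL WL 1] by simp
  qed
  \<comment> \<open>The cutoff is \<open>1\<close> on the support of the translate number
    \<open>i\<close> and \<open>0\<close> on the supports of the others, which are centred more than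
    \<open>2 * (R + L)\<close> away.\<close>
  define \<phi> where "\<phi> x = bump R L (x - ?g i)" for x
  have lc: "lipcut L \<phi>" unfolding \<phi>_def[abs_def] by (rule lipcut_bump[OF L(1)])
  have \<phi>W: "cut \<phi> * W = shift_op (?g i) v"
  proof -
    have v0: "v x = 0" if "norm x \<ge> R" for x using fun_cong[OF v(2), of x] that by (simp add: fun_ops)
    have "cut \<phi> * scl (d j) (shift_op (?g j) v) = 0" if "j \<noteq> i" for j
    proof
      fix x
      show "(cut \<phi> * scl (d j) (shift_op (?g j) v)) x = 0 x"
      proof (cases "norm (x - ?g j) \<ge> R")
        case True
        then show ?thesis using v0 by (simp add: fun_ops scl_def shift_op_def)
      next
        case False
        have "dist (?g i) (?g j) \<le> norm (x - ?g i) + norm (x - ?g j)"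
          using dist_triangle2[of "?g i" "?g j" x] by (simp add: dist_norm norm_minus_commute)
        then have "norm (x - ?g i) \<ge> R + L" using f(2)[of i j] that False L(1) R by simp
        then have "\<phi> x = 0" unfolding \<phi>_def by (rule bump_0[OF L(1)])
        then show ?thesis by (simp add: fun_ops cut_def)
      qed
    qed
    then have "(\<Sum>j\<le>n. cut \<phi> * scl (d j) (shift_op (?g j) v)) = (\<Sum>j\<in>{i}. cut \<phi> * scl (d j) (shift_op (?g j) v))"
      using d(1) by (intro sum.mono_neutral_right) auto
    then have "cut \<phi> * W = cut \<phi> * shift_op (?g i) v" unfolding W_def sum_distrib_left using d(2) by simp
    also have "\<dots> = shift_op (?g i) v"
    proof
      fix x
      show "(cut \<phi> * shift_op (?g i) v) x = shift_op (?g i) v x"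
      proof (cases "norm (x - ?g i) \<ge> R")
        case True
        then show ?thesis using v0 by (simp add: fun_ops shift_op_def)
      next
        case False
        then have "\<phi> x = 1" unfolding \<phi>_def by (intro bump_1[OF L(1)]) auto
        then show ?thesis by (simp add: fun_ops cut_def)
      qed
    qed
    finally show ?thesis .
  qed
  have cU: "cut \<phi> * U \<in> LP" "NP (cut \<phi> * U) \<le> NP U" using cut_mem[OF lc L(1) UL] by auto
  have "NP (cut \<phi> * (A U - W)) \<le> NP (A U - W)" using cut_mem(2)[OF lc L(1)] UL WL by simp
  then have c0: "NP (cut \<phi> * A U - shift_op (?g i) v) \<le> 0" using WU \<phi>W by (simp add: right_diff_distrib)
  have "NP (A (cut \<phi> * U) - shift_op (?g i) v)
      \<le> NP (A (cut \<phi> * U) - cut \<phi> * A U) + NP (cut \<phi> * A U - shift_op (?g i) v)"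
    using cU cut_mem(1)[OF lc L(1) A_mem[OF UL]] hm v by (intro tri3) auto
  also have "\<dots> \<le> coef * \<eta> * NP U" using A_cut[OF lc L(1) UL L(2)[OF lc UL]] c0 by linarith
  finally have "NP (A (cut \<phi> * U) - shift_op (?g i) v) \<le> coef * \<eta> * NP U" .
  moreover have "coef * \<eta> * NP U \<le> coef * \<eta> * Q" using NU coef(1) \<eta> by (intro mult_left_mono) auto
  ultimately have near: "NP (A (cut \<phi> * U) - shift_op (?g i) v) \<le> coef * \<eta> * Q" by linarith
  define u where "u = shift_op (- ?g i) (cut \<phi> * U)"
  have uL: "u \<in> LP" and Nu: "NP u \<le> Q" unfolding u_def using G_uminus[OF hm] cU NU by auto
  have sh: "shift_op (?g i) u = cut \<phi> * U" by (simp add: u_def shift_shift)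
  \<comment> \<open>\<open>limit_close\<close> asks for a support condition at every point of the
    plane, so the values off the graph are removed; this changes \<open>u\<close> by a null
    function.\<close>
  define u' where "u' = indicator (\<Gamma> \<inter> ball 0 (R + L)) * u"
  have u'L: "u' \<in> LP" unfolding u'_def by (rule indicator_mem(1)[OF ball_sets uL])
  have uu': "NP (u - u') = 0" unfolding null_diff_iff[OF uL u'L]
  proof (rule AE_I2)
    fix x assume x: "x \<in> space M"
    show "u x = u' x"
    proof (cases "norm x < R + L")
      case False
      then have "\<phi> (x + ?g i) = 0" unfolding \<phi>_def by (intro bump_0[OF L(1)]) auto
      then show ?thesis by (simp add: u_def u'_def fun_ops shift_op_def cut_def)
    qed (use x in \<open>simp add: u'_def fun_ops\<close>)
  qed
  have "indicator (\<Gamma> \<inter> ball 0 (R + L)) * u' = u'" by (auto simp: u'_def fun_eq_iff fun_ops indicator_def)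
  from m0[OF f(1) u'L this] have 1: "NP (Ash (?g i) u' - B u') \<le> \<eta> * NP u'" .
  have Nu': "NP u' = NP u" using N_eq[OF uL u'L uu'] by simp
  have AL: "Ash (?g i) x \<in> LP" if "x \<in> LP" for x by (rule blin_mem[OF blin_Ash[OF hm] that])
  have 2: "NP (Ash (?g i) u - v) = NP (A (cut \<phi> * U) - shift_op (?g i) v)"
  proof -
    have "Ash (?g i) u - v = shift_op (- ?g i) (A (cut \<phi> * U) - shift_op (?g i) v)"
      unfolding Ash_def sh shift_diff shift_shift by simp
    then show ?thesis using G_uminus[OF hm] cU hm v by simp
  qed
  have 3: "NP (Ash (?g i) u' - Ash (?g i) u) = 0"
    using blin_cong[OF blin_Ash[OF hm] u'L uL] uu' N_minus_commute[OF uL u'L] by simp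
  have "NP (B u' - v) \<le> NP (B u' - Ash (?g i) u') + NP (Ash (?g i) u' - v)"
    using u'L v AL by (intro tri3) auto
  also have "NP (Ash (?g i) u' - v) \<le> NP (Ash (?g i) u' - Ash (?g i) u) + NP (Ash (?g i) u - v)"
    using u'L uL v AL by (intro tri3) auto
  finally have "NP (B u' - v) \<le> NP (Ash (?g i) u' - B u') + coef * \<eta> * Q"
    using 2 3 near N_minus_commute[of "B u'" "Ash (?g i) u'"] u'L AL by simp
  also have "\<dots> \<le> \<eta> * Q + coef * \<eta> * Q"
  proof -
    have "\<eta> * NP u' \<le> \<eta> * Q" using Nu Nu' \<eta> by (intro mult_left_mono) auto
    then show ?thesis using 1 by linarith
  qed
  also have "\<dots> \<le> \<eta> * ((coef + 1) * (Q + 1))" using \<eta> Q coef(1) by (simp add: algebra_simps)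
  also have "\<dots> \<le> e"
  proof -
    have "\<eta> * (2 * (coef + 1) * (Q + 1)) = e"
      unfolding \<eta>_def using den by (metis less_irrefl nonzero_eq_divide_eq)
    then have "2 * (\<eta> * ((coef + 1) * (Q + 1))) = e" by (simp only: mult.assoc mult.left_commute)
    then show ?thesis using e by linarith
  qed
  finally show ?thesis using u'L by blast
qed

lemma fred_imp_limit_op_invertible:
  assumes A: "fred A" and h: "h \<in> escaping_seqs G" and lim: "is_limit_op E p A h B"
  shows "inv_op B"
proof -
  have hG: "range h \<subseteq> G" using h by (simp add: escaping_seqs_def)
  have B: "blin B" using lim unfolding limit_op_eq[OF hG] by auto
  obtain K' where K': "\<forall>u\<in>LP. NP u \<le> K' * NP (B u)"
    using fred_imp_limit_op_bounded_below[OF A h lim] by blast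
  show ?thesis
  proof (rule inv_opI[OF B])
    show "NP u \<le> K' * NP (B u)" if "u \<in> LP" for u using K' that by blast
    fix v and e :: real assume v: "v \<in> LP" and e: "e > 0"
    have "eventually (\<lambda>n. NP (v - indicator (\<Gamma> \<inter> ball 0 (real n)) * v) < e / 2) sequentially"
      by (rule order_tendstoD(2)[OF Lp_ball_approx[OF v]]) (use e in simp)
    then obtain n where n: "NP (v - indicator (\<Gamma> \<inter> ball 0 (real n)) * v) < e / 2"
      unfolding eventually_sequentially by blast
    let ?v = "indicator (\<Gamma> \<inter> ball 0 (real n)) * v"
    have vL: "?v \<in> LP" by (rule indicator_mem(1)[OF ball_sets v])
    have "indicator (\<Gamma> \<inter> ball 0 (real n)) * ?v = ?v" by (auto simp: fun_eq_iff fun_ops indicator_def)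
    from fred_imp_limit_op_dense_range[OF A h lim vL this, of "e / 2"]
    obtain u where u: "u \<in> LP" "NP (B u - ?v) \<le> e / 2" using e by auto
    have "NP (B u - v) \<le> NP (B u - ?v) + NP (?v - v)"
      using blin_mem[OF B u(1)] vL v by (intro tri3)
    also have "NP (?v - v) = NP (v - ?v)" by (rule N_minus_commute[OF vL v])
    finally show "\<exists>u\<in>LP. NP (B u - v) \<le> e" using u n by (intro bexI[of _ u]) auto
  qed
qed

end

section \<open>Limit operators of slowly oscillating coefficients\<close>

lemma tendsto_0_ennrealI:
  fixes f :: "nat \<Rightarrow> ennreal"
  assumes "\<And>e::real. e > 0 \<Longrightarrow> \<exists>m0. \<forall>m\<ge>m0. f m \<le> ennreal e"
  shows "f \<longlonglongrightarrow> 0"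
proof (rule order_tendstoI)
  fix x :: ennreal assume x: "0 < x"
  obtain e :: real where e: "e > 0" "ennreal e < x"
  proof (cases x)
    case (real r)
    then have "r > 0" using x by simp
    then show ?thesis using that[of "r / 2"] real by (simp add: ennreal_less_iff)
  next
    case top
    then show ?thesis using that[of 1] by simp
  qed
  then show "eventually (\<lambda>m. f m < x) sequentially"
    using assms[OF e(1)] unfolding eventually_sequentially by (meson order.strict_trans1)
qed simp

context convolution_operator
begin

text \<open>Uniformity on bounded parts of the graph is what the operator norms in the definition of
  a limit operator call for.\<close>

definition limit_pair :: "(nat \<Rightarrow> plane) \<Rightarrow> (plane \<Rightarrow> complex) \<Rightarrow> (plane \<Rightarrow> complex) \<Rightarrow> bool" where
  "limit_pair h a' b' \<longleftrightarrow> h \<in> escaping_seqs G \<and>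
     (\<forall>R. \<forall>\<eta>>0. \<exists>m0. \<forall>m\<ge>m0. \<forall>x\<in>\<Gamma>. norm x \<le> R \<longrightarrow>
        cmod (a (x + h m) - a' x) \<le> \<eta> \<and> cmod (b (x + h m) - b' x) \<le> \<eta>)"

definition pair_op :: "(plane \<Rightarrow> complex) \<Rightarrow> (plane \<Rightarrow> complex) \<Rightarrow> plane oper" where
  "pair_op a' b' u = a' * u + b' * T u"

definition bounded_coeff :: "(plane \<Rightarrow> complex) \<Rightarrow> bool" where
  "bounded_coeff f \<longleftrightarrow> f \<in> borel_measurable M \<and> (\<forall>x\<in>\<Gamma>. cmod (f x) \<le> coef)"

lemma bounded_coeff_mult:
  assumes "bounded_coeff f" "u \<in> LP"
  shows "f * u \<in> LP" "NP (f * u) \<le> coef * NP u"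
  using mult_mem[of f coef u] assms coef(1) by (auto simp: bounded_coeff_def)

lemma blin_bounded_coeff: "bounded_coeff f \<Longrightarrow> blin (\<lambda>u. f * u)"
  using coef(1) by (intro blin_mult[where c = coef]) (auto simp: bounded_coeff_def)

lemma blin_pair_op:
  assumes "bounded_coeff a'" "bounded_coeff b'" shows "blin (pair_op a' b')"
  using blin_plus_op[OF blin_bounded_coeff[OF assms(1)] blin_comp[OF blin_bounded_coeff[OF assms(2)] blin_T]]
  by (simp add: pair_op_def[abs_def])

text \<open>The points \<open>x + h m\<close> escape to infinity, so slow oscillation makes
  \<open>f (x + g + h m) - f (x + h m)\<close> tend to \<open>0\<close>. This is why the limit is
  \<open>G\<close>-periodic.\<close>

lemma limit_coeff:
  assumes h: "h \<in> escaping_seqs G" and f: "f \<in> SO G E D" "\<And>x. x \<in> \<Gamma> \<Longrightarrow> cmod (f x) \<le> coef"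
    and lim: "\<And>x. x \<in> \<Gamma> \<Longrightarrow> (\<lambda>m. f (x + h m)) \<longlonglongrightarrow> f' x"
  shows "bounded_coeff f'" "\<And>x g. x \<in> \<Gamma> \<Longrightarrow> g \<in> G \<Longrightarrow> f' (x + g) = f' x"
proof -
  have hm: "h m \<in> G" for m using h unfolding escaping_seqs_def by blast
  have "f' \<in> borel_measurable M"
  proof (rule borel_measurable_LIMSEQ_metric)
    show "(\<lambda>x. f (x + h m)) \<in> borel_measurable M" for m
      using measurable_compose[OF measurable_translate[OF hm] SO_measurable[OF f(1)]] .
  qed (use lim in simp)
  moreover have "cmod (f' x) \<le> coef" if x: "x \<in> \<Gamma>" for x
    using f(2)[OF \<Gamma>_add[OF x hm]] tendsto_norm[OF lim[OF x]]
    by (intro LIMSEQ_le_const2[of "\<lambda>m. cmod (f (x + h m))"]) auto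
  ultimately show "bounded_coeff f'" by (simp add: bounded_coeff_def)
  fix x g assume x: "x \<in> \<Gamma>" and g: "g \<in> G"
  have 1: "(\<lambda>m. f (x + g + h m) - f (x + h m)) \<longlonglongrightarrow> f' (x + g) - f' x"
    by (intro tendsto_diff lim x \<Gamma>_add g)
  have "(\<lambda>m. f (x + g + h m) - f (x + h m)) \<longlonglongrightarrow> 0"
  proof (rule LIMSEQ_I)
    fix r :: real assume r: "r > 0"
    obtain R' where R': "\<And>y. y \<in> \<Gamma> \<Longrightarrow> norm y \<ge> R' \<Longrightarrow> cmod (f (y + g) - f y) \<le> r / 2"
      using SO_uniform[OF f(1), of "r / 2" "norm g"] r g by auto
    have "eventually (\<lambda>m. norm (h m) \<ge> R' + norm x) sequentially"
      using h unfolding escaping_seqs_def filterlim_at_top by blast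
    then obtain m0 where m0: "\<And>m. m \<ge> m0 \<Longrightarrow> norm (h m) \<ge> R' + norm x" unfolding eventually_sequentially by blast
    have "norm (f (x + g + h m) - f (x + h m) - 0) < r" if "m \<ge> m0" for m
    proof -
      have "norm (x + h m) \<ge> R'" using m0[OF that] norm_triangle_ineq4[of "x + h m" x] by simp
      then have "cmod (f (x + h m + g) - f (x + h m)) \<le> r / 2" by (intro R' \<Gamma>_add x hm)
      then show ?thesis using r by (simp add: algebra_simps)
    qed
    then show "\<exists>no. \<forall>n\<ge>no. norm (f (x + g + h n) - f (x + h n) - 0) < r" by blast
  qed
  then have "f' (x + g) - f' x = 0" using LIMSEQ_unique[OF 1] by simp
  then show "f' (x + g) = f' x" by simp
qed

lemma limit_pair_tendsto:
  assumes "limit_pair h a' b'" "x \<in> \<Gamma>"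
  shows "(\<lambda>m. a (x + h m)) \<longlonglongrightarrow> a' x" "(\<lambda>m. b (x + h m)) \<longlonglongrightarrow> b' x"
proof -
  have *: "\<exists>m0. \<forall>m\<ge>m0. cmod (a (x + h m) - a' x) \<le> \<eta> \<and> cmod (b (x + h m) - b' x) \<le> \<eta>" if "\<eta> > 0" for \<eta>
    using assms that unfolding limit_pair_def by (meson order_refl)
  have **: "\<exists>m0. \<forall>m\<ge>m0. cmod (a (x + h m) - a' x) < r \<and> cmod (b (x + h m) - b' x) < r" if r: "r > 0" for r
  proof -
    obtain m0 where "\<forall>m\<ge>m0. cmod (a (x + h m) - a' x) \<le> r / 2 \<and> cmod (b (x + h m) - b' x) \<le> r / 2"
      using *[of "r / 2"] r by auto
    then show ?thesis using r by (intro exI[of _ m0]) (smt (verit) field_sum_of_halves)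
  qed
  show "(\<lambda>m. a (x + h m)) \<longlonglongrightarrow> a' x" "(\<lambda>m. b (x + h m)) \<longlonglongrightarrow> b' x"
    using ** by (intro LIMSEQ_I, blast)+
qed

lemma limit_pair_coeff:
  assumes "limit_pair h a' b'"
  shows "bounded_coeff a'" "bounded_coeff b'" "\<And>x g. x \<in> \<Gamma> \<Longrightarrow> g \<in> G \<Longrightarrow> a' (x + g) = a' x"
    "\<And>x g. x \<in> \<Gamma> \<Longrightarrow> g \<in> G \<Longrightarrow> b' (x + g) = b' x"
proof -
  have h: "h \<in> escaping_seqs G" using assms by (simp add: limit_pair_def)
  note A = limit_coeff[OF h a_SO coef(2) limit_pair_tendsto(1)[OF assms]]
  note B = limit_coeff[OF h b_SO coef(3) limit_pair_tendsto(2)[OF assms]]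
  show "bounded_coeff a'" "bounded_coeff b'" "\<And>x g. x \<in> \<Gamma> \<Longrightarrow> g \<in> G \<Longrightarrow> a' (x + g) = a' x"
    "\<And>x g. x \<in> \<Gamma> \<Longrightarrow> g \<in> G \<Longrightarrow> b' (x + g) = b' x" using A B by blast+
qed

lemma shift_coeff:
  assumes "g \<in> G" shows "shift_op (- g) a \<in> borel_measurable M" "shift_op (- g) b \<in> borel_measurable M"
    "\<And>x. x \<in> \<Gamma> \<Longrightarrow> cmod (shift_op (- g) a x) \<le> coef" "\<And>x. x \<in> \<Gamma> \<Longrightarrow> cmod (shift_op (- g) b x) \<le> coef"
  using shift_measurable[OF G_uminus[OF assms] a_meas] shift_measurable[OF G_uminus[OF assms] b_meas]
    coef(2,3) \<Gamma>_add[OF _ assms] by (auto simp: shift_op_def)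

text \<open>Away from the support of its argument \<open>T\<close> acts through the tail of
  \<open>k\<close> alone. The lemma is for functions whose image under \<open>T\<close> spreads over
  the whole graph, where coefficients converge only on bounded sets.\<close>

lemma T_far_small:
  assumes S: "S \<in> sets borel" "S \<subseteq> ball 0 R" and \<eta>: "\<eta> > 0"
  shows "\<exists>R'. \<forall>u\<in>LP. indicator S * u \<in> LP \<longrightarrow> NP (indicator (\<Gamma> - ball 0 R') * T (indicator S * u)) \<le> \<eta> * NP u"
proof -
  have "\<eta> / K > 0" using \<eta> K by simp
  then obtain r where r: "r > 0" "\<And>z. norm z \<ge> r \<Longrightarrow> cmod (k z) \<le> \<eta> / K * w z" using k_decay by blast
  define \<kappa> where "\<kappa> x y = indicator (- ball 0 (R + r)) x * k (x - y) * indicator S y" for x y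
  have kap: "kernel (\<eta> / K) \<kappa>" unfolding kernel_def
  proof (intro conjI allI)
    have [measurable]: "(indicator S :: plane \<Rightarrow> complex) \<in> borel_measurable borel"
      "(indicator (- ball 0 (R + r)) :: plane \<Rightarrow> complex) \<in> borel_measurable borel"
      using S by (auto intro!: borel_measurable_indicator)
    show "(\<lambda>(x, y). \<kappa> x y) \<in> borel_measurable (borel \<Otimes>\<^sub>M borel)" unfolding \<kappa>_def by measurable
    fix x y
    show "cmod (\<kappa> x y) \<le> \<eta> / K * w (x - y)"
    proof (cases "x \<notin> ball 0 (R + r) \<and> y \<in> S")
      case True
      then have "norm x \<ge> R + r" "norm y < R" using S(2) by auto
      then have "norm (x - y) \<ge> r" using norm_triangle_ineq2[of x y] by linarith
      then show ?thesis using True r(2) by (simp add: \<kappa>_def)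
    next
      case False
      then have "\<kappa> x y = 0" by (auto simp: \<kappa>_def)
      moreover have "0 \<le> \<eta> / K * w (x - y)"
        using \<open>\<eta> / K > 0\<close> less_imp_le[OF weight_pos] by (intro mult_nonneg_nonneg) auto
      ultimately show ?thesis by (simp only: norm_zero)
    qed
  qed
  have "NP (indicator (\<Gamma> - ball 0 (R + r)) * T (indicator S * u)) \<le> \<eta> * NP u" if u: "u \<in> LP" and Su: "indicator S * u \<in> LP" for u
  proof -
    have FS: "\<Gamma> - ball 0 (R + r) \<in> sets M" using \<Gamma>_borel by (auto simp: sets_M_iff)
    have m: "indicator (\<Gamma> - ball 0 (R + r)) * T (indicator S * u) \<in> LP"
      using indicator_mem(1)[OF FS T_mem[OF Su]] .
    have "NP (indicator (\<Gamma> - ball 0 (R + r)) * T (indicator S * u) - Kop \<kappa> u) = 0"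
      unfolding null_diff_iff[OF m Kop_mem(1)[OF kap \<open>\<eta> / K > 0\<close> u]]
    proof (rule AE_I2)
      fix x assume "x \<in> space M"
      then have x: "indicator (\<Gamma> - ball 0 (R + r)) x = (indicator (- ball 0 (R + r)) x :: complex)"
        by (simp add: indicator_def)
      have "Kop \<kappa> u x = (\<integral>y. indicator (- ball 0 (R + r)) x * (k (x - y) * (indicator S * u) y) \<partial>M)"
        by (simp add: Kop_def \<kappa>_def fun_ops mult.assoc)
      also have "\<dots> = indicator (- ball 0 (R + r)) x * T (indicator S * u) x"
        using Kop_integrable[OF k_kernel C0 Su] by (simp add: T_eq Kop_def)
      finally show "(indicator (\<Gamma> - ball 0 (R + r)) * T (indicator S * u)) x = Kop \<kappa> u x"
        by (simp only: fun_ops x)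
    qed
    then have "NP (indicator (\<Gamma> - ball 0 (R + r)) * T (indicator S * u)) = NP (Kop \<kappa> u)"
      using m Kop_mem(1)[OF kap \<open>\<eta> / K > 0\<close> u] by (intro N_eq)
    also have "\<dots> \<le> \<eta> / K * K * NP u" by (rule Kop_mem(2)[OF kap \<open>\<eta> / K > 0\<close> u])
    finally show ?thesis using K(1) by simp
  qed
  then show ?thesis by blast
qed

text \<open>The difference of the operators consists of multiplications by the coefficient errors
  \<open>da\<close> and \<open>db\<close>. With the compact set on the left these are uniformly
  small where they matter. With the compact set on the right, \<open>T\<close> leaves the set: on a
  large ball \<open>db\<close> is small, outside it \<open>db\<close> is merely bounded but
  \<open>T_far_small\<close> applies.\<close>

lemma limit_pair_imp_limit_op:
  assumes lp: "limit_pair h a' b'"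
  shows "is_limit_op E p A h (pair_op a' b')"
proof -
  have h: "h \<in> escaping_seqs G" and hG: "range h \<subseteq> G" using lp by (auto simp: limit_pair_def escaping_seqs_def)
  then have hm: "h m \<in> G" for m by blast
  note co = limit_pair_coeff[OF lp]
  have am: "a' \<in> borel_measurable M" "b' \<in> borel_measurable M" using co by (auto simp: bounded_coeff_def)
  have B: "blin (pair_op a' b')" by (rule blin_pair_op[OF co(1,2)])
  define da where "da m = shift_op (- h m) a - a'" for m
  define db where "db m = shift_op (- h m) b - b'" for m
  have dm [measurable]: "da m \<in> borel_measurable M" "db m \<in> borel_measurable M" for m
    using shift_coeff(1,2)[OF hm] am by (auto simp: da_def db_def fun_diff_def)
  have db2: "cmod (db m x) \<le> 2 * coef" if "x \<in> \<Gamma>" for m x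
  proof -
    have "cmod (b' x) \<le> coef" using co(2) that by (simp add: bounded_coeff_def)
    then show ?thesis using norm_triangle_ineq4[of "shift_op (- h m) b x" "b' x"] shift_coeff(4)[OF hm[of m] that]
      unfolding db_def fun_ops by linarith
  qed
  have diff: "Ash (h m) u - pair_op a' b' u = da m * u + db m * T u" if "u \<in> LP" for m u
    unfolding Ash_eq[OF hm that] pair_op_def da_def db_def by (simp add: algebra_simps)
  have small: "\<exists>m0. \<forall>m\<ge>m0. \<forall>x\<in>\<Gamma>. norm x \<le> R \<longrightarrow> cmod (da m x) \<le> \<eta> \<and> cmod (db m x) \<le> \<eta>" if "\<eta> > 0" for R \<eta>
    using lp that unfolding limit_pair_def by (simp add: da_def db_def fun_ops shift_op_def)
  have loc: "indicator S * d * u \<in> LP \<and> NP (indicator S * d * u) \<le> \<eta> * NP u"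
    if "S \<in> sets M" "d \<in> borel_measurable M" "\<And>x. x \<in> S \<Longrightarrow> cmod (d x) \<le> \<eta>" "\<eta> > 0" "u \<in> LP" for S d \<eta> u
  proof -
    have [measurable]: "(indicator S :: plane \<Rightarrow> complex) \<in> borel_measurable M" "d \<in> borel_measurable M"
      using that indicator_measurable by auto
    have m: "indicator S * d \<in> borel_measurable M" by (simp add: times_fun_def)
    have le: "cmod ((indicator S * d) x) \<le> \<eta>" for x using that(3)[of x] that(4) by (cases "x \<in> S") (auto simp: fun_ops)
    show ?thesis using mult_mem[OF m le _ that(5)] that(4) by simp
  qed
  show ?thesis unfolding limit_op_eq[OF hG]
  proof (intro conjI allI impI B)
    fix S assume S: "compactin (mtopology_of (path_metric E)) S"
    have cS: "compact S" "S \<subseteq> \<Gamma>" by (rule compactin_imp_compact[OF S])+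
    then have SM: "S \<in> sets M" and Sb: "S \<in> sets borel" by (auto simp: sets_M_iff borel_compact)
    obtain R where R: "\<And>x. x \<in> S \<Longrightarrow> norm x \<le> R" using compact_imp_bounded[OF cS(1)] unfolding bounded_iff by blast
    have Sball: "S \<subseteq> ball 0 (R + 1)" using R by fastforce
    note iS = indicator_mem[OF SM]
    let ?c = "1 + C0 * K"
    have c: "?c > 0" using C0 K by (simp add: add_pos_pos)
    have Sx: "x \<in> S \<Longrightarrow> x \<in> \<Gamma> \<and> norm x \<le> R" for x using cS(2) R by blast
    show "(\<lambda>m. op_norm M p (\<lambda>u. indicator S * (Ash (h m) u - pair_op a' b' u))) \<longlonglongrightarrow> 0"
    proof (rule tendsto_0_ennrealI)
      fix e :: real assume e: "e > 0"
      define \<eta> where "\<eta> = e / ?c"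
      have \<eta>: "\<eta> > 0" using e c by (simp add: \<eta>_def)
      obtain m0 where m0: "\<And>m x. m \<ge> m0 \<Longrightarrow> x \<in> \<Gamma> \<Longrightarrow> norm x \<le> R \<Longrightarrow> cmod (da m x) \<le> \<eta> \<and> cmod (db m x) \<le> \<eta>"
        using small[OF \<eta>, of R] by blast
      have "op_norm M p (\<lambda>u. indicator S * (Ash (h m) u - pair_op a' b' u)) \<le> ennreal e" if m: "m \<ge> m0" for m
      proof (rule op_normI)
        fix u assume u: "u \<in> LP"
        have 1: "indicator S * da m * u \<in> LP \<and> NP (indicator S * da m * u) \<le> \<eta> * NP u"
          using m0[OF m] Sx \<eta> by (intro loc SM dm u) auto
        have 2: "indicator S * db m * T u \<in> LP \<and> NP (indicator S * db m * T u) \<le> \<eta> * NP (T u)"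
          using m0[OF m] Sx \<eta> by (intro loc SM dm T_mem u) auto
        have "indicator S * (Ash (h m) u - pair_op a' b' u) = indicator S * da m * u + indicator S * db m * T u"
          unfolding diff[OF u] by (simp add: algebra_simps)
        then have "NP (indicator S * (Ash (h m) u - pair_op a' b' u)) \<le> \<eta> * NP u + \<eta> * NP (T u)"
          using tri[of "indicator S * da m * u" "indicator S * db m * T u"] 1 2 by simp
        also have "\<dots> \<le> \<eta> * NP u + \<eta> * (C0 * K * NP u)" using T_le[OF u] \<eta> by (intro add_left_mono mult_left_mono) auto
        also have "\<dots> = (\<eta> * ?c) * NP u" by (simp add: algebra_simps)
        also have "\<eta> * ?c = e" using c by (simp add: \<eta>_def)
        finally show "NP (indicator S * (Ash (h m) u - pair_op a' b' u)) \<le> e * NP u" .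
      qed (use e in simp)
      then show "\<exists>m0. \<forall>m\<ge>m0. op_norm M p (\<lambda>u. indicator S * (Ash (h m) u - pair_op a' b' u)) \<le> ennreal e" by blast
    qed
    show "(\<lambda>m. op_norm M p (\<lambda>u. Ash (h m) (indicator S * u) - pair_op a' b' (indicator S * u))) \<longlonglongrightarrow> 0"
    proof (rule tendsto_0_ennrealI)
      fix e :: real assume e: "e > 0"
      define c' where "c' = ?c + 2 * coef"
      have c': "c' > 0" using c coef(1) by (simp add: c'_def)
      define \<eta> where "\<eta> = e / c'"
      have \<eta>: "\<eta> > 0" using e c' by (simp add: \<eta>_def)
      obtain R' where R': "\<forall>u\<in>LP. indicator S * u \<in> LP \<longrightarrow> NP (indicator (\<Gamma> - ball 0 R') * T (indicator S * u)) \<le> \<eta> * NP u"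
        using T_far_small[OF Sb Sball \<eta>] by blast
      obtain m0 where m0: "\<And>m x. m \<ge> m0 \<Longrightarrow> x \<in> \<Gamma> \<Longrightarrow> norm x \<le> max R R' \<Longrightarrow> cmod (da m x) \<le> \<eta> \<and> cmod (db m x) \<le> \<eta>"
        using small[OF \<eta>, of "max R R'"] by blast
      have "op_norm M p (\<lambda>u. Ash (h m) (indicator S * u) - pair_op a' b' (indicator S * u)) \<le> ennreal e" if m: "m \<ge> m0" for m
      proof (rule op_normI)
        fix u assume u: "u \<in> LP"
        let ?u = "indicator S * u" and ?F = "\<Gamma> - ball 0 R'" and ?N = "\<Gamma> \<inter> ball 0 R'"
        have uL: "?u \<in> LP" "NP ?u \<le> NP u" using iS u by auto
        have FS: "?F \<in> sets M" using \<Gamma>_borel by (auto simp: sets_M_iff)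
        have 1: "indicator S * da m * u \<in> LP \<and> NP (indicator S * da m * u) \<le> \<eta> * NP u"
          using m0[OF m] Sx \<eta> by (intro loc SM dm u) fastforce+
        have 2: "indicator ?N * db m * T ?u \<in> LP \<and> NP (indicator ?N * db m * T ?u) \<le> \<eta> * NP (T ?u)"
          using m0[OF m] \<eta> by (intro loc ball_sets dm T_mem uL) auto
        have FT: "indicator ?F * T ?u \<in> LP" by (rule indicator_mem(1)[OF FS T_mem[OF uL(1)]])
        have 3: "db m * (indicator ?F * T ?u) \<in> LP" "NP (db m * (indicator ?F * T ?u)) \<le> 2 * coef * NP (indicator ?F * T ?u)"
          using mult_mem[OF dm(2) _ _ FT, of m "2 * coef"] db2 coef(1) by auto
        let ?X = "indicator S * da m * u + (indicator ?N * db m * T ?u + db m * (indicator ?F * T ?u))"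
        have XL: "?X \<in> LP" using 1 2 3 by simp
        have YL: "Ash (h m) ?u - pair_op a' b' ?u \<in> LP"
          using blin_mem[OF blin_Ash[OF hm] uL(1)] blin_mem[OF B uL(1)] by simp
        have "AE x in M. (Ash (h m) ?u - pair_op a' b' ?u) x = ?X x"
          unfolding diff[OF uL(1)] by (rule AE_I2) (auto simp: fun_ops indicator_def)
        then have "NP (Ash (h m) ?u - pair_op a' b' ?u - ?X) = 0"
          unfolding null_diff_iff[OF YL XL] .
        then have "NP (Ash (h m) ?u - pair_op a' b' ?u) = NP ?X" using XL YL by (intro N_eq)
        also have "\<dots> \<le> NP (indicator S * da m * u) + (NP (indicator ?N * db m * T ?u) + NP (db m * (indicator ?F * T ?u)))"
          using 1 2 3 by (intro order.trans[OF tri] add_left_mono tri) auto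
        also have "\<dots> \<le> \<eta> * NP u + (\<eta> * (C0 * K * NP u) + 2 * coef * (\<eta> * NP u))"
        proof (intro add_mono)
          have "\<eta> * NP (T ?u) \<le> \<eta> * (C0 * K * NP u)"
            using order.trans[OF T_le[OF uL(1)] mult_left_mono[OF uL(2), of "C0 * K"]] \<eta> C0 K(1) by (intro mult_left_mono) auto
          then show "NP (indicator ?N * db m * T ?u) \<le> \<eta> * (C0 * K * NP u)" using 2 by linarith
          have "NP (indicator ?F * T ?u) \<le> \<eta> * NP u" using R' u uL(1) by blast
          then have "2 * coef * NP (indicator ?F * T ?u) \<le> 2 * coef * (\<eta> * NP u)" using coef(1) by (intro mult_left_mono) auto
          then show "NP (db m * (indicator ?F * T ?u)) \<le> 2 * coef * (\<eta> * NP u)" using 3 by linarith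
        qed (use 1 in auto)
        also have "\<dots> = (\<eta> * c') * NP u" by (simp add: c'_def algebra_simps)
        also have "\<eta> * c' = e" using c' by (simp add: \<eta>_def)
        finally show "NP (Ash (h m) ?u - pair_op a' b' ?u) \<le> e * NP u" .
      qed (use e in simp)
      then show "\<exists>m0. \<forall>m\<ge>m0. op_norm M p (\<lambda>u. Ash (h m) (indicator S * u) - pair_op a' b' (indicator S * u)) \<le> ennreal e" by blast
    qed
  qed
qed

subsection \<open>Total boundedness of the translates\<close>

definition close_on_domain :: "real \<Rightarrow> plane \<Rightarrow> (plane \<Rightarrow> complex) \<Rightarrow> (plane \<Rightarrow> complex) \<Rightarrow> bool" where
  "close_on_domain \<eta> \<alpha> a' b' \<longleftrightarrow> (\<forall>y\<in>D. cmod (a (y + \<alpha>) - a' y) \<le> \<eta> \<and> cmod (b (y + \<alpha>) - b' y) \<le> \<eta>)"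

text \<open>An Arzela-Ascoli argument by colouring: uniform continuity reduces closeness on
  \<open>D\<close> to finitely many points \<open>W\<close>, boundedness leaves finitely many
  rounded values there, and translates with equal rounded values form one class.\<close>

lemma translates_totally_bounded:
  assumes \<eta>: "\<eta> > 0"
  shows "\<exists>\<P>. finite \<P> \<and> \<Union>\<P> = G \<and>
    (\<forall>S\<in>\<P>. \<forall>\<alpha>\<in>S. \<forall>\<beta>\<in>S. close_on_domain \<eta> \<alpha> (\<lambda>y. a (y + \<beta>)) (\<lambda>y. b (y + \<beta>)))"
proof -
  \<comment> \<open>Going from \<open>y\<close> to a nearby point of \<open>W\<close> costs
    \<open>r\<close> for each of the two translates, and equal rounding of real and imaginary parts
    costs \<open>2 * r\<close>.\<close>
  define r where "r = \<eta> / 4"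
  have r: "r > 0" using \<eta> by (simp add: r_def)
  obtain \<delta>1 where \<delta>1: "\<delta>1 > 0" "\<forall>x\<in>\<Gamma>. \<forall>y\<in>\<Gamma>. path_dist E x y < \<delta>1 \<longrightarrow> cmod (a x - a y) < r"
    using BUC_uniform[OF a_BUC r] by blast
  obtain \<delta>2 where \<delta>2: "\<delta>2 > 0" "\<forall>x\<in>\<Gamma>. \<forall>y\<in>\<Gamma>. path_dist E x y < \<delta>2 \<longrightarrow> cmod (b x - b y) < r"
    using BUC_uniform[OF b_BUC r] by blast
  define \<delta> where "\<delta> = min \<delta>1 \<delta>2"
  have "\<delta> > 0" using \<delta>1 \<delta>2 by (simp add: \<delta>_def)
  from orbit_cover[of "\<lambda>_. \<delta>", OF this]
  obtain Z where "finite Z \<and> Z \<subseteq> \<Gamma> \<and> (\<forall>x\<in>\<Gamma>. \<exists>z\<in>Z. \<exists>g\<in>G. path_dist E (z + g) x < \<delta>)" ..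
  then have Z: "finite Z" "Z \<subseteq> \<Gamma>" "\<And>x. x \<in> \<Gamma> \<Longrightarrow> \<exists>z\<in>Z. \<exists>g\<in>G. path_dist E (z + g) x < \<delta>" by simp_all
  obtain d where d: "d > 0" "\<And>y. y \<in> D \<Longrightarrow> norm y \<le> d" using domain_bounded by blast
  \<comment> \<open>The points in the orbits of \<open>Z\<close> that can come within
    \<open>\<delta>\<close> of \<open>D\<close>; discreteness of \<open>G\<close> makes them finite
    in number.\<close>
  define W where "W = (\<Union>z\<in>Z. (\<lambda>g. z + g) ` {g \<in> G. norm (- z - g) \<le> d + \<delta>})"
  have finW: "finite W" unfolding W_def using Z(1) G_finite by blast
  have W\<Gamma>: "w \<in> \<Gamma>" if "w \<in> W" for w using that Z(2) \<Gamma>_add unfolding W_def by blast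
  have near: "\<exists>w\<in>W. path_dist E w y < \<delta>" if y: "y \<in> D" for y
  proof -
    have y\<Gamma>: "y \<in> \<Gamma>" using y domain_subset by blast
    obtain z g where z: "z \<in> Z" "g \<in> G" "path_dist E (z + g) y < \<delta>" using Z(3)[OF y\<Gamma>] by blast
    have "dist (z + g) y < \<delta>" using dist_le_path_dist[of "z + g" y] z y\<Gamma> Z(2) \<Gamma>_add by fastforce
    then have "norm (z + g) \<le> d + \<delta>" using d(2)[OF y] norm_triangle_ineq2[of "z + g" y] by (simp add: dist_norm)
    moreover have "norm (- z - g) = norm (z + g)" using norm_minus_cancel[of "z + g"] by simp
    ultimately have "g \<in> {g \<in> G. norm (- z - g) \<le> d + \<delta>}" using z(2) by simp
    then have "z + g \<in> W" using z(1) unfolding W_def by blast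
    then show ?thesis using z(3) by blast
  qed
  define q where "q z = (\<lfloor>Re z / r\<rfloor>, \<lfloor>Im z / r\<rfloor>)" for z
  have q: "cmod (z - z') \<le> 2 * r" if "q z = q z'" for z z'
  proof -
    have *: "\<bar>s - t\<bar> \<le> r" if "\<lfloor>s / r\<rfloor> = \<lfloor>t / r\<rfloor>" for s t :: real
    proof -
      have "\<bar>s / r - t / r\<bar> \<le> 1" using that floor_correct[of "s / r"] floor_correct[of "t / r"] by linarith
      then have "\<bar>s - t\<bar> / r \<le> 1" using r by (simp add: diff_divide_distrib[symmetric])
      then show ?thesis using r by simp
    qed
    have "\<bar>Re (z - z')\<bar> \<le> r" "\<bar>Im (z - z')\<bar> \<le> r" using that * by (auto simp: q_def)
    then show ?thesis using cmod_le[of "z - z'"] by linarith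
  qed
  define I where "I = {\<lfloor>- coef / r\<rfloor>..\<lfloor>coef / r\<rfloor>}"
  have qI: "q z \<in> I \<times> I" if "cmod z \<le> coef" for z
  proof -
    have "- coef \<le> Re z" "Re z \<le> coef" "- coef \<le> Im z" "Im z \<le> coef"
      using abs_Re_le_cmod[of z] abs_Im_le_cmod[of z] that by linarith+
    then have "- coef / r \<le> Re z / r" "Re z / r \<le> coef / r" "- coef / r \<le> Im z / r" "Im z / r \<le> coef / r"
      using r by (intro divide_right_mono; simp)+
    then show ?thesis unfolding q_def I_def mem_Times_iff fst_conv snd_conv atLeastAtMost_iff
      by (intro conjI floor_mono)
  qed
  define col where "col \<alpha> = restrict (\<lambda>w. (q (a (w + \<alpha>)), q (b (w + \<alpha>)))) W" for \<alpha>
  have "col ` G \<subseteq> W \<rightarrow>\<^sub>E ((I \<times> I) \<times> (I \<times> I))"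
  proof
    fix c assume "c \<in> col ` G"
    then obtain \<alpha> where "\<alpha> \<in> G" "c = col \<alpha>" by blast
    have "(q (a (w + \<alpha>)), q (b (w + \<alpha>))) \<in> (I \<times> I) \<times> (I \<times> I)" if "w \<in> W" for w
      by (rule SigmaI) (intro qI coef \<Gamma>_add W\<Gamma> that \<open>\<alpha> \<in> G\<close>)+
    then show "c \<in> W \<rightarrow>\<^sub>E ((I \<times> I) \<times> (I \<times> I))"
      unfolding \<open>c = col \<alpha>\<close> col_def restrict_PiE_iff by blast
  qed
  moreover have "finite (W \<rightarrow>\<^sub>E ((I \<times> I) \<times> (I \<times> I)))" using finW by (intro finite_PiE) (auto simp: I_def)
  ultimately have fin: "finite (col ` G)" by (rule finite_subset)
  define \<P> where "\<P> = (\<lambda>c. {\<alpha> \<in> G. col \<alpha> = c}) ` (col ` G)"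
  have "close_on_domain \<eta> \<alpha> (\<lambda>y. a (y + \<beta>)) (\<lambda>y. b (y + \<beta>))" if \<alpha>: "\<alpha> \<in> G" "\<beta> \<in> G" "col \<alpha> = col \<beta>" for \<alpha> \<beta>
    unfolding close_on_domain_def
  proof
    fix y assume y: "y \<in> D"
    then have y\<Gamma>: "y \<in> \<Gamma>" using domain_subset by blast
    obtain w where w: "w \<in> W" "path_dist E w y < \<delta>" using near[OF y] by blast
    have "q (a (w + \<alpha>)) = q (a (w + \<beta>)) \<and> q (b (w + \<alpha>)) = q (b (w + \<beta>))"
      using fun_cong[OF \<alpha>(3), of w] w(1) by (simp add: col_def)
    then have 1: "cmod (a (w + \<alpha>) - a (w + \<beta>)) \<le> 2 * r" "cmod (b (w + \<alpha>) - b (w + \<beta>)) \<le> 2 * r" using q by auto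
    have pd: "path_dist E (w + g) (y + g) < \<delta>1" "path_dist E (w + g) (y + g) < \<delta>2" if "g \<in> G" for g
      using w(2) path_dist_translate[OF that, of w y] by (auto simp: \<delta>_def)
    have 2: "cmod (a (w + g) - a (y + g)) < r" "cmod (b (w + g) - b (y + g)) < r" if "g \<in> G" for g
      using \<delta>1(2) \<delta>2(2) pd[OF that] \<Gamma>_add[OF W\<Gamma>[OF w(1)] that] \<Gamma>_add[OF y\<Gamma> that] by auto
    have tri4: "cmod (f (y + \<alpha>) - f (y + \<beta>)) \<le> \<eta>"
      if "cmod (f (w + \<alpha>) - f (w + \<beta>)) \<le> 2 * r" "cmod (f (w + \<alpha>) - f (y + \<alpha>)) < r" "cmod (f (w + \<beta>) - f (y + \<beta>)) < r"
      for f :: "plane \<Rightarrow> complex"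
    proof -
      have "cmod (f (y + \<alpha>) - f (y + \<beta>)) \<le> cmod (f (w + \<alpha>) - f (w + \<beta>)) + cmod (f (w + \<alpha>) - f (y + \<alpha>)) + cmod (f (w + \<beta>) - f (y + \<beta>))"
        using norm_triangle_ineq[of "(f (w + \<alpha>) - f (w + \<beta>)) - (f (w + \<alpha>) - f (y + \<alpha>))" "f (w + \<beta>) - f (y + \<beta>)"]
          norm_triangle_ineq4[of "f (w + \<alpha>) - f (w + \<beta>)" "f (w + \<alpha>) - f (y + \<alpha>)"] by simp
      then show ?thesis using that by (simp add: r_def)
    qed
    show "cmod (a (y + \<alpha>) - a (y + \<beta>)) \<le> \<eta> \<and> cmod (b (y + \<alpha>) - b (y + \<beta>)) \<le> \<eta>"
      by (intro conjI tri4 1 2 \<alpha>)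
  qed
  then show ?thesis using fin by (intro exI[of _ \<P>]) (auto simp: \<P>_def)
qed

definition lpair :: "(plane \<Rightarrow> complex) \<times> (plane \<Rightarrow> complex) \<Rightarrow> bool" where
  "lpair t \<longleftrightarrow> (\<exists>h. limit_pair h (fst t) (snd t))"

text \<open>If no finite family of limit pairs approximated all far translates, then neither would it on the members
  of a decreasing sequence of sets of translates with diameters tending to \<open>0\<close>. But such a sequence
  contains a sequence of translates converging to a limit pair, which approximates all of a late member.\<close>

lemma finite_limit_cover:
  assumes \<eta>: "\<And>t. lpair t \<Longrightarrow> \<eta> t > 0"
  shows "\<exists>F r. finite F \<and> (\<forall>t\<in>F. lpair t) \<and>
    (\<forall>\<alpha>\<in>G. norm \<alpha> \<ge> r \<longrightarrow> (\<exists>t\<in>F. close_on_domain (\<eta> t) \<alpha> (fst t) (snd t)))"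
proof -
  define good where "good S \<longleftrightarrow> (\<exists>F r. finite F \<and> (\<forall>t\<in>F. lpair t) \<and>
    (\<forall>\<alpha>\<in>S. norm \<alpha> \<ge> r \<longrightarrow> (\<exists>t\<in>F. close_on_domain (\<eta> t) \<alpha> (fst t) (snd t))))" for S
  have good_Un: "good (S \<union> S')" if "good S" "good S'" for S S'
  proof -
    from that(1) obtain F r where "finite F \<and> (\<forall>t\<in>F. lpair t) \<and>
        (\<forall>\<alpha>\<in>S. norm \<alpha> \<ge> r \<longrightarrow> (\<exists>t\<in>F. close_on_domain (\<eta> t) \<alpha> (fst t) (snd t)))"
      unfolding good_def by (elim exE)
    then have 1: "finite F" "\<forall>t\<in>F. lpair t" "\<forall>\<alpha>\<in>S. norm \<alpha> \<ge> r \<longrightarrow> (\<exists>t\<in>F. close_on_domain (\<eta> t) \<alpha> (fst t) (snd t))"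
      by blast+
    from that(2) obtain F' r' where "finite F' \<and> (\<forall>t\<in>F'. lpair t) \<and>
        (\<forall>\<alpha>\<in>S'. norm \<alpha> \<ge> r' \<longrightarrow> (\<exists>t\<in>F'. close_on_domain (\<eta> t) \<alpha> (fst t) (snd t)))"
      unfolding good_def by (elim exE)
    then have 2: "finite F'" "\<forall>t\<in>F'. lpair t" "\<forall>\<alpha>\<in>S'. norm \<alpha> \<ge> r' \<longrightarrow> (\<exists>t\<in>F'. close_on_domain (\<eta> t) \<alpha> (fst t) (snd t))"
      by blast+
    have "\<exists>t\<in>F \<union> F'. close_on_domain (\<eta> t) \<alpha> (fst t) (snd t)" if "\<alpha> \<in> S \<union> S'" "norm \<alpha> \<ge> max r r'" for \<alpha>
      using 1(3) 2(3) that by (metis UnE UnI1 UnI2 max.bounded_iff)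
    then show ?thesis unfolding good_def using 1 2 by (intro exI[of _ "F \<union> F'"] exI[of _ "max r r'"]) auto
  qed
  have good_Union: "good (\<Union>\<Q>)" if "finite \<Q>" "\<And>S. S \<in> \<Q> \<Longrightarrow> good S" for \<Q>
    using that
  proof (induction \<Q>)
    case empty
    have "good {}" unfolding good_def by (intro exI[of _ "{}"]) simp
    then show ?case by simp
  next
    case (insert S \<Q>)
    then show ?case unfolding Union_insert by (intro good_Un) auto
  qed
  define diam where "diam e S \<longleftrightarrow> (\<forall>\<alpha>\<in>S. \<forall>\<beta>\<in>S. close_on_domain e \<alpha> (\<lambda>y. a (y + \<beta>)) (\<lambda>y. b (y + \<beta>)))" for e S
  have step: "\<exists>S'\<subseteq>S. \<not> good S' \<and> diam e S'" if S: "S \<subseteq> G" "\<not> good S" and e: "e > 0" for S e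
  proof (rule ccontr)
    assume no: "\<not> ?thesis"
    obtain \<P> where P: "finite \<P>" "\<Union>\<P> = G" "\<forall>S\<in>\<P>. diam e S"
      using translates_totally_bounded[OF e] unfolding diam_def by blast
    have "good (S \<inter> P)" if "P \<in> \<P>" for P
    proof -
      have "diam e (S \<inter> P)" using P(3) that unfolding diam_def by blast
      then show ?thesis using no by blast
    qed
    then have "good (\<Union>((\<lambda>P. S \<inter> P) ` \<P>))" using P(1) by (intro good_Union) auto
    moreover have "\<Union>((\<lambda>P. S \<inter> P) ` \<P>) = S" using P(2) S(1) by auto
    ultimately show False using S(2) by simp
  qed
  have "good G"
  proof (rule ccontr)
    assume bad: "\<not> good G"
    have "\<exists>f. \<forall>n. (f n \<subseteq> G \<and> \<not> good (f n)) \<and> (f (Suc n) \<subseteq> f n \<and> diam (1 / (real n + 1)) (f (Suc n)))"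
    proof (rule dependent_nat_choice)
      show "\<exists>S\<subseteq>G. \<not> good S" using bad by blast
      fix S and n :: nat assume S: "S \<subseteq> G \<and> \<not> good S"
      have "1 / (real n + 1) > 0" by simp
      then have "\<exists>S'\<subseteq>S. \<not> good S' \<and> diam (1 / (real n + 1)) S'"
        using S by (intro step[of S]) simp_all
      then obtain S' where "S' \<subseteq> S" "\<not> good S'" "diam (1 / (real n + 1)) S'" by (elim exE conjE)
      with S show "\<exists>S'. (S' \<subseteq> G \<and> \<not> good S') \<and> S' \<subseteq> S \<and> diam (1 / (real n + 1)) S'"
        by (intro exI[of _ S'] conjI subset_trans[of S' S G]) simp_all
    qed
    then obtain f :: "nat \<Rightarrow> plane set" where
      "\<forall>n. (f n \<subseteq> G \<and> \<not> good (f n)) \<and> (f (Suc n) \<subseteq> f n \<and> diam (1 / (real n + 1)) (f (Suc n)))" ..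
    then have f: "\<And>n. f n \<subseteq> G" "\<And>n. \<not> good (f n)" "\<And>n. f (Suc n) \<subseteq> f n" "\<And>n. diam (1 / (real n + 1)) (f (Suc n))"
      by blast+
    have anti: "f m \<subseteq> f n" if "n \<le> m" for m n
      using that by (induction rule: dec_induct) (use f(3) in auto)
    \<comment> \<open>A set of translates without elements of large norm is good for trivial
      reasons, with the empty family.\<close>
    have "\<exists>\<alpha>. \<alpha> \<in> f (Suc n) \<and> norm \<alpha> \<ge> real n" for n
    proof (rule ccontr)
      assume "\<nexists>\<alpha>. \<alpha> \<in> f (Suc n) \<and> norm \<alpha> \<ge> real n"
      then have "good (f (Suc n))" unfolding good_def by (intro exI[of _ "{}"] exI[of _ "real n"]) auto
      then show False using f(2) by blast
    qed
    then obtain h where h: "\<And>n. h n \<in> f (Suc n)" "\<And>n. norm (h n) \<ge> real n" by metis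
    have hf: "h m \<in> f (Suc n)" if "m \<ge> n" for m n using h(1)[of m] anti[of "Suc n" "Suc m"] that by auto
    have hG: "h m \<in> G" for m using h(1) f(1) by blast
    have esc: "h \<in> escaping_seqs G"
      unfolding escaping_seqs_def using hG h(2)
      by (auto intro!: filterlim_at_top_mono[OF filterlim_real_sequentially] always_eventually)
    obtain d where d: "d > 0" "\<And>y. y \<in> D \<Longrightarrow> norm y \<le> d" using domain_bounded by blast
    \<comment> \<open>Small diameter gives closeness on \<open>D\<close> only. A point
      \<open>x\<close> of a bounded region is moved into \<open>D\<close> by a group element of
      bounded norm, and slow oscillation charges \<open>e / 3\<close> for this at each of the two
      translates.\<close>
    have cauchy: "\<exists>m0. \<forall>m\<ge>m0. \<forall>l\<ge>m0. \<forall>x\<in>\<Gamma>. norm x \<le> R \<longrightarrow>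
        cmod (a (x + h m) - a (x + h l)) \<le> e \<and> cmod (b (x + h m) - b (x + h l)) \<le> e" if e: "e > 0" for R e
    proof -
      have e3: "e / 3 > 0" using e by simp
      obtain r1 where r1: "\<And>x \<beta>. x \<in> \<Gamma> \<Longrightarrow> norm x \<ge> r1 \<Longrightarrow> \<beta> \<in> G \<Longrightarrow> norm \<beta> \<le> R + d \<Longrightarrow> cmod (a (x + \<beta>) - a x) \<le> e / 3"
        using SO_uniform[OF a_SO e3, of "R + d"] by blast
      obtain r2 where r2: "\<And>x \<beta>. x \<in> \<Gamma> \<Longrightarrow> norm x \<ge> r2 \<Longrightarrow> \<beta> \<in> G \<Longrightarrow> norm \<beta> \<le> R + d \<Longrightarrow> cmod (b (x + \<beta>) - b x) \<le> e / 3"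
        using SO_uniform[OF b_SO e3, of "R + d"] by blast
      obtain n where n: "3 / e \<le> real n" using real_arch_simple by blast
      have "1 / (real n + 1) \<le> 1 / (3 / e)" using n e by (intro divide_left_mono) auto
      then have n3: "1 / (real n + 1) \<le> e / 3" by simp
      obtain n' where n': "max r1 r2 + d \<le> real n'" using real_arch_simple by blast
      have "cmod (a (x + h m) - a (x + h l)) \<le> e \<and> cmod (b (x + h m) - b (x + h l)) \<le> e"
        if ml: "m \<ge> max n n'" "l \<ge> max n n'" and x: "x \<in> \<Gamma>" "norm x \<le> R" for m l x
      proof -
        obtain y g where y: "y \<in> D" "g \<in> G" "x = y + g" using domain_cover[OF x(1)] by blast
        have y\<Gamma>: "y \<in> \<Gamma>" using y(1) domain_subset by blast
        have g: "norm g \<le> R + d" using x(2) d(2)[OF y(1)] norm_triangle_ineq4[of x y] y(3) by simp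
        have far: "norm (y + h m) \<ge> max r1 r2" if "m \<ge> n'" for m
        proof -
          have "norm (h m) \<le> norm (y + h m) + norm y" using norm_triangle_ineq4[of "y + h m" y] by simp
          moreover have "real n' \<le> real m" using that by simp
          ultimately show ?thesis using h(2)[of m] n' d(2)[OF y(1)] by linarith
        qed
        have "close_on_domain (1 / (real n + 1)) (h m) (\<lambda>y. a (y + h l)) (\<lambda>y. b (y + h l))"
          using f(4)[of n] hf ml unfolding diam_def by simp
        then have c: "cmod (a (y + h m) - a (y + h l)) \<le> e / 3" "cmod (b (y + h m) - b (y + h l)) \<le> e / 3"
          using n3 y(1) unfolding close_on_domain_def by (meson order.trans)+
        have t3: "cmod (q1 - q2) \<le> e" if "cmod (q1 - p1) \<le> e / 3" "cmod (q2 - p2) \<le> e / 3" "cmod (p1 - p2) \<le> e / 3" for q1 q2 p1 p2 :: complex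
        proof -
          have "cmod (q1 - q2) \<le> cmod (q1 - p1) + cmod (p1 - p2) + cmod (q2 - p2)"
            using norm_triangle_ineq[of "(q1 - p1) + (p1 - p2)" "p2 - q2"] norm_triangle_ineq[of "q1 - p1" "p1 - p2"]
            by (simp add: norm_minus_commute)
          then show ?thesis using that by linarith
        qed
        have sw: "x + h m = (y + h m) + g" for m using y(3) by (simp add: algebra_simps)
        have lo: "cmod (a (x + h m) - a (y + h m)) \<le> e / 3" "cmod (b (x + h m) - b (y + h m)) \<le> e / 3" if "m \<ge> n'" for m
          unfolding sw using r1[OF \<Gamma>_add[OF y\<Gamma> hG] _ y(2) g] r2[OF \<Gamma>_add[OF y\<Gamma> hG] _ y(2) g] far[OF that] by auto
        have "m \<ge> n'" "l \<ge> n'" using ml by simp_all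
        then show ?thesis by (intro conjI t3[OF lo(1) lo(1) c(1)] t3[OF lo(2) lo(2) c(2)])
      qed
      then show ?thesis by blast
    qed
    have conv: "convergent (\<lambda>m. a (x + h m))" "convergent (\<lambda>m. b (x + h m))" if x: "x \<in> \<Gamma>" for x
    proof -
      have "\<exists>m0. \<forall>m\<ge>m0. \<forall>l\<ge>m0. cmod (a (x + h m) - a (x + h l)) < e"
        "\<exists>m0. \<forall>m\<ge>m0. \<forall>l\<ge>m0. cmod (b (x + h m) - b (x + h l)) < e" if e: "e > 0" for e
      proof -
        obtain m0 where m0: "\<forall>m\<ge>m0. \<forall>l\<ge>m0. \<forall>z\<in>\<Gamma>. norm z \<le> norm x \<longrightarrow>
            cmod (a (z + h m) - a (z + h l)) \<le> e / 2 \<and> cmod (b (z + h m) - b (z + h l)) \<le> e / 2"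
          using cauchy[OF half_gt_zero[OF e], of "norm x"] ..
        have le: "cmod (a (x + h m) - a (x + h l)) \<le> e / 2" "cmod (b (x + h m) - b (x + h l)) \<le> e / 2"
          if "m \<ge> m0" "l \<ge> m0" for m l
          using m0[rule_format, OF that x order_refl] by simp_all
        have "e / 2 < e" using e by simp
        note lt = order.strict_trans1[OF le(1) this] order.strict_trans1[OF le(2) this]
        show "\<exists>m0. \<forall>m\<ge>m0. \<forall>l\<ge>m0. cmod (a (x + h m) - a (x + h l)) < e"
          "\<exists>m0. \<forall>m\<ge>m0. \<forall>l\<ge>m0. cmod (b (x + h m) - b (x + h l)) < e"
          by (intro exI[of _ m0] allI impI lt; assumption)+
      qed
      then have "Cauchy (\<lambda>m. a (x + h m))" "Cauchy (\<lambda>m. b (x + h m))" by (auto intro!: CauchyI)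
      then show "convergent (\<lambda>m. a (x + h m))" "convergent (\<lambda>m. b (x + h m))" by (simp_all add: Cauchy_convergent_iff)
    qed
    define a' where "a' x = lim (\<lambda>m. a (x + h m))" for x
    define b' where "b' x = lim (\<lambda>m. b (x + h m))" for x
    have limab: "(\<lambda>m. a (x + h m)) \<longlonglongrightarrow> a' x" "(\<lambda>m. b (x + h m)) \<longlonglongrightarrow> b' x" if "x \<in> \<Gamma>" for x
      using conv[OF that] by (simp_all add: a'_def b'_def convergent_LIMSEQ_iff)
    have lp: "limit_pair h a' b'" unfolding limit_pair_def
    proof (intro conjI allI impI esc)
      fix R e :: real assume "e > 0"
      then obtain m0 where m0: "\<forall>m\<ge>m0. \<forall>l\<ge>m0. \<forall>x\<in>\<Gamma>. norm x \<le> R \<longrightarrow>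
        cmod (a (x + h m) - a (x + h l)) \<le> e \<and> cmod (b (x + h m) - b (x + h l)) \<le> e" using cauchy by blast
      have "cmod (a (x + h m) - a' x) \<le> e \<and> cmod (b (x + h m) - b' x) \<le> e" if "m \<ge> m0" "x \<in> \<Gamma>" "norm x \<le> R" for m x
      proof
        have "(\<lambda>l. cmod (a (x + h m) - a (x + h l))) \<longlonglongrightarrow> cmod (a (x + h m) - a' x)"
          by (intro tendsto_intros limab that)
        then show "cmod (a (x + h m) - a' x) \<le> e" by (rule LIMSEQ_le_const2) (use m0 that in blast)
        have "(\<lambda>l. cmod (b (x + h m) - b (x + h l))) \<longlonglongrightarrow> cmod (b (x + h m) - b' x)"
          by (intro tendsto_intros limab that)
        then show "cmod (b (x + h m) - b' x) \<le> e" by (rule LIMSEQ_le_const2) (use m0 that in blast)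
      qed
      then show "\<exists>m0. \<forall>m\<ge>m0. \<forall>x\<in>\<Gamma>. norm x \<le> R \<longrightarrow> cmod (a (x + h m) - a' x) \<le> e \<and> cmod (b (x + h m) - b' x) \<le> e" by blast
    qed
    define t where "t = (a', b')"
    have lt: "lpair t" unfolding lpair_def t_def using lp by auto
    define e where "e = \<eta> t"
    have e: "e > 0" unfolding e_def by (rule \<eta>[OF lt])
    obtain m0 where m0: "\<And>m x. m \<ge> m0 \<Longrightarrow> x \<in> \<Gamma> \<Longrightarrow> norm x \<le> d \<Longrightarrow> cmod (a (x + h m) - a' x) \<le> e / 2 \<and> cmod (b (x + h m) - b' x) \<le> e / 2"
      using lp e unfolding limit_pair_def by (metis half_gt_zero)
    obtain n where n: "2 / e \<le> real n" using real_arch_simple by blast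
    have "1 / (real n + 1) \<le> 1 / (2 / e)" using n e by (intro divide_left_mono) auto
    then have n2: "1 / (real n + 1) \<le> e / 2" by simp
    \<comment> \<open>The limit pair serves every member of \<open>f (Suc n)\<close>, not only the
      sequence: the diameter leads from \<open>\<alpha>\<close> to a late \<open>h ?m\<close>, and
      convergence leads from there to the limit, at \<open>e / 2\<close> each.\<close>
    have "close_on_domain (\<eta> t) \<alpha> (fst t) (snd t)" if \<alpha>: "\<alpha> \<in> f (Suc n)" for \<alpha>
      unfolding close_on_domain_def
    proof
      fix y assume y: "y \<in> D"
      let ?m = "max n m0"
      have "close_on_domain (1 / (real n + 1)) \<alpha> (\<lambda>y. a (y + h ?m)) (\<lambda>y. b (y + h ?m))"
        using f(4)[of n] \<alpha> hf[of n ?m] unfolding diam_def by simp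
      then have 1: "cmod (a (y + \<alpha>) - a (y + h ?m)) \<le> e / 2" "cmod (b (y + \<alpha>) - b (y + h ?m)) \<le> e / 2"
        using n2 y unfolding close_on_domain_def by (meson order.trans)+
      have 2: "cmod (a (y + h ?m) - a' y) \<le> e / 2" "cmod (b (y + h ?m) - b' y) \<le> e / 2"
        using m0[of ?m y] y domain_subset d(2) by auto
      show "cmod (a (y + \<alpha>) - fst t y) \<le> \<eta> t \<and> cmod (b (y + \<alpha>) - snd t y) \<le> \<eta> t"
        using norm_triangle_ineq[of "a (y + \<alpha>) - a (y + h ?m)" "a (y + h ?m) - a' y"]
          norm_triangle_ineq[of "b (y + \<alpha>) - b (y + h ?m)" "b (y + h ?m) - b' y"] 1 2
        by (simp add: t_def e_def[symmetric, unfolded t_def])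
    qed
    then have "good (f (Suc n))" unfolding good_def using lt by (intro exI[of _ "{t}"] exI[of _ 0]) auto
    then show False using f(2) by blast
  qed
  then show ?thesis unfolding good_def .
qed

text \<open>From the domain to large balls: points of the ball are moved into the translate of
  \<open>D\<close> by \<open>\<alpha>\<close> using group elements of bounded norm. By slow
  oscillation this hardly changes \<open>a\<close> and \<open>b\<close>, and it leaves the periodic
  limit coefficients as they are. Moving and approximating cost one \<open>\<eta> t\<close> each,
  hence the factor \<open>2\<close>.\<close>

lemma limit_cover_balls:
  assumes F: "finite F" "\<And>t. t \<in> F \<Longrightarrow> lpair t" "\<And>t. t \<in> F \<Longrightarrow> \<eta> t > 0"
    and cov: "\<And>\<alpha>. \<alpha> \<in> G \<Longrightarrow> norm \<alpha> \<ge> r \<Longrightarrow> \<exists>t\<in>F. close_on_domain (\<eta> t) \<alpha> (fst t) (snd t)"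
  shows "\<exists>R. \<forall>x. norm x \<ge> R \<longrightarrow> \<Gamma> \<inter> ball x L \<noteq> {} \<longrightarrow>
    (\<exists>t\<in>F. \<forall>z\<in>\<Gamma> \<inter> ball x L. cmod (a z - fst t z) \<le> 2 * \<eta> t \<and> cmod (b z - snd t z) \<le> 2 * \<eta> t)"
proof -
  \<comment> \<open>Slow oscillation needs one tolerance for all pairs; the \<open>1\<close>
    provides a value if \<open>F\<close> is empty.\<close>
  define \<eta>0 where "\<eta>0 = Min (insert 1 (\<eta> ` F))"
  have \<eta>0: "\<eta>0 > 0" "\<And>t. t \<in> F \<Longrightarrow> \<eta>0 \<le> \<eta> t" unfolding \<eta>0_def using F by auto
  obtain d where d: "d > 0" "\<And>y. y \<in> D \<Longrightarrow> norm y \<le> d" using domain_bounded by blast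
  obtain r1 where r1: "\<And>x \<beta>. x \<in> \<Gamma> \<Longrightarrow> norm x \<ge> r1 \<Longrightarrow> \<beta> \<in> G \<Longrightarrow> norm \<beta> \<le> 2 * L + 2 * d \<Longrightarrow> cmod (a (x + \<beta>) - a x) \<le> \<eta>0"
    using SO_uniform[OF a_SO \<eta>0(1), of "2 * L + 2 * d"] by blast
  obtain r2 where r2: "\<And>x \<beta>. x \<in> \<Gamma> \<Longrightarrow> norm x \<ge> r2 \<Longrightarrow> \<beta> \<in> G \<Longrightarrow> norm \<beta> \<le> 2 * L + 2 * d \<Longrightarrow> cmod (b (x + \<beta>) - b x) \<le> \<eta>0"
    using SO_uniform[OF b_SO \<eta>0(1), of "2 * L + 2 * d"] by blast
  define R where "R = max r (max r1 r2) + L + 2 * d"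
  have "\<exists>t\<in>F. \<forall>z\<in>\<Gamma> \<inter> ball x L. cmod (a z - fst t z) \<le> 2 * \<eta> t \<and> cmod (b z - snd t z) \<le> 2 * \<eta> t"
    if x: "norm x \<ge> R" "\<Gamma> \<inter> ball x L \<noteq> {}" for x
  proof -
    obtain z0 where z0: "z0 \<in> \<Gamma>" "dist x z0 < L" using x(2) by auto
    obtain y0 \<alpha> where y0: "y0 \<in> D" "\<alpha> \<in> G" "z0 = y0 + \<alpha>" using domain_cover[OF z0(1)] by blast
    have n0: "norm \<alpha> \<ge> norm x - L - d"
      using z0(2) d(2)[OF y0(1)] norm_triangle_ineq[of "x - z0" z0] norm_triangle_ineq[of y0 \<alpha>] y0(3) by (simp add: dist_norm)
    then have "norm \<alpha> \<ge> r" using x(1) d(1) unfolding R_def by linarith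
    then obtain t where t: "t \<in> F" "close_on_domain (\<eta> t) \<alpha> (fst t) (snd t)"
      using cov[OF y0(2)] by blast
    obtain h where h: "limit_pair h (fst t) (snd t)" using F(2)[OF t(1)] by (auto simp: lpair_def)
    have "cmod (a z - fst t z) \<le> 2 * \<eta> t \<and> cmod (b z - snd t z) \<le> 2 * \<eta> t" if z: "z \<in> \<Gamma> \<inter> ball x L" for z
    proof -
      have z\<Gamma>: "z \<in> \<Gamma>" using z by blast
      obtain y \<gamma> where y: "y \<in> D" "\<gamma> \<in> G" "z = y + \<gamma>" using domain_cover[OF z\<Gamma>] by blast
      have y\<Gamma>: "y \<in> \<Gamma>" using y(1) domain_subset by blast
      define \<beta> where "\<beta> = \<gamma> - \<alpha>"
      have \<beta>: "\<beta> \<in> G" unfolding \<beta>_def by (rule G_diff[OF y(2) y0(2)])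
      have "\<beta> = (z - x) + (x - z0) + (y0 - y)" by (simp add: \<beta>_def y(3) y0(3))
      then have "norm \<beta> \<le> norm (z - x) + norm (x - z0) + (norm y0 + norm y)"
        using norm_triangle_ineq[of "(z - x) + (x - z0)" "y0 - y"] norm_triangle_ineq[of "z - x" "x - z0"]
          norm_triangle_ineq4[of y0 y] by simp
      moreover have "norm (z - x) < L" "norm (x - z0) < L" using z z0(2) by (auto simp: dist_norm norm_minus_commute)
      ultimately have n\<beta>: "norm \<beta> \<le> 2 * L + 2 * d" using d(2)[OF y(1)] d(2)[OF y0(1)] by linarith
      have "norm (y + \<alpha>) \<ge> norm \<alpha> - d" using norm_triangle_ineq4[of "y + \<alpha>" y] d(2)[OF y(1)] by simp
      then have far: "norm (y + \<alpha>) \<ge> r1" "norm (y + \<alpha>) \<ge> r2" using n0 x(1) by (auto simp: R_def)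
      have zz: "z = (y + \<alpha>) + \<beta>" by (simp add: \<beta>_def y(3))
      have 1: "cmod (a z - a (y + \<alpha>)) \<le> \<eta> t" "cmod (b z - b (y + \<alpha>)) \<le> \<eta> t"
        unfolding zz using r1[OF \<Gamma>_add[OF y\<Gamma> y0(2)] far(1) \<beta> n\<beta>] r2[OF \<Gamma>_add[OF y\<Gamma> y0(2)] far(2) \<beta> n\<beta>] \<eta>0(2)[OF t(1)] by linarith+
      have 2: "cmod (a (y + \<alpha>) - fst t y) \<le> \<eta> t" "cmod (b (y + \<alpha>) - snd t y) \<le> \<eta> t"
        using t(2) y(1) unfolding close_on_domain_def by auto
      have 3: "fst t z = fst t y" "snd t z = snd t y" unfolding y(3) using limit_pair_coeff(3,4)[OF h y\<Gamma> y(2)] by auto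
      show ?thesis unfolding 3
        using norm_triangle_ineq[of "a z - a (y + \<alpha>)" "a (y + \<alpha>) - fst t y"]
          norm_triangle_ineq[of "b z - b (y + \<alpha>)" "b (y + \<alpha>) - snd t y"] 1 2 by simp
    qed
    then show ?thesis using t(1) by blast
  qed
  then show ?thesis by blast
qed

end

section \<open>Approximation by operators of finite rank\<close>

definition cell :: "real \<Rightarrow> plane \<Rightarrow> int \<times> int" where
  "cell s x = (\<lfloor>x $ 1 / s\<rfloor>, \<lfloor>x $ 2 / s\<rfloor>)"

text \<open>For positive \<open>s\<close>, the lower left corner of the grid square with index
  \<open>q\<close>.\<close>

definition gridpt :: "real \<Rightarrow> int \<times> int \<Rightarrow> plane" where
  "gridpt s q = vector [s * of_int (fst q), s * of_int (snd q)]"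

lemma cell_sets: "{x. cell s x \<in> Q} \<in> sets borel"
proof -
  have [measurable]: "(\<lambda>x::plane. x $ k / s) \<in> borel_measurable borel" for k
    by (intro borel_measurable_continuous_onI) (cases "s = 0"; auto intro!: continuous_intros)
  have "{x \<in> space borel. \<lfloor>x $ 1 / s\<rfloor> = i \<and> \<lfloor>x $ 2 / s\<rfloor> = j} \<in> sets borel" for i j by measurable
  then have "(\<Union>q\<in>Q. {x. cell s x = q}) \<in> sets borel"
    by (intro sets.countable_UN' countableI_type) (auto simp: cell_def prod_eq_iff)
  moreover have "(\<Union>q\<in>Q. {x. cell s x = q}) = {x. cell s x \<in> Q}" by auto
  ultimately show ?thesis by simp
qed

lemma cell_measurable: "cell s \<in> measurable borel (count_space UNIV)"
proof (rule measurableI)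
  fix A :: "(int \<times> int) set"
  have "cell s -` A \<inter> space borel = {x. cell s x \<in> A}" by auto
  then show "cell s -` A \<inter> space borel \<in> sets borel" using cell_sets by simp
qed simp

lemma gridpt_cell_measurable [measurable]: "(\<lambda>x. gridpt s (cell s x)) \<in> borel_measurable borel"
  by (rule measurable_compose[OF cell_measurable]) simp

lemma dist_gridpt:
  assumes "s > 0" shows "norm (x - gridpt s (cell s x)) < 2 * s"
proof -
  have *: "0 \<le> t - s * of_int \<lfloor>t / s\<rfloor> \<and> t - s * of_int \<lfloor>t / s\<rfloor> < s" for t :: real
  proof -
    have "of_int \<lfloor>t / s\<rfloor> * s \<le> t" "t < (of_int \<lfloor>t / s\<rfloor> + 1) * s"
      using assms by (rule floor_divide_lower, rule floor_divide_upper)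
    then show ?thesis by (simp add: algebra_simps)
  qed
  have "norm (x - gridpt s (cell s x)) \<le> (\<Sum>i\<in>UNIV. \<bar>(x - gridpt s (cell s x)) $ i\<bar>)" by (rule norm_le_l1_cart)
  also have "\<dots> < 2 * s" using *[of "x $ 1"] *[of "x $ 2"] by (simp add: sum_2 gridpt_def cell_def)
  finally show ?thesis .
qed

lemma finite_cells:
  assumes "S \<subseteq> ball 0 R" "s > 0" shows "finite (cell s ` S)"
proof -
  have "cell s ` S \<subseteq> {\<lfloor>- R / s\<rfloor>..\<lfloor>R / s\<rfloor>} \<times> {\<lfloor>- R / s\<rfloor>..\<lfloor>R / s\<rfloor>}"
  proof
    fix q assume "q \<in> cell s ` S"
    then obtain x where x: "x \<in> S" "q = cell s x" by blast
    have "- R \<le> x $ i" "x $ i \<le> R" for i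
      using x(1) assms(1) component_le_norm_cart[of x i] by fastforce+
    then have "- R / s \<le> x $ i / s" "x $ i / s \<le> R / s" for i
      using assms(2) by (intro divide_right_mono; simp)+
    then show "q \<in> {\<lfloor>- R / s\<rfloor>..\<lfloor>R / s\<rfloor>} \<times> {\<lfloor>- R / s\<rfloor>..\<lfloor>R / s\<rfloor>}"
      unfolding x(2) cell_def mem_Times_iff fst_conv snd_conv atLeastAtMost_iff by (intro conjI floor_mono)
  qed
  then show ?thesis by (rule finite_subset) simp
qed

context Lp_space
begin

lemma Lp_integrable_on_finite:
  assumes u: "u \<in> LP" and A: "A \<in> sets M" "emeasure M A < \<infinity>"
  shows "integrable M (\<lambda>x. indicator A x * u x)"
proof -
  have [measurable]: "u \<in> borel_measurable M" "A \<in> sets M" using u A Lp_measurable by auto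
  have le1: "t \<le> 1 + t powr p" if "t \<ge> 0" for t :: real
  proof (cases "t \<le> 1")
    case False
    then show ?thesis using powr_mono[of 1 p t] p that by simp
  qed (auto intro: add_increasing2)
  have iu: "integrable M (\<lambda>y. cmod (u y) powr p)" using u by (simp add: Lp_set_def)
  have iA: "integrable M (indicator A :: 'a \<Rightarrow> real)" using A by (intro integrable_real_indicator) auto
  show ?thesis
  proof (rule Bochner_Integration.integrable_bound[OF Bochner_Integration.integrable_add[OF iA iu]])
    show "AE x in M. norm (indicator A x * u x) \<le> norm (indicator A x + cmod (u x) powr p)"
      using le1[OF norm_ge_zero] by (intro AE_I2) (auto simp: indicator_def)
  qed measurable
qed

lemma indicator_LP:
  assumes A: "A \<in> sets M" "emeasure M A < \<infinity>"
  shows "(indicator A :: 'a \<Rightarrow> complex) \<in> LP"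
proof -
  have "(\<lambda>x. cmod (indicator A x) powr p) = indicator A" by (auto simp: indicator_def)
  moreover have "integrable M (indicator A :: 'a \<Rightarrow> real)" using A by (intro integrable_real_indicator) auto
  ultimately show ?thesis using A(1) by (simp add: Lp_set_def borel_measurable_indicator)
qed

end

context convolution_operator
begin

text \<open>On a compact ball this is uniform continuity, the weight being bounded below there;
  farther out both values of \<open>k\<close> are small. The weight on the right turns the change of
  the argument into a kernel with small constant.\<close>

lemma k_uniform:
  assumes \<eta>: "\<eta> > 0"
  shows "\<exists>\<delta>>0. \<forall>z z'. norm (z - z') \<le> \<delta> \<longrightarrow> cmod (k z - k z') \<le> \<eta> * w z"
proof -
  \<comment> \<open>For \<open>norm z \<ge> 1\<close>, a displacement by at most \<open>1\<close>
    diminishes \<open>1 + norm z\<close> at most by the factor \<open>1/2\<close>, so the weight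
    grows at most by the factor \<open>c\<close>.\<close>
  define c where "c = (1/2::real) powr (- 2 - \<epsilon> / 2)"
  have c: "c > 0" by (simp add: c_def)
  define \<eta>' where "\<eta>' = \<eta> / (1 + c)"
  have \<eta>': "\<eta>' > 0" "\<eta>' * (1 + c) = \<eta>" using \<eta> c by (simp_all add: \<eta>'_def)
  obtain R where R: "R > 0" "\<And>z. norm z \<ge> R \<Longrightarrow> cmod (k z) \<le> \<eta>' * w z" using k_decay[OF \<eta>'(1)] by blast
  define wm where "wm = (2 + R) powr (- 2 - \<epsilon> / 2)"
  have wm: "wm > 0" using R(1) by (simp add: wm_def)
  have "uniformly_continuous_on (cball 0 (R + 2)) k"
    by (intro compact_uniformly_continuous continuous_on_subset[OF k_cont]) auto
  moreover have "\<eta> * wm > 0" using \<eta> wm by simp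
  ultimately have "\<exists>d>0. \<forall>z\<in>cball 0 (R + 2). \<forall>z'\<in>cball 0 (R + 2). dist z' z < d \<longrightarrow> dist (k z') (k z) < \<eta> * wm"
    unfolding uniformly_continuous_on_def by (elim allE impE)
  then obtain d where d: "d > 0"
    and dk: "\<forall>z\<in>cball 0 (R + 2). \<forall>z'\<in>cball 0 (R + 2). dist z' z < d \<longrightarrow> dist (k z') (k z) < \<eta> * wm"
    by (elim exE conjE)
  have "cmod (k z - k z') \<le> \<eta> * w z" if z: "norm (z - z') \<le> min 1 (d / 2)" for z z'
  proof (cases "norm z \<ge> R + 1")
    case True
    have z': "norm z' \<ge> norm z - 1" using z norm_triangle_ineq2[of z "z - z'"] by simp
    have "w z' \<le> c * w z"
    proof -
      have "(1 + norm z') powr (- 2 - \<epsilon> / 2) \<le> (1/2 * (1 + norm z)) powr (- 2 - \<epsilon> / 2)"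
        using z' \<epsilon> True R(1) by (intro powr_mono2') auto
      also have "\<dots> = c * (1 + norm z) powr (- 2 - \<epsilon> / 2)" unfolding c_def by (rule powr_mult)
      finally show ?thesis by (simp add: weight_def)
    qed
    then have "\<eta>' * w z' \<le> \<eta>' * (c * w z)" using \<eta>'(1) by (intro mult_left_mono) auto
    then have "cmod (k z - k z') \<le> \<eta>' * w z + \<eta>' * (c * w z)"
      using R(2)[of z] R(2)[of z'] True z' norm_triangle_ineq4[of "k z" "k z'"] by linarith
    also have "\<dots> = (\<eta>' * (1 + c)) * w z" by (simp add: algebra_simps)
    finally show ?thesis by (simp only: \<eta>'(2))
  next
    case False
    have "norm z' \<le> norm z + 1" using z norm_triangle_ineq2[of z' z] by (simp add: norm_minus_commute)
    then have "dist (k z') (k z) < \<eta> * wm" using False z d dk by (auto simp: dist_norm norm_minus_commute)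
    moreover have "wm \<le> w z" unfolding wm_def weight_def using False \<epsilon> by (intro powr_mono2') (auto simp: add_pos_nonneg)
    then have "\<eta> * wm \<le> \<eta> * w z" using \<eta> by (intro mult_left_mono) auto
    ultimately show ?thesis by (simp add: dist_norm norm_minus_commute)
  qed
  then show ?thesis using d by (intro exI[of _ "min 1 (d / 2)"]) auto
qed

text \<open>As the weight is at most \<open>1\<close> and \<open>p > 1\<close>, its
  \<open>p\<close>-th power is dominated by the weight itself, which is integrable.\<close>

lemma k_translate_LP: "(\<lambda>x. k (x - z)) \<in> LP"
proof -
  have m: "(\<lambda>x. k (x - z)) \<in> borel_measurable M" by (rule borel_measurable_M) measurable
  have w1: "w z \<le> 1" for z
    unfolding weight_def using \<epsilon> powr_mono2'[of "- 2 - \<epsilon> / 2" 1 "1 + norm z"] by simp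
  have "(\<integral>\<^sup>+x. ennreal (cmod (k (x - z)) powr p) \<partial>M) \<le> (\<integral>\<^sup>+x. ennreal (C0 powr p) * ennreal (w (x - z)) \<partial>M)"
  proof (rule nn_integral_mono)
    fix x
    have "cmod (k (x - z)) powr p \<le> (C0 * w (x - z)) powr p"
      using k_kernel p_gt by (intro powr_mono2) (auto simp: kernel_def)
    also have "\<dots> = C0 powr p * w (x - z) powr p" by (rule powr_mult)
    also have "w (x - z) powr p \<le> w (x - z) powr 1"
      using p_gt w1 less_imp_le[OF weight_pos] by (intro powr_mono') auto
    also have "w (x - z) powr 1 = w (x - z)" using weight_pos[of "\<epsilon> / 2" "x - z"] by simp
    finally have "cmod (k (x - z)) powr p \<le> C0 powr p * w (x - z)" by (simp add: mult_left_mono)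
    then show "ennreal (cmod (k (x - z)) powr p) \<le> ennreal (C0 powr p) * ennreal (w (x - z))"
      using less_imp_le[OF weight_pos] by (simp add: ennreal_mult[symmetric] ennreal_leI)
  qed
  also have "\<dots> = ennreal (C0 powr p) * (\<integral>\<^sup>+x. ennreal (w (x - z)) \<partial>M)" by (rule nn_integral_cmult) measurable
  also have "\<dots> \<le> ennreal (C0 powr p) * ennreal K" by (intro mult_left_mono K') auto
  also have "\<dots> = ennreal (((C0 powr p * K) powr (1 / p)) powr p)"
    using C0 K(1) p_gt by (simp add: ennreal_mult[symmetric] powr_powr)
  finally show ?thesis by (rule LpI(1)[OF p0 m powr_ge_zero])
qed

text \<open>Replacing \<open>y\<close> by the corner of its grid square turns the kernel into a
  finite sum of products of a function of \<open>x\<close> and a function of \<open>y\<close>,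
  because the bounded set \<open>S\<close> meets finitely many squares. The error kernel is small by
  \<open>k_uniform\<close>.\<close>

lemma finite_rank_right:
  assumes S: "S \<in> sets M" "S \<subseteq> ball 0 R" and \<eta>: "\<eta> > 0"
  shows "\<exists>\<Phi> F. blin \<Phi> \<and> finite F \<and> F \<subseteq> LP \<and> (\<forall>u\<in>LP. \<Phi> u \<in> fun_vs.span F) \<and>
    (\<forall>u\<in>LP. NP (T (indicator S * u) - \<Phi> u) \<le> \<eta> * NP u)"
proof -
  define e where "e = \<eta> / K"
  have e: "e > 0" using \<eta> K by (simp add: e_def)
  obtain \<delta> where \<delta>: "\<delta> > 0" "\<And>z z'. norm (z - z') \<le> \<delta> \<Longrightarrow> cmod (k z - k z') \<le> e * w z" using k_uniform[OF e] by blast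
  define s where "s = \<delta> / 2"
  have s: "s > 0" using \<delta> by (simp add: s_def)
  define \<pi> where "\<pi> y = gridpt s (cell s y)" for y
  have \<pi>: "norm (y - \<pi> y) \<le> \<delta>" for y using dist_gridpt[OF s, of y] by (simp add: \<pi>_def s_def)
  have [measurable]: "\<pi> \<in> borel_measurable borel" unfolding \<pi>_def[abs_def] by measurable
  have Sb: "S \<in> sets borel" using S(1) by (simp add: sets_M_iff)
  have [measurable]: "(indicator S :: plane \<Rightarrow> complex) \<in> borel_measurable borel" using Sb by (rule borel_measurable_indicator)
  define \<kappa>1 where "\<kappa>1 x y = k (x - y) * indicator S y" for x y
  define \<kappa>2 where "\<kappa>2 x y = k (x - \<pi> y) * indicator S y" for x y
  have k1: "kernel C0 \<kappa>1" unfolding kernel_def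
  proof (intro conjI allI)
    show "(\<lambda>(x, y). \<kappa>1 x y) \<in> borel_measurable (borel \<Otimes>\<^sub>M borel)" unfolding \<kappa>1_def by measurable
    show "cmod (\<kappa>1 x y) \<le> C0 * w (x - y)" for x y
      using k_kernel C0 less_imp_le[OF weight_pos] by (auto simp: kernel_def \<kappa>1_def indicator_def)
  qed
  have k12: "kernel e (\<lambda>x y. \<kappa>1 x y - \<kappa>2 x y)" unfolding kernel_def
  proof (intro conjI allI)
    show "(\<lambda>(x, y). \<kappa>1 x y - \<kappa>2 x y) \<in> borel_measurable (borel \<Otimes>\<^sub>M borel)" unfolding \<kappa>1_def \<kappa>2_def by measurable
    fix x y
    have "norm ((x - y) - (x - \<pi> y)) \<le> \<delta>" using \<pi>[of y] by (simp add: norm_minus_commute)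
    then show "cmod (\<kappa>1 x y - \<kappa>2 x y) \<le> e * w (x - y)"
      using \<delta>(2)[of "x - y" "x - \<pi> y"] e less_imp_le[OF weight_pos] by (auto simp: \<kappa>1_def \<kappa>2_def indicator_def)
  qed
  have k2: "kernel (C0 + e) \<kappa>2" unfolding kernel_def
  proof (intro conjI allI)
    show "(\<lambda>(x, y). \<kappa>2 x y) \<in> borel_measurable (borel \<Otimes>\<^sub>M borel)" unfolding \<kappa>2_def by measurable
    fix x y
    have "cmod (\<kappa>1 x y) \<le> C0 * w (x - y)" "cmod (\<kappa>1 x y - \<kappa>2 x y) \<le> e * w (x - y)" using k1 k12 by (auto simp: kernel_def)
    then show "cmod (\<kappa>2 x y) \<le> (C0 + e) * w (x - y)"
      using norm_triangle_ineq4[of "\<kappa>1 x y" "\<kappa>1 x y - \<kappa>2 x y"] by (simp add: distrib_right)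
  qed
  have C0e: "C0 + e > 0" using C0 e by simp
  have TS: "T (indicator S * u) = Kop \<kappa>1 u" for u
    by (simp add: T_eq Kop_def \<kappa>1_def fun_ops fun_eq_iff mult.assoc)
  have near: "NP (T (indicator S * u) - Kop \<kappa>2 u) \<le> \<eta> * NP u" if u: "u \<in> LP" for u
    unfolding TS Kop_kernel_diff[OF k1 C0 k2 C0e u] using Kop_mem(2)[OF k12 e u] K(1) by (simp add: e_def)
  define Q where "Q = cell s ` S"
  have Q: "finite Q" unfolding Q_def by (rule finite_cells[OF S(2) s])
  define Sq where "Sq q = S \<inter> {y. cell s y = q}" for q
  have Sq: "Sq q \<in> sets M" "emeasure M (Sq q) < \<infinity>" for q
  proof -
    have "{y. cell s y \<in> {q}} \<in> sets borel" by (rule cell_sets)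
    then show *: "Sq q \<in> sets M" using S(1) by (auto simp: Sq_def sets_M_iff)
    have "emeasure M (Sq q) \<le> emeasure M (\<Gamma> \<inter> ball 0 R)"
      using S * by (intro emeasure_mono ball_sets) (auto simp: Sq_def sets_M_iff)
    then show "emeasure M (Sq q) < \<infinity>" using bounded_emeasure order.strict_trans1 by blast
  qed
  define F where "F = (\<lambda>q x. k (x - gridpt s q)) ` Q"
  have span: "Kop \<kappa>2 u \<in> fun_vs.span F" if u: "u \<in> LP" for u
  proof -
    have "Kop \<kappa>2 u = (\<Sum>q\<in>Q. scl (\<integral>y. indicator (Sq q) y * u y \<partial>M) (\<lambda>x. k (x - gridpt s q)))"
    proof
      fix x
      have "\<kappa>2 x y * u y = (\<Sum>q\<in>Q. k (x - gridpt s q) * (indicator (Sq q) y * u y))" for y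
      proof (cases "y \<in> S")
        case True
        have "(\<Sum>q\<in>Q. k (x - gridpt s q) * (indicator (Sq q) y * u y))
            = (\<Sum>q\<in>{cell s y}. k (x - gridpt s q) * (indicator (Sq q) y * u y))"
          using True Q by (intro sum.mono_neutral_right) (auto simp: Q_def Sq_def)
        then show ?thesis using True by (simp add: \<kappa>2_def \<pi>_def Sq_def)
      qed (simp add: \<kappa>2_def Sq_def)
      then have "Kop \<kappa>2 u x = (\<integral>y. (\<Sum>q\<in>Q. k (x - gridpt s q) * (indicator (Sq q) y * u y)) \<partial>M)"
        unfolding Kop_def by (simp only:)
      also have "\<dots> = (\<Sum>q\<in>Q. \<integral>y. k (x - gridpt s q) * (indicator (Sq q) y * u y) \<partial>M)"
        by (intro Bochner_Integration.integral_sum integrable_mult_right Lp_integrable_on_finite u Sq)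
      finally show "Kop \<kappa>2 u x = (\<Sum>q\<in>Q. scl (\<integral>y. indicator (Sq q) y * u y \<partial>M) (\<lambda>x. k (x - gridpt s q))) x"
        by (simp add: sum_fun_apply scl_def mult.commute)
    qed
    then show ?thesis by (simp only:) (intro fun_vs.span_sum fun_vs.span_scale fun_vs.span_base, auto simp: F_def)
  qed
  have "finite F" "F \<subseteq> LP" using Q k_translate_LP by (auto simp: F_def)
  then show ?thesis by (intro exI[of _ "Kop \<kappa>2"] exI[of _ F] conjI ballI blin_Kop[OF k2 C0e] span near)
qed

text \<open>The same discretisation in the variable \<open>x\<close>, since the cutoff now stands on
  the left; the range is spanned by indicators. Additivity and homogeneity are recorded as equations
  of functions for the sake of \<open>fred_kernel\<close>.\<close>

lemma finite_rank_left:
  assumes S: "S \<in> sets M" "S \<subseteq> ball 0 R" and \<eta>: "\<eta> > 0"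
  shows "\<exists>\<Phi> F. (\<forall>u\<in>LP. \<forall>v\<in>LP. \<Phi> (u + v) = \<Phi> u + \<Phi> v) \<and> (\<forall>u\<in>LP. \<forall>c. \<Phi> (scl c u) = scl c (\<Phi> u)) \<and>
    finite F \<and> F \<subseteq> LP \<and> (\<forall>u\<in>LP. \<Phi> u \<in> fun_vs.span F) \<and>
    (\<forall>u\<in>LP. NP (indicator S * T u - \<Phi> u) \<le> \<eta> * NP u)"
proof -
  define e where "e = \<eta> / K"
  have e: "e > 0" using \<eta> K by (simp add: e_def)
  obtain \<delta> where \<delta>: "\<delta> > 0" "\<And>z z'. norm (z - z') \<le> \<delta> \<Longrightarrow> cmod (k z - k z') \<le> e * w z" using k_uniform[OF e] by blast
  define s where "s = \<delta> / 2"
  have s: "s > 0" using \<delta> by (simp add: s_def)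
  define \<pi> where "\<pi> y = gridpt s (cell s y)" for y
  have \<pi>: "norm (y - \<pi> y) \<le> \<delta>" for y using dist_gridpt[OF s, of y] by (simp add: \<pi>_def s_def)
  have [measurable]: "\<pi> \<in> borel_measurable borel" unfolding \<pi>_def[abs_def] by measurable
  have Sb: "S \<in> sets borel" using S(1) by (simp add: sets_M_iff)
  have [measurable]: "(indicator S :: plane \<Rightarrow> complex) \<in> borel_measurable borel" using Sb by (rule borel_measurable_indicator)
  define \<kappa>1 where "\<kappa>1 x y = indicator S x * k (x - y)" for x y
  define \<kappa>2 where "\<kappa>2 x y = indicator S x * k (\<pi> x - y)" for x y
  have k1: "kernel C0 \<kappa>1" unfolding kernel_def
  proof (intro conjI allI)
    show "(\<lambda>(x, y). \<kappa>1 x y) \<in> borel_measurable (borel \<Otimes>\<^sub>M borel)" unfolding \<kappa>1_def by measurable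
    show "cmod (\<kappa>1 x y) \<le> C0 * w (x - y)" for x y
      using k_kernel C0 less_imp_le[OF weight_pos] by (auto simp: kernel_def \<kappa>1_def indicator_def)
  qed
  have k12: "kernel e (\<lambda>x y. \<kappa>1 x y - \<kappa>2 x y)" unfolding kernel_def
  proof (intro conjI allI)
    show "(\<lambda>(x, y). \<kappa>1 x y - \<kappa>2 x y) \<in> borel_measurable (borel \<Otimes>\<^sub>M borel)" unfolding \<kappa>1_def \<kappa>2_def by measurable
    fix x y
    have "norm ((x - y) - (\<pi> x - y)) \<le> \<delta>" using \<pi>[of x] by simp
    then show "cmod (\<kappa>1 x y - \<kappa>2 x y) \<le> e * w (x - y)"
      using \<delta>(2)[of "x - y" "\<pi> x - y"] e less_imp_le[OF weight_pos] by (auto simp: \<kappa>1_def \<kappa>2_def indicator_def)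
  qed
  have k2: "kernel (C0 + e) \<kappa>2" unfolding kernel_def
  proof (intro conjI allI)
    show "(\<lambda>(x, y). \<kappa>2 x y) \<in> borel_measurable (borel \<Otimes>\<^sub>M borel)" unfolding \<kappa>2_def by measurable
    fix x y
    have "cmod (\<kappa>1 x y) \<le> C0 * w (x - y)" "cmod (\<kappa>1 x y - \<kappa>2 x y) \<le> e * w (x - y)" using k1 k12 by (auto simp: kernel_def)
    then show "cmod (\<kappa>2 x y) \<le> (C0 + e) * w (x - y)"
      using norm_triangle_ineq4[of "\<kappa>1 x y" "\<kappa>1 x y - \<kappa>2 x y"] by (simp add: distrib_right)
  qed
  have C0e: "C0 + e > 0" using C0 e by simp
  have TS: "indicator S * T u = Kop \<kappa>1 u" for u
    by (simp add: T_eq Kop_def \<kappa>1_def fun_ops fun_eq_iff mult.assoc)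
  have near: "NP (indicator S * T u - Kop \<kappa>2 u) \<le> \<eta> * NP u" if u: "u \<in> LP" for u
    unfolding TS Kop_kernel_diff[OF k1 C0 k2 C0e u] using Kop_mem(2)[OF k12 e u] K(1) by (simp add: e_def)
  define Q where "Q = cell s ` S"
  have Q: "finite Q" unfolding Q_def by (rule finite_cells[OF S(2) s])
  define Sq where "Sq q = S \<inter> {y. cell s y = q}" for q
  have Sq: "Sq q \<in> sets M" "emeasure M (Sq q) < \<infinity>" for q
  proof -
    have "{y. cell s y \<in> {q}} \<in> sets borel" by (rule cell_sets)
    then show *: "Sq q \<in> sets M" using S(1) by (auto simp: Sq_def sets_M_iff)
    have "emeasure M (Sq q) \<le> emeasure M (\<Gamma> \<inter> ball 0 R)"
      using S * by (intro emeasure_mono ball_sets) (auto simp: Sq_def sets_M_iff)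
    then show "emeasure M (Sq q) < \<infinity>" using bounded_emeasure order.strict_trans1 by blast
  qed
  define F where "F = (\<lambda>q. indicator (Sq q) :: plane \<Rightarrow> complex) ` Q"
  have span: "Kop \<kappa>2 u \<in> fun_vs.span F" if u: "u \<in> LP" for u
  proof -
    have "Kop \<kappa>2 u = (\<Sum>q\<in>Q. scl (T u (gridpt s q)) (indicator (Sq q)))"
    proof
      fix x
      have 1: "Kop \<kappa>2 u x = indicator S x * T u (\<pi> x)"
        by (simp add: Kop_def \<kappa>2_def T_eq mult.assoc)
      show "Kop \<kappa>2 u x = (\<Sum>q\<in>Q. scl (T u (gridpt s q)) (indicator (Sq q))) x"
      proof (cases "x \<in> S")
        case True
        have "(\<Sum>q\<in>Q. T u (gridpt s q) * indicator (Sq q) x) = (\<Sum>q\<in>{cell s x}. T u (gridpt s q) * indicator (Sq q) x)"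
          using True Q by (intro sum.mono_neutral_right) (auto simp: Q_def Sq_def)
        then show ?thesis using True by (simp add: 1 \<pi>_def Sq_def sum_fun_apply scl_def)
      qed (simp add: 1 Sq_def sum_fun_apply scl_def)
    qed
    then show ?thesis by (simp only:) (intro fun_vs.span_sum fun_vs.span_scale fun_vs.span_base, auto simp: F_def)
  qed
  have "finite F" "F \<subseteq> LP" using Q indicator_LP Sq by (auto simp: F_def)
  then show ?thesis
    by (intro exI[of _ "Kop \<kappa>2"] exI[of _ F] conjI ballI allI Kop_add[OF k2 C0e] Kop_scl span near)
qed

end

section \<open>Sufficiency\<close>

lemma span_mult:
  assumes "finite F" "z \<in> fun_vs.span F"
  shows "h * z \<in> fun_vs.span ((\<lambda>s. h * s) ` F)"
proof -
  obtain u where u: "z = (\<Sum>s\<in>F. scl (u s) s)" using fun_vs.span_finite[OF assms(1)] assms(2) by auto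
  have "h * scl c s = scl c (h * s)" for c s by (simp add: fun_eq_iff fun_ops scl_def)
  then have "h * z = (\<Sum>s\<in>F. scl (u s) (h * s))" unfolding u sum_distrib_left by simp
  then show ?thesis by (simp only:) (intro fun_vs.span_sum fun_vs.span_scale fun_vs.span_base imageI)
qed

context convolution_operator
begin

lemma A_add: "u \<in> LP \<Longrightarrow> v \<in> LP \<Longrightarrow> A (u + v) = A u + A v"
  unfolding A_def by (simp add: T_add algebra_simps)

lemma A_sum: "(\<And>t. t \<in> I \<Longrightarrow> u t \<in> LP) \<Longrightarrow> A (\<Sum>t\<in>I. u t) = (\<Sum>t\<in>I. A (u t))"
proof (induction I rule: infinite_finite_induct)
  case (insert t I)
  have "A (u t + (\<Sum>t\<in>I. u t)) = A (u t) + A (\<Sum>t\<in>I. u t)"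
    by (rule A_add) (auto intro: sum_mem insert.prems)
  then show "A (\<Sum>t\<in>insert t I. u t) = (\<Sum>t\<in>insert t I. A (u t))"
    unfolding sum.insert[OF insert.hyps] using insert by simp
qed (simp_all add: A_def T_def conv_op_def fun_eq_iff fun_ops)

lemma blin_cut:
  assumes "lipcut L f" "L > 0" shows "blin (\<lambda>u. cut f * u)"
proof -
  have [measurable]: "f \<in> borel_measurable M" by (rule borel_measurable_M[OF lipcut_measurable[OF assms]])
  show ?thesis
    by (rule blin_mult[where c = 1]) (use assms in \<open>auto simp: cut_def lipcut_def\<close>)
qed

definition com :: "(plane \<Rightarrow> real) \<Rightarrow> plane oper" where
  "com f u = cut f * T u - T (cut f * u)"

text \<open>The local inverses \<open>X t\<close> of the limit operators are glued to parametrices: \<open>S0\<close> and the \<open>S t\<close> partition the graph,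
  \<open>f t\<close> is a cutoff for \<open>S t\<close>, and on its support the coefficients are close to those of the limit operator.
  The size of the errors does not depend on the number of sets in the partition because of the
  bounded overlap of the cutoffs; only the commutator estimate does, but the commutators become small
  after the partition indices have been chosen.\<close>

lemma parametrix:
  fixes I :: "'t set" and a' b' :: "'t \<Rightarrow> plane \<Rightarrow> complex"
  assumes fin: "finite I"
    and co: "\<And>t. t \<in> I \<Longrightarrow> bounded_coeff (a' t)" "\<And>t. t \<in> I \<Longrightarrow> bounded_coeff (b' t)"
    and X: "\<And>t. t \<in> I \<Longrightarrow> blin (X t)" "\<And>t. t \<in> I \<Longrightarrow> c t > 0" "\<And>t u. t \<in> I \<Longrightarrow> u \<in> LP \<Longrightarrow> NP (X t u) \<le> c t * NP u"
      "\<And>t u. t \<in> I \<Longrightarrow> u \<in> LP \<Longrightarrow> NP (pair_op (a' t) (b' t) (X t u) - u) = 0"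
      "\<And>t u. t \<in> I \<Longrightarrow> u \<in> LP \<Longrightarrow> NP (X t (pair_op (a' t) (b' t) u) - u) = 0"
    and f: "\<And>t. t \<in> I \<Longrightarrow> lipcut L (f t)" and L: "L > 0"
    and S: "\<And>t. t \<in> I \<Longrightarrow> S t \<in> sets M" and S0: "S0 \<in> sets M" "S0 \<subseteq> ball 0 R0"
    and fS: "\<And>t x. t \<in> I \<Longrightarrow> x \<in> S t \<Longrightarrow> f t x = 1"
    and part: "\<And>x. x \<in> \<Gamma> \<Longrightarrow> indicator S0 x + (\<Sum>t\<in>I. indicator (S t) x) = (1::complex)"
    and dis: "\<And>x. x \<in> \<Gamma> \<Longrightarrow> card {t \<in> I. x \<in> S t} \<le> 1"
    and ov: "\<And>x. x \<in> \<Gamma> \<Longrightarrow> card {t \<in> I. f t x \<noteq> 0} \<le> 9"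
    and cl: "\<And>t x. t \<in> I \<Longrightarrow> x \<in> \<Gamma> \<Longrightarrow> f t x \<noteq> 0 \<Longrightarrow> cmod (a x - a' t x) \<le> 2 * (\<theta> / c t) \<and> cmod (b x - b' t x) \<le> 2 * (\<theta> / c t)"
    and \<theta>: "\<theta> = 1 / (144 * (1 + C0 * K))"
    and comm: "\<And>t u. t \<in> I \<Longrightarrow> u \<in> LP \<Longrightarrow> NP (com (f t) u) \<le> \<eta> * NP u" and \<eta>: "\<eta> \<ge> 0" "coef * \<eta> * (\<Sum>t\<in>I. c t) \<le> 1 / 8"
    and low: "\<And>x. x \<in> \<Gamma> \<Longrightarrow> cmod (a x) \<ge> c1" and c1: "c1 > 0"
  shows "fred A"
proof -
  have N1: "1 + C0 * K > 0" using C0 K(1) by (simp add: add_pos_pos)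
  \<comment> \<open>The number \<open>144\<close> is \<open>8 * 9 * 2\<close>: the desired error
    \<open>1 / 8\<close>, nine overlapping cutoffs, and coefficient errors up to
    \<open>2 * (\<theta> / c t)\<close>.\<close>
  have \<theta>0: "\<theta> > 0" and \<theta>N: "18 * \<theta> * (1 + C0 * K) = 1 / 8"
    using N1 by (simp_all add: \<theta>)
  define ra where "ra = (\<lambda>x. 1 / a x)"
  have ram [measurable]: "ra \<in> borel_measurable M" unfolding ra_def by measurable
  have rab: "cmod (ra x) \<le> 1 / c1" if "x \<in> space M" for x
  proof -
    have "1 / cmod (a x) \<le> 1 / c1" using low[of x] that c1 by (intro divide_left_mono mult_pos_pos) auto
    then show ?thesis by (simp add: ra_def norm_divide)
  qed
  have raa: "ra x * a x = 1" if "x \<in> \<Gamma>" for x using low[OF that] c1 by (auto simp: ra_def)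
  have ra: "ra * u \<in> LP" "NP (ra * u) \<le> 1 / c1 * NP u" if "u \<in> LP" for u
    using mult_mem[OF ram rab _ that] c1 by auto
  have blin_ra: "blin (\<lambda>u. ra * u)" using c1 by (intro blin_mult[OF ram rab]) auto
  define i0 :: "plane \<Rightarrow> complex" where "i0 = indicator S0"
  define it :: "'t \<Rightarrow> plane \<Rightarrow> complex" where "it t = indicator (S t)" for t
  have i0: "i0 * u \<in> LP" if "u \<in> LP" for u unfolding i0_def by (rule indicator_mem(1)[OF S0(1) that])
  have it: "it t * u \<in> LP" "NP (it t * u) \<le> NP u" if "t \<in> I" "u \<in> LP" for t u
    unfolding it_def using indicator_mem[OF S[OF that(1)] that(2)] .
  have cf: "cut (f t) * u \<in> LP" "NP (cut (f t) * u) \<le> NP u" if "t \<in> I" "u \<in> LP" for t u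
    using cut_mem[OF f[OF that(1)] L that(2)] .
  have cit: "cut (f t) * (it t * u) = it t * u" "it t * (cut (f t) * u) = it t * u" if "t \<in> I" for t u
    using fS[OF that] by (auto simp: fun_eq_iff fun_ops cut_def it_def indicator_def)
  note Xm = blin_mem[OF X(1)]
  have pm: "pair_op (a' t) (b' t) u \<in> LP" if "t \<in> I" "u \<in> LP" for t u
    by (rule blin_mem[OF blin_pair_op[OF co[OF that(1)]] that(2)])
  have comL: "com (f t) u \<in> LP" if "t \<in> I" "u \<in> LP" for t u unfolding com_def using cf that by simp
  have sumit: "i0 x * (ra x * a x) * u x + (\<Sum>t\<in>I. it t x * u x) = u x" if "x \<in> \<Gamma>" for x and u :: "plane \<Rightarrow> complex"
  proof -
    have "i0 x * (ra x * a x) * u x + (\<Sum>t\<in>I. it t x * u x) = (i0 x + (\<Sum>t\<in>I. it t x)) * u x"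
      unfolding raa[OF that] by (simp add: distrib_right sum_distrib_right)
    then show ?thesis using part[OF that] by (simp add: i0_def it_def)
  qed
  \<comment> \<open>The finite rank approximation is multiplied by \<open>b\<close> and by
    \<open>1 / a\<close>; its error shall then be \<open>1 / 8\<close>.\<close>
  define \<eta>2 where "\<eta>2 = c1 / (8 * coef)"
  have \<eta>2: "\<eta>2 > 0" "coef * \<eta>2 * (1 / c1) = 1 / 8" using c1 coef(1) by (simp_all add: \<eta>2_def)
  define da where "da t = cut (f t) * (a - a' t)" for t
  define db where "db t = cut (f t) * (b - b' t)" for t
  have dm: "da t \<in> borel_measurable M" "db t \<in> borel_measurable M" if "t \<in> I" for t
  proof -
    have [measurable]: "f t \<in> borel_measurable M" "a' t \<in> borel_measurable M" "b' t \<in> borel_measurable M"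
      using borel_measurable_M[OF lipcut_measurable[OF f[OF that] L]] co[OF that] by (auto simp: bounded_coeff_def)
    show "da t \<in> borel_measurable M" "db t \<in> borel_measurable M"
      unfolding da_def db_def cut_def times_fun_def fun_diff_def by measurable
  qed
  have dle: "cmod (da t x) \<le> 2 * (\<theta> / c t)" "cmod (db t x) \<le> 2 * (\<theta> / c t)" if t: "t \<in> I" and x: "x \<in> space M" for t x
  proof -
    have f01: "0 \<le> f t x" "f t x \<le> 1" using f[OF t] by (auto simp: lipcut_def)
    have "\<theta> / c t \<ge> 0" using \<theta>0 X(2)[OF t] by simp
    have *: "cmod (cut (f t) x * z) \<le> 2 * (\<theta> / c t)" if "f t x \<noteq> 0 \<Longrightarrow> cmod z \<le> 2 * (\<theta> / c t)" for z
    proof (cases "f t x = 0")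
      case False
      then have "\<bar>f t x\<bar> * cmod z \<le> 1 * (2 * (\<theta> / c t))" using f01 that \<open>\<theta> / c t \<ge> 0\<close> by (intro mult_mono) auto
      then show ?thesis by (simp add: cut_def norm_mult)
    qed (use \<open>\<theta> / c t \<ge> 0\<close> in \<open>simp add: cut_def\<close>)
    have xG: "x \<in> \<Gamma>" using x by simp
    show "cmod (da t x) \<le> 2 * (\<theta> / c t)"
      unfolding da_def fun_ops by (rule *) (rule conjunct1[OF cl[OF t xG]])
    show "cmod (db t x) \<le> 2 * (\<theta> / c t)"
      unfolding db_def fun_ops by (rule *) (rule conjunct2[OF cl[OF t xG]])
  qed
  have dmult: "da t * u \<in> LP" "NP (da t * u) \<le> 2 * (\<theta> / c t) * NP u" "db t * u \<in> LP" "NP (db t * u) \<le> 2 * (\<theta> / c t) * NP u"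
    if "t \<in> I" "u \<in> LP" for t u
    using mult_mem[OF dm(1)[OF that(1)] dle(1)[OF that(1)] _ that(2)] mult_mem[OF dm(2)[OF that(1)] dle(2)[OF that(1)] _ that(2)]
      \<theta>0 X(2)[OF that(1)] by auto
  have cutA: "cut (f t) * A u = cut (f t) * pair_op (a' t) (b' t) u + (da t * u + db t * T u)" for t u
    unfolding A_def pair_op_def da_def db_def by (simp add: algebra_simps)
  have null_mult: "NP (h * u) = 0" if "h * u \<in> LP" "u \<in> LP" "NP u = 0" for h u
    using that unfolding null_iff[OF that(1)] null_iff[OF that(2)] by (auto simp: fun_ops elim: eventually_mono)
  have null_sum: "NP (\<Sum>t\<in>I. g t) = 0" if "\<And>t. t \<in> I \<Longrightarrow> g t \<in> LP" "\<And>t. t \<in> I \<Longrightarrow> NP (g t) = 0" for g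
  proof (rule null_le)
    show "(\<Sum>t\<in>I. g t) \<in> LP" using that by (intro sum_mem)
    show "NP (\<Sum>t\<in>I. g t) \<le> 0" using N_sum_le[of I g] that by simp
  qed
  have p1: "1 \<le> p" using p_gt by simp
  \<comment> \<open>\<open>sum_NP_overlap\<close> puts the overlap count outside the
    \<open>p\<close>-th power. Since \<open>p \<ge> 1\<close> it can be moved inside, where it costs
    a factor \<open>9\<close> in the norm.\<close>
  have pow9: "9 * y powr p \<le> (9 * y) powr p" if "y \<ge> 0" for y :: real
  proof -
    have "(9::real) powr 1 \<le> 9 powr p" using p1 by (intro powr_mono) auto
    then have "9 * y powr p \<le> 9 powr p * y powr p" by (intro mult_right_mono) auto
    then show ?thesis by (simp add: powr_mult)
  qed

  \<comment> \<open>In the right parametrix the cutoffs stand outside and the indicators inside. The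
    deviation splits into the partition identity \<open>E0\<close> and the defect \<open>E2\<close>
    of the local inverses, both null, the finite rank error \<open>E1\<close>, the coefficient
    errors \<open>E3\<close> and the commutators \<open>E4\<close>; the last three contribute at
    most \<open>1 / 8\<close> each.\<close>
  have right: "\<exists>B F1 Q. blin B \<and> blin F1 \<and> finite Q \<and> Q \<subseteq> LP \<and> (\<forall>v\<in>LP. F1 v \<in> fun_vs.span Q) \<and>
    (\<forall>v\<in>LP. NP (A (B v) - v - F1 v) \<le> NP v / 2)"
  proof -
    obtain \<Phi> F where \<Phi>: "blin \<Phi>" "finite F" "F \<subseteq> LP" "\<forall>u\<in>LP. \<Phi> u \<in> fun_vs.span F"
      "\<forall>u\<in>LP. NP (T (i0 * u) - \<Phi> u) \<le> \<eta>2 * NP u"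
      using finite_rank_right[OF S0 \<eta>2(1)] unfolding i0_def by (elim exE conjE)
    define F1 where "F1 v = b * \<Phi> (ra * v)" for v
    define Br where "Br v = ra * (i0 * v) + (\<Sum>t\<in>I. cut (f t) * X t (it t * v))" for v
    have blin_b: "blin (\<lambda>u. b * u)" using coef by (intro blin_mult[where c = coef]) auto
    have bF1: "blin F1" unfolding F1_def[abs_def] by (rule blin_comp[OF blin_b blin_comp[OF \<Phi>(1) blin_ra]])
    have bi0: "blin (\<lambda>v. i0 * v)" unfolding i0_def by (rule blin_indicator[OF S0(1)])
    have bit: "blin (\<lambda>v. it t * v)" if "t \<in> I" for t unfolding it_def by (rule blin_indicator[OF S[OF that]])
    have bBr: "blin Br" unfolding Br_def[abs_def]
    proof (intro blin_plus_op blin_comp[OF blin_ra bi0] blin_sum_op)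
      fix t assume t: "t \<in> I"
      show "blin (\<lambda>v. cut (f t) * X t (it t * v))"
        by (rule blin_comp[OF blin_cut[OF f[OF t] L] blin_comp[OF X(1)[OF t] bit[OF t]]])
    qed
    have "F1 v \<in> fun_vs.span ((\<lambda>s. b * s) ` F)" if "v \<in> LP" for v
      unfolding F1_def using \<Phi>(4) ra(1)[OF that] by (intro span_mult[OF \<Phi>(2)]) blast
    moreover have "(\<lambda>s. b * s) ` F \<subseteq> LP" using \<Phi>(3) by auto
    moreover have "NP (A (Br v) - v - F1 v) \<le> NP v / 2" if v: "v \<in> LP" for v
    proof -
      define Y where "Y t = X t (it t * v)" for t
      have Y: "Y t \<in> LP" "NP (Y t) \<le> c t * NP (it t * v)" "NP (pair_op (a' t) (b' t) (Y t) - it t * v) = 0" if "t \<in> I" for t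
        using that it[OF that v] Xm[OF that] X(3,4)[OF that] by (auto simp: Y_def)
      define E0 where "E0 = a * (ra * (i0 * v)) + (\<Sum>t\<in>I. it t * v) - v"
      define E1 where "E1 = b * (T (i0 * (ra * v)) - \<Phi> (ra * v))"
      define E2 where "E2 t = cut (f t) * (pair_op (a' t) (b' t) (Y t) - it t * v)" for t
      define E3 where "E3 t = da t * Y t + db t * T (Y t)" for t
      define E4 where "E4 t = b * com (f t) (Y t)" for t
      have A1: "A (cut (f t) * Y t) = it t * v + E2 t + E3 t - E4 t" if t: "t \<in> I" for t
      proof -
        have "A (cut (f t) * Y t) = cut (f t) * A (Y t) - b * com (f t) (Y t)"
          unfolding A_def com_def by (simp add: algebra_simps)
        then show ?thesis unfolding cutA E2_def E3_def E4_def using cit(1)[OF t, of v] by (simp add: algebra_simps)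
      qed
      have m1: "ra * (i0 * v) \<in> LP" "cut (f t) * Y t \<in> LP" if "t \<in> I" for t using ra i0 v cf Y that by auto
      have "A (Br v) = A (ra * (i0 * v)) + A (\<Sum>t\<in>I. cut (f t) * Y t)"
        unfolding Br_def Y_def[symmetric] using ra(1)[OF i0[OF v]] cf Y by (intro A_add sum_mem) auto
      also have "A (\<Sum>t\<in>I. cut (f t) * Y t) = (\<Sum>t\<in>I. A (cut (f t) * Y t))" using cf Y by (intro A_sum) auto
      also have "\<dots> = (\<Sum>t\<in>I. it t * v + E2 t + E3 t - E4 t)" using A1 by (intro sum.cong) auto
      also have "A (ra * (i0 * v)) = a * (ra * (i0 * v)) + b * T (i0 * (ra * v))"
        unfolding A_def by (simp add: algebra_simps)
      finally have Br: "A (Br v) - v - F1 v = E0 + (E1 + ((\<Sum>t\<in>I. E2 t) + ((\<Sum>t\<in>I. E3 t) - (\<Sum>t\<in>I. E4 t))))"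
        unfolding E0_def E1_def F1_def by (simp add: sum.distrib sum_subtractf algebra_simps)
      have E0L: "E0 \<in> LP" unfolding E0_def using ra i0 it v by (intro diff_mem add_mem sum_mem) auto
      have "NP E0 = 0" unfolding null_iff[OF E0L]
      proof (rule AE_I2)
        fix x assume "x \<in> space M"
        then have "i0 x * (ra x * a x) * v x + (\<Sum>t\<in>I. it t x * v x) = v x" using sumit by simp
        then show "E0 x = 0" by (simp add: E0_def fun_ops sum_fun_apply algebra_simps)
      qed
      have rv: "ra * v \<in> LP" "NP (ra * v) \<le> 1 / c1 * NP v" using ra[OF v] by auto
      have dL: "T (i0 * (ra * v)) - \<Phi> (ra * v) \<in> LP" using i0 rv blin_mem[OF \<Phi>(1)] by simp
      have E1L: "E1 \<in> LP" unfolding E1_def using dL by simp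
      have "NP E1 \<le> coef * NP (T (i0 * (ra * v)) - \<Phi> (ra * v))" unfolding E1_def by (rule b_mult_le[OF dL])
      also have "\<dots> \<le> coef * (\<eta>2 * (1 / c1 * NP v))"
        using \<Phi>(5) rv coef(1) \<eta>2(1) by (intro mult_left_mono order.trans[OF _ mult_left_mono[OF rv(2)]]) auto
      also have "\<dots> = (coef * \<eta>2 * (1 / c1)) * NP v" by simp
      finally have E1: "NP E1 \<le> 1 / 8 * NP v" unfolding \<eta>2(2) .
      have E2L: "E2 t \<in> LP" "NP (E2 t) = 0" if "t \<in> I" for t
      proof -
        have m: "pair_op (a' t) (b' t) (Y t) - it t * v \<in> LP" using pm Y it v that by simp
        show "E2 t \<in> LP" unfolding E2_def by (rule cf(1)[OF that m])
        then show "NP (E2 t) = 0" unfolding E2_def by (rule null_mult[OF _ m Y(3)[OF that]])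
      qed
      have E2s: "NP (\<Sum>t\<in>I. E2 t) = 0" using E2L by (rule null_sum)
      have E3L: "E3 t \<in> LP" if "t \<in> I" for t unfolding E3_def using dmult Y that by simp
      \<comment> \<open>The bound \<open>c t\<close> of the local inverse cancels against the
        tolerance \<open>\<theta> / c t\<close>, so the estimate is the same for all
        \<open>t\<close>.\<close>
      have E3n: "NP (E3 t) \<le> 2 * \<theta> * (1 + C0 * K) * NP (it t * v)" if t: "t \<in> I" for t
      proof -
        have ct: "c t > 0" by (rule X(2)[OF t])
        have "NP (E3 t) \<le> NP (da t * Y t) + NP (db t * T (Y t))" unfolding E3_def using dmult Y t by (intro tri) auto
        also have "\<dots> \<le> 2 * (\<theta> / c t) * NP (Y t) + 2 * (\<theta> / c t) * NP (T (Y t))"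
          using dmult Y t by (intro add_mono) auto
        also have "\<dots> \<le> 2 * (\<theta> / c t) * NP (Y t) + 2 * (\<theta> / c t) * (C0 * K * NP (Y t))"
          using T_le[OF Y(1)[OF t]] \<theta>0 ct by (intro add_left_mono mult_left_mono) auto
        also have "\<dots> = 2 * (\<theta> / c t) * (1 + C0 * K) * NP (Y t)"
          unfolding distrib_left distrib_right mult_1_right mult.assoc by (rule refl)
        also have "\<dots> \<le> 2 * (\<theta> / c t) * (1 + C0 * K) * (c t * NP (it t * v))"
          using Y(2)[OF t] \<theta>0 ct N1 by (intro mult_left_mono) auto
        also have "\<dots> = 2 * \<theta> * (1 + C0 * K) * NP (it t * v)" using ct by simp
        finally show ?thesis .
      qed
      \<comment> \<open>The terms \<open>E3 t\<close> are supported where \<open>f t\<close> is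
        nonzero and overlap at most nine times, while the pieces \<open>it t * v\<close> are
        disjoint.\<close>
      have E3s: "NP (\<Sum>t\<in>I. E3 t) \<le> 1 / 8 * NP v"
      proof -
        have "NP (\<Sum>t\<in>I. E3 t) \<le> real 9 * (2 * \<theta> * (1 + C0 * K) * NP v)"
        proof (rule NP_sum_overlap[OF fin E3L])
          fix x assume x: "x \<in> space M"
          have "{t \<in> I. E3 t x \<noteq> 0} \<subseteq> {t \<in> I. f t x \<noteq> 0}"
            by (auto simp: E3_def fun_ops da_def db_def cut_def)
          then have "card {t \<in> I. E3 t x \<noteq> 0} \<le> card {t \<in> I. f t x \<noteq> 0}" using fin by (intro card_mono) auto
          then show "card {t \<in> I. E3 t x \<noteq> 0} \<le> 9" using ov[of x] x by simp
        next
          have itm: "it t \<in> borel_measurable M" if "t \<in> I" for t unfolding it_def by (rule indicator_measurable[OF S[OF that]])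
          have "(\<Sum>t\<in>I. NP (E3 t) powr p) \<le> (\<Sum>t\<in>I. (2 * \<theta> * (1 + C0 * K)) powr p * NP (it t * v) powr p)"
          proof (rule sum_mono)
            fix t assume t: "t \<in> I"
            have "NP (E3 t) powr p \<le> (2 * \<theta> * (1 + C0 * K) * NP (it t * v)) powr p"
              using E3n[OF t] E3L[OF t] p1 by (intro powr_mono2) auto
            then show "NP (E3 t) powr p \<le> (2 * \<theta> * (1 + C0 * K)) powr p * NP (it t * v) powr p" by (simp add: powr_mult)
          qed
          also have "\<dots> = (2 * \<theta> * (1 + C0 * K)) powr p * (\<Sum>t\<in>I. NP (it t * v) powr p)" by (simp add: sum_distrib_left)
          also have "(\<Sum>t\<in>I. NP (it t * v) powr p) \<le> real 1 * NP v powr p"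
          proof (rule sum_NP_overlap[OF fin itm _ _ v])
            fix x assume x: "x \<in> space M"
            have "{t \<in> I. it t x \<noteq> 0} = {t \<in> I. x \<in> S t}" by (auto simp: it_def indicator_def)
            then show "card {t \<in> I. it t x \<noteq> 0} \<le> 1" using dis[of x] x by simp
          qed (auto simp: it_def indicator_def)
          finally show "(\<Sum>t\<in>I. NP (E3 t) powr p) \<le> (2 * \<theta> * (1 + C0 * K) * NP v) powr p"
            by (simp add: powr_mult mult_left_mono)
        qed (use \<theta>0 N1 v in auto)
        also have "real 9 * (2 * \<theta> * (1 + C0 * K) * NP v) = (18 * \<theta> * (1 + C0 * K)) * NP v" by simp
        finally show ?thesis unfolding \<theta>N .
      qed
      have E4L: "E4 t \<in> LP" if "t \<in> I" for t unfolding E4_def using comL Y that by simp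
      have E4s: "NP (\<Sum>t\<in>I. E4 t) \<le> 1 / 8 * NP v"
      proof -
        have "NP (\<Sum>t\<in>I. E4 t) \<le> (\<Sum>t\<in>I. NP (E4 t))" using E4L by (rule N_sum_le)
        also have "\<dots> \<le> (\<Sum>t\<in>I. coef * \<eta> * c t * NP v)"
        proof (rule sum_mono)
          fix t assume t: "t \<in> I"
          have "NP (E4 t) \<le> coef * NP (com (f t) (Y t))" unfolding E4_def by (rule b_mult_le[OF comL[OF t Y(1)[OF t]]])
          also have "\<dots> \<le> coef * (\<eta> * NP (Y t))" using comm[OF t Y(1)[OF t]] coef(1) by (intro mult_left_mono) auto
          also have "\<dots> \<le> coef * (\<eta> * (c t * NP v))"
          proof -
            have "NP (Y t) \<le> c t * NP v"
              using Y(2)[OF t] mult_left_mono[OF it(2)[OF t v], of "c t"] X(2)[OF t] by linarith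
            then show ?thesis using coef(1) \<eta>(1) by (intro mult_left_mono) auto
          qed
          finally show "NP (E4 t) \<le> coef * \<eta> * c t * NP v" by (simp add: mult.assoc)
        qed
        also have "\<dots> = (coef * \<eta> * (\<Sum>t\<in>I. c t)) * NP v" by (simp add: sum_distrib_left sum_distrib_right)
        also have "\<dots> \<le> 1 / 8 * NP v" using \<eta>(2) v by (intro mult_right_mono) auto
        finally show ?thesis .
      qed
      have sL: "(\<Sum>t\<in>I. E2 t) \<in> LP" "(\<Sum>t\<in>I. E3 t) \<in> LP" "(\<Sum>t\<in>I. E4 t) \<in> LP"
        using E2L E3L E4L by (auto intro!: sum_mem)
      have "NP (A (Br v) - v - F1 v) \<le> NP E0 + (NP E1 + (NP (\<Sum>t\<in>I. E2 t) + (NP (\<Sum>t\<in>I. E3 t) + NP (\<Sum>t\<in>I. E4 t))))"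
        unfolding Br using E0L E1L sL
        by (intro order.trans[OF tri] add_left_mono tri_diff add_mem diff_mem order_refl)
      then show ?thesis using \<open>NP E0 = 0\<close> E1 E2s E3s E4s N_nonneg[OF v] by linarith
    qed
    ultimately show ?thesis using bBr bF1 \<Phi>(2) by (intro exI[of _ Br] exI[of _ F1] exI[of _ "(\<lambda>s. b * s) ` F"]) auto
  qed

  \<comment> \<open>In the left parametrix the indicators stand outside and the cutoffs inside.
    Commutators with \<open>X t\<close> are avoided: \<open>cut (f t) * A u\<close> is the limit
    operator applied to \<open>cut (f t) * u\<close> plus the errors \<open>g1\<close>,
    \<open>g2\<close>, \<open>g3\<close>, and \<open>X t\<close> inverts the former and is bounded
    on the latter.\<close>
  have left: "\<exists>B F1 Q. blin B \<and> (\<forall>u\<in>LP. \<forall>v\<in>LP. F1 (u + v) = F1 u + F1 v) \<and> (\<forall>u\<in>LP. \<forall>c. F1 (scl c u) = scl c (F1 u)) \<and>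
    finite Q \<and> Q \<subseteq> LP \<and> (\<forall>v\<in>LP. F1 v \<in> fun_vs.span Q) \<and> (\<forall>u\<in>LP. NP (B (A u) - u - F1 u) \<le> NP u / 2)"
  proof -
    obtain \<Phi> F where \<Phi>: "\<forall>u\<in>LP. \<forall>v\<in>LP. \<Phi> (u + v) = \<Phi> u + \<Phi> v" "\<forall>u\<in>LP. \<forall>c. \<Phi> (scl c u) = scl c (\<Phi> u)"
      "finite F" "F \<subseteq> LP" "\<forall>u\<in>LP. \<Phi> u \<in> fun_vs.span F"
      "\<forall>u\<in>LP. NP (i0 * T u - \<Phi> u) \<le> \<eta>2 * NP u"
      using finite_rank_left[OF S0 \<eta>2(1)] unfolding i0_def by (elim exE conjE)
    have \<Phi>L: "\<Phi> u \<in> LP" if "u \<in> LP" for u using span_mem[OF \<Phi>(4)] \<Phi>(5) that by blast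
    define F1 where "F1 u = (ra * b) * \<Phi> u" for u
    define Bl where "Bl g = ra * (i0 * g) + (\<Sum>t\<in>I. it t * X t (cut (f t) * g))" for g
    have bi0: "blin (\<lambda>v. i0 * v)" unfolding i0_def by (rule blin_indicator[OF S0(1)])
    have bit: "blin (\<lambda>v. it t * v)" if "t \<in> I" for t unfolding it_def by (rule blin_indicator[OF S[OF that]])
    have bBl: "blin Bl" unfolding Bl_def[abs_def]
    proof (intro blin_plus_op blin_comp[OF blin_ra bi0] blin_sum_op)
      fix t assume t: "t \<in> I"
      show "blin (\<lambda>v. it t * X t (cut (f t) * v))"
        by (rule blin_comp[OF bit[OF t] blin_comp[OF X(1)[OF t] blin_cut[OF f[OF t] L]]])
    qed
    have "F1 v \<in> fun_vs.span ((\<lambda>s. (ra * b) * s) ` F)" if "v \<in> LP" for v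
      unfolding F1_def using \<Phi>(5) that by (intro span_mult[OF \<Phi>(3)]) blast
    moreover have "(\<lambda>s. (ra * b) * s) ` F \<subseteq> LP" using \<Phi>(4) ra(1) by (auto simp: mult.assoc)
    moreover have "F1 (u + v) = F1 u + F1 v" if "u \<in> LP" "v \<in> LP" for u v
      using \<Phi>(1) that by (simp add: F1_def distrib_left)
    moreover have "F1 (scl d u) = scl d (F1 u)" if "u \<in> LP" for u d
      using \<Phi>(2) that by (simp add: F1_def fun_eq_iff fun_ops scl_def)
    moreover have "NP (Bl (A u) - u - F1 u) \<le> NP u / 2" if u: "u \<in> LP" for u
    proof -
      define g1 where "g1 t = b' t * com (f t) u" for t
      define g2 where "g2 t = da t * u" for t
      define g3 where "g3 t = db t * T u" for t
      have g: "g1 t \<in> LP" "g2 t \<in> LP" "g3 t \<in> LP" if "t \<in> I" for t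
        unfolding g1_def g2_def g3_def using bounded_coeff_mult(1)[OF co(2)[OF that] comL[OF that u]] dmult that u by auto
      define E0 where "E0 = ra * (i0 * (a * u)) + (\<Sum>t\<in>I. it t * u) - u"
      define E1 where "E1 = ra * (b * (i0 * T u - \<Phi> u))"
      define E2 where "E2 t = it t * (X t (cut (f t) * A u) - cut (f t) * u - X t (g1 t) - X t (g2 t) - X t (g3 t))" for t
      have Bl: "Bl (A u) - u - F1 u = E0 + (E1 + ((\<Sum>t\<in>I. E2 t) + ((\<Sum>t\<in>I. it t * X t (g1 t)) + ((\<Sum>t\<in>I. it t * X t (g2 t)) + (\<Sum>t\<in>I. it t * X t (g3 t))))))"
      proof -
        have "(\<Sum>t\<in>I. it t * X t (cut (f t) * A u))
          = (\<Sum>t\<in>I. E2 t + it t * u + it t * X t (g1 t) + it t * X t (g2 t) + it t * X t (g3 t))"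
        proof (rule sum.cong[OF refl])
          fix t assume "t \<in> I"
          then show "it t * X t (cut (f t) * A u) = E2 t + it t * u + it t * X t (g1 t) + it t * X t (g2 t) + it t * X t (g3 t)"
            unfolding E2_def right_diff_distrib using cit(2)[of t u] by simp
        qed
        moreover have "ra * (i0 * A u) = ra * (i0 * (a * u)) + ra * (b * (i0 * T u))"
          unfolding A_def by (simp add: algebra_simps)
        ultimately show ?thesis unfolding Bl_def E0_def E1_def F1_def by (simp add: sum.distrib algebra_simps)
      qed
      have E0L: "E0 \<in> LP" unfolding E0_def using ra i0 it u by (intro diff_mem add_mem sum_mem) auto
      have "NP E0 = 0" unfolding null_iff[OF E0L]
      proof (rule AE_I2)
        fix x assume "x \<in> space M"
        then have "i0 x * (ra x * a x) * u x + (\<Sum>t\<in>I. it t x * u x) = u x" using sumit by simp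
        then show "E0 x = 0" by (simp add: E0_def fun_ops sum_fun_apply algebra_simps)
      qed
      have dL: "i0 * T u - \<Phi> u \<in> LP" using i0 u \<Phi>L by simp
      have E1L: "E1 \<in> LP" unfolding E1_def using ra(1)[OF b_mult[OF dL]] .
      have "NP E1 \<le> 1 / c1 * NP (b * (i0 * T u - \<Phi> u))" unfolding E1_def by (rule ra(2)[OF b_mult[OF dL]])
      also have "\<dots> \<le> 1 / c1 * (coef * (\<eta>2 * NP u))"
      proof -
        have "NP (i0 * T u - \<Phi> u) \<le> \<eta>2 * NP u" using \<Phi>(6) u by blast
        then have "coef * NP (i0 * T u - \<Phi> u) \<le> coef * (\<eta>2 * NP u)" using coef(1) by (intro mult_left_mono) auto
        then show ?thesis using b_mult_le[OF dL] c1 by (intro mult_left_mono) auto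
      qed
      also have "\<dots> = (coef * \<eta>2 * (1 / c1)) * NP u" by simp
      finally have E1: "NP E1 \<le> 1 / 8 * NP u" unfolding \<eta>2(2) .
      have E2L: "E2 t \<in> LP" "NP (E2 t) = 0" if t: "t \<in> I" for t
      proof -
        let ?P = "pair_op (a' t) (b' t) (cut (f t) * u)"
        have P: "?P \<in> LP" using pm[OF t] cf[OF t u] by simp
        have dec: "cut (f t) * A u = ?P + (g1 t + (g2 t + g3 t))"
          unfolding cutA g1_def g2_def g3_def pair_op_def com_def by (simp add: algebra_simps)
        let ?W = "X t (cut (f t) * A u) - cut (f t) * u - X t (g1 t) - X t (g2 t) - X t (g3 t)"
        have WL: "?W \<in> LP" using Xm[OF t] cf[OF t] g[OF t] u by simp
        show EL: "E2 t \<in> LP" unfolding E2_def by (rule it(1)[OF t WL])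
        have 1: "NP (X t (?P + (g1 t + (g2 t + g3 t))) - (X t ?P + X t (g1 t + (g2 t + g3 t)))) = 0"
          using P g[OF t] by (intro blin_add[OF X(1)[OF t]]) auto
        have 2: "NP (X t (g1 t + (g2 t + g3 t)) - (X t (g1 t) + X t (g2 t + g3 t))) = 0"
          using g[OF t] by (intro blin_add[OF X(1)[OF t]]) auto
        have 3: "NP (X t (g2 t + g3 t) - (X t (g2 t) + X t (g3 t))) = 0"
          using g[OF t] by (intro blin_add[OF X(1)[OF t]]) auto
        have 4: "NP (X t ?P - cut (f t) * u) = 0" by (rule X(5)[OF t cf(1)[OF t u]])
        let ?w1 = "X t (?P + (g1 t + (g2 t + g3 t))) - (X t ?P + X t (g1 t + (g2 t + g3 t)))"
        let ?w2 = "X t (g1 t + (g2 t + g3 t)) - (X t (g1 t) + X t (g2 t + g3 t))"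
        let ?w3 = "X t (g2 t + g3 t) - (X t (g2 t) + X t (g3 t))"
        let ?w4 = "X t ?P - cut (f t) * u"
        have wL: "?w1 \<in> LP" "?w2 \<in> LP" "?w3 \<in> LP" "?w4 \<in> LP" using Xm[OF t] P g[OF t] cf[OF t u] by simp_all
        have W: "?W = ?w1 + (?w2 + (?w3 + ?w4))" unfolding dec by simp
        have "NP ?W = 0" unfolding W using wL 1 2 3 4 by (intro null_add add_mem)
        then show "NP (E2 t) = 0" using EL unfolding E2_def by (intro null_mult[OF _ WL])
      qed
      have E2s: "NP (\<Sum>t\<in>I. E2 t) = 0" using E2L by (rule null_sum)
      have XL: "it t * X t h \<in> LP" if "t \<in> I" "h \<in> LP" for t h using it Xm that by simp
      have G1: "NP (\<Sum>t\<in>I. it t * X t (g1 t)) \<le> 1 / 8 * NP u"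
      proof -
        have "NP (\<Sum>t\<in>I. it t * X t (g1 t)) \<le> (\<Sum>t\<in>I. NP (it t * X t (g1 t)))" using XL g by (intro N_sum_le) auto
        also have "\<dots> \<le> (\<Sum>t\<in>I. coef * \<eta> * c t * NP u)"
        proof (rule sum_mono)
          fix t assume t: "t \<in> I"
          have "NP (it t * X t (g1 t)) \<le> NP (X t (g1 t))" using it(2)[OF t] Xm[OF t] g[OF t] by blast
          also have "\<dots> \<le> c t * NP (g1 t)" by (rule X(3)[OF t g(1)[OF t]])
          also have "\<dots> \<le> c t * (coef * NP (com (f t) u))"
            unfolding g1_def using bounded_coeff_mult(2)[OF co(2)[OF t] comL[OF t u]] X(2)[OF t] by (intro mult_left_mono) auto
          also have "\<dots> \<le> c t * (coef * (\<eta> * NP u))"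
            using comm[OF t u] coef(1) X(2)[OF t] by (intro mult_left_mono) auto
          finally show "NP (it t * X t (g1 t)) \<le> coef * \<eta> * c t * NP u" by (simp add: mult_ac)
        qed
        also have "\<dots> = (coef * \<eta> * (\<Sum>t\<in>I. c t)) * NP u" by (simp add: sum_distrib_left sum_distrib_right)
        also have "\<dots> \<le> 1 / 8 * NP u" using \<eta>(2) u by (intro mult_right_mono) auto
        finally show ?thesis .
      qed
      \<comment> \<open>The roles are exchanged: the outer indicators are disjoint, and the inner
        functions overlap up to nine times. The error coefficient \<open>d t\<close> is rescaled to
        \<open>e t\<close>, of modulus at most \<open>1\<close>, so that
        \<open>sum_NP_overlap\<close> applies with the same constant for all
        \<open>t\<close>.\<close>
      have loc: "NP (\<Sum>t\<in>I. it t * X t (d t * h)) \<le> 18 * \<theta> * NP h"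
        if dm: "\<And>t. t \<in> I \<Longrightarrow> d t \<in> borel_measurable M"
          and dle: "\<And>t x. t \<in> I \<Longrightarrow> x \<in> space M \<Longrightarrow> cmod (d t x) \<le> 2 * (\<theta> / c t)"
          and dL: "\<And>t. t \<in> I \<Longrightarrow> d t * h \<in> LP"
          and d0: "\<And>t x. d t x \<noteq> 0 \<Longrightarrow> f t x \<noteq> 0" and h: "h \<in> LP" for d h
      proof -
        define e where "e t = scl (of_real (c t / (2 * \<theta>))) (d t)" for t
        have em: "e t \<in> borel_measurable M" if "t \<in> I" for t
        proof -
          note [measurable] = dm[OF that]
          show ?thesis unfolding e_def scl_def by measurable
        qed
        have ec: "d t * h = scl (of_real (2 * \<theta> / c t)) (e t * h)" if "t \<in> I" for t
          using X(2)[OF that] \<theta>0 by (simp add: e_def scl_def fun_eq_iff fun_ops)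
        have ele: "cmod (e t x) \<le> 1" if t: "t \<in> I" and x: "x \<in> space M" for t x
        proof -
          have "cmod (e t x) = c t / (2 * \<theta>) * cmod (d t x)"
            using X(2)[OF t] \<theta>0 by (simp add: e_def scl_def norm_mult norm_divide)
          also have "\<dots> \<le> c t / (2 * \<theta>) * (2 * (\<theta> / c t))" using dle[OF t x] X(2)[OF t] \<theta>0 by (intro mult_left_mono) auto
          also have "\<dots> = 1" using X(2)[OF t] \<theta>0 by simp
          finally show ?thesis .
        qed
        have eL: "e t * h \<in> LP" if "t \<in> I" for t using mult_mem(1)[OF em[OF that] ele[OF that] _ h] by simp
        have "NP (\<Sum>t\<in>I. it t * X t (d t * h)) \<le> real 1 * (18 * \<theta> * NP h)"
        proof (rule NP_sum_overlap[OF fin XL])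
          fix x assume x: "x \<in> space M"
          have "{t \<in> I. (it t * X t (d t * h)) x \<noteq> 0} \<subseteq> {t \<in> I. x \<in> S t}" by (auto simp: fun_ops it_def indicator_def split: if_splits)
          then have "card {t \<in> I. (it t * X t (d t * h)) x \<noteq> 0} \<le> card {t \<in> I. x \<in> S t}" using fin by (intro card_mono) auto
          then show "card {t \<in> I. (it t * X t (d t * h)) x \<noteq> 0} \<le> 1" using dis[of x] x by simp
        next
          have "(\<Sum>t\<in>I. NP (it t * X t (d t * h)) powr p) \<le> (\<Sum>t\<in>I. (2 * \<theta>) powr p * NP (e t * h) powr p)"
          proof (rule sum_mono)
            fix t assume t: "t \<in> I"
            have "NP (it t * X t (d t * h)) \<le> NP (X t (d t * h))" using it(2)[OF t] Xm[OF t] dL[OF t] by blast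
            also have "\<dots> \<le> c t * NP (d t * h)" by (rule X(3)[OF t dL[OF t]])
            also have "NP (d t * h) = 2 * \<theta> / c t * NP (e t * h)"
              unfolding ec[OF t] using eL[OF t] X(2)[OF t] \<theta>0 by (simp add: norm_mult norm_divide)
            also have "c t * (2 * \<theta> / c t * NP (e t * h)) = 2 * \<theta> * NP (e t * h)" using X(2)[OF t] by simp
            finally have "NP (it t * X t (d t * h)) powr p \<le> (2 * \<theta> * NP (e t * h)) powr p"
              using p1 XL[OF t dL[OF t]] by (intro powr_mono2) auto
            then show "NP (it t * X t (d t * h)) powr p \<le> (2 * \<theta>) powr p * NP (e t * h) powr p" by (simp add: powr_mult)
          qed
          also have "\<dots> = (2 * \<theta>) powr p * (\<Sum>t\<in>I. NP (e t * h) powr p)" by (simp add: sum_distrib_left)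
          also have "\<dots> \<le> (2 * \<theta>) powr p * (real 9 * NP h powr p)"
          proof (intro mult_left_mono sum_NP_overlap[OF fin em ele _ h])
            fix x assume x: "x \<in> space M"
            have "{t \<in> I. e t x \<noteq> 0} \<subseteq> {t \<in> I. f t x \<noteq> 0}" using d0 by (auto simp: e_def scl_def)
            then have "card {t \<in> I. e t x \<noteq> 0} \<le> card {t \<in> I. f t x \<noteq> 0}" using fin by (intro card_mono) auto
            then show "card {t \<in> I. e t x \<noteq> 0} \<le> 9" using ov[of x] x by simp
          qed auto
          also have "\<dots> = 9 * (2 * \<theta> * NP h) powr p" by (simp add: powr_mult)
          also have "\<dots> \<le> (9 * (2 * \<theta> * NP h)) powr p" using \<theta>0 h by (intro pow9) auto
          also have "9 * (2 * \<theta> * NP h) = 18 * \<theta> * NP h" by simp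
          finally show "(\<Sum>t\<in>I. NP (it t * X t (d t * h)) powr p) \<le> (18 * \<theta> * NP h) powr p" .
        qed (use \<theta>0 h dL in auto)
        then show ?thesis by simp
      qed
      have G2: "NP (\<Sum>t\<in>I. it t * X t (g2 t)) \<le> 18 * \<theta> * NP u"
        unfolding g2_def using dm(1) dle(1) dmult(1) u by (intro loc) (auto simp: da_def fun_ops cut_def)
      have "NP (\<Sum>t\<in>I. it t * X t (g3 t)) \<le> 18 * \<theta> * NP (T u)"
        unfolding g3_def using dm(2) dle(2) dmult(3) u by (intro loc) (auto simp: db_def fun_ops cut_def)
      also have "\<dots> \<le> 18 * \<theta> * (C0 * K * NP u)" using T_le[OF u] \<theta>0 by (intro mult_left_mono) auto
      finally have "NP (\<Sum>t\<in>I. it t * X t (g2 t)) + NP (\<Sum>t\<in>I. it t * X t (g3 t)) \<le> (18 * \<theta> * (1 + C0 * K)) * NP u"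
        using G2 by (simp add: algebra_simps)
      then have G23: "NP (\<Sum>t\<in>I. it t * X t (g2 t)) + NP (\<Sum>t\<in>I. it t * X t (g3 t)) \<le> 1 / 8 * NP u" unfolding \<theta>N .
      have sL: "(\<Sum>t\<in>I. E2 t) \<in> LP" "(\<Sum>t\<in>I. it t * X t (g1 t)) \<in> LP" "(\<Sum>t\<in>I. it t * X t (g2 t)) \<in> LP"
        "(\<Sum>t\<in>I. it t * X t (g3 t)) \<in> LP" using E2L XL g by (auto intro!: sum_mem)
      have "NP (Bl (A u) - u - F1 u) \<le> NP E0 + (NP E1 + (NP (\<Sum>t\<in>I. E2 t) + (NP (\<Sum>t\<in>I. it t * X t (g1 t))
          + (NP (\<Sum>t\<in>I. it t * X t (g2 t)) + NP (\<Sum>t\<in>I. it t * X t (g3 t))))))"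
        unfolding Bl using E0L E1L sL
        by (intro order.trans[OF tri] add_left_mono tri add_mem order_refl)
      then show ?thesis using \<open>NP E0 = 0\<close> E1 E2s G1 G23 N_nonneg[OF u] by linarith
    qed
    ultimately show ?thesis using bBl \<Phi>(3) by (intro exI[of _ Bl] exI[of _ F1] exI[of _ "(\<lambda>s. (ra * b) * s) ` F"]) auto
  qed

  obtain B F1 Q where R: "blin B" "blin F1" "finite Q" "Q \<subseteq> LP" "\<forall>v\<in>LP. F1 v \<in> fun_vs.span Q"
    "\<forall>v\<in>LP. NP (A (B v) - v - F1 v) \<le> NP v / 2" using right by (elim exE conjE)
  have "corange A Q" by (rule fred_corange[OF blin_A R(1-4)]) (use R(5,6) in auto)
  obtain B' F2 Q' where L': "blin B'" "\<forall>u\<in>LP. \<forall>v\<in>LP. F2 (u + v) = F2 u + F2 v" "\<forall>u\<in>LP. \<forall>c. F2 (scl c u) = scl c (F2 u)"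
    "finite Q'" "Q' \<subseteq> LP" "\<forall>v\<in>LP. F2 v \<in> fun_vs.span Q'"
    "\<forall>u\<in>LP. NP (B' (A u) - u - F2 u) \<le> NP u / 2" using left by (elim exE conjE)
  have "\<exists>S. finite S \<and> S \<subseteq> {u \<in> LP. NP (A u) = 0} \<and>
       (\<forall>u\<in>LP. NP (A u) = 0 \<longrightarrow> (\<exists>c. NP (u - (\<Sum>s\<in>S. scl (c s) s)) = 0))"
    by (rule fred_kernel[OF blin_A L'(1), of F2 Q']) (use L' in auto)
  then show ?thesis unfolding fred_def using blin_A \<open>corange A Q\<close> by blast
qed

end

text \<open>Points closer than the mesh lie in the same square or in neighbouring ones. These nine
  squares are the origin of the overlap bound.\<close>

lemma cell_near:
  assumes "dist x y < s"
  shows "cell s y \<in> {fst (cell s x) - 1..fst (cell s x) + 1} \<times> {snd (cell s x) - 1..snd (cell s x) + 1}"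
proof -
  have s: "s > 0" using assms zero_le_dist[of x y] by linarith
  have "\<bar>x $ i / s - y $ i / s\<bar> < 1" for i
  proof -
    have "\<bar>(x - y) $ i\<bar> < s" using component_le_norm_cart[of "x - y" i] assms by (simp add: dist_norm)
    then have "\<bar>(x - y) $ i / s\<bar> < 1" using s by simp
    then show ?thesis by (simp add: diff_divide_distrib)
  qed
  then have 1: "x $ i / s \<le> y $ i / s + 1" "y $ i / s \<le> x $ i / s + 1" for i
    by (simp_all add: abs_less_iff diff_less_eq less_imp_le add.commute)
  have "\<lfloor>x $ i / s\<rfloor> - 1 \<le> \<lfloor>y $ i / s\<rfloor>" "\<lfloor>y $ i / s\<rfloor> \<le> \<lfloor>x $ i / s\<rfloor> + 1" for i
    using floor_mono[OF 1(1)[of i]] floor_mono[OF 1(2)[of i]] by simp_all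
  then show ?thesis by (simp add: cell_def)
qed

context convolution_operator
begin

lemma limit_ops_invertible_imp_fred:
  assumes low: "(INF x\<in>\<Gamma>. cmod (a x)) > 0"
    and inv: "\<And>h B. h \<in> escaping_seqs G \<Longrightarrow> is_limit_op E p A h B \<Longrightarrow> inv_op B"
  shows "fred A"
proof -
  define c1 where "c1 = (INF x\<in>\<Gamma>. cmod (a x))"
  have c1: "c1 \<le> cmod (a x)" if "x \<in> \<Gamma>" for x
    unfolding c1_def using that by (auto intro!: cINF_lower bdd_belowI[of _ 0])
  define P :: "(plane \<Rightarrow> complex) \<times> (plane \<Rightarrow> complex) \<Rightarrow> plane oper \<Rightarrow> real \<Rightarrow> bool"
    where "P t X c \<longleftrightarrow> c > 0 \<and> blin X \<and> (\<forall>u\<in>LP. NP (X u) \<le> c * NP u) \<and>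
      (\<forall>u\<in>LP. NP (pair_op (fst t) (snd t) (X u) - u) = 0 \<and> NP (X (pair_op (fst t) (snd t) u) - u) = 0)" for t X c
  have ex: "\<exists>X c. P t X c" if "lpair t" for t
  proof -
    obtain h where h: "limit_pair h (fst t) (snd t)" using \<open>lpair t\<close> unfolding lpair_def by blast
    have "h \<in> escaping_seqs G" using h by (simp add: limit_pair_def)
    from inv[OF this limit_pair_imp_limit_op[OF h]] obtain X where X: "blin X"
      "\<forall>u\<in>LP. NP (pair_op (fst t) (snd t) (X u) - u) = 0 \<and> NP (X (pair_op (fst t) (snd t) u) - u) = 0"
      unfolding inv_op_def by (elim exE conjE)
    obtain c where "c > 0" "\<And>u. u \<in> LP \<Longrightarrow> NP (X u) \<le> c * NP u" using blin_bound[OF X(1)] by blast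
    then have "P t X c" using X unfolding P_def by (intro conjI ballI) auto
    then show ?thesis by (intro exI)
  qed
  \<comment> \<open>Inverses and their bounds are fixed for all limit pairs at once, since the
    tolerance handed to the covering argument depends on them while the finite family is not yet
    known.\<close>
  define X where "X t = (SOME X. \<exists>c. P t X c)" for t
  define c where "c t = (SOME c. P t (X t) c)" for t
  have P: "P t (X t) (c t)" if "lpair t" for t
    using someI_ex[OF ex[OF that]] unfolding X_def[symmetric] c_def by (rule someI_ex)
  have cpos: "c t > 0" if "lpair t" for t using P[OF that] by (simp add: P_def)
  define \<theta> where "\<theta> = 1 / (144 * (1 + C0 * K))"
  have \<theta>: "\<theta> > 0" using C0 K(1) by (simp add: \<theta>_def add_pos_pos)
  define \<eta> where "\<eta> t = \<theta> / c t" for t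
  have \<eta>: "\<eta> t > 0" if "lpair t" for t using cpos[OF that] \<theta> by (simp add: \<eta>_def)
  obtain F r where F: "finite F" "\<forall>t\<in>F. lpair t"
    "\<forall>\<alpha>\<in>G. norm \<alpha> \<ge> r \<longrightarrow> (\<exists>t\<in>F. close_on_domain (\<eta> t) \<alpha> (fst t) (snd t))"
    using finite_limit_cover[of \<eta>] \<eta> by metis
  define cs where "cs = (\<Sum>t\<in>F. c t)"
  have cs: "cs \<ge> 0" unfolding cs_def using F(2) cpos by (intro sum_nonneg) (auto simp: less_imp_le)
  \<comment> \<open>Made such that \<open>coef * \<eta>' * (cs + 1) = 1 / 8\<close>. As
    \<open>F\<close> is already fixed, the mesh \<open>L\<close> may depend on the sum of all
    bounds.\<close>
  define \<eta>' where "\<eta>' = 1 / (8 * coef * (cs + 1))"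
  have \<eta>': "\<eta>' > 0" using coef(1) cs by (simp add: \<eta>'_def)
  obtain L where L: "L > 0" "\<forall>L'\<ge>L. \<forall>f. lipcut L' f \<longrightarrow> (\<forall>u\<in>LP. NP (cut f * T u - T (cut f * u)) \<le> \<eta>' * NP u)"
    using commutator[OF \<eta>'] by (elim exE conjE)
  \<comment> \<open>A point of a square is within \<open>2 * L\<close> of its corner, and the cutoff
    reaches farther by \<open>L\<close>; this makes the radius \<open>3 * L\<close>.\<close>
  define near where "near q t \<longleftrightarrow> (\<forall>z\<in>\<Gamma> \<inter> ball (gridpt L q) (3 * L).
    cmod (a z - fst t z) \<le> 2 * \<eta> t \<and> cmod (b z - snd t z) \<le> 2 * \<eta> t)" for q t
  obtain R where "\<forall>x. norm x \<ge> R \<longrightarrow> \<Gamma> \<inter> ball x (3 * L) \<noteq> {} \<longrightarrow>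
    (\<exists>t\<in>F. \<forall>z\<in>\<Gamma> \<inter> ball x (3 * L). cmod (a z - fst t z) \<le> 2 * \<eta> t \<and> cmod (b z - snd t z) \<le> 2 * \<eta> t)"
    using limit_cover_balls[of F \<eta> r "3 * L"] F \<eta> by blast
  then have R: "\<exists>t\<in>F. near q t" if "norm (gridpt L q) \<ge> R" "\<Gamma> \<inter> ball (gridpt L q) (3 * L) \<noteq> {}" for q
    unfolding near_def using that by blast
  \<comment> \<open>\<open>None\<close> occurs only for squares near the origin and for squares
    whose surrounding ball misses the graph. Hence the part of the graph in such squares is
    bounded.\<close>
  define assign where "assign q = (if \<exists>t\<in>F. near q t then Some (SOME t. t \<in> F \<and> near q t) else None)" for q
  have assign: "t \<in> F \<and> near q t" if "assign q = Some t" for q t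
  proof -
    have ex: "\<exists>t. t \<in> F \<and> near q t" and "t = (SOME t. t \<in> F \<and> near q t)"
      using that by (auto simp: assign_def split: if_splits)
    then show ?thesis using someI_ex[OF ex] by blast
  qed
  \<comment> \<open>All squares with the same partner form one set, so there are at most as many
    sets as members of \<open>F\<close>, however fine or coarse the mesh is.\<close>
  define Z where "Z t = {x. assign (cell L x) = Some t}" for t
  define S where "S t = \<Gamma> \<inter> Z t" for t
  define S0 where "S0 = \<Gamma> \<inter> {x. assign (cell L x) = None}"
  \<comment> \<open>Empty sets are sorted out because \<open>infdist\<close> to the empty set is
    \<open>0\<close>, which would make the cutoff constantly \<open>1\<close>.\<close>
  define I where "I = {t \<in> F. Z t \<noteq> {}}"
  define f where "f t x = max 0 (1 - infdist x (Z t) / L)" for t x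
  have finI: "finite I" using F by (simp add: I_def)
  have lI: "lpair t" if "t \<in> I" for t using F(2) that by (simp add: I_def)
  have PI: "c t > 0" "blin (X t)" "\<forall>u\<in>LP. NP (X t u) \<le> c t * NP u"
    "\<forall>u\<in>LP. NP (pair_op (fst t) (snd t) (X t u) - u) = 0 \<and> NP (X t (pair_op (fst t) (snd t) u) - u) = 0" if "t \<in> I" for t
    using P[OF lI[OF that]] unfolding P_def by simp_all
  have lip: "lipcut L (f t)" for t
    unfolding lipcut_def
  proof (intro conjI allI)
    fix x y
    show "0 \<le> f t x" "f t x \<le> 1" using L(1) infdist_nonneg[of x "Z t"] by (simp_all add: f_def)
    have "\<bar>infdist x (Z t) - infdist y (Z t)\<bar> \<le> dist x y" by (rule infdist_triangle_abs)
    then have "\<bar>infdist x (Z t) - infdist y (Z t)\<bar> / L \<le> dist x y / L" using L(1) by (intro divide_right_mono) auto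
    then have "\<bar>infdist x (Z t) / L - infdist y (Z t) / L\<bar> \<le> dist x y / L"
      using L(1) by (simp add: diff_divide_distrib[symmetric])
    then show "\<bar>f t x - f t y\<bar> \<le> dist x y / L" unfolding f_def by linarith
  qed
  have supp: "\<exists>y\<in>Z t. dist x y < L" if "t \<in> I" "f t x \<noteq> 0" for t x
  proof -
    have ne: "Z t \<noteq> {}" using that by (simp add: I_def)
    have "infdist x (Z t) / L < 1" using that(2) unfolding f_def by linarith
    then have "(INF y\<in>Z t. dist x y) < L" using L(1) infdist_notempty[OF ne, of x] by simp
    then show ?thesis using cINF_less_iff[OF ne, of "dist x" L] by (auto intro: bdd_belowI[of _ 0])
  qed
  have sets: "\<Gamma> \<inter> {x. assign (cell L x) = o'} \<in> sets M" for o'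
  proof -
    have "{x. cell L x \<in> {q. assign q = o'}} \<in> sets borel" by (rule cell_sets)
    then show ?thesis using \<Gamma>_borel by (simp add: sets_M_iff)
  qed
  have S0b: "S0 \<subseteq> ball 0 (R + 2 * L)"
  proof
    fix x assume x: "x \<in> S0"
    let ?y = "gridpt L (cell L x)"
    have d: "norm (x - ?y) < 2 * L" by (rule dist_gridpt[OF L(1)])
    then have "x \<in> \<Gamma> \<inter> ball ?y (3 * L)" using x L(1) by (simp add: S0_def dist_norm norm_minus_commute)
    moreover have "\<not> (\<exists>t\<in>F. near (cell L x) t)" using x by (auto simp: S0_def assign_def split: if_splits)
    ultimately have "norm ?y < R" using R[of "cell L x"] by fastforce
    moreover have "norm x \<le> norm ?y + norm (x - ?y)" using norm_triangle_ineq[of ?y "x - ?y"] by simp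
    ultimately show "x \<in> ball 0 (R + 2 * L)" using d by simp
  qed
  show ?thesis
  proof (rule parametrix[where I = I and a' = fst and b' = snd and X = X and c = c and f = f and L = L and S = S
        and ?S0.0 = S0 and ?R0.0 = "R + 2 * L" and \<theta> = \<theta> and \<eta> = \<eta>' and ?c1.0 = c1])
    show "bounded_coeff (fst t)" "bounded_coeff (snd t)" if "t \<in> I" for t
      using lI[OF that] limit_pair_coeff(1,2) unfolding lpair_def by blast+
    show "S t \<in> sets M" for t unfolding S_def Z_def by (rule sets)
    show "S0 \<in> sets M" unfolding S0_def by (rule sets)
    show "f t x = 1" if "x \<in> S t" for t x using that by (simp add: f_def S_def)
    show "indicator S0 x + (\<Sum>t\<in>I. indicator (S t) x) = (1::complex)" if x: "x \<in> \<Gamma>" for x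
    proof (cases "assign (cell L x)")
      case None
      then show ?thesis using x by (simp add: S0_def S_def Z_def)
    next
      case (Some s)
      then have "s \<in> I" using assign[OF Some] by (auto simp: I_def Z_def)
      moreover have "indicator (S t) x = (if t = s then 1 else (0::complex))" for t
        using Some x by (auto simp: S_def Z_def)
      ultimately show ?thesis using Some finI by (simp add: S0_def)
    qed
    show "card {t \<in> I. x \<in> S t} \<le> 1" for x
    proof -
      have "{t \<in> I. x \<in> S t} \<subseteq> {the (assign (cell L x))}" by (auto simp: S_def Z_def)
      from card_mono[OF _ this] show ?thesis by simp
    qed
    show "card {t \<in> I. f t x \<noteq> 0} \<le> 9" for x
    proof -
      let ?B = "{fst (cell L x) - 1..fst (cell L x) + 1} \<times> {snd (cell L x) - 1..snd (cell L x) + 1}"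
      have "{t \<in> I. f t x \<noteq> 0} \<subseteq> (\<lambda>q. the (assign q)) ` ?B"
      proof
        fix t assume "t \<in> {t \<in> I. f t x \<noteq> 0}"
        then obtain y where y: "y \<in> Z t" "dist x y < L" using supp[of t x] by blast
        have "t = the (assign (cell L y))" using y(1) by (simp add: Z_def)
        then show "t \<in> (\<lambda>q. the (assign q)) ` ?B" using cell_near[OF y(2)] by (rule image_eqI)
      qed
      then have "card {t \<in> I. f t x \<noteq> 0} \<le> card ?B" by (rule surj_card_le[rotated]) simp
      then show ?thesis by simp
    qed
    show "cmod (a x - fst t x) \<le> 2 * (\<theta> / c t) \<and> cmod (b x - snd t x) \<le> 2 * (\<theta> / c t)"
      if t: "t \<in> I" and x: "x \<in> \<Gamma>" and f: "f t x \<noteq> 0" for t x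
    proof -
      obtain y where y: "y \<in> Z t" "dist x y < L" using supp[OF t f] by blast
      have "dist (gridpt L (cell L y)) x \<le> norm (y - gridpt L (cell L y)) + dist x y"
        using dist_triangle[of "gridpt L (cell L y)" x y] by (simp add: dist_norm norm_minus_commute)
      then have "x \<in> \<Gamma> \<inter> ball (gridpt L (cell L y)) (3 * L)"
        using dist_gridpt[OF L(1), of y] y(2) x by simp
      moreover have "near (cell L y) t" using assign[of "cell L y" t] y(1) by (simp add: Z_def)
      ultimately show ?thesis unfolding near_def \<eta>_def by blast
    qed
    show "NP (com (f t) u) \<le> \<eta>' * NP u" if "u \<in> LP" for t u
      unfolding com_def using L(2)[rule_format, OF order_refl lip that] .
    have "sum c I \<le> cs" unfolding cs_def using F(2) cpos
      by (intro sum_mono2[OF F(1)]) (auto simp: I_def less_imp_le)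
    then have "sum c I \<le> cs + 1" by simp
    then have "coef * \<eta>' * (\<Sum>t\<in>I. c t) \<le> coef * \<eta>' * (cs + 1)"
      using coef(1) \<eta>' by (intro mult_left_mono) auto
    also have "\<dots> = 1 / 8" using coef(1) cs by (simp add: \<eta>'_def)
    finally show "coef * \<eta>' * (\<Sum>t\<in>I. c t) \<le> 1 / 8" .
    show "finite I" by (rule finI)
    show "blin (X t)" "c t > 0" if "t \<in> I" for t using PI(1,2)[OF that] by simp_all
    show "NP (X t u) \<le> c t * NP u" if "t \<in> I" "u \<in> LP" for t u by (rule bspec[OF PI(3)[OF that(1)] that(2)])
    show "NP (pair_op (fst t) (snd t) (X t u) - u) = 0" if "t \<in> I" "u \<in> LP" for t u
      by (rule conjunct1[OF bspec[OF PI(4)[OF that(1)] that(2)]])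
    show "NP (X t (pair_op (fst t) (snd t) u) - u) = 0" if "t \<in> I" "u \<in> LP" for t u
      by (rule conjunct2[OF bspec[OF PI(4)[OF that(1)] that(2)]])
    show "lipcut L (f t)" for t by (rule lip)
    show "L > 0" by (rule L(1))
    show "S0 \<subseteq> ball 0 (R + 2 * L)" by (rule S0b)
    show "\<theta> = 1 / (144 * (1 + C0 * K))" by (rule \<theta>_def)
    show "\<eta>' \<ge> 0" using \<eta>' by simp
    show "c1 \<le> cmod (a x)" if "x \<in> \<Gamma>" for x by (rule c1[OF that])
    show "c1 > 0" using low by (simp add: c1_def)
  qed
qed

end

theorem theorem21:
  fixes \<iota> :: "int ^ 'n::finite \<Rightarrow> plane"
    and G V D :: "plane set" and E :: "plane set set"
    and a b k :: "plane \<Rightarrow> complex" and p :: real and A :: "plane oper"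
  assumes "CARD('n) \<in> {1, 2}"
    and "lattice_embedding \<iota>" and "G = range \<iota>"
    and "planar_graph V E" and "periodic_graph G V E" and "fundamental_domain G E D"
    and "a \<in> BUC E \<inter> SO G E D" and "b \<in> BUC E \<inter> SO G E D"
    and "continuous_on UNIV k"
    and "\<exists>C>0. \<exists>\<epsilon>>0. \<forall>z. cmod (k z) \<le> C * (1 + norm z) powr (- 2 - \<epsilon>)"
    and "1 < p"
    and "A = (\<lambda>u x. mult_op a u x + mult_op b (conv_op E k u) x)"
  shows "fredholm_op (graph_measure E) p A \<longleftrightarrow>
      (INF x\<in>graph_points E. cmod (a x)) > 0 \<and>
      (\<forall>h\<in>escaping_seqs G. \<forall>B. is_limit_op E p A h B \<longrightarrow> invertible_op (graph_measure E) p B)"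
proof -
  note hyps = assms(2-)
  obtain C0 \<epsilon> where k: "C0 > 0" "\<epsilon> > 0" "\<forall>z. cmod (k z) \<le> C0 * (1 + norm z) powr (- 2 - \<epsilon>)"
    using assms(10) by (elim exE conjE)
  have \<iota>: "\<iota> (x + y) = \<iota> x + \<iota> y" for x y using \<open>lattice_embedding \<iota>\<close> by (simp add: lattice_embedding_def)
  have \<iota>0: "\<iota> 0 = 0" using \<iota>[of 0 0] by simp
  have \<iota>m: "\<iota> (- x) = - \<iota> x" for x using \<iota>[of x "- x"] by (simp add: \<iota>0 eq_neg_iff_add_eq_0 add.commute)
  interpret convolution_operator G V D E a b k p C0 \<epsilon>
  proof
    show "0 \<in> G" using rangeI[of \<iota> 0] by (simp add: \<iota>0 \<open>G = range \<iota>\<close>)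
    show "g + h \<in> G" if "g \<in> G" "h \<in> G" for g h using that unfolding \<open>G = range \<iota>\<close> by (auto simp flip: \<iota>)
    show "- g \<in> G" if "g \<in> G" for g using that unfolding \<open>G = range \<iota>\<close> by (auto simp flip: \<iota>m)
    show "discrete G" using hyps by (simp add: lattice_embedding_def)
  qed (use hyps k in auto)
  have AA: "A = convolution_operator.A E a b k"
    unfolding assms(12) fun_eq_iff by (simp add: A_def T_def mult_op_def fun_ops)
  show ?thesis
    unfolding AA fredholm_op_iff invertible_op_iff
    using fred_imp_a_bounded_below fred_imp_limit_op_invertible limit_ops_invertible_imp_fred by (intro iffI conjI ballI allI impI) simp_all
qed

end
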